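(* Let $H$ be a subgroup of $G$. If $\rho$ is a well-behaved inducible $*$-representation of the $*$-algebra $\mathcal{A}_H$ with metrizable graph topology, then the induced representation $\pi=\mathrm{Ind}_{\mathcal{A}_H\uparrow\mathcal{A}}(\rho)$ is a well-behaved $*$-representation of the $*$-algebra $\mathcal{A}$.
   Context: A $*$-representation $\pi$ of a $*$-algebra $\mathcal{A}$ on a dense linear subspace $\mathcal{D}(\pi)$ of a Hilbert space $\mathcal{H}_\pi$ is an algebra homomorphism of $\mathcal{A}$ into the linear operators on $\mathcal{D}(\pi)$ with $\langle\pi(a)\varphi,\psi\rangle=\langle\varphi,\pi(a^* )\psi\rangle$. The graph topology of $\pi$ is the locally convex topology on $\mathcal{D}(\pi)$ given by the norms $\varphi\mapsto\|\varphi\|+\|\pi(a)\varphi\|$, $a\in\mathcal{A}$; $\pi$ is closed if $\mathcal{D}(\pi)$ is complete in it; the closure of $\pi$ is its extension by continuity to the completion. A closed $*$-representation $\pi$ of a commutative $*$-algebra $\mathcal{B}$ is integrable if $\overline{\pi(b^* )}=\pi(b)^*$ for all $b\in\mathcal{B}$. $\mathrm{Res}_{\mathcal{B}}$ denotes restriction to $\mathcal{B}$; $\sum\mathcal{A}^2$ is the set of finite sums of elements $a^*a$. Standing assumptions. $G$ is a discrete group and $\mathcal{A}=\bigoplus_{g\in G}\mathcal{A}_g$ is a unital $G$-graded $*$-algebra ($\mathcal{A}_g\mathcal{A}_h\subseteq\mathcal{A}_{gh}$, $\mathcal{A}_g^*\subseteq\mathcal{A}_{g^{-1}}$) such that $\mathcal{B}:=\mathcal{A}_e$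 is commutative and countably generated. $\widehat{\mathcal{B}}^+$ is the set of characters (nontrivial $*$-homomorphisms $\mathcal{B}\to\mathbb{C}$) that are nonnegative on $\sum\mathcal{A}^2\cap\mathcal{B}$. It is assumed that $\chi(c^*d)\chi(d^*c)=\chi(c^*c)\chi(d^*d)$ for all $\chi\in\widehat{\mathcal{B}}^+$, $g\in G$, $c,d\in\mathcal{A}_g$, and that $\widehat{\mathcal{B}}^+$ is locally compact in the weakest topology making all functions $f_b(\chi)=\chi(b)$, $b\in\mathcal{B}$, continuous. Partial action: $\mathcal{D}_g$ is the set of $\chi\in\widehat{\mathcal{B}}^+$ with $\chi(a_g^*a_g)\neq0$ for some $a_g\in\mathcal{A}_g$; for such $\chi$, $\chi^g(b)=\chi(a_g^*ba_g)/\chi(a_g^*a_g)$ (independent of $a_g$, again in $\widehat{\mathcal{B}}^+$). For $\Delta\subseteq\widehat{\mathcal{B}}^+$, $\Delta^g=\{\chi^g:\chi\in\Delta\cap\mathcal{D}_g\}$. A $*$-representation $\pi$ of $\mathcal{A}$ is well-behaved if (a) $\mathrm{Res}_{\mathcal{B}}\pi$ is integrable and there is a spectral measure $E_\pi$ on $\widehat{\mathcal{B}}^+$ with $\overline{\pi(b)}=\int f_b\,dE_\pi$ for $b\in\mathcal{B}$, and (b) $E_\pi(\Delta^g)\pi(a_g)\subseteq\pi(a_g)E_\pi(\Delta)$ for all $g\in G$, $a_g\in\mathcal{A}_g$ and Borel sets $\Delta\subseteq\widehat{\mathcal{B}}^+$. For the $*$-subalgebra $\mathcal{A}_H=\bigoplus_{h\in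 H}\mathcal{A}_h$, well-behaved $*$-representations $\rho$ are defined in the same way, with a spectral measure $E_\rho$ on $\widehat{\mathcal{B}}^+$ and $g$ ranging over $H$. Induction: $p_H:\mathcal{A}\to\mathcal{A}_H$ is the canonical projection. A $*$-representation $\rho$ of $\mathcal{A}_H$ is inducible if the form $\langle a_1\otimes v_1,a_2\otimes v_2\rangle_0=\langle\rho(p_H(a_2^*a_1))v_1,v_2\rangle$ on $\mathcal{A}\otimes_{\mathcal{A}_H}\mathcal{D}(\rho)$ is nonnegative; then $\mathrm{Ind}_{\mathcal{A}_H\uparrow\mathcal{A}}\rho$ is the closure of the representation $a\mapsto([b\otimes v]\mapsto[ab\otimes v])$ on the quotient by the kernel $\{\eta:\langle\eta,\eta\rangle_0=0\}$. *)

theory Defs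
  imports
    "HOL-Analysis.Analysis"
    "HOL-Algebra.Module"
    "HOL-Algebra.AbelCoset"
    "HOL-Library.Poly_Mapping"
begin

section \<open>Unital complex *-algebras\<close>

text \<open>Built on the classes for unital rings without the axiom that zero and one differ.\<close>

class star_algebra = ring + monoid_mult +
  fixes scaleC :: "complex \<Rightarrow> 'a \<Rightarrow> 'a"  (infixr \<open>*\<^sub>C\<close> 75)
    and star :: "'a \<Rightarrow> 'a"
  assumes scaleC_add_right: "c *\<^sub>C (x + y) = c *\<^sub>C x + c *\<^sub>C y"
    and scaleC_add_left: "(c + d) *\<^sub>C x = c *\<^sub>C x + d *\<^sub>C x"
    and scaleC_scaleC: "c *\<^sub>C d *\<^sub>C x = (c * d) *\<^sub>C x"
    and scaleC_one: "1 *\<^sub>C x = x"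
    and mult_scaleC_left: "(c *\<^sub>C x) * y = c *\<^sub>C (x * y)"
    and mult_scaleC_right: "x * (c *\<^sub>C y) = c *\<^sub>C (x * y)"
    and star_add: "star (x + y) = star x + star y"
    and star_scaleC: "star (c *\<^sub>C x) = cnj c *\<^sub>C star x"
    and star_mult: "star (x * y) = star y * star x"
    and star_star: "star (star x) = x"

global_interpretation cvs: vector_space "scaleC :: complex \<Rightarrow> 'a \<Rightarrow> 'a::star_algebra"
  by unfold_locales (simp_all add: scaleC_add_right scaleC_add_left scaleC_scaleC scaleC_one)

definition star_subalgebra :: "'a::star_algebra set \<Rightarrow> bool" where
  "star_subalgebra S \<longleftrightarrow>
     cvs.subspace S \<and> 1 \<in> S \<and> (\<forall>x\<in>S. \<forall>y\<in>S. x * y \<in> S) \<and> (\<forall>x\<in>S. star x \<in> S)"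

definition countably_generated :: "'a::star_algebra set \<Rightarrow> bool" where
  "countably_generated B \<longleftrightarrow> (\<exists>C. countable C \<and> star_subalgebra hull C = B)"

definition sums_of_squares :: "'a::star_algebra set" where
  "sums_of_squares = {\<Sum>i<n. star (f i) * f i | (n::nat) f. True}"


section \<open>Graded *-algebras\<close>

definition decomposition ::
  "('g, 'm) monoid_scheme \<Rightarrow> ('g \<Rightarrow> 'a::star_algebra set) \<Rightarrow> 'a \<Rightarrow> ('g \<Rightarrow> 'a) \<Rightarrow> bool" where
  "decomposition G A a f \<longleftrightarrow>
     (\<forall>g\<in>carrier G. f g \<in> A g) \<and> (\<forall>g. g \<notin> carrier G \<longrightarrow> f g = 0) \<and>
     finite {g. f g \<noteq> 0} \<and> a = (\<Sum>g | f g \<noteq> 0. f g)"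

locale graded_star_algebra = group G for G (structure) +
  fixes A :: "'g \<Rightarrow> 'a::star_algebra set"
  assumes subspace_component: "g \<in> carrier G \<Longrightarrow> cvs.subspace (A g)"
    and direct_sum: "\<exists>!f. decomposition G A a f"
    and mult_component:
      "\<lbrakk>g \<in> carrier G; h \<in> carrier G; x \<in> A g; y \<in> A h\<rbrakk> \<Longrightarrow> x * y \<in> A (g \<otimes> h)"
    and star_component: "\<lbrakk>g \<in> carrier G; x \<in> A g\<rbrakk> \<Longrightarrow> star x \<in> A (inv g)"

definition component ::
  "('g, 'm) monoid_scheme \<Rightarrow> ('g \<Rightarrow> 'a::star_algebra set) \<Rightarrow> 'a \<Rightarrow> 'g \<Rightarrow> 'a" where
  "component G A a = (THE f. decomposition G A a f)"

definition graded_part :: "('g \<Rightarrow> 'a::star_algebra set) \<Rightarrow> 'g set \<Rightarrow> 'a set" where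
  "graded_part A K = cvs.span (\<Union>k\<in>K. A k)"

definition part_projection ::
  "('g, 'm) monoid_scheme \<Rightarrow> ('g \<Rightarrow> 'a::star_algebra set) \<Rightarrow> 'g set \<Rightarrow> 'a \<Rightarrow> 'a" where
  "part_projection G A H a = (\<Sum>h | h \<in> H \<and> component G A a h \<noteq> 0. component G A a h)"


section \<open>Characters and the partial action\<close>

text \<open>Characters of a *-subalgebra \<open>B\<close> take the value \<open>undefined\<close> outside \<open>B\<close>, so that equality
  of functions is equality of characters.\<close>

definition star_characters :: "'a::star_algebra set \<Rightarrow> ('a \<Rightarrow> complex) set" where
  "star_characters B = {\<xi> \<in> extensional B.
     (\<forall>x\<in>B. \<forall>y\<in>B. \<xi> (x + y) = \<xi> x + \<xi> y \<and> \<xi> (x * y) = \<xi> x * \<xi> y) \<and>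
     (\<forall>c. \<forall>x\<in>B. \<xi> (c *\<^sub>C x) = c * \<xi> x) \<and>
     (\<forall>x\<in>B. \<xi> (star x) = cnj (\<xi> x)) \<and>
     (\<exists>x\<in>B. \<xi> x \<noteq> 0)}"

definition positive_characters ::
  "('g, 'm) monoid_scheme \<Rightarrow> ('g \<Rightarrow> 'a::star_algebra set) \<Rightarrow> ('a \<Rightarrow> complex) set" where
  "positive_characters G A =
     {\<xi> \<in> star_characters (A \<one>\<^bsub>G\<^esub>). \<forall>x \<in> sums_of_squares \<inter> A \<one>\<^bsub>G\<^esub>. \<xi> x \<in> \<real>\<^sub>\<ge>\<^sub>0}"

definition character_topology ::
  "('g, 'm) monoid_scheme \<Rightarrow> ('g \<Rightarrow> 'a::star_algebra set) \<Rightarrow> ('a \<Rightarrow> complex) topology" where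
  "character_topology G A = topology_generated_by
     {{\<xi> \<in> positive_characters G A. \<xi> b \<in> U} | b U. b \<in> A \<one>\<^bsub>G\<^esub> \<and> open U}"

definition borel_of :: "'x topology \<Rightarrow> 'x measure" where
  "borel_of X = sigma (topspace X) {U. openin X U}"

definition action_domain ::
  "('g, 'm) monoid_scheme \<Rightarrow> ('g \<Rightarrow> 'a::star_algebra set) \<Rightarrow> 'g \<Rightarrow> ('a \<Rightarrow> complex) set" where
  "action_domain G A g = {\<xi> \<in> positive_characters G A. \<exists>a\<in>A g. \<xi> (star a * a) \<noteq> 0}"

definition act_character ::
  "('g, 'm) monoid_scheme \<Rightarrow> ('g \<Rightarrow> 'a::star_algebra set) \<Rightarrow> 'g \<Rightarrow> ('a \<Rightarrow> complex) \<Rightarrow> 'a \<Rightarrow> complex"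
  where
  "act_character G A g \<xi> =
     (let a = (SOME a. a \<in> A g \<and> \<xi> (star a * a) \<noteq> 0)
      in (\<lambda>b\<in>A \<one>\<^bsub>G\<^esub>. \<xi> (star a * b * a) / \<xi> (star a * a)))"

definition act_set ::
  "('g, 'm) monoid_scheme \<Rightarrow> ('g \<Rightarrow> 'a::star_algebra set) \<Rightarrow> 'g \<Rightarrow> ('a \<Rightarrow> complex) set
     \<Rightarrow> ('a \<Rightarrow> complex) set" where
  "act_set G A g \<Delta> = act_character G A g ` (\<Delta> \<inter> action_domain G A g)"


section \<open>Complex inner product spaces\<close>

definition complex_ring :: "complex ring" where
  "complex_ring = \<lparr>carrier = UNIV, mult = (*), one = 1, zero = 0, add = (+)\<rparr>"

text \<open>The fields \<open>mult\<close> and \<open>one\<close> inherited from the record of modules play no role.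
  Inner products are linear in the first argument.\<close>

record 'v ip_space = "(complex, 'v) module" +
  ip :: "'v \<Rightarrow> 'v \<Rightarrow> complex"

definition vnorm :: "'v ip_space \<Rightarrow> 'v \<Rightarrow> real" where
  "vnorm V x = sqrt (Re (ip V x x))"

text \<open>The value outside the carrier is fixed because the locale \<open>Metric_space\<close> requires
  nonnegativity and symmetry on the whole type.\<close>

definition vdist :: "'v ip_space \<Rightarrow> 'v \<Rightarrow> 'v \<Rightarrow> real" where
  "vdist V x y = (if x \<in> carrier V \<and> y \<in> carrier V then vnorm V (x \<ominus>\<^bsub>V\<^esub> y) else 0)"

definition vtop :: "'v ip_space \<Rightarrow> 'v topology" where
  "vtop V = Metric_space.mtopology (carrier V) (vdist V)"

locale pre_hilbert_space = Module.module complex_ring V for V :: "'v ip_space" (structure) +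
  assumes ip_add_left: "\<lbrakk>x \<in> carrier V; y \<in> carrier V; z \<in> carrier V\<rbrakk> \<Longrightarrow>
      ip V (x \<oplus> y) z = ip V x z + ip V y z"
    and ip_smult_left: "\<lbrakk>x \<in> carrier V; y \<in> carrier V\<rbrakk> \<Longrightarrow> ip V (c \<odot> x) y = c * ip V x y"
    and ip_commute: "\<lbrakk>x \<in> carrier V; y \<in> carrier V\<rbrakk> \<Longrightarrow> ip V y x = cnj (ip V x y)"
    and ip_nonneg: "x \<in> carrier V \<Longrightarrow> ip V x x \<in> \<real>\<^sub>\<ge>\<^sub>0"
    and ip_definite: "\<lbrakk>x \<in> carrier V; ip V x x = 0\<rbrakk> \<Longrightarrow> x = \<zero>"

locale hilbert_space = pre_hilbert_space V for V :: "'v ip_space" (structure) +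
  assumes complete: "Metric_space.mcomplete (carrier V) (vdist V)"


section \<open>Quotients and completion\<close>

text \<open>Quotient by a linear subspace \<open>N\<close>; the form is evaluated on representatives, which is
  meaningful if \<open>N\<close> is contained in its radical.\<close>

definition quotient_space :: "'v ip_space \<Rightarrow> 'v set \<Rightarrow> 'v set ip_space" where
  "quotient_space V N = \<lparr>carrier = a_rcosets\<^bsub>V\<^esub> N, mult = undefined, one = undefined,
     zero = N, add = (\<lambda>X Y. X <+>\<^bsub>V\<^esub> Y),
     smult = (\<lambda>c X. N +>\<^bsub>V\<^esub> (c \<odot>\<^bsub>V\<^esub> (SOME x. x \<in> X))),
     ip = (\<lambda>X Y. ip V (SOME x. x \<in> X) (SOME y. y \<in> Y))\<rparr>"

definition quotient_map :: "'v ip_space \<Rightarrow> 'v set \<Rightarrow> ('v \<Rightarrow> 'v) \<Rightarrow> 'v set \<Rightarrow> 'v set" where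
  "quotient_map V N f X = N +>\<^bsub>V\<^esub> f (SOME x. x \<in> X)"

definition null_space :: "'v ip_space \<Rightarrow> 'v set" where
  "null_space V = {x \<in> carrier V. ip V x x = 0}"

text \<open>The completion consists of classes of Cauchy sequences modulo the null sequences.\<close>

definition cauchy_space :: "'v ip_space \<Rightarrow> (nat \<Rightarrow> 'v) ip_space" where
  "cauchy_space V = \<lparr>carrier = {s. Metric_space.MCauchy (carrier V) (vdist V) s},
     mult = undefined, one = undefined,
     zero = (\<lambda>_. \<zero>\<^bsub>V\<^esub>), add = (\<lambda>s t n. s n \<oplus>\<^bsub>V\<^esub> t n), smult = (\<lambda>c s n. c \<odot>\<^bsub>V\<^esub> s n),
     ip = (\<lambda>s t. lim (\<lambda>n. ip V (s n) (t n)))\<rparr>"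

definition completion :: "'v ip_space \<Rightarrow> (nat \<Rightarrow> 'v) set ip_space" where
  "completion V = quotient_space (cauchy_space V) (null_space (cauchy_space V))"

definition completion_embedding :: "'v ip_space \<Rightarrow> 'v \<Rightarrow> (nat \<Rightarrow> 'v) set" where
  "completion_embedding V x = null_space (cauchy_space V) +>\<^bsub>cauchy_space V\<^esub> (\<lambda>_. x)"


section \<open>Unbounded operators and spectral integrals\<close>

text \<open>An operator is identified with its graph, so the composite of \<open>T\<close> after \<open>S\<close> is \<open>S O T\<close>
  and extension of operators is inclusion.\<close>

definition op_graph :: "'v set \<Rightarrow> ('v \<Rightarrow> 'v) \<Rightarrow> ('v \<times> 'v) set" where
  "op_graph D f = (\<lambda>x. (x, f x)) ` D"

definition op_closure :: "'v ip_space \<Rightarrow> ('v \<times> 'v) set \<Rightarrow> ('v \<times> 'v) set" where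
  "op_closure V T = prod_topology (vtop V) (vtop V) closure_of T"

definition op_adjoint :: "'v ip_space \<Rightarrow> ('v \<times> 'v) set \<Rightarrow> ('v \<times> 'v) set" where
  "op_adjoint V T = {(y, z) \<in> carrier V \<times> carrier V. \<forall>(x, x') \<in> T. ip V x' y = ip V x z}"

definition orthogonal_projection :: "'v ip_space \<Rightarrow> ('v \<Rightarrow> 'v) \<Rightarrow> bool" where
  "orthogonal_projection V P \<longleftrightarrow>
     P \<in> carrier V \<rightarrow> carrier V \<and>
     (\<forall>x\<in>carrier V. \<forall>y\<in>carrier V. P (x \<oplus>\<^bsub>V\<^esub> y) = P x \<oplus>\<^bsub>V\<^esub> P y) \<and>
     (\<forall>c. \<forall>x\<in>carrier V. P (c \<odot>\<^bsub>V\<^esub> x) = c \<odot>\<^bsub>V\<^esub> P x) \<and>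
     (\<forall>x\<in>carrier V. P (P x) = P x) \<and>
     (\<forall>x\<in>carrier V. \<forall>y\<in>carrier V. ip V (P x) y = ip V x (P y))"

definition spectral_measure ::
  "'v ip_space \<Rightarrow> 'x measure \<Rightarrow> ('x set \<Rightarrow> 'v \<Rightarrow> 'v) \<Rightarrow> bool" where
  "spectral_measure V M E \<longleftrightarrow>
     (\<forall>\<Delta>\<in>sets M. orthogonal_projection V (E \<Delta>)) \<and>
     (\<forall>x\<in>carrier V. E (space M) x = x) \<and>
     (\<forall>F :: nat \<Rightarrow> 'x set. range F \<subseteq> sets M \<longrightarrow> disjoint_family F \<longrightarrow>
        (\<forall>x\<in>carrier V. limitin (vtop V) (\<lambda>n. \<Oplus>\<^bsub>V\<^esub>i\<in>{..<n}. E (F i) x) (E (\<Union>i. F i) x) sequentially))"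

definition scalar_measure ::
  "'v ip_space \<Rightarrow> 'x measure \<Rightarrow> ('x set \<Rightarrow> 'v \<Rightarrow> 'v) \<Rightarrow> 'v \<Rightarrow> 'x measure" where
  "scalar_measure V M E x =
     measure_of (space M) (sets M) (\<lambda>\<Delta>. ennreal (Re (ip V (E \<Delta> x) x)))"

definition spectral_integral_domain ::
  "'v ip_space \<Rightarrow> 'x measure \<Rightarrow> ('x set \<Rightarrow> 'v \<Rightarrow> 'v) \<Rightarrow> ('x \<Rightarrow> complex) \<Rightarrow> 'v set" where
  "spectral_integral_domain V M E f =
     {x \<in> carrier V. (\<integral>\<^sup>+\<xi>. ennreal ((cmod (f \<xi>))\<^sup>2) \<partial>scalar_measure V M E x) < \<infinity>}"

text \<open>The operator \<open>T\<close> with \<open>\<langle>T x, y\<rangle> = \<integral> f d\<langle>E(\<cdot>) x, y\<rangle>\<close> for all \<open>x\<close>, \<open>y\<close> in its domain. The integral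
  with respect to the complex measure is expressed by polarization.\<close>

definition spectral_integral ::
  "'v ip_space \<Rightarrow> 'x measure \<Rightarrow> ('x set \<Rightarrow> 'v \<Rightarrow> 'v) \<Rightarrow> ('x \<Rightarrow> complex) \<Rightarrow> ('v \<times> 'v) set" where
  "spectral_integral V M E f =
     {(x, z). x \<in> spectral_integral_domain V M E f \<and> z \<in> carrier V \<and>
        (\<forall>y\<in>spectral_integral_domain V M E f. ip V z y =
           (\<Sum>k<4. \<i> ^ k * (\<integral>\<xi>. f \<xi> \<partial>scalar_measure V M E (x \<oplus>\<^bsub>V\<^esub> (\<i> ^ k) \<odot>\<^bsub>V\<^esub> y))) / 4)}"


section \<open>*-representations\<close>

text \<open>The operators matter only on the domain and for elements of the *-subalgebra \<open>S\<close> that is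
  represented; replacing \<open>S\<close> by a smaller *-subalgebra amounts to restricting the
  representation.\<close>

record ('a, 'v) rep =
  rep_space :: "'v ip_space"
  rep_dom :: "'v set"
  rep_op :: "'a \<Rightarrow> 'v \<Rightarrow> 'v"

locale star_representation =
  fixes S :: "'a::star_algebra set" and \<pi> :: "('a, 'v) rep"
  assumes hilbert: "hilbert_space (rep_space \<pi>)"
    and subspace_dom: "submodule (rep_dom \<pi>) complex_ring (rep_space \<pi>)"
    and dense_dom: "vtop (rep_space \<pi>) closure_of rep_dom \<pi> = carrier (rep_space \<pi>)"
    and op_closed: "\<lbrakk>a \<in> S; x \<in> rep_dom \<pi>\<rbrakk> \<Longrightarrow> rep_op \<pi> a x \<in> rep_dom \<pi>"
    and op_add: "\<lbrakk>a \<in> S; x \<in> rep_dom \<pi>; y \<in> rep_dom \<pi>\<rbrakk> \<Longrightarrow>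
      rep_op \<pi> a (x \<oplus>\<^bsub>rep_space \<pi>\<^esub> y) = rep_op \<pi> a x \<oplus>\<^bsub>rep_space \<pi>\<^esub> rep_op \<pi> a y"
    and op_smult: "\<lbrakk>a \<in> S; x \<in> rep_dom \<pi>\<rbrakk> \<Longrightarrow>
      rep_op \<pi> a (c \<odot>\<^bsub>rep_space \<pi>\<^esub> x) = c \<odot>\<^bsub>rep_space \<pi>\<^esub> rep_op \<pi> a x"
    and hom_add: "\<lbrakk>a \<in> S; b \<in> S; x \<in> rep_dom \<pi>\<rbrakk> \<Longrightarrow>
      rep_op \<pi> (a + b) x = rep_op \<pi> a x \<oplus>\<^bsub>rep_space \<pi>\<^esub> rep_op \<pi> b x"
    and hom_scaleC: "\<lbrakk>a \<in> S; x \<in> rep_dom \<pi>\<rbrakk> \<Longrightarrow>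
      rep_op \<pi> (c *\<^sub>C a) x = c \<odot>\<^bsub>rep_space \<pi>\<^esub> rep_op \<pi> a x"
    and hom_mult: "\<lbrakk>a \<in> S; b \<in> S; x \<in> rep_dom \<pi>\<rbrakk> \<Longrightarrow>
      rep_op \<pi> (a * b) x = rep_op \<pi> a (rep_op \<pi> b x)"
    and hom_star: "\<lbrakk>a \<in> S; x \<in> rep_dom \<pi>; y \<in> rep_dom \<pi>\<rbrakk> \<Longrightarrow>
      ip (rep_space \<pi>) (rep_op \<pi> a x) y = ip (rep_space \<pi>) x (rep_op \<pi> (star a) y)"

definition graph_norm :: "('a, 'v) rep \<Rightarrow> 'a \<Rightarrow> 'v \<Rightarrow> real" where
  "graph_norm \<pi> a x = vnorm (rep_space \<pi>) x + vnorm (rep_space \<pi>) (rep_op \<pi> a x)"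

definition graph_topology :: "'a set \<Rightarrow> ('a, 'v) rep \<Rightarrow> 'v topology" where
  "graph_topology S \<pi> = topology_generated_by
     {{y \<in> rep_dom \<pi>. graph_norm \<pi> a (y \<ominus>\<^bsub>rep_space \<pi>\<^esub> x) < r} | a x r.
        a \<in> S \<and> x \<in> rep_dom \<pi> \<and> 0 < r}"

definition graph_cauchy :: "'a set \<Rightarrow> ('a, 'v) rep \<Rightarrow> 'v filter \<Rightarrow> bool" where
  "graph_cauchy S \<pi> F \<longleftrightarrow> F \<noteq> bot \<and> (\<forall>\<^sub>F x in F. x \<in> rep_dom \<pi>) \<and>
     (\<forall>a\<in>S. \<forall>\<epsilon>>0. \<forall>\<^sub>F (x, y) in F \<times>\<^sub>F F. graph_norm \<pi> a (x \<ominus>\<^bsub>rep_space \<pi>\<^esub> y) < \<epsilon>)"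

definition closed_rep :: "'a set \<Rightarrow> ('a, 'v) rep \<Rightarrow> bool" where
  "closed_rep S \<pi> \<longleftrightarrow>
     (\<forall>F. graph_cauchy S \<pi> F \<longrightarrow> (\<exists>x. limitin (graph_topology S \<pi>) (\<lambda>y. y) x F))"

text \<open>The completion of the domain in the graph topology is realized inside the Hilbert space
  by sending a graph Cauchy filter to its limit in norm; each operator is extended by taking
  limits along such filters.\<close>

definition rep_closure :: "'a set \<Rightarrow> ('a, 'v) rep \<Rightarrow> ('a, 'v) rep" where
  "rep_closure S \<pi> = \<lparr>rep_space = rep_space \<pi>,
     rep_dom = {x. \<exists>F. graph_cauchy S \<pi> F \<and> limitin (vtop (rep_space \<pi>)) (\<lambda>y. y) x F},
     rep_op = (\<lambda>a x. THE z. \<exists>F. graph_cauchy S \<pi> F \<and>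
        limitin (vtop (rep_space \<pi>)) (\<lambda>y. y) x F \<and>
        limitin (vtop (rep_space \<pi>)) (rep_op \<pi> a) z F)\<rparr>"

definition integrable_rep :: "'a::star_algebra set \<Rightarrow> ('a, 'v) rep \<Rightarrow> bool" where
  "integrable_rep B \<pi> \<longleftrightarrow> star_representation B \<pi> \<and> closed_rep B \<pi> \<and>
     (\<forall>b\<in>B. op_closure (rep_space \<pi>) (op_graph (rep_dom \<pi>) (rep_op \<pi> (star b))) =
              op_adjoint (rep_space \<pi>) (op_graph (rep_dom \<pi>) (rep_op \<pi> b)))"

text \<open>Well-behaved *-representations of the part of the algebra graded by the subgroup \<open>K\<close>.
  Positivity of characters and the partial action always refer to the whole algebra.\<close>

definition well_behaved ::
  "('g, 'm) monoid_scheme \<Rightarrow> ('g \<Rightarrow> 'a::star_algebra set) \<Rightarrow> 'g set \<Rightarrow> ('a, 'v) rep \<Rightarrow> bool" where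
  "well_behaved G A K \<pi> \<longleftrightarrow>
     star_representation (graded_part A K) \<pi> \<and>
     integrable_rep (A \<one>\<^bsub>G\<^esub>) \<pi> \<and>
     (\<exists>E. spectral_measure (rep_space \<pi>) (borel_of (character_topology G A)) E \<and>
        (\<forall>b\<in>A \<one>\<^bsub>G\<^esub>. op_closure (rep_space \<pi>) (op_graph (rep_dom \<pi>) (rep_op \<pi> b)) =
           spectral_integral (rep_space \<pi>) (borel_of (character_topology G A)) E (\<lambda>\<xi>. \<xi> b)) \<and>
        (\<forall>g\<in>K. \<forall>a\<in>A g. \<forall>\<Delta>\<in>sets (borel_of (character_topology G A)).
           op_graph (rep_dom \<pi>) (rep_op \<pi> a) O
             op_graph (carrier (rep_space \<pi>)) (E (act_set G A g \<Delta>))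
           \<subseteq> op_graph (carrier (rep_space \<pi>)) (E \<Delta>) O op_graph (rep_dom \<pi>) (rep_op \<pi> a)))"


section \<open>Induced representations\<close>

text \<open>The free complex vector space on the pairs \<open>(a, v)\<close>, with the sesquilinear form determined
  by \<open>\<langle>(a, v), (b, w)\<rangle> = \<langle>\<rho> (p\<^sub>H (star b * a)) v, w\<rangle>\<close>.\<close>

definition free_space ::
  "('g, 'm) monoid_scheme \<Rightarrow> ('g \<Rightarrow> 'a::star_algebra set) \<Rightarrow> 'g set \<Rightarrow> ('a, 'v) rep
     \<Rightarrow> (('a \<times> 'v) \<Rightarrow>\<^sub>0 complex) ip_space" where
  "free_space G A H \<rho> = \<lparr>carrier = {p. Poly_Mapping.keys p \<subseteq> UNIV \<times> rep_dom \<rho>},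
     mult = undefined, one = undefined, zero = 0, add = (+),
     smult = (\<lambda>c. Poly_Mapping.map ((*) c)),
     ip = (\<lambda>p q. \<Sum>(a, v)\<in>Poly_Mapping.keys p. \<Sum>(b, w)\<in>Poly_Mapping.keys q.
       Poly_Mapping.lookup p (a, v) * cnj (Poly_Mapping.lookup q (b, w)) *
       ip (rep_space \<rho>) (rep_op \<rho> (part_projection G A H (star b * a)) v) w)\<rparr>"

abbreviation tensor_gen :: "'a \<Rightarrow> 'v \<Rightarrow> ('a \<times> 'v) \<Rightarrow>\<^sub>0 complex" where
  "tensor_gen a v \<equiv> Poly_Mapping.single (a, v) 1"

definition tensor_relations ::
  "('g, 'm) monoid_scheme \<Rightarrow> ('g \<Rightarrow> 'a::star_algebra set) \<Rightarrow> 'g set \<Rightarrow> ('a, 'v) rep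
     \<Rightarrow> (('a \<times> 'v) \<Rightarrow>\<^sub>0 complex) set" where
  "tensor_relations G A H \<rho> =
     (\<lambda>N. submodule N complex_ring (free_space G A H \<rho>)) hull
       ({tensor_gen (a + b) v - tensor_gen a v - tensor_gen b v | a b v. v \<in> rep_dom \<rho>} \<union>
        {tensor_gen a (v \<oplus>\<^bsub>rep_space \<rho>\<^esub> w) - tensor_gen a v - tensor_gen a w | a v w.
           v \<in> rep_dom \<rho> \<and> w \<in> rep_dom \<rho>} \<union>
        {tensor_gen (c *\<^sub>C a) v - Poly_Mapping.single (a, v) c | c a v. v \<in> rep_dom \<rho>} \<union>
        {tensor_gen a (c \<odot>\<^bsub>rep_space \<rho>\<^esub> v) - Poly_Mapping.single (a, v) c | c a v.
           v \<in> rep_dom \<rho>} \<union>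
        {tensor_gen (a * b) v - tensor_gen a (rep_op \<rho> b v) | a b v.
           b \<in> graded_part A H \<and> v \<in> rep_dom \<rho>})"

definition tensor_space ::
  "('g, 'm) monoid_scheme \<Rightarrow> ('g \<Rightarrow> 'a::star_algebra set) \<Rightarrow> 'g set \<Rightarrow> ('a, 'v) rep
     \<Rightarrow> (('a \<times> 'v) \<Rightarrow>\<^sub>0 complex) set ip_space" where
  "tensor_space G A H \<rho> = quotient_space (free_space G A H \<rho>) (tensor_relations G A H \<rho>)"

definition inducible ::
  "('g, 'm) monoid_scheme \<Rightarrow> ('g \<Rightarrow> 'a::star_algebra set) \<Rightarrow> 'g set \<Rightarrow> ('a, 'v) rep \<Rightarrow> bool" where
  "inducible G A H \<rho> \<longleftrightarrow>
     (\<forall>\<eta>\<in>carrier (tensor_space G A H \<rho>). ip (tensor_space G A H \<rho>) \<eta> \<eta> \<in> \<real>\<^sub>\<ge>\<^sub>0)"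

definition free_left_mult ::
  "'a::star_algebra \<Rightarrow> (('a \<times> 'v) \<Rightarrow>\<^sub>0 complex) \<Rightarrow> (('a \<times> 'v) \<Rightarrow>\<^sub>0 complex)" where
  "free_left_mult a p =
     (\<Sum>(b, v)\<in>Poly_Mapping.keys p. Poly_Mapping.single (a * b, v) (Poly_Mapping.lookup p (b, v)))"

definition tensor_left_mult ::
  "('g, 'm) monoid_scheme \<Rightarrow> ('g \<Rightarrow> 'a::star_algebra set) \<Rightarrow> 'g set \<Rightarrow> ('a, 'v) rep \<Rightarrow> 'a
     \<Rightarrow> (('a \<times> 'v) \<Rightarrow>\<^sub>0 complex) set \<Rightarrow> (('a \<times> 'v) \<Rightarrow>\<^sub>0 complex) set" where
  "tensor_left_mult G A H \<rho> a =
     quotient_map (free_space G A H \<rho>) (tensor_relations G A H \<rho>) (free_left_mult a)"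

definition induced_rep ::
  "('g, 'm) monoid_scheme \<Rightarrow> ('g \<Rightarrow> 'a::star_algebra set) \<Rightarrow> 'g set \<Rightarrow> ('a, 'v) rep
     \<Rightarrow> ('a, (nat \<Rightarrow> (('a \<times> 'v) \<Rightarrow>\<^sub>0 complex) set set) set) rep" where
  "induced_rep G A H \<rho> =
     (let T = tensor_space G A H \<rho>;
          Q = quotient_space T (null_space T);
          j = completion_embedding Q
      in rep_closure UNIV
           \<lparr>rep_space = completion Q,
            rep_dom = j ` carrier Q,
            rep_op = (\<lambda>a x. j (quotient_map T (null_space T) (tensor_left_mult G A H \<rho> a)
                                (the_inv_into (carrier Q) j x)))\<rparr>)"

end

theory Submission
  imports Defs
begin

text \<open>Let \<open>E\<close> be the spectral measure of \<open>\<rho>\<close> and let \<open>t a v\<close> be the class of \<open>a \<otimes> v\<close> in the Hilbert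
  space of the induced representation \<open>\<pi>\<close>. Covariance leaves only one candidate for the spectral
  measure of \<open>\<pi>\<close>: for \<open>a\<close> homogeneous of degree \<open>g\<close> it must send \<open>t a v\<close> to \<open>t a (E (pull g \<Delta>) v)\<close>,
  where \<open>pull g \<Delta>\<close> is the set of all \<open>\<xi>\<close> in the domain of \<open>g\<close> with \<open>\<xi>\<^sup>g \<in> \<Delta>\<close>. The proof consists in
  showing that this prescription works.

  Existence. Since \<open>\<parallel>t a (E S v)\<parallel>\<^sup>2 = \<langle>\<rho>(a\<^sup>*a) E(S)v, E(S)v\<rangle>\<close>, the vector \<open>t a (E S v)\<close> depends on \<open>S\<close>
  only through the characters with \<open>\<xi>(a\<^sup>*a) \<noteq> 0\<close> (\<open>t_agree\<close>). Together with the composition law of the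
  partial action this shows that the prescription is symmetric for the induced form
  (\<open>t_symmetric\<close>). A symmetric idempotent relation on a dense set of vectors is automatically
  well defined and contractive, so it extends to an orthogonal projection
  (\<open>dense_relation_projection\<close>). Countable additivity and covariance are then checked on the
  vectors \<open>t a v\<close>.

  Spectral integrals. The vectors \<open>t a v\<close> for different degrees in one coset of \<open>H\<close> are not
  orthogonal, so the formula \<open>\<langle>\<pi>(b)x, x\<rangle> = \<integral> \<xi>(b) d\<langle>E\<^sub>\<pi>(\<xi>)x, x\<rangle>\<close> does not pass from them to their sums.
  Instead, the graph of a spectral integral \<open>\<integral> f dE\<close> is described locally (\<open>locally_eigen\<close>): on
  every set on which \<open>f\<close> is \<open>\<epsilon>\<close>-close to a constant \<open>c\<close>, the image of \<open>x\<close> is \<open>2\<epsilon>\<close>-close to \<open>c x\<close>. For \<open>\<pi>\<close>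
  this asks for \<open>\<parallel>\<pi>(b - c) y\<parallel> \<le> \<epsilon> \<parallel>y\<parallel>\<close>, where \<open>y\<close> is in the range of the projection of such a set. The vectors
  \<open>t a v\<close> satisfy the analogous bounds for all powers of \<open>s = (b - c)\<^sup>*(b - c)\<close>; sums satisfy them up to
  a constant factor, and the factor disappears because \<open>k \<mapsto> \<parallel>\<pi>(s\<^sup>k) y\<parallel>\<close> is logarithmically convex
  (\<open>D0_bound\<close>).

  Integrability. The spectral projections of the sets \<open>{\<bar>f\<bar> \<le> n}\<close> commute with \<open>\<pi>(b)\<close> and make it
  bounded. Truncating with them shows that the closure of \<open>\<pi>(b)\<close> is the whole spectral integral and
  that the closure of \<open>\<pi>(b\<^sup>*)\<close> is the adjoint of \<open>\<pi>(b)\<close> (\<open>closure_eq_spectral_integral\<close>,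
  \<open>closure_eq_adjoint\<close>). Finally \<open>\<parallel>\<pi>(a)x\<parallel>\<^sup>2 = \<langle>\<pi>(a\<^sup>*a)x, x\<rangle>\<close> with \<open>a\<^sup>*a\<close> of trivial degree for homogeneous
  \<open>a\<close>, so the graph topologies of the whole algebra and of its part of trivial degree have the same
  Cauchy filters (\<open>graph_cauchy_B\<close>) and the restriction of \<open>\<pi>\<close> is closed.\<close>

section \<open>Hermitian forms and Hilbert spaces\<close>

lemma complex_ring_simps [simp]:
  "carrier complex_ring = UNIV" "mult complex_ring = (*)" "one complex_ring = 1"
  "zero complex_ring = 0" "add complex_ring = (+)"
  by (auto simp: complex_ring_def)

lemma complex_cring: "cring complex_ring"
proof (intro cringI abelian_groupI comm_monoidI)
  fix x assume "x \<in> carrier complex_ring"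
  show "\<exists>y\<in>carrier complex_ring. y \<oplus>\<^bsub>complex_ring\<^esub> x = \<zero>\<^bsub>complex_ring\<^esub>"
    by (rule bexI[of _ "- x"]) simp_all
qed (simp_all add: algebra_simps)

text \<open>Positivity is split off because the form on the free space over \<open>A \<times> D(\<rho>)\<close> is first known only to be
  hermitian; it becomes nonnegative on the tensor product by inducibility.\<close>

locale hermitian_space = Module.module complex_ring V for V :: "'v ip_space" (structure) +
  assumes ip_add_left: "\<lbrakk>x \<in> carrier V; y \<in> carrier V; z \<in> carrier V\<rbrakk> \<Longrightarrow>
      ip V (x \<oplus> y) z = ip V x z + ip V y z"
    and ip_smult_left: "\<lbrakk>x \<in> carrier V; y \<in> carrier V\<rbrakk> \<Longrightarrow> ip V (c \<odot> x) y = c * ip V x y"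
    and ip_commute: "\<lbrakk>x \<in> carrier V; y \<in> carrier V\<rbrakk> \<Longrightarrow> ip V y x = cnj (ip V x y)"
begin

lemma smult_in [simp, intro]: "x \<in> carrier V \<Longrightarrow> c \<odot> x \<in> carrier V"
  by (rule smult_closed) simp_all

lemma diff_zero [simp]: "x \<in> carrier V \<Longrightarrow> x \<ominus> \<zero> = x"
  by (simp add: M.minus_eq)

lemma diff_eq_zero: "\<lbrakk>x \<in> carrier V; y \<in> carrier V\<rbrakk> \<Longrightarrow> x \<ominus> y = \<zero> \<longleftrightarrow> x = y"
  by (metis M.a_inv_closed M.add.inv_equality M.minus_eq M.minus_minus M.r_neg)

lemma ip_add_right: "\<lbrakk>x \<in> carrier V; y \<in> carrier V; z \<in> carrier V\<rbrakk> \<Longrightarrow>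
      ip V z (x \<oplus> y) = ip V z x + ip V z y"
  by (metis M.a_closed complex_cnj_add ip_add_left ip_commute)

lemma ip_smult_right: "\<lbrakk>x \<in> carrier V; y \<in> carrier V\<rbrakk> \<Longrightarrow> ip V x (c \<odot> y) = cnj c * ip V x y"
  by (metis complex_cnj_mult ip_commute ip_smult_left smult_in)

lemma ip_zero_left: "y \<in> carrier V \<Longrightarrow> ip V \<zero> y = 0"
  using ip_add_left[of \<zero> \<zero> y] by simp

lemma ip_zero_right: "y \<in> carrier V \<Longrightarrow> ip V y \<zero> = 0"
  using ip_add_right[of \<zero> \<zero> y] by simp

lemma ip_inv_left: "\<lbrakk>x \<in> carrier V; y \<in> carrier V\<rbrakk> \<Longrightarrow> ip V (\<ominus> x) y = - ip V x y"
  using ip_add_left[of x "\<ominus> x" y] by (simp add: M.r_neg ip_zero_left add_eq_0_iff)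

lemma ip_inv_right: "\<lbrakk>x \<in> carrier V; y \<in> carrier V\<rbrakk> \<Longrightarrow> ip V y (\<ominus> x) = - ip V y x"
  by (metis M.a_inv_closed complex_cnj_minus ip_commute ip_inv_left)

lemma ip_diff_left: "\<lbrakk>x \<in> carrier V; y \<in> carrier V; z \<in> carrier V\<rbrakk> \<Longrightarrow>
      ip V (x \<ominus> y) z = ip V x z - ip V y z"
  by (simp add: M.minus_eq ip_add_left ip_inv_left)

lemma ip_diff_right: "\<lbrakk>x \<in> carrier V; y \<in> carrier V; z \<in> carrier V\<rbrakk> \<Longrightarrow>
      ip V z (x \<ominus> y) = ip V z x - ip V z y"
  by (simp add: M.minus_eq ip_add_right ip_inv_right)

lemmas ip_simps = ip_add_left ip_add_right ip_smult_left ip_smult_right ip_zero_left ip_zero_right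
  ip_inv_left ip_inv_right ip_diff_left ip_diff_right

lemma submodule_closed:
  assumes "submodule D complex_ring V"
  shows "x \<in> D \<Longrightarrow> x \<in> carrier V" "\<zero> \<in> D" "x \<in> D \<Longrightarrow> y \<in> D \<Longrightarrow> x \<oplus> y \<in> D"
    "x \<in> D \<Longrightarrow> y \<in> D \<Longrightarrow> x \<ominus> y \<in> D" "x \<in> D \<Longrightarrow> c \<odot> x \<in> D"
proof -
  note E = submoduleE[OF assms]
  show "x \<in> carrier V" if "x \<in> D" using E that by auto
  have s: "c \<odot> x \<in> D" if "x \<in> D" for c x using E(4)[of c x] that by simp
  then show "x \<in> D \<Longrightarrow> c \<odot> x \<in> D" .
  show "x \<in> D \<Longrightarrow> y \<in> D \<Longrightarrow> x \<oplus> y \<in> D" using E by auto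
  show "x \<in> D \<Longrightarrow> y \<in> D \<Longrightarrow> x \<ominus> y \<in> D" using E by (auto simp: M.minus_eq)
  obtain w where "w \<in> D" using E(2) by auto
  then have "w \<ominus> w \<in> D" "w \<in> carrier V" using E by (auto simp: M.minus_eq)
  then show "\<zero> \<in> D" by (simp add: M.minus_eq M.r_neg)
qed

end

locale semi_ip_space = hermitian_space +
  assumes ip_nonneg: "x \<in> carrier V \<Longrightarrow> ip V x x \<in> \<real>\<^sub>\<ge>\<^sub>0"
begin

lemma vnorm_nonneg [simp]: "x \<in> carrier V \<Longrightarrow> 0 \<le> vnorm V x"
  using ip_nonneg[of x] by (auto simp: vnorm_def elim!: nonneg_Reals_cases)

lemma ip_self: "x \<in> carrier V \<Longrightarrow> ip V x x = complex_of_real ((vnorm V x)\<^sup>2)"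
  using ip_nonneg[of x] by (auto simp: vnorm_def elim!: nonneg_Reals_cases simp flip: of_real_power)

lemma vnorm_sq: "x \<in> carrier V \<Longrightarrow> (vnorm V x)\<^sup>2 = Re (ip V x x)"
  using ip_self[of x] by simp

lemma vnorm_add_sq:
  "\<lbrakk>x \<in> carrier V; y \<in> carrier V\<rbrakk> \<Longrightarrow>
    (vnorm V (x \<oplus> y))\<^sup>2 = (vnorm V x)\<^sup>2 + 2 * Re (ip V x y) + (vnorm V y)\<^sup>2"
  using ip_commute[of x y] by (simp add: vnorm_sq ip_simps)

lemma vnorm_smult: "x \<in> carrier V \<Longrightarrow> vnorm V (c \<odot> x) = cmod c * vnorm V x"
proof -
  assume x: "x \<in> carrier V"
  have "ip V (c \<odot> x) (c \<odot> x) = (c * cnj c) * ip V x x" using x by (simp add: ip_simps)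
  also have "\<dots> = complex_of_real ((cmod c * vnorm V x)\<^sup>2)"
    using x by (simp add: ip_self power_mult_distrib complex_mult_cnj cmod_power2)
  finally have "(vnorm V (c \<odot> x))\<^sup>2 = (cmod c * vnorm V x)\<^sup>2"
    using x by (simp add: vnorm_sq)
  then show ?thesis using x by (simp add: power2_eq_iff_nonneg)
qed

lemma vnorm_zero [simp]: "vnorm V \<zero> = 0"
  by (simp add: vnorm_def ip_simps)

lemma cauchy_schwarz:
  assumes x: "x \<in> carrier V" and y: "y \<in> carrier V"
  shows "cmod (ip V x y) \<le> vnorm V x * vnorm V y"
proof -
  define z where "z = ip V x y"
  \<comment> \<open>The vector \<open>x - t \<langle>x, y\<rangle> y\<close> has a nonnegative square for every real \<open>t\<close>.\<close>
  have *: "0 \<le> (vnorm V x)\<^sup>2 - 2 * t * (cmod z)\<^sup>2 + t\<^sup>2 * (cmod z)\<^sup>2 * (vnorm V y)\<^sup>2" for t :: real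
  proof -
    have "0 \<le> (vnorm V (x \<oplus> (- complex_of_real t * z) \<odot> y))\<^sup>2" by simp
    also have "\<dots> = (vnorm V x)\<^sup>2 + 2 * Re (- complex_of_real t * cnj z * z) + (t * cmod z * vnorm V y)\<^sup>2"
      using x y by (simp add: vnorm_add_sq ip_smult_right vnorm_smult z_def norm_mult power_mult_distrib)
    also have "Re (- complex_of_real t * cnj z * z) = - t * (cmod z)\<^sup>2"
      by (simp add: cmod_power2) (simp add: algebra_simps power2_eq_square)
    finally show ?thesis by (simp add: power_mult_distrib)
  qed
  have "(cmod z)\<^sup>2 \<le> (vnorm V x)\<^sup>2 * (vnorm V y)\<^sup>2"
  proof (cases "vnorm V y = 0")
    \<comment> \<open>The form may be degenerate: for \<open>\<parallel>y\<parallel> = 0\<close> the bound is affine in \<open>t\<close>, which forces \<open>z = 0\<close>.\<close>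
    case True
    have "cmod z = 0"
    proof (rule ccontr)
      assume "cmod z \<noteq> 0"
      then have "2 * (((vnorm V x)\<^sup>2 + 1) / (2 * (cmod z)\<^sup>2)) * (cmod z)\<^sup>2 = (vnorm V x)\<^sup>2 + 1" by simp
      with *[of "((vnorm V x)\<^sup>2 + 1) / (2 * (cmod z)\<^sup>2)"] True show False by simp
    qed
    then show ?thesis by simp
  next
    case False
    then have p: "(vnorm V y)\<^sup>2 > 0" by simp
    have "0 \<le> (vnorm V x)\<^sup>2 - (cmod z)\<^sup>2 / (vnorm V y)\<^sup>2"
    proof -
      have "2 * (1 / (vnorm V y)\<^sup>2) * (cmod z)\<^sup>2 - (1 / (vnorm V y)\<^sup>2)\<^sup>2 * (cmod z)\<^sup>2 * (vnorm V y)\<^sup>2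
        = (cmod z)\<^sup>2 / (vnorm V y)\<^sup>2"
        using False by (simp add: field_simps power2_eq_square)
      then show ?thesis using *[of "1 / (vnorm V y)\<^sup>2"] by linarith
    qed
    then show ?thesis using p by (simp add: pos_divide_le_eq)
  qed
  then have "(cmod z)\<^sup>2 \<le> (vnorm V x * vnorm V y)\<^sup>2" by (simp add: power_mult_distrib)
  then show ?thesis using x y by (auto simp: z_def intro: power2_le_imp_le)
qed

lemma vnorm_triangle: "\<lbrakk>x \<in> carrier V; y \<in> carrier V\<rbrakk> \<Longrightarrow> vnorm V (x \<oplus> y) \<le> vnorm V x + vnorm V y"
proof -
  assume x: "x \<in> carrier V" and y: "y \<in> carrier V"
  have "Re (ip V x y) \<le> vnorm V x * vnorm V y"
    using cauchy_schwarz[OF x y] complex_Re_le_cmod[of "ip V x y"] by linarith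
  then have "(vnorm V (x \<oplus> y))\<^sup>2 \<le> (vnorm V x + vnorm V y)\<^sup>2"
    using x y by (simp add: vnorm_add_sq power2_sum)
  then show ?thesis using x y by (auto intro: power2_le_imp_le)
qed

lemma vnorm_inv: "x \<in> carrier V \<Longrightarrow> vnorm V (\<ominus> x) = vnorm V x"
  by (simp add: vnorm_def ip_simps)

lemma vnorm_commute: "\<lbrakk>x \<in> carrier V; y \<in> carrier V\<rbrakk> \<Longrightarrow> vnorm V (x \<ominus> y) = vnorm V (y \<ominus> x)"
  by (simp add: vnorm_def ip_simps)

lemma vnorm_diff_triangle: "\<lbrakk>x \<in> carrier V; y \<in> carrier V; z \<in> carrier V\<rbrakk> \<Longrightarrow>
  vnorm V (x \<ominus> z) \<le> vnorm V (x \<ominus> y) + vnorm V (y \<ominus> z)"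
proof -
  assume c: "x \<in> carrier V" "y \<in> carrier V" "z \<in> carrier V"
  have "x \<ominus> z = (x \<ominus> y) \<oplus> (y \<ominus> z)"
    using c by (simp add: M.minus_eq M.a_assoc[symmetric]) (simp add: M.a_assoc M.l_neg)
  then show ?thesis using c vnorm_triangle[of "x \<ominus> y" "y \<ominus> z"] by simp
qed

lemma vnorm_diff_ineq: "\<lbrakk>x \<in> carrier V; y \<in> carrier V\<rbrakk> \<Longrightarrow> \<bar>vnorm V x - vnorm V y\<bar> \<le> vnorm V (x \<ominus> y)"
  using vnorm_diff_triangle[of x y \<zero>] vnorm_diff_triangle[of y x \<zero>] vnorm_commute[of x y]
  by simp

text \<open>For a nonnegative form the null vectors are the radical, by the Cauchy-Schwarz inequality.\<close>

lemma null_space_eq: "null_space V = {x \<in> carrier V. \<forall>y\<in>carrier V. ip V x y = 0}"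
proof -
  have "ip V x y = 0" if x: "x \<in> carrier V" "ip V x x = 0" and y: "y \<in> carrier V" for x y
  proof -
    have "vnorm V x = 0" using x by (simp add: vnorm_def)
    then show ?thesis using cauchy_schwarz[OF x(1) y] by simp
  qed
  then show ?thesis by (auto simp: null_space_def)
qed

lemma null_space_submodule: "submodule (null_space V) complex_ring V"
  unfolding null_space_eq by (rule submoduleI) (auto simp: ip_simps)

end

sublocale pre_hilbert_space \<subseteq> semi_ip_space
  by unfold_locales (fact ip_add_left ip_smult_left ip_commute ip_nonneg)+


context pre_hilbert_space
begin

text \<open>Identities between linear expressions reduce to identities of complex numbers, because the form
  separates points.\<close>

lemma ip_eqI:
  assumes "x \<in> carrier V" "y \<in> carrier V" "\<And>u. u \<in> carrier V \<Longrightarrow> ip V x u = ip V y u"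
  shows "x = y"
proof -
  have "ip V (x \<ominus> y) (x \<ominus> y) = 0" using assms by (simp add: ip_simps)
  then have "x \<ominus> y = \<zero>" using assms by (intro ip_definite) auto
  then show ?thesis using assms(1,2) by (simp add: diff_eq_zero)
qed

lemma vnorm_eq_zero: "x \<in> carrier V \<Longrightarrow> vnorm V x = 0 \<longleftrightarrow> x = \<zero>"
  using ip_self[of x] ip_definite[of x] by auto

lemma Metric: "Metric_space (carrier V) (vdist V)"
proof
  show "vdist V x y = 0 \<longleftrightarrow> x = y" if "x \<in> carrier V" "y \<in> carrier V" for x y
    using that by (simp add: vdist_def vnorm_eq_zero diff_eq_zero)
  show "vdist V x z \<le> vdist V x y + vdist V y z"
    if "x \<in> carrier V" "y \<in> carrier V" "z \<in> carrier V" for x y z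
    using that vnorm_diff_triangle by (simp add: vdist_def)
qed (auto simp: vdist_def intro: vnorm_commute)

sublocale Met: Metric_space "carrier V" "vdist V" by (rule Metric)

lemma vtop_eq: "vtop V = Met.mtopology" by (simp add: vtop_def)

lemma topspace_vtop [simp]: "topspace (vtop V) = carrier V" by (simp add: vtop_eq)

abbreviation conv :: "('b \<Rightarrow> 'v) \<Rightarrow> 'v \<Rightarrow> 'b filter \<Rightarrow> bool" where
  "conv f l F \<equiv> limitin (vtop V) f l F"

lemma conv_iff: "conv f l F \<longleftrightarrow> l \<in> carrier V \<and> eventually (\<lambda>n. f n \<in> carrier V) F \<and>
    ((\<lambda>n. vnorm V (f n \<ominus> l)) \<longlongrightarrow> 0) F" (is "?L \<longleftrightarrow> ?R")
proof -
  have 1: "?L \<longleftrightarrow> l \<in> carrier V \<and> (\<forall>\<epsilon>>0. eventually (\<lambda>x. f x \<in> carrier V \<and> vdist V (f x) l < \<epsilon>) F)"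
    by (simp add: vtop_eq Met.limitin_metric)
  have 2: "eventually (\<lambda>x. f x \<in> carrier V \<and> vdist V (f x) l < \<epsilon>) F \<longleftrightarrow>
      eventually (\<lambda>x. f x \<in> carrier V \<and> dist (vnorm V (f x \<ominus> l)) 0 < \<epsilon>) F" if "l \<in> carrier V" for \<epsilon>
    using that by (intro eventually_cong refl always_eventually) (auto simp: vdist_def)
  show ?thesis
    unfolding 1 tendsto_iff using 2
    by (auto simp: eventually_conj_iff intro: zero_less_one)
qed

lemma conv_in: "conv f l F \<Longrightarrow> l \<in> carrier V" by (simp add: conv_iff)

lemma conv_ev: "conv f l F \<Longrightarrow> eventually (\<lambda>n. f n \<in> carrier V) F" by (simp add: conv_iff)

lemma convI:
  assumes "l \<in> carrier V" "eventually (\<lambda>n. f n \<in> carrier V) F"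
    "eventually (\<lambda>n. f n \<in> carrier V \<longrightarrow> vnorm V (f n \<ominus> l) \<le> g n) F" "(g \<longlongrightarrow> 0) F"
  shows "conv f l F"
  unfolding conv_iff
proof (intro conjI assms)
  show "((\<lambda>n. vnorm V (f n \<ominus> l)) \<longlongrightarrow> 0) F"
  proof (rule tendsto_sandwich[OF _ _ tendsto_const assms(4)])
    show "\<forall>\<^sub>F n in F. 0 \<le> vnorm V (f n \<ominus> l)"
      using assms(2) by eventually_elim (use assms(1) in simp)
    show "\<forall>\<^sub>F n in F. vnorm V (f n \<ominus> l) \<le> g n"
      using assms(2,3) by eventually_elim simp
  qed
qed

lemma conv_unique: "conv f l F \<Longrightarrow> conv f l' F \<Longrightarrow> F \<noteq> bot \<Longrightarrow> l = l'"
  unfolding vtop_eq by (rule Met.limitin_metric_unique)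

lemma conv_const: "l \<in> carrier V \<Longrightarrow> conv (\<lambda>_. l) l F"
  by (simp add: conv_iff M.minus_eq M.r_neg)

lemma conv_add:
  assumes "conv f l F" "conv g m F" shows "conv (\<lambda>n. f n \<oplus> g n) (l \<oplus> m) F"
proof (rule convI)
  show "l \<oplus> m \<in> carrier V" using assms by (auto simp: conv_iff)
  show "\<forall>\<^sub>F n in F. f n \<oplus> g n \<in> carrier V"
    using assms[THEN conv_ev] by eventually_elim simp
  have lm: "l \<in> carrier V" "m \<in> carrier V" using assms by (auto simp: conv_iff)
  show "\<forall>\<^sub>F n in F. f n \<oplus> g n \<in> carrier V \<longrightarrow>
      vnorm V ((f n \<oplus> g n) \<ominus> (l \<oplus> m)) \<le> vnorm V (f n \<ominus> l) + vnorm V (g n \<ominus> m)"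
    using assms[THEN conv_ev]
  proof eventually_elim
    case (elim n)
    have "(f n \<oplus> g n) \<ominus> (l \<oplus> m) = (f n \<ominus> l) \<oplus> (g n \<ominus> m)"
      using elim lm by (intro ip_eqI) (auto simp: ip_simps)
    then show ?case using elim lm vnorm_triangle[of "f n \<ominus> l" "g n \<ominus> m"] by simp
  qed
  show "((\<lambda>n. vnorm V (f n \<ominus> l) + vnorm V (g n \<ominus> m)) \<longlongrightarrow> 0) F"
    using assms by (auto simp: conv_iff intro: tendsto_add_zero)
qed

lemma conv_smult:
  assumes "conv f l F" shows "conv (\<lambda>n. c \<odot> f n) (c \<odot> l) F"
proof (rule convI)
  have l: "l \<in> carrier V" using assms by (auto simp: conv_iff)
  then show "c \<odot> l \<in> carrier V" by simp
  show "\<forall>\<^sub>F n in F. c \<odot> f n \<in> carrier V"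
    using assms[THEN conv_ev] by eventually_elim simp
  show "\<forall>\<^sub>F n in F. c \<odot> f n \<in> carrier V \<longrightarrow> vnorm V (c \<odot> f n \<ominus> c \<odot> l) \<le> cmod c * vnorm V (f n \<ominus> l)"
    using assms[THEN conv_ev]
  proof eventually_elim
    case (elim n)
    have "c \<odot> f n \<ominus> c \<odot> l = c \<odot> (f n \<ominus> l)"
      using elim l by (intro ip_eqI) (auto simp: ip_simps algebra_simps)
    then show ?case using elim l by (simp add: vnorm_smult)
  qed
  show "((\<lambda>n. cmod c * vnorm V (f n \<ominus> l)) \<longlongrightarrow> 0) F"
    using assms by (auto simp: conv_iff intro: tendsto_mult_right_zero)
qed

lemma conv_norm:
  assumes "conv f l F" shows "((\<lambda>n. vnorm V (f n)) \<longlongrightarrow> vnorm V l) F"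
proof -
  have l: "l \<in> carrier V" using assms by (auto simp: conv_iff)
  have "((\<lambda>n. vnorm V (f n) - vnorm V l) \<longlongrightarrow> 0) F"
  proof (rule Lim_null_comparison)
    show "\<forall>\<^sub>F n in F. norm (vnorm V (f n) - vnorm V l) \<le> vnorm V (f n \<ominus> l)"
      using assms[THEN conv_ev] by eventually_elim (use l vnorm_diff_ineq in auto)
  qed (use assms in \<open>simp add: conv_iff\<close>)
  then show ?thesis using LIM_zero_iff by blast
qed

lemma conv_ip:
  assumes "conv f l F" "conv g m F" shows "((\<lambda>n. ip V (f n) (g n)) \<longlongrightarrow> ip V l m) F"
proof -
  have lm: "l \<in> carrier V" "m \<in> carrier V" using assms by (auto simp: conv_iff)
  have "((\<lambda>n. ip V (f n) (g n) - ip V l m) \<longlongrightarrow> 0) F"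
  proof (rule Lim_null_comparison)
    show "\<forall>\<^sub>F n in F. norm (ip V (f n) (g n) - ip V l m) \<le>
        vnorm V (f n \<ominus> l) * vnorm V (g n) + vnorm V l * vnorm V (g n \<ominus> m)"
      using assms[THEN conv_ev]
    proof eventually_elim
      case (elim n)
      have "ip V (f n) (g n) - ip V l m = ip V (f n \<ominus> l) (g n) + ip V l (g n \<ominus> m)"
        using elim lm by (simp add: ip_simps)
      also have "cmod \<dots> \<le> cmod (ip V (f n \<ominus> l) (g n)) + cmod (ip V l (g n \<ominus> m))"
        by (rule norm_triangle_ineq)
      also have "\<dots> \<le> vnorm V (f n \<ominus> l) * vnorm V (g n) + vnorm V l * vnorm V (g n \<ominus> m)"
        using elim lm by (intro add_mono cauchy_schwarz) auto
      finally show ?case .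
    qed
    have "((\<lambda>n. vnorm V (f n \<ominus> l) * vnorm V (g n) + vnorm V l * vnorm V (g n \<ominus> m)) \<longlongrightarrow>
        0 * vnorm V m + vnorm V l * 0) F"
      using assms conv_norm[OF assms(2)] by (intro tendsto_intros) (auto simp: conv_iff)
    then show "((\<lambda>n. vnorm V (f n \<ominus> l) * vnorm V (g n) + vnorm V l * vnorm V (g n \<ominus> m)) \<longlongrightarrow> 0) F"
      by simp
  qed
  then show ?thesis using LIM_zero_iff by blast
qed

lemma conv_diff:
  assumes "conv f l F" "conv g m F" shows "conv (\<lambda>n. f n \<ominus> g n) (l \<ominus> m) F"
proof -
  have lm: "l \<in> carrier V" "m \<in> carrier V" using assms by (auto simp: conv_iff)
  have *: "x \<oplus> (-1) \<odot> y = x \<ominus> y" if "x \<in> carrier V" "y \<in> carrier V" for x y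
    using that by (intro ip_eqI) (auto simp: ip_simps)
  have "conv (\<lambda>n. f n \<oplus> (-1) \<odot> g n) (l \<ominus> m) F"
    using conv_add[OF assms(1) conv_smult[OF assms(2)], of "-1"] * lm by simp
  then show ?thesis
    by (rule limitin_transform_eventually[rotated])
      (use assms[THEN conv_ev] in \<open>eventually_elim, simp add: *\<close>)
qed

lemma mball_iff:
  "u \<in> Met.mball x \<epsilon> \<longleftrightarrow> x \<in> carrier V \<and> u \<in> carrier V \<and> vnorm V (u \<ominus> x) < \<epsilon>"
proof (cases "x \<in> carrier V \<and> u \<in> carrier V")
  case True
  then have "vdist V x u = vnorm V (u \<ominus> x)" unfolding vdist_def using vnorm_commute by metis
  with True show ?thesis by simp
qed auto

lemma closure_iff:
  assumes "D \<subseteq> carrier V"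
  shows "x \<in> vtop V closure_of D \<longleftrightarrow> x \<in> carrier V \<and> (\<forall>\<epsilon>>0. \<exists>y\<in>D. vnorm V (y \<ominus> x) < \<epsilon>)"
proof -
  have "vdist V x y = vnorm V (y \<ominus> x)" if "x \<in> carrier V" "y \<in> D" for y
    using that assms vnorm_commute by (auto simp: vdist_def)
  then show ?thesis using assms
    by (auto simp: vtop_eq Met.metric_closure_of subset_iff)
qed

definition dense_in :: "'v set \<Rightarrow> bool" where
  "dense_in D \<longleftrightarrow> D \<subseteq> carrier V \<and> (\<forall>x\<in>carrier V. \<forall>\<epsilon>>0. \<exists>y\<in>D. vnorm V (y \<ominus> x) < \<epsilon>)"

lemma dense_in_iff: "D \<subseteq> carrier V \<Longrightarrow> vtop V closure_of D = carrier V \<longleftrightarrow> dense_in D"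
  unfolding dense_in_def using closure_iff[of D] by (simp add: set_eq_iff) blast

lemma dense_seq:
  assumes "dense_in D" "x \<in> carrier V"
  obtains s where "range s \<subseteq> D" "conv s x sequentially"
proof -
  have "\<exists>y\<in>D. vnorm V (y \<ominus> x) < 1 / real (Suc n)" for n
    using assms unfolding dense_in_def by auto
  then obtain s where s: "\<And>n. s n \<in> D" "\<And>n. vnorm V (s n \<ominus> x) < 1 / real (Suc n)" by metis
  have "conv s x sequentially"
  proof (rule convI)
    show "(\<lambda>n. 1 / real (Suc n)) \<longlonglongrightarrow> 0" using LIMSEQ_inverse_real_of_nat by (simp add: field_simps)
    have "s n \<in> carrier V" for n using s(1)[of n] assms by (auto simp: dense_in_def)
    then show "\<forall>\<^sub>F n in sequentially. s n \<in> carrier V" by simp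
  qed (use s(2) assms in \<open>auto intro: less_imp_le always_eventually\<close>)
  then show ?thesis using that s by blast
qed

lemma dense_eqI:
  assumes "dense_in D" "x \<in> carrier V" "y \<in> carrier V" "\<And>u. u \<in> D \<Longrightarrow> ip V x u = ip V y u"
  shows "x = y"
proof (rule ip_eqI)
  fix u assume "u \<in> carrier V"
  then obtain s where s: "range s \<subseteq> D" "conv s u sequentially" using dense_seq assms by metis
  have "(\<lambda>n. ip V x (s n)) \<longlonglongrightarrow> ip V x u" "(\<lambda>n. ip V y (s n)) \<longlonglongrightarrow> ip V y u"
    using s assms by (auto intro: conv_ip conv_const)
  moreover have "ip V x (s n) = ip V y (s n)" for n using s assms by auto
  ultimately show "ip V x u = ip V y u" using LIMSEQ_unique by fastforce
qed (use assms in auto)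

text \<open>The closure of a graph in the product topology, in terms of simultaneous approximation of argument
  and value.\<close>

lemma op_closure_iff:
  assumes T: "T \<subseteq> carrier V \<times> carrier V"
  shows "(x, z) \<in> op_closure V T \<longleftrightarrow> x \<in> carrier V \<and> z \<in> carrier V \<and>
    (\<forall>\<epsilon>>0. \<exists>(u, w)\<in>T. vnorm V (u \<ominus> x) < \<epsilon> \<and> vnorm V (w \<ominus> z) < \<epsilon>)" (is "_ \<longleftrightarrow> ?R")
proof
  assume L: "(x, z) \<in> op_closure V T"
  then have xz: "x \<in> carrier V" "z \<in> carrier V" by (auto simp: op_closure_def in_closure_of)
  moreover have "\<exists>(u, w)\<in>T. vnorm V (u \<ominus> x) < \<epsilon> \<and> vnorm V (w \<ominus> z) < \<epsilon>" if "\<epsilon> > 0" for \<epsilon>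
  proof -
    have "openin (prod_topology (vtop V) (vtop V)) (Met.mball x \<epsilon> \<times> Met.mball z \<epsilon>)"
      by (simp add: openin_prod_Times_iff vtop_eq)
    moreover have "(x, z) \<in> Met.mball x \<epsilon> \<times> Met.mball z \<epsilon>" using xz that by simp
    ultimately obtain p where "p \<in> T" "p \<in> Met.mball x \<epsilon> \<times> Met.mball z \<epsilon>"
      using L unfolding op_closure_def in_closure_of by metis
    then obtain u w where "(u, w) \<in> T" "u \<in> Met.mball x \<epsilon>" "w \<in> Met.mball z \<epsilon>"
      by (cases p) (simp only: mem_Times_iff fst_conv snd_conv)
    then have "vnorm V (u \<ominus> x) < \<epsilon>" "vnorm V (w \<ominus> z) < \<epsilon>" "(u, w) \<in> T"
      by (simp_all only: mball_iff)
    then show ?thesis by (intro bexI[of _ "(u, w)"]) simp_all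
  qed
  ultimately show ?R by blast
next
  assume R: ?R
  show "(x, z) \<in> op_closure V T"
    unfolding op_closure_def in_closure_of
  proof (intro conjI allI impI)
    show "(x, z) \<in> topspace (prod_topology (vtop V) (vtop V))" using R by simp
    fix W assume "(x, z) \<in> W \<and> openin (prod_topology (vtop V) (vtop V)) W"
    then obtain U U' where U: "openin (vtop V) U" "openin (vtop V) U'" "x \<in> U" "z \<in> U'" "U \<times> U' \<subseteq> W"
      by (metis openin_prod_topology_alt)
    obtain r where r: "r > 0" "Met.mball x r \<subseteq> U" using U by (auto simp: vtop_eq Met.openin_mtopology)
    obtain r' where r': "r' > 0" "Met.mball z r' \<subseteq> U'" using U by (auto simp: vtop_eq Met.openin_mtopology)
    obtain u w where uw: "(u, w) \<in> T" "vnorm V (u \<ominus> x) < min r r'" "vnorm V (w \<ominus> z) < min r r'"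
      using R r r' by (metis (no_types, lifting) case_prodE min_less_iff_conj)
    have "u \<in> carrier V" "w \<in> carrier V" using uw T by auto
    then have "u \<in> Met.mball x r" "w \<in> Met.mball z r'"
      using uw R unfolding mball_iff by auto
    then show "\<exists>y. y \<in> T \<and> y \<in> W" using uw r r' U by blast
  qed
qed

lemma op_closure_seq:
  assumes T: "T \<subseteq> carrier V \<times> carrier V" and xz: "(x, z) \<in> op_closure V T"
  obtains s t where "\<And>n. (s n, t n) \<in> T" "conv s x sequentially" "conv t z sequentially"
proof -
  have R: "x \<in> carrier V" "z \<in> carrier V"
    "\<And>n. \<exists>p\<in>T. vnorm V (fst p \<ominus> x) < 1 / real (Suc n) \<and> vnorm V (snd p \<ominus> z) < 1 / real (Suc n)"
    using xz unfolding op_closure_iff[OF T] by (auto simp: case_prod_beta)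
  then obtain p where p: "\<And>n. p n \<in> T" "\<And>n. vnorm V (fst (p n) \<ominus> x) < 1 / real (Suc n)"
    "\<And>n. vnorm V (snd (p n) \<ominus> z) < 1 / real (Suc n)" by metis
  have l: "(\<lambda>n. 1 / real (Suc n)) \<longlonglongrightarrow> 0" using LIMSEQ_inverse_real_of_nat by (simp add: field_simps)
  have c: "fst (p n) \<in> carrier V" "snd (p n) \<in> carrier V" for n using p(1)[of n] T by auto
  have "conv (\<lambda>n. fst (p n)) x sequentially" "conv (\<lambda>n. snd (p n)) z sequentially"
    by (rule convI[OF _ _ _ l]; use R p c in \<open>auto simp: less_imp_le\<close>)+
  then show ?thesis using that[of "\<lambda>n. fst (p n)" "\<lambda>n. snd (p n)"] p by simp
qed

lemma op_closureI:
  assumes T: "T \<subseteq> carrier V \<times> carrier V" and F: "F \<noteq> bot"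
    and "eventually (\<lambda>n. (s n, t n) \<in> op_closure V T) F" "conv s x F" "conv t z F"
  shows "(x, z) \<in> op_closure V T"
proof -
  have "limitin (prod_topology (vtop V) (vtop V)) (\<lambda>n. (s n, t n)) (x, z) F"
    using assms by (simp add: limitin_pairwise o_def)
  then show ?thesis
    unfolding op_closure_def
    by (rule limitin_closedin[OF _ closedin_closure_of assms(3)[unfolded op_closure_def] F])
qed

lemma op_closure_superset:
  "T \<subseteq> carrier V \<times> carrier V \<Longrightarrow> T \<subseteq> op_closure V T"
  unfolding op_closure_def by (intro closure_of_subset) simp

end

context hilbert_space
begin

text \<open>Completeness is given for sequences, whereas graph topologies lead to Cauchy filters. As the norm
  topology is metrizable, a Cauchy sequence running through members of the filter suffices.\<close>

lemma filter_complete: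
  assumes F: "F \<noteq> bot" and car: "eventually (\<lambda>n. f n \<in> carrier V) F"
    and cau: "\<And>\<epsilon>. \<epsilon> > 0 \<Longrightarrow> eventually (\<lambda>(m, n). vnorm V (f m \<ominus> f n) < \<epsilon>) (F \<times>\<^sub>F F)"
  obtains l where "conv f l F"
proof -
  have "\<exists>P. eventually P F \<and> (\<forall>m n. P m \<longrightarrow> P n \<longrightarrow> f m \<in> carrier V \<and> vnorm V (f m \<ominus> f n) < \<epsilon>)"
    if "\<epsilon> > 0" for \<epsilon>
  proof -
    obtain P Q where "eventually P F" "eventually Q F"
      "\<And>m n. P m \<Longrightarrow> Q n \<Longrightarrow> vnorm V (f m \<ominus> f n) < \<epsilon>"
      using cau[OF \<open>\<epsilon> > 0\<close>] unfolding eventually_prod_filter by auto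
    with car show ?thesis
      by (intro exI[of _ "\<lambda>n. P n \<and> Q n \<and> f n \<in> carrier V"]) (auto simp: eventually_conj_iff)
  qed
  then have "\<forall>k::nat. \<exists>P. eventually P F \<and>
      (\<forall>m n. P m \<longrightarrow> P n \<longrightarrow> f m \<in> carrier V \<and> vnorm V (f m \<ominus> f n) < 1 / real (Suc k))"
    by simp
  then obtain P where P: "\<And>k. eventually (P k) F"
    "\<And>k m n. P k m \<Longrightarrow> P k n \<Longrightarrow> f m \<in> carrier V \<and> vnorm V (f m \<ominus> f n) < 1 / real (Suc k)"
    by metis
  have "\<exists>n. \<forall>j\<le>k. P j n" for k
  proof -
    have "eventually (\<lambda>n. \<forall>j\<in>{..k}. P j n) F" using P(1) by (intro eventually_ball_finite) auto
    then show ?thesis using F eventually_happens' by fastforce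
  qed
  then obtain x where x: "\<And>k j. j \<le> k \<Longrightarrow> P j (x k)" by metis
  have fx: "f (x k) \<in> carrier V" for k using P(2)[OF x x, of k k k] by simp
  have l0: "(\<lambda>n. 1 / real (Suc n)) \<longlonglongrightarrow> 0" using LIMSEQ_inverse_real_of_nat by (simp add: field_simps)
  have "Met.MCauchy (\<lambda>k. f (x k))"
    unfolding Met.MCauchy_def
  proof (intro conjI allI impI)
    fix \<epsilon> :: real assume "\<epsilon> > 0"
    then obtain N where N: "1 / real (Suc N) < \<epsilon>" using nat_approx_posE by blast
    show "\<exists>N. \<forall>n n'. N \<le> n \<longrightarrow> N \<le> n' \<longrightarrow> vdist V (f (x n)) (f (x n')) < \<epsilon>"
    proof (intro exI allI impI)
      fix n n' assume "N \<le> n" "N \<le> n'"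
      then show "vdist V (f (x n)) (f (x n')) < \<epsilon>"
        using P(2)[OF x x, of N n n'] fx N by (auto simp: vdist_def)
    qed
  qed (use fx in auto)
  then obtain l where l: "conv (\<lambda>k. f (x k)) l sequentially"
    using complete unfolding vtop_eq Met.mcomplete_def by blast
  then have lc: "l \<in> carrier V" by (rule conv_in)
  have "conv f l F"
    unfolding conv_iff
  proof (intro conjI lc car tendstoI)
    fix \<epsilon> :: real assume e: "\<epsilon> > 0"
    then obtain N where N: "1 / real (Suc N) < \<epsilon> / 2" using nat_approx_posE half_gt_zero by blast
    have "eventually (\<lambda>k. vnorm V (f (x k) \<ominus> l) < \<epsilon> / 2) sequentially"
    proof -
      have "eventually (\<lambda>k. dist (vnorm V (f (x k) \<ominus> l)) 0 < \<epsilon> / 2) sequentially"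
        using l e half_gt_zero unfolding conv_iff tendsto_iff by blast
      then show ?thesis by eventually_elim simp
    qed
    then obtain k where k: "k \<ge> N" "vnorm V (f (x k) \<ominus> l) < \<epsilon> / 2"
      by (metis (no_types, lifting) eventually_sequentially nle_le)
    show "\<forall>\<^sub>F n in F. dist (vnorm V (f n \<ominus> l)) 0 < \<epsilon>"
      using P(1)[of N]
    proof eventually_elim
      case (elim n)
      have *: "f n \<in> carrier V" "vnorm V (f n \<ominus> f (x k)) < 1 / real (Suc N)"
        using P(2)[OF elim x[OF k(1)]] by auto
      then have "vnorm V (f n \<ominus> l) < \<epsilon>"
        using vnorm_diff_triangle[OF *(1) fx[of k] lc] k N by linarith
      then show ?case using * lc by simp
    qed
  qed
  then show ?thesis using that by blast
qed

lemma seq_complete: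
  assumes "range f \<subseteq> carrier V" "\<And>\<epsilon>. \<epsilon> > 0 \<Longrightarrow> \<exists>N. \<forall>m\<ge>N. \<forall>n\<ge>N. vnorm V (f m \<ominus> f n) < \<epsilon>"
  obtains l where "conv f l sequentially"
proof -
  have "Met.MCauchy f"
    unfolding Met.MCauchy_def
  proof (intro conjI allI impI)
    fix \<epsilon> :: real assume "\<epsilon> > 0"
    then obtain N where "\<forall>m\<ge>N. \<forall>n\<ge>N. vnorm V (f m \<ominus> f n) < \<epsilon>" using assms(2) by blast
    then show "\<exists>N. \<forall>n n'. N \<le> n \<longrightarrow> N \<le> n' \<longrightarrow> vdist V (f n) (f n') < \<epsilon>"
      using assms(1) by (intro exI[of _ N]) (auto simp: vdist_def image_subset_iff)
  qed (use assms in auto)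
  then show ?thesis using that complete unfolding vtop_eq Met.mcomplete_def by blast
qed

end

section \<open>Quotients and completion\<close>

text \<open>This setting occurs three times: for the tensor relations, for the null vectors of the tensor
  product, and for the null sequences in the completion.\<close>

locale quotient_by_radical = hermitian_space +
  fixes N :: "'v set"
  assumes submodule_N: "submodule N complex_ring V"
    and N_radical: "\<lbrakk>x \<in> N; y \<in> carrier V\<rbrakk> \<Longrightarrow> ip V x y = 0"
begin

abbreviation Q where "Q \<equiv> quotient_space V N"
abbreviation q where "q x \<equiv> N +> x"

lemma abelian_subgroup_N: "abelian_subgroup N V"
  using submodule_N
  by (auto intro!: abelian_subgroupI3 additive_subgroupI M.abelian_group_axioms dest: submodule.axioms(1))

interpretation Nsub: abelian_subgroup N V by (rule abelian_subgroup_N)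

lemma mem_q: "x \<in> carrier V \<Longrightarrow> y \<in> q x \<longleftrightarrow> y \<in> carrier V \<and> y \<ominus> x \<in> N"
  using Nsub.a_rcos_module[of x y] Nsub.a_elemrcos_carrier[of x y] by (auto simp: M.minus_eq)

lemma self_in_q: "x \<in> carrier V \<Longrightarrow> x \<in> q x"
  by (simp add: mem_q diff_eq_zero[THEN iffD2] submodule_closed(2)[OF submodule_N])

lemma q_eq: "\<lbrakk>x \<in> carrier V; y \<in> carrier V\<rbrakk> \<Longrightarrow> q x = q y \<longleftrightarrow> x \<ominus> y \<in> N"
  using Nsub.a_repr_independence'[of x y] Nsub.a_repr_independenceD[of y x]
  by (metis mem_q self_in_q M.a_repr_independence Nsub.a_subgroup)

lemma some_q:
  assumes "x \<in> carrier V"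
  shows "(SOME y. y \<in> q x) \<in> carrier V" "(SOME y. y \<in> q x) \<ominus> x \<in> N"
  using someI[of "\<lambda>y. y \<in> q x", OF self_in_q[OF assms]] mem_q[OF assms] by auto

lemma Q_carrier: "carrier Q = q ` carrier V"
  by (auto simp: quotient_space_def A_RCOSETS_def')

lemma Q_in [simp]: "x \<in> carrier V \<Longrightarrow> q x \<in> carrier Q"
  by (auto simp: Q_carrier)

lemma Q_add: "\<lbrakk>x \<in> carrier V; y \<in> carrier V\<rbrakk> \<Longrightarrow> q x \<oplus>\<^bsub>Q\<^esub> q y = q (x \<oplus> y)"
  by (simp add: quotient_space_def Nsub.a_rcos_sum)

lemma Q_zero: "\<zero>\<^bsub>Q\<^esub> = q \<zero>"
  using Nsub.a_subset by (simp add: quotient_space_def)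

lemma N_diff_ip:
  assumes "x \<in> carrier V" "y \<in> carrier V" "y \<ominus> x \<in> N" "u \<in> carrier V"
  shows "ip V y u = ip V x u" "ip V u y = ip V u x"
proof -
  have "ip V (y \<ominus> x) u = 0" using assms N_radical by blast
  then show "ip V y u = ip V x u" using assms by (simp add: ip_simps)
  then show "ip V u y = ip V u x" using assms ip_commute[of _ u] by metis
qed

lemma Q_smult: "x \<in> carrier V \<Longrightarrow> c \<odot>\<^bsub>Q\<^esub> q x = q (c \<odot> x)"
proof -
  assume x: "x \<in> carrier V"
  define y where "y = (SOME y. y \<in> q x)"
  have y: "y \<in> carrier V" "y \<ominus> x \<in> N" using some_q[OF x] by (auto simp: y_def)
  have "c \<odot> y \<ominus> c \<odot> x = c \<odot> (y \<ominus> x)"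
    using x y(1) smult_r_minus[of c x] by (simp add: M.minus_eq smult_r_distr)
  then have "c \<odot> y \<ominus> c \<odot> x \<in> N" using y submodule_closed(5)[OF submodule_N] by simp
  then show ?thesis using x y by (simp add: quotient_space_def q_eq flip: y_def)
qed

lemma Q_ip: "\<lbrakk>x \<in> carrier V; y \<in> carrier V\<rbrakk> \<Longrightarrow> ip Q (q x) (q y) = ip V x y"
  by (simp add: quotient_space_def some_q N_diff_ip(1)[OF _ some_q] N_diff_ip(2)[OF _ some_q])

lemma Q_quotient_map:
  assumes "x \<in> carrier V"
  obtains y where "y \<in> carrier V" "y \<ominus> x \<in> N" "quotient_map V N f (q x) = q (f y)"
  using some_q[OF assms] that by (auto simp: quotient_map_def)

lemma Q_hermitian: "hermitian_space Q"
proof -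
  have ag: "abelian_group Q"
  proof (rule abelian_groupI; (unfold Q_carrier Q_zero)?)
    fix X assume "X \<in> q ` carrier V"
    then obtain x where x: "x \<in> carrier V" "X = q x" by auto
    then show "\<exists>Y\<in>q ` carrier V. Y \<oplus>\<^bsub>Q\<^esub> X = q \<zero>"
      by (intro bexI[of _ "q (\<ominus> x)"]) (auto simp: Q_add M.l_neg)
  qed (auto simp: Q_add M.a_ac)
  interpret Q: abelian_group Q by (rule ag)
  have "Module.module complex_ring Q"
    by (rule moduleI[OF complex_cring ag])
      (auto simp: Q_carrier Q_add Q_smult smult_l_distr[of c d for c d, simplified]
        smult_r_distr[of c for c, simplified] smult_assoc1[of c d for c d, simplified]
        smult_one[simplified])
  then interpret Q: Module.module complex_ring Q .
  show ?thesis
  proof unfold_locales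
    fix X Y assume "X \<in> carrier Q" "Y \<in> carrier Q"
    then obtain x y where xy: "x \<in> carrier V" "y \<in> carrier V" "X = q x" "Y = q y"
      by (auto simp: Q_carrier)
    then show "ip Q Y X = cnj (ip Q X Y)" using ip_commute[of x y] by (simp add: Q_ip)
    show "ip Q (c \<odot>\<^bsub>Q\<^esub> X) Y = c * ip Q X Y" for c
      using xy by (simp add: Q_smult Q_ip ip_simps)
    fix Z assume "Z \<in> carrier Q"
    then obtain z where "z \<in> carrier V" "Z = q z" by (auto simp: Q_carrier)
    then show "ip Q (X \<oplus>\<^bsub>Q\<^esub> Y) Z = ip Q X Z + ip Q Y Z"
      using xy by (simp add: Q_add Q_ip ip_simps)
  qed
qed

lemma Q_minus: "\<lbrakk>x \<in> carrier V; y \<in> carrier V\<rbrakk> \<Longrightarrow> q x \<ominus>\<^bsub>Q\<^esub> q y = q (x \<ominus> y)"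
proof -
  assume xy: "x \<in> carrier V" "y \<in> carrier V"
  interpret Q: hermitian_space Q by (rule Q_hermitian)
  have "\<ominus>\<^bsub>Q\<^esub> q y = q (\<ominus> y)"
    using xy by (intro Q.M.minus_equality) (auto simp: Q_add Q_zero M.l_neg)
  then show ?thesis using xy by (simp add: Q.M.minus_eq M.minus_eq Q_add)
qed

lemma Q_norm: "x \<in> carrier V \<Longrightarrow> vnorm Q (q x) = vnorm V x"
  by (simp add: vnorm_def Q_ip)

end

lemma (in semi_ip_space) null_quotient_by_radical: "quotient_by_radical V (null_space V)"
proof (intro quotient_by_radical.intro quotient_by_radical_axioms.intro hermitian_space_axioms)
  show "submodule (null_space V) complex_ring V" by (rule null_space_submodule)
  show "ip V x y = 0" if "x \<in> null_space V" "y \<in> carrier V" for x y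
    using that by (simp add: null_space_eq)
qed

lemma (in semi_ip_space) null_quotient_pre_hilbert:
  "pre_hilbert_space (quotient_space V (null_space V))"
proof -
  interpret quotient_by_radical V "null_space V" by (rule null_quotient_by_radical)
  interpret Q: hermitian_space Q by (rule Q_hermitian)
  show ?thesis
  proof unfold_locales
    fix X assume X: "X \<in> carrier Q"
    then obtain x where x: "x \<in> carrier V" "X = q x" by (auto simp: Q_carrier)
    show "ip Q X X \<in> \<real>\<^sub>\<ge>\<^sub>0" using x ip_nonneg by (simp add: Q_ip)
    show "X = \<zero>\<^bsub>Q\<^esub>" if "ip Q X X = 0"
    proof -
      have "ip V x x = 0" using that x by (simp add: Q_ip)
      then have "x \<in> null_space V" using x by (simp add: null_space_def)
      then show ?thesis using x by (simp add: Q_zero q_eq)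
    qed
  qed (simp_all add: Q.ip_add_left Q.ip_smult_left Q.ip_commute[symmetric])
qed

context pre_hilbert_space
begin

abbreviation C where "C \<equiv> cauchy_space V"

lemma C_carrier: "s \<in> carrier C \<longleftrightarrow> (\<forall>n. s n \<in> carrier V) \<and>
    (\<forall>\<epsilon>>0. \<exists>N. \<forall>m\<ge>N. \<forall>n\<ge>N. vnorm V (s m \<ominus> s n) < \<epsilon>)"
  by (auto simp: cauchy_space_def Met.MCauchy_def vdist_def image_subset_iff)

lemma C_in: "s \<in> carrier C \<Longrightarrow> s n \<in> carrier V" by (simp add: C_carrier)

lemma C_bounded:
  assumes s: "s \<in> carrier C"
  obtains K where "K > 0" "\<And>n. vnorm V (s n) \<le> K"
proof -
  have "Cauchy (\<lambda>n. vnorm V (s n))"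
    unfolding Cauchy_def
  proof (intro allI impI)
    fix e :: real assume "e > 0"
    then obtain N where N: "\<forall>m\<ge>N. \<forall>n\<ge>N. vnorm V (s m \<ominus> s n) < e" using s by (auto simp: C_carrier)
    show "\<exists>M. \<forall>m\<ge>M. \<forall>n\<ge>M. dist (vnorm V (s m)) (vnorm V (s n)) < e"
      using N vnorm_diff_ineq[OF C_in[OF s] C_in[OF s]]
      by (intro exI[of _ N]) (metis dist_real_def le_less_trans)
  qed
  then have "Bseq (\<lambda>n. vnorm V (s n))" by (rule Cauchy_Bseq)
  then obtain K where "K > 0" "\<And>n. norm (vnorm V (s n)) \<le> K" by (auto simp: Bseq_def)
  then show ?thesis using that[of K] by (force dest: abs_le_D1)
qed

text \<open>The limit that defines the form on Cauchy sequences exists.\<close>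

lemma C_lim:
  assumes s: "s \<in> carrier C" and t: "t \<in> carrier C"
  shows "(\<lambda>n. ip V (s n) (t n)) \<longlonglongrightarrow> ip C s t"
proof -
  obtain K where K: "K > 0" "\<And>n. vnorm V (s n) \<le> K" using C_bounded[OF s] by blast
  obtain L where L: "L > 0" "\<And>n. vnorm V (t n) \<le> L" using C_bounded[OF t] by blast
  have "Cauchy (\<lambda>n. ip V (s n) (t n))"
    unfolding Cauchy_def
  proof (intro allI impI)
    fix e :: real assume e: "e > 0"
    obtain N1 where N1: "\<And>m n. m \<ge> N1 \<Longrightarrow> n \<ge> N1 \<Longrightarrow> vnorm V (s m \<ominus> s n) < e / (2 * L)"
      using s e L by (auto simp: C_carrier) (metis divide_pos_pos mult_pos_pos zero_less_numeral)
    obtain N2 where N2: "\<And>m n. m \<ge> N2 \<Longrightarrow> n \<ge> N2 \<Longrightarrow> vnorm V (t m \<ominus> t n) < e / (2 * K)"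
      using t e K by (auto simp: C_carrier) (metis divide_pos_pos mult_pos_pos zero_less_numeral)
    have "dist (ip V (s m) (t m)) (ip V (s n) (t n)) < e" if mn: "m \<ge> max N1 N2" "n \<ge> max N1 N2" for m n
    proof -
      have "ip V (s m) (t m) - ip V (s n) (t n) = ip V (s m \<ominus> s n) (t m) + ip V (s n) (t m \<ominus> t n)"
        using C_in[OF s] C_in[OF t] by (simp add: ip_simps)
      then have "dist (ip V (s m) (t m)) (ip V (s n) (t n)) \<le>
          cmod (ip V (s m \<ominus> s n) (t m)) + cmod (ip V (s n) (t m \<ominus> t n))"
        by (simp add: dist_norm norm_triangle_ineq)
      also have "\<dots> \<le> vnorm V (s m \<ominus> s n) * vnorm V (t m) + vnorm V (s n) * vnorm V (t m \<ominus> t n)"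
        using C_in[OF s] C_in[OF t] by (intro add_mono cauchy_schwarz) auto
      also have "\<dots> \<le> vnorm V (s m \<ominus> s n) * L + K * vnorm V (t m \<ominus> t n)"
        using C_in[OF s] C_in[OF t] K L by (intro add_mono mult_left_mono mult_right_mono) auto
      also have "\<dots> < e / (2 * L) * L + K * (e / (2 * K))"
        using N1[of m n] N2[of m n] mn K L
        by (intro add_strict_mono mult_strict_right_mono mult_strict_left_mono) auto
      also have "\<dots> = e" using K L by (simp add: field_simps)
      finally show ?thesis .
    qed
    then show "\<exists>M. \<forall>m\<ge>M. \<forall>n\<ge>M. dist (ip V (s m) (t m)) (ip V (s n) (t n)) < e" by blast
  qed
  then show ?thesis
    by (simp add: cauchy_space_def Cauchy_convergent_iff convergent_LIMSEQ_iff)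
qed

lemma C_add_closed:
  assumes s: "s \<in> carrier C" and t: "t \<in> carrier C"
  shows "(\<lambda>n. s n \<oplus> t n) \<in> carrier C"
  unfolding C_carrier
proof (intro conjI allI impI)
  fix e :: real assume e: "e > 0"
  obtain N1 where N1: "\<And>m n. m \<ge> N1 \<Longrightarrow> n \<ge> N1 \<Longrightarrow> vnorm V (s m \<ominus> s n) < e / 2"
    using s e unfolding C_carrier by (metis half_gt_zero)
  obtain N2 where N2: "\<And>m n. m \<ge> N2 \<Longrightarrow> n \<ge> N2 \<Longrightarrow> vnorm V (t m \<ominus> t n) < e / 2"
    using t e unfolding C_carrier by (metis half_gt_zero)
  have "vnorm V ((s m \<oplus> t m) \<ominus> (s n \<oplus> t n)) < e" if "m \<ge> max N1 N2" "n \<ge> max N1 N2" for m n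
  proof -
    have "(s m \<oplus> t m) \<ominus> (s n \<oplus> t n) = (s m \<ominus> s n) \<oplus> (t m \<ominus> t n)"
      using C_in[OF s] C_in[OF t] by (intro ip_eqI) (auto simp: ip_simps)
    then show ?thesis
      using N1[of m n] N2[of m n] that vnorm_triangle[of "s m \<ominus> s n" "t m \<ominus> t n"] C_in[OF s] C_in[OF t]
      by simp
  qed
  then show "\<exists>N. \<forall>m\<ge>N. \<forall>n\<ge>N. vnorm V (s m \<oplus> t m \<ominus> (s n \<oplus> t n)) < e" by blast
qed (use assms in \<open>simp add: C_in\<close>)

lemma C_smult_closed:
  assumes s: "s \<in> carrier C"
  shows "(\<lambda>n. c \<odot> s n) \<in> carrier C"
  unfolding C_carrier
proof (intro conjI allI impI)
  fix e :: real assume e: "e > 0"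
  then have "e / (cmod c + 1) > 0" by (simp add: add_nonneg_pos)
  then obtain N1 where N1: "\<And>m n. m \<ge> N1 \<Longrightarrow> n \<ge> N1 \<Longrightarrow> vnorm V (s m \<ominus> s n) < e / (cmod c + 1)"
    using s unfolding C_carrier by metis
  have "vnorm V (c \<odot> s m \<ominus> c \<odot> s n) < e" if "m \<ge> N1" "n \<ge> N1" for m n
  proof -
    have "c \<odot> s m \<ominus> c \<odot> s n = c \<odot> (s m \<ominus> s n)"
      using C_in[OF s] by (intro ip_eqI) (auto simp: ip_simps algebra_simps)
    then have "vnorm V (c \<odot> s m \<ominus> c \<odot> s n) \<le> (cmod c + 1) * vnorm V (s m \<ominus> s n)"
      using C_in[OF s] by (simp add: vnorm_smult mult_right_mono)
    also have "\<dots> < (cmod c + 1) * (e / (cmod c + 1))"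
      using N1[OF that] by (intro mult_strict_left_mono) (auto simp: add_nonneg_pos)
    also have "\<dots> = e" by (simp add: add_nonneg_eq_0_iff)
    finally show ?thesis .
  qed
  then show "\<exists>N. \<forall>m\<ge>N. \<forall>n\<ge>N. vnorm V (c \<odot> s m \<ominus> c \<odot> s n) < e" by blast
qed (use assms in \<open>simp add: C_in\<close>)

lemma C_const: "x \<in> carrier V \<Longrightarrow> (\<lambda>_. x) \<in> carrier C"
  by (simp add: C_carrier diff_eq_zero[THEN iffD2])

lemma C_ops: "s \<oplus>\<^bsub>C\<^esub> t = (\<lambda>n. s n \<oplus> t n)" "c \<odot>\<^bsub>C\<^esub> s = (\<lambda>n. c \<odot> s n)" "\<zero>\<^bsub>C\<^esub> = (\<lambda>_. \<zero>)"
  by (simp_all add: cauchy_space_def)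

lemma C_abelian_group: "abelian_group C"
proof (rule abelian_groupI; (unfold C_ops)?)
  fix s assume s: "s \<in> carrier C"
  have "(-1) \<odot> s n \<oplus> s n = \<zero>" for n
    using C_in[OF s] by (intro ip_eqI) (auto simp: ip_simps)
  then show "\<exists>t\<in>carrier C. (\<lambda>n. t n \<oplus> s n) = (\<lambda>_. \<zero>)"
    using C_smult_closed[OF s, of "-1"] by (intro bexI[of _ "\<lambda>n. (-1) \<odot> s n"]) auto
qed (auto simp: C_add_closed C_const C_in M.a_ac)

lemma C_semi_ip_space: "semi_ip_space C"
proof -
  have "Module.module complex_ring C"
    by (rule moduleI[OF complex_cring C_abelian_group])
      (auto simp: C_ops C_smult_closed C_in smult_l_distr[of c d for c d, simplified]
        smult_r_distr[of c for c, simplified] smult_assoc1[of c d for c d, simplified]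
        smult_one[simplified])
  then interpret C: Module.module complex_ring C .
  show ?thesis
  proof unfold_locales
    fix s t u assume stu: "s \<in> carrier C" "t \<in> carrier C" "u \<in> carrier C"
    have "(\<lambda>n. ip V (s n \<oplus> t n) (u n)) \<longlonglongrightarrow> ip C (s \<oplus>\<^bsub>C\<^esub> t) u"
      using C_lim[OF C_add_closed stu(3)] stu by (simp add: C_ops)
    moreover have "(\<lambda>n. ip V (s n \<oplus> t n) (u n)) \<longlonglongrightarrow> ip C s u + ip C t u"
      using stu by (auto simp: ip_simps C_in intro!: tendsto_add C_lim)
    ultimately show "ip C (s \<oplus>\<^bsub>C\<^esub> t) u = ip C s u + ip C t u" by (rule LIMSEQ_unique)
  next
    fix c s t assume stu: "s \<in> carrier C" "t \<in> carrier C"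
    have "(\<lambda>n. ip V (c \<odot> s n) (t n)) \<longlonglongrightarrow> ip C (c \<odot>\<^bsub>C\<^esub> s) t"
      using C_lim[OF C_smult_closed stu(2)] stu by (simp add: C_ops)
    moreover have "(\<lambda>n. ip V (c \<odot> s n) (t n)) \<longlonglongrightarrow> c * ip C s t"
      using stu by (auto simp: ip_simps C_in intro!: tendsto_mult_left C_lim)
    ultimately show "ip C (c \<odot>\<^bsub>C\<^esub> s) t = c * ip C s t" by (rule LIMSEQ_unique)
  next
    fix s t assume stu: "s \<in> carrier C" "t \<in> carrier C"
    have "(\<lambda>n. cnj (ip V (s n) (t n))) \<longlonglongrightarrow> cnj (ip C s t)"
      using stu by (intro tendsto_cnj C_lim)
    moreover have "(\<lambda>n. cnj (ip V (s n) (t n))) = (\<lambda>n. ip V (t n) (s n))"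
      using ip_commute[OF C_in[OF stu(1)] C_in[OF stu(2)]] by simp
    ultimately show "ip C t s = cnj (ip C s t)" using C_lim[OF stu(2,1)] LIMSEQ_unique by metis
  next
    fix s assume s: "s \<in> carrier C"
    show "ip C s s \<in> \<real>\<^sub>\<ge>\<^sub>0"
      by (rule closed_sequentially[OF closed_nonneg_Reals_complex _ C_lim[OF s s]])
        (simp add: ip_nonneg C_in[OF s])
  qed
qed

lemma C_norm_lim: "s \<in> carrier C \<Longrightarrow> (\<lambda>n. vnorm V (s n)) \<longlonglongrightarrow> vnorm C s"
  unfolding vnorm_def by (intro tendsto_real_sqrt tendsto_Re C_lim)

lemma C_minus:
  assumes "s \<in> carrier C" "t \<in> carrier C"
  shows "s \<ominus>\<^bsub>C\<^esub> t = (\<lambda>n. s n \<ominus> t n)"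
proof -
  interpret C: semi_ip_space C by (rule C_semi_ip_space)
  have e: "(-1) \<odot> t n = \<ominus> t n" for n
    using C_in[OF assms(2)] by (intro ip_eqI) (auto simp: ip_simps)
  have "(\<lambda>n. \<ominus> t n) \<in> carrier C" using C_smult_closed[OF assms(2), of "-1"] by (simp add: e)
  then have "\<ominus>\<^bsub>C\<^esub> t = (\<lambda>n. \<ominus> t n)"
    using assms by (intro C.M.minus_equality) (auto simp: C_ops M.l_neg C_in)
  then show ?thesis by (simp add: C.M.minus_eq C_ops M.minus_eq)
qed

lemma completion_pre_hilbert: "pre_hilbert_space (completion V)"
  unfolding completion_def by (rule semi_ip_space.null_quotient_pre_hilbert[OF C_semi_ip_space])

interpretation CQ: quotient_by_radical C "null_space C"
  by (rule semi_ip_space.null_quotient_by_radical[OF C_semi_ip_space])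

abbreviation emb where "emb \<equiv> completion_embedding V"

lemma emb_eq: "emb x = CQ.q (\<lambda>_. x)" by (simp add: completion_embedding_def)

lemma emb_in: "x \<in> carrier V \<Longrightarrow> emb x \<in> carrier (completion V)"
  unfolding emb_eq completion_def by (simp add: C_const)

lemma emb_add: "x \<in> carrier V \<Longrightarrow> y \<in> carrier V \<Longrightarrow> emb (x \<oplus> y) = emb x \<oplus>\<^bsub>completion V\<^esub> emb y"
  unfolding emb_eq completion_def by (simp add: C_const CQ.Q_add C_ops)

lemma emb_smult: "x \<in> carrier V \<Longrightarrow> emb (c \<odot> x) = c \<odot>\<^bsub>completion V\<^esub> emb x"
  unfolding emb_eq completion_def by (simp add: C_const CQ.Q_smult C_ops)

lemma emb_ip: "x \<in> carrier V \<Longrightarrow> y \<in> carrier V \<Longrightarrow> ip (completion V) (emb x) (emb y) = ip V x y"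
  unfolding emb_eq completion_def
  by (simp add: C_const CQ.Q_ip) (simp add: cauchy_space_def)

lemma emb_minus: "x \<in> carrier V \<Longrightarrow> y \<in> carrier V \<Longrightarrow> emb (x \<ominus> y) = emb x \<ominus>\<^bsub>completion V\<^esub> emb y"
  unfolding emb_eq completion_def by (simp add: C_const CQ.Q_minus C_minus)

lemma emb_norm: "x \<in> carrier V \<Longrightarrow> vnorm (completion V) (emb x) = vnorm V x"
  by (simp add: vnorm_def emb_ip)

lemma emb_inj: "inj_on emb (carrier V)"
proof (rule inj_onI)
  fix x y assume xy: "x \<in> carrier V" "y \<in> carrier V" "emb x = emb y"
  show "x = y"
  proof (rule ip_eqI)
    fix u assume "u \<in> carrier V"
    then show "ip V x u = ip V y u" using xy emb_ip by metis
  qed (use xy in auto)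
qed

lemma completion_obtain:
  assumes "X \<in> carrier (completion V)"
  obtains s where "s \<in> carrier C" "X = CQ.q s"
  using assms unfolding completion_def CQ.Q_carrier by auto

lemma emb_approx:
  assumes s: "s \<in> carrier C" and e: "e > 0"
  shows "\<exists>N. \<forall>n\<ge>N. vnorm (completion V) (emb (s n) \<ominus>\<^bsub>completion V\<^esub> CQ.q s) \<le> e"
proof -
  interpret C: semi_ip_space C by (rule C_semi_ip_space)
  obtain N where N: "\<And>m n. m \<ge> N \<Longrightarrow> n \<ge> N \<Longrightarrow> vnorm V (s m \<ominus> s n) < e"
    using s e unfolding C_carrier by metis
  have "vnorm (completion V) (emb (s n) \<ominus>\<^bsub>completion V\<^esub> CQ.q s) \<le> e" if "n \<ge> N" for n
  proof -
    have c: "(\<lambda>_. s n) \<in> carrier C" using C_const C_in[OF s] by blast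
    have "vnorm (completion V) (emb (s n) \<ominus>\<^bsub>completion V\<^esub> CQ.q s) = vnorm C ((\<lambda>_. s n) \<ominus>\<^bsub>C\<^esub> s)"
      unfolding completion_def emb_eq using s c by (simp add: CQ.Q_minus CQ.Q_norm)
    moreover have "(\<lambda>m. vnorm V (s n \<ominus> s m)) \<longlonglongrightarrow> vnorm C ((\<lambda>_. s n) \<ominus>\<^bsub>C\<^esub> s)"
    proof -
      have "(\<lambda>_. s n) \<ominus>\<^bsub>C\<^esub> s \<in> carrier C" using c s by simp
      from C_norm_lim[OF this] show ?thesis by (simp add: C_minus[OF c s])
    qed
    moreover have "\<exists>M. \<forall>m\<ge>M. vnorm V (s n \<ominus> s m) \<le> e" using N that by (meson less_imp_le)
    ultimately show ?thesis using LIMSEQ_le_const2 by metis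
  qed
  then show ?thesis by blast
qed

text \<open>A class of Cauchy sequences is the limit of the images of the members of any of its
  representatives.\<close>

lemma emb_dense: "pre_hilbert_space.dense_in (completion V) (emb ` carrier V)"
proof -
  interpret K: pre_hilbert_space "completion V" by (rule completion_pre_hilbert)
  show ?thesis
    unfolding K.dense_in_def
  proof (intro conjI ballI allI impI)
    fix X and e :: real assume X: "X \<in> carrier (completion V)" and e: "e > 0"
    obtain s where s: "s \<in> carrier C" "X = CQ.q s" using completion_obtain[OF X] by blast
    obtain n where "vnorm (completion V) (emb (s n) \<ominus>\<^bsub>completion V\<^esub> X) \<le> e / 2"
      using emb_approx[OF s(1), of "e / 2"] e s(2) by auto
    then show "\<exists>y\<in>emb ` carrier V. vnorm (completion V) (y \<ominus>\<^bsub>completion V\<^esub> X) < e"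
      using C_in[OF s(1)] e by (intro bexI[of _ "emb (s n)"]) auto
  qed (auto simp: emb_in)
qed

text \<open>Choose \<open>x n\<close> with image close to the \<open>n\<close>-th member of a Cauchy sequence in the completion. These form
  a Cauchy sequence of the original space, and its class is the limit.\<close>

lemma completion_hilbert: "hilbert_space (completion V)"
proof -
  interpret K: pre_hilbert_space "completion V" by (rule completion_pre_hilbert)
  have "K.Met.mcomplete"
    unfolding K.Met.mcomplete_def
  proof (intro allI impI)
    fix X assume "K.Met.MCauchy X"
    then have Xc: "\<And>n. X n \<in> carrier (completion V)"
      and X: "\<And>\<epsilon>. \<epsilon> > 0 \<Longrightarrow> \<exists>N. \<forall>m\<ge>N. \<forall>n\<ge>N. vnorm (completion V) (X m \<ominus>\<^bsub>completion V\<^esub> X n) < \<epsilon>"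
      by (auto simp: K.Met.MCauchy_def vdist_def image_subset_iff)
    have "\<exists>x\<in>carrier V. vnorm (completion V) (emb x \<ominus>\<^bsub>completion V\<^esub> X n) < 1 / real (Suc n)" for n
      using emb_dense Xc[of n] unfolding K.dense_in_def by auto
    then obtain x where x: "\<And>n. x n \<in> carrier V"
      "\<And>n. vnorm (completion V) (emb (x n) \<ominus>\<^bsub>completion V\<^esub> X n) < 1 / real (Suc n)" by metis
    have ex: "emb (x n) \<in> carrier (completion V)" for n using x emb_in by blast
    have small: "vnorm (completion V) (emb (x n) \<ominus>\<^bsub>completion V\<^esub> X n) < 1 / real (Suc N)" if "n \<ge> N" for n N
    proof -
      have "1 / real (Suc n) \<le> 1 / real (Suc N)" using that by (simp add: frac_le)
      then show ?thesis using x(2)[of n] by linarith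
    qed
    have xC: "x \<in> carrier C"
      unfolding C_carrier
    proof (intro conjI allI impI x)
      fix e :: real assume e: "e > 0"
      obtain N1 where N1: "\<And>m n. m \<ge> N1 \<Longrightarrow> n \<ge> N1 \<Longrightarrow> vnorm (completion V) (X m \<ominus>\<^bsub>completion V\<^esub> X n) < e / 3"
        using X[of "e / 3"] e by auto
      obtain N2 where N2: "1 / real (Suc N2) < e / 3" using nat_approx_posE[of "e / 3"] e by auto
      have "vnorm V (x m \<ominus> x n) < e" if mn: "m \<ge> max N1 N2" "n \<ge> max N1 N2" for m n
      proof -
        have "vnorm V (x m \<ominus> x n) = vnorm (completion V) (emb (x m) \<ominus>\<^bsub>completion V\<^esub> emb (x n))"
          using x by (simp flip: emb_minus add: emb_norm)
        also have "\<dots> \<le> vnorm (completion V) (emb (x m) \<ominus>\<^bsub>completion V\<^esub> X m)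
            + (vnorm (completion V) (X m \<ominus>\<^bsub>completion V\<^esub> X n) + vnorm (completion V) (X n \<ominus>\<^bsub>completion V\<^esub> emb (x n)))"
          using K.vnorm_diff_triangle[OF ex[of m] Xc[of m] ex[of n]] K.vnorm_diff_triangle[OF Xc[of m] Xc[of n] ex[of n]]
          by linarith
        also have "vnorm (completion V) (X n \<ominus>\<^bsub>completion V\<^esub> emb (x n)) = vnorm (completion V) (emb (x n) \<ominus>\<^bsub>completion V\<^esub> X n)"
          by (rule K.vnorm_commute[OF Xc ex])
        finally show ?thesis
          using N1[of m n] small[of N2 m] small[of N2 n] N2 mn by simp
      qed
      then show "\<exists>N. \<forall>m\<ge>N. \<forall>n\<ge>N. vnorm V (x m \<ominus> x n) < e" by blast
    qed
    let ?l = "CQ.q x"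
    have lc: "?l \<in> carrier (completion V)" using xC by (simp add: completion_def)
    have "K.conv X ?l sequentially"
      unfolding K.conv_iff
    proof (intro conjI lc tendstoI)
      show "\<forall>\<^sub>F n in sequentially. X n \<in> carrier (completion V)" using Xc by simp
      fix e :: real assume e: "e > 0"
      obtain N1 where N1: "\<And>n. n \<ge> N1 \<Longrightarrow> vnorm (completion V) (emb (x n) \<ominus>\<^bsub>completion V\<^esub> ?l) \<le> e / 3"
        using emb_approx[OF xC, of "e / 3"] e by auto
      obtain N2 where N2: "1 / real (Suc N2) < e / 3" using nat_approx_posE[of "e / 3"] e by auto
      have "vnorm (completion V) (X n \<ominus>\<^bsub>completion V\<^esub> ?l) < e" if n: "n \<ge> max N1 N2" for n
        using K.vnorm_diff_triangle[OF Xc[of n] ex[of n] lc] N1[of n] small[of N2 n] n N2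
          K.vnorm_commute[OF Xc[of n] ex[of n]] e by simp
      then have "\<forall>\<^sub>F n in sequentially. vnorm (completion V) (X n \<ominus>\<^bsub>completion V\<^esub> ?l) < e"
        unfolding eventually_sequentially by blast
      then show "\<forall>\<^sub>F n in sequentially. dist (vnorm (completion V) (X n \<ominus>\<^bsub>completion V\<^esub> ?l)) 0 < e"
        by eventually_elim (use Xc lc in simp)
    qed
    then show "\<exists>l. limitin K.Met.mtopology X l sequentially"
      unfolding K.vtop_eq by blast
  qed
  then show ?thesis
    by (intro hilbert_space.intro hilbert_space_axioms.intro K.pre_hilbert_space_axioms)
qed

end

lemma sum4: "(\<Sum>k<4. f k) = f 0 + f 1 + f 2 + f (3::nat)"
  by (simp add: eval_nat_numeral)

lemma i_cubed: "\<i> ^ 3 = - \<i>"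
  by (simp add: eval_nat_numeral)

lemma small_multiple_le_zero:
  fixes a K :: real
  assumes "\<And>\<epsilon>. 0 < \<epsilon> \<Longrightarrow> \<epsilon> < 1 \<Longrightarrow> a \<le> \<epsilon> * K"
  shows "a \<le> 0"
proof (rule ccontr)
  assume a: "\<not> a \<le> 0"
  define e where "e = min (1 / 2) (a / (2 * (\<bar>K\<bar> + 1)))"
  have p: "0 < \<bar>K\<bar> + 1" by simp
  have e: "0 < e" "e < 1" using a p by (auto simp: e_def)
  have "a \<le> e * K" by (rule assms[OF e])
  also have "\<dots> \<le> e * (\<bar>K\<bar> + 1)" using e by (intro mult_left_mono) auto
  also have "\<dots> \<le> (a / (2 * (\<bar>K\<bar> + 1))) * (\<bar>K\<bar> + 1)" by (intro mult_right_mono) (auto simp: e_def)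
  also have "\<dots> = a / 2" using p by (simp add: field_simps)
  finally show False using a by simp
qed

section \<open>Spectral measures and spectral integrals\<close>

context pre_hilbert_space
begin

context
  fixes P assumes P: "orthogonal_projection V P"
begin

lemma proj_in [simp]: "x \<in> carrier V \<Longrightarrow> P x \<in> carrier V"
  using P by (auto simp: orthogonal_projection_def)
lemma proj_add: "x \<in> carrier V \<Longrightarrow> y \<in> carrier V \<Longrightarrow> P (x \<oplus> y) = P x \<oplus> P y"
  using P by (auto simp: orthogonal_projection_def)
lemma proj_smult: "x \<in> carrier V \<Longrightarrow> P (c \<odot> x) = c \<odot> P x"
  using P by (auto simp: orthogonal_projection_def)
lemma proj_idem: "x \<in> carrier V \<Longrightarrow> P (P x) = P x"
  using P by (auto simp: orthogonal_projection_def)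
lemma proj_sym: "x \<in> carrier V \<Longrightarrow> y \<in> carrier V \<Longrightarrow> ip V (P x) y = ip V x (P y)"
  using P by (auto simp: orthogonal_projection_def)

lemma proj_diff: "x \<in> carrier V \<Longrightarrow> y \<in> carrier V \<Longrightarrow> P (x \<ominus> y) = P x \<ominus> P y"
  by (rule ip_eqI) (auto simp: proj_sym ip_simps)

lemma proj_zero: "P \<zero> = \<zero>"
  by (rule ip_eqI) (auto simp: proj_sym ip_simps)

lemma proj_ip: "x \<in> carrier V \<Longrightarrow> ip V (P x) x = complex_of_real ((vnorm V (P x))\<^sup>2)"
  by (metis ip_self proj_idem proj_in proj_sym)

lemma proj_norm_le: "x \<in> carrier V \<Longrightarrow> vnorm V (P x) \<le> vnorm V x"
proof -
  assume x: "x \<in> carrier V"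
  have "(vnorm V (P x))\<^sup>2 \<le> vnorm V (P x) * vnorm V x"
    using cauchy_schwarz[of "P x" x] x by (simp add: proj_ip del: of_real_power)
  then show ?thesis using x vnorm_nonneg[of "P x"]
    by (cases "vnorm V (P x) = 0") (auto simp: power2_eq_square less_le intro: mult_left_le_imp_le)
qed

lemma proj_conv:
  assumes "conv f l F" shows "conv (\<lambda>n. P (f n)) (P l) F"
proof -
  have l: "l \<in> carrier V" using assms by (rule conv_in)
  show ?thesis
  proof (rule convI)
    show "\<forall>\<^sub>F n in F. P (f n) \<in> carrier V" using conv_ev[OF assms] by eventually_elim simp
    show "\<forall>\<^sub>F n in F. P (f n) \<in> carrier V \<longrightarrow> vnorm V (P (f n) \<ominus> P l) \<le> vnorm V (f n \<ominus> l)"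
      using conv_ev[OF assms]
      by eventually_elim (use l proj_norm_le in \<open>simp flip: proj_diff\<close>)
  qed (use assms l in \<open>auto simp: conv_iff\<close>)
qed

end

lemma polarization:
  assumes "x \<in> carrier V" "y \<in> carrier V"
  shows "(\<Sum>k<4. \<i> ^ k * complex_of_real ((vnorm V (x \<oplus> (\<i> ^ k) \<odot> y))\<^sup>2)) / 4 = ip V x y"
proof -
  have "complex_of_real ((vnorm V (x \<oplus> c \<odot> y))\<^sup>2) = ip V x x + cnj c * ip V x y + c * ip V y x + c * cnj c * ip V y y"
    for c
    using assms by (simp add: ip_self[symmetric] ip_simps algebra_simps del: of_real_power)
  then show ?thesis by (simp add: sum4 i_cubed algebra_simps del: of_real_power)
qed

lemma polarization_norms:
  assumes "x \<in> carrier V" "y \<in> carrier V"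
  shows "(\<Sum>k<4. (vnorm V (x \<oplus> (\<i> ^ k) \<odot> y))\<^sup>2) = 4 * ((vnorm V x)\<^sup>2 + (vnorm V y)\<^sup>2)"
proof -
  have "(vnorm V (x \<oplus> c \<odot> y))\<^sup>2 = (vnorm V x)\<^sup>2 + 2 * Re (cnj c * ip V x y) + (cmod c * vnorm V y)\<^sup>2" for c
    using assms by (simp add: vnorm_add_sq ip_smult_right vnorm_smult)
  then show ?thesis by (simp add: sum4 i_cubed algebra_simps)
qed

end

locale spectral_family = hilbert_space V for V :: "'v ip_space" (structure) +
  fixes M :: "'x measure" and E :: "'x set \<Rightarrow> 'v \<Rightarrow> 'v"
  assumes spectral: "spectral_measure V M E"
begin

lemma E_proj: "\<Delta> \<in> sets M \<Longrightarrow> orthogonal_projection V (E \<Delta>)"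
  using spectral by (auto simp: spectral_measure_def)

lemmas E_in [simp] = proj_in[OF E_proj]
lemmas E_sym = proj_sym[OF E_proj]
lemmas E_idem = proj_idem[OF E_proj]
lemmas E_norm_le = proj_norm_le[OF E_proj]

lemma E_space: "x \<in> carrier V \<Longrightarrow> E (space M) x = x"
  using spectral by (auto simp: spectral_measure_def)

lemma E_conv_sums:
  assumes "range F \<subseteq> sets M" "disjoint_family F" "x \<in> carrier V"
  shows "conv (\<lambda>n. \<Oplus>i\<in>{..<n}. E (F i) x) (E (\<Union>i. F i) x) sequentially"
  using assms spectral by (auto simp: spectral_measure_def)

lemma finsum_Suc: "(\<And>i. f i \<in> carrier V) \<Longrightarrow> (\<Oplus>i\<in>{..<Suc n}. f i) = f n \<oplus> (\<Oplus>i\<in>{..<n::nat}. f i)"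
  by (simp add: lessThan_Suc)

lemma E_empty: "x \<in> carrier V \<Longrightarrow> E {} x = \<zero>"
proof -
  assume x: "x \<in> carrier V"
  define S where "S n = (\<Oplus>i\<in>{..<n::nat}. E {} x)" for n
  have Sc: "S n \<in> carrier V" for n using x by (auto simp: S_def intro!: M.finsum_closed)
  have S: "conv S (E {} x) sequentially"
    unfolding S_def using E_conv_sums[of "\<lambda>_. {}" x] x by (simp add: disjoint_family_on_def)
  have "conv (\<lambda>n. S (Suc n)) (E {} x) sequentially"
    using S unfolding conv_iff by (auto intro: LIMSEQ_Suc Sc always_eventually)
  moreover have "S (Suc n) = E {} x \<oplus> S n" for n
    unfolding S_def using x by (intro finsum_Suc) simp
  moreover have "conv (\<lambda>n. E {} x \<oplus> S n) (E {} x \<oplus> E {} x) sequentially"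
    using S x by (intro conv_add conv_const) auto
  ultimately have "E {} x = E {} x \<oplus> E {} x" using conv_unique by fastforce
  then show ?thesis using x by simp
qed

lemma E_Un:
  assumes "A \<in> sets M" "B \<in> sets M" "A \<inter> B = {}" "x \<in> carrier V"
  shows "E (A \<union> B) x = E A x \<oplus> E B x"
proof -
  define F where "F i = (if i = 0 then A else if i = 1 then B else {})" for i :: nat
  have Fs: "range F \<subseteq> sets M" "disjoint_family F" using assms by (auto simp: F_def disjoint_family_on_def)
  have "(\<Union>i. F i) = A \<union> B" by (force simp: F_def split: if_splits)
  then have c: "conv (\<lambda>n. \<Oplus>i\<in>{..<n}. E (F i) x) (E (A \<union> B) x) sequentially"
    using E_conv_sums[OF Fs assms(4)] by simp
  have Fc: "E (F i) x \<in> carrier V" for i using Fs assms by auto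
  have "(\<Oplus>i\<in>{..<Suc (Suc n)}. E (F i) x) = E A x \<oplus> E B x" for n
  proof (induction n)
    case 0 then show ?case using assms Fc by (simp add: finsum_Suc M.a_comm) (simp add: F_def M.a_comm)
  next
    case (Suc n)
    have "E (F (Suc (Suc n))) x = \<zero>" using assms E_empty by (simp add: F_def)
    then show ?case using Suc assms Fc by (subst finsum_Suc) auto
  qed
  then have "\<forall>\<^sub>F n in sequentially. (\<Oplus>i\<in>{..<n}. E (F i) x) = E A x \<oplus> E B x"
    unfolding eventually_sequentially by (metis Suc_le_D add_2_eq_Suc le_add_diff_inverse)
  with c have "conv (\<lambda>_. E A x \<oplus> E B x) (E (A \<union> B) x) sequentially"
    by (rule limitin_transform_eventually[rotated])
  then show ?thesis using conv_unique[OF _ conv_const] assms by force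
qed

text \<open>Additivity gives \<open>\<parallel>E(A)y\<parallel>\<^sup>2 + \<parallel>E(B)y\<parallel>\<^sup>2 = \<parallel>E(A \<union> B)y\<parallel>\<^sup>2 \<le> \<parallel>y\<parallel>\<^sup>2\<close>, and the second summand is already
  \<open>\<parallel>y\<parallel>\<^sup>2\<close> for \<open>y\<close> in the range of \<open>E(B)\<close>.\<close>

lemma E_disjoint:
  assumes "A \<in> sets M" "B \<in> sets M" "A \<inter> B = {}" "x \<in> carrier V"
  shows "E A (E B x) = \<zero>"
proof -
  let ?y = "E B x"
  have y: "?y \<in> carrier V" using assms by simp
  have "ip V (E (A \<union> B) ?y) ?y = ip V (E A ?y) ?y + ip V (E B ?y) ?y"
    using assms y by (simp add: E_Un ip_simps)
  then have "(vnorm V (E (A \<union> B) ?y))\<^sup>2 = (vnorm V (E A ?y))\<^sup>2 + (vnorm V (E B ?y))\<^sup>2"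
    using assms y by (simp add: proj_ip[OF E_proj] flip: of_real_add of_real_power)
  moreover have "E B ?y = ?y" using assms by (simp add: E_idem)
  moreover have "(vnorm V (E (A \<union> B) ?y))\<^sup>2 \<le> (vnorm V ?y)\<^sup>2"
    using assms y by (intro power_mono E_norm_le) auto
  ultimately have "(vnorm V (E A ?y))\<^sup>2 \<le> 0" by simp
  then show ?thesis using assms y by (simp add: vnorm_eq_zero)
qed

lemma E_Int:
  assumes A: "A \<in> sets M" and B: "B \<in> sets M" and x: "x \<in> carrier V"
  shows "E A (E B x) = E (A \<inter> B) x"
proof -
  have "E B x = E (A \<inter> B) x \<oplus> E (B - A) x"
    using E_Un[of "A \<inter> B" "B - A" x] A B x
    by (simp only: sets.Int sets.Diff Int_commute[of A B] Int_Diff_Un) blast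
  moreover have "E A (E (B - A) x) = \<zero>" using A B x by (intro E_disjoint) auto
  moreover have "E A (E (A \<inter> B) x) = E (A \<inter> B) x"
  proof -
    have "E A y = E (A \<inter> B) y \<oplus> E (A - B) y" if "y \<in> carrier V" for y
      using E_Un[of "A \<inter> B" "A - B" y] A B that by (auto simp: Int_Diff_Un)
    moreover have "E (A - B) (E (A \<inter> B) x) = \<zero>" using A B x by (intro E_disjoint) auto
    ultimately show ?thesis using A B x by (simp add: E_idem)
  qed
  ultimately show ?thesis using A B x by (simp add: proj_add[OF E_proj])
qed

lemma E_sums:
  assumes F: "range F \<subseteq> sets M" "disjoint_family F" and xy: "x \<in> carrier V" "y \<in> carrier V"
  shows "(\<lambda>i. ip V (E (F i) x) y) sums ip V (E (\<Union>i. F i) x) y"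
proof -
  have Fc: "E (F i) x \<in> carrier V" for i using F xy by auto
  have "ip V (\<Oplus>i\<in>{..<n}. E (F i) x) y = (\<Sum>i<n. ip V (E (F i) x) y)" for n :: nat
  proof (induction n)
    case (Suc n)
    have "(\<Oplus>i\<in>{..<n}. E (F i) x) \<in> carrier V" using Fc by (auto intro!: M.finsum_closed)
    then show ?case using Suc Fc xy by (subst finsum_Suc) (auto simp: ip_simps)
  qed (use xy in \<open>simp add: ip_simps\<close>)
  then show ?thesis
    using conv_ip[OF E_conv_sums[OF F xy(1)] conv_const[OF xy(2)]] by (simp add: sums_def)
qed

lemma E_norm_sums:
  assumes F: "range F \<subseteq> sets M" "disjoint_family F" and x: "x \<in> carrier V"
  shows "(\<lambda>i. (vnorm V (E (F i) x))\<^sup>2) sums (vnorm V (E (\<Union>i. F i) x))\<^sup>2"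
proof -
  have "(\<Union>i. F i) \<in> sets M" using F by auto
  then have "(\<lambda>i. complex_of_real ((vnorm V (E (F i) x))\<^sup>2)) sums complex_of_real ((vnorm V (E (\<Union>i. F i) x))\<^sup>2)"
    using E_sums[OF F x x] F x by (simp add: proj_ip[OF E_proj] image_subset_iff)
  then show ?thesis by (simp only: sums_of_real_iff)
qed

abbreviation mu where "mu x \<equiv> scalar_measure V M E x"

lemma mu_simps [simp, measurable_cong]: "sets (mu x) = sets M" and space_mu [simp]: "space (mu x) = space M"
  by (simp_all add: scalar_measure_def)

lemma emeasure_mu:
  assumes x: "x \<in> carrier V" and D: "\<Delta> \<in> sets M"
  shows "emeasure (mu x) \<Delta> = ennreal ((vnorm V (E \<Delta> x))\<^sup>2)"
proof -
  have v: "ennreal (Re (ip V (E \<Delta> x) x)) = ennreal ((vnorm V (E \<Delta> x))\<^sup>2)" if "\<Delta> \<in> sets M" for \<Delta>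
    using that x by (simp add: proj_ip[OF E_proj] del: of_real_power)
  have "emeasure (mu x) \<Delta> = ennreal (Re (ip V (E \<Delta> x) x))"
  proof (rule emeasure_measure_of[OF scalar_measure_def])
    show "positive (sets (mu x)) (\<lambda>\<Delta>. ennreal (Re (ip V (E \<Delta> x) x)))"
      using x by (simp add: positive_def E_empty ip_simps)
    show "countably_additive (sets (mu x)) (\<lambda>\<Delta>. ennreal (Re (ip V (E \<Delta> x) x)))"
      unfolding countably_additive_def
    proof (intro allI impI)
      fix F :: "nat \<Rightarrow> 'x set" assume F: "range F \<subseteq> sets (mu x)" "disjoint_family F"
        "\<Union> (range F) \<in> sets (mu x)"
      have Fs: "\<And>i. F i \<in> sets M" "\<Union> (range F) \<in> sets M" using F(1,3) unfolding mu_simps by auto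
      from F have s: "(\<lambda>i. (vnorm V (E (F i) x))\<^sup>2) sums (vnorm V (E (\<Union>i. F i) x))\<^sup>2"
        using E_norm_sums x by simp
      have "suminf (\<lambda>i. ennreal ((vnorm V (E (F i) x))\<^sup>2)) = ennreal ((vnorm V (E (\<Union>i. F i) x))\<^sup>2)"
        using suminf_ennreal2[OF zero_le_power2 sums_summable[OF s]] sums_unique[OF s] by simp
      then show "suminf (\<lambda>i. ennreal (Re (ip V (E (F i) x) x))) = ennreal (Re (ip V (E (\<Union> (range F)) x) x))"
        by (simp only: v[OF Fs(1)] v[OF Fs(2)])
    qed
  qed (use D sets.space_closed in auto)
  then show ?thesis using v D by simp
qed

lemma finite_mu: "x \<in> carrier V \<Longrightarrow> finite_measure (mu x)"
  by (rule finite_measureI) (simp add: emeasure_mu)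

lemma measure_mu: "x \<in> carrier V \<Longrightarrow> \<Delta> \<in> sets M \<Longrightarrow> measure (mu x) \<Delta> = (vnorm V (E \<Delta> x))\<^sup>2"
  by (simp add: measure_def emeasure_mu)

lemma mu_restrict:
  assumes x: "x \<in> carrier V" and D: "\<Delta> \<in> sets M"
  shows "mu (E \<Delta> x) = density (mu x) (indicator \<Delta>)"
proof (rule measure_eqI)
  fix A assume A: "A \<in> sets (mu (E \<Delta> x))"
  show "emeasure (mu (E \<Delta> x)) A = emeasure (density (mu x) (indicator \<Delta>)) A"
    using A x D by (subst emeasure_restricted) (auto simp: emeasure_mu E_Int Int_commute)
qed simp

lemma AE_mu_in:
  assumes x: "x \<in> carrier V" and D: "\<Delta> \<in> sets M"
  shows "AE \<xi> in mu (E \<Delta> x). \<xi> \<in> \<Delta>"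
proof (rule AE_I)
  show "{\<xi> \<in> space (mu (E \<Delta> x)). \<xi> \<notin> \<Delta>} \<subseteq> space M - \<Delta>" by auto
  show "emeasure (mu (E \<Delta> x)) (space M - \<Delta>) = 0"
    using x D by (simp add: emeasure_mu E_disjoint Diff_disjoint Int_commute)
qed (use D in auto)

lemma mu_integral_restrict:
  fixes f :: "'x \<Rightarrow> complex"
  assumes x: "x \<in> carrier V" and D: "\<Delta> \<in> sets M" and f: "f \<in> borel_measurable M"
  shows "(\<integral>\<xi>. f \<xi> \<partial>mu (E \<Delta> x)) = (\<integral>\<xi>. indicat_real \<Delta> \<xi> *\<^sub>R f \<xi> \<partial>mu x)"
    "integrable (mu x) f \<Longrightarrow> integrable (mu (E \<Delta> x)) f"
proof -
  have e: "density (mu x) (indicator \<Delta>) = density (mu x) (\<lambda>\<xi>. ennreal (indicat_real \<Delta> \<xi>))"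
    by (simp add: ennreal_indicator)
  show "(\<integral>\<xi>. f \<xi> \<partial>mu (E \<Delta> x)) = (\<integral>\<xi>. indicat_real \<Delta> \<xi> *\<^sub>R f \<xi> \<partial>mu x)"
    unfolding mu_restrict[OF x D] e using D f by (intro integral_density) auto
  assume "integrable (mu x) f"
  then show "integrable (mu (E \<Delta> x)) f"
    unfolding mu_restrict[OF x D] e using D f
    by (subst integrable_density) (auto intro: integrable_mult_indicator)
qed

text \<open>The parallelogram inequality for the scalar measures. It makes the domain of a spectral integral a
  linear space.\<close>

lemma mu_add_le:
  fixes g :: "'x \<Rightarrow> ennreal"
  assumes x: "x \<in> carrier V" and y: "y \<in> carrier V" and g: "g \<in> borel_measurable M"
  shows "(\<integral>\<^sup>+\<xi>. g \<xi> \<partial>mu (x \<oplus> y)) \<le> 2 * (\<integral>\<^sup>+\<xi>. g \<xi> \<partial>mu x) + 2 * (\<integral>\<^sup>+\<xi>. g \<xi> \<partial>mu y)"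
  using g
proof (induction rule: borel_measurable_induct)
  case (set A)
  have a: "E A x \<in> carrier V" "E A y \<in> carrier V" using x y set by auto
  have "(vnorm V (E A x \<oplus> E A y))\<^sup>2 \<le> (vnorm V (E A x) + vnorm V (E A y))\<^sup>2"
    using a by (intro power_mono vnorm_triangle) auto
  also have "\<dots> \<le> 2 * (vnorm V (E A x))\<^sup>2 + 2 * (vnorm V (E A y))\<^sup>2"
    using sum_squares_bound[of "vnorm V (E A x)" "vnorm V (E A y)"] by (simp add: power2_sum)
  finally have "ennreal ((vnorm V (E A (x \<oplus> y)))\<^sup>2) \<le> ennreal (2 * (vnorm V (E A x))\<^sup>2 + 2 * (vnorm V (E A y))\<^sup>2)"
    using x y set by (intro ennreal_leI) (simp add: proj_add[OF E_proj])
  also have "\<dots> = 2 * ennreal ((vnorm V (E A x))\<^sup>2) + 2 * ennreal ((vnorm V (E A y))\<^sup>2)"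
    by (simp add: ennreal_plus ennreal_mult)
  finally show ?case using x y set by (simp add: emeasure_mu)
next
  case (cong f g)
  then show ?case by (simp cong: nn_integral_cong_simp)
next
  case (mult u c)
  then have "(\<integral>\<^sup>+\<xi>. c * u \<xi> \<partial>mu (x \<oplus> y)) \<le> c * (2 * (\<integral>\<^sup>+\<xi>. u \<xi> \<partial>mu x) + 2 * (\<integral>\<^sup>+\<xi>. u \<xi> \<partial>mu y))"
    by (subst nn_integral_cmult) (auto intro: mult_left_mono)
  then show ?case using mult by (simp add: nn_integral_cmult distrib_left mult.left_commute)
next
  case (add u v)
  have "(\<integral>\<^sup>+\<xi>. v \<xi> + u \<xi> \<partial>mu w) = (\<integral>\<^sup>+\<xi>. v \<xi> \<partial>mu w) + (\<integral>\<^sup>+\<xi>. u \<xi> \<partial>mu w)" for w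
    using add by (intro nn_integral_add) auto
  moreover note add_mono[OF \<open>(\<integral>\<^sup>+\<xi>. v \<xi> \<partial>mu (x \<oplus> y)) \<le> _\<close> \<open>(\<integral>\<^sup>+\<xi>. u \<xi> \<partial>mu (x \<oplus> y)) \<le> _\<close>]
  ultimately show ?case by (simp only: distrib_left ac_simps)
next
  case (seq U)
  have m: "\<And>i. U i \<in> borel_measurable (mu w)" for w using seq by auto
  have e: "(\<integral>\<^sup>+\<xi>. (SUP i. U i) \<xi> \<partial>mu w) = (SUP i. \<integral>\<^sup>+\<xi>. U i \<xi> \<partial>mu w)" for w
    using nn_integral_monotone_convergence_SUP[OF \<open>incseq U\<close> m] by (simp add: image_comp)
  have "(\<integral>\<^sup>+\<xi>. U i \<xi> \<partial>mu (x \<oplus> y)) \<le> 2 * (\<integral>\<^sup>+\<xi>. (SUP i. U i) \<xi> \<partial>mu x) + 2 * (\<integral>\<^sup>+\<xi>. (SUP i. U i) \<xi> \<partial>mu y)" for i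
  proof -
    have "(\<integral>\<^sup>+\<xi>. U i \<xi> \<partial>mu w) \<le> (\<integral>\<^sup>+\<xi>. (SUP i. U i) \<xi> \<partial>mu w)" for w
      unfolding e by (rule SUP_upper) simp
    then have "2 * (\<integral>\<^sup>+\<xi>. U i \<xi> \<partial>mu x) + 2 * (\<integral>\<^sup>+\<xi>. U i \<xi> \<partial>mu y) \<le>
        2 * (\<integral>\<^sup>+\<xi>. (SUP i. U i) \<xi> \<partial>mu x) + 2 * (\<integral>\<^sup>+\<xi>. (SUP i. U i) \<xi> \<partial>mu y)"
      by (intro add_mono mult_left_mono) auto
    moreover have "(\<integral>\<^sup>+\<xi>. U i \<xi> \<partial>mu (x \<oplus> y)) \<le> 2 * (\<integral>\<^sup>+\<xi>. U i \<xi> \<partial>mu x) + 2 * (\<integral>\<^sup>+\<xi>. U i \<xi> \<partial>mu y)"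
      by (rule seq)
    ultimately show ?thesis by (rule order_trans[rotated])
  qed
  then show ?case unfolding e[of "x \<oplus> y"] by (intro SUP_least)
qed

abbreviation sdom where "sdom f \<equiv> spectral_integral_domain V M E f"

lemma sdom_add:
  assumes f: "f \<in> borel_measurable M" and x: "x \<in> sdom f" and y: "y \<in> sdom f"
  shows "x \<oplus> y \<in> sdom f"
proof -
  have xy: "x \<in> carrier V" "y \<in> carrier V" using x y by (auto simp: spectral_integral_domain_def)
  have "(\<integral>\<^sup>+\<xi>. ennreal ((cmod (f \<xi>))\<^sup>2) \<partial>mu (x \<oplus> y)) \<le>
     2 * (\<integral>\<^sup>+\<xi>. ennreal ((cmod (f \<xi>))\<^sup>2) \<partial>mu x) + 2 * (\<integral>\<^sup>+\<xi>. ennreal ((cmod (f \<xi>))\<^sup>2) \<partial>mu y)"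
    using f by (intro mu_add_le xy) measurable
  also have "\<dots> < \<infinity>"
    using x y by (auto simp: spectral_integral_domain_def ennreal_mult_less_top)
  finally show ?thesis using xy by (simp add: spectral_integral_domain_def)
qed

lemma mu_smult:
  assumes "x \<in> carrier V" "cmod c = 1" shows "mu (c \<odot> x) = mu x"
  using assms by (intro measure_eqI) (auto simp: emeasure_mu proj_smult[OF E_proj] vnorm_smult)

lemma sdom_smult: "x \<in> sdom f \<Longrightarrow> cmod c = 1 \<Longrightarrow> c \<odot> x \<in> sdom f"
  by (auto simp: spectral_integral_domain_def mu_smult)

lemma sdom_integrable:
  assumes f: "f \<in> borel_measurable M" and x: "x \<in> sdom f"
  shows "integrable (mu x) f"
proof (rule integrableI_bounded)
  have xc: "x \<in> carrier V" using x by (auto simp: spectral_integral_domain_def)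
  have "(\<integral>\<^sup>+\<xi>. ennreal (norm (f \<xi>)) \<partial>mu x) \<le> (\<integral>\<^sup>+\<xi>. 1 + ennreal ((cmod (f \<xi>))\<^sup>2) \<partial>mu x)"
  proof (rule nn_integral_mono)
    fix \<xi>
    have "norm (f \<xi>) \<le> 1 + (cmod (f \<xi>))\<^sup>2"
      using sum_squares_bound[of 1 "cmod (f \<xi>)"] norm_ge_zero[of "f \<xi>"] by (simp del: norm_ge_zero)
    then show "ennreal (norm (f \<xi>)) \<le> 1 + ennreal ((cmod (f \<xi>))\<^sup>2)"
      by (metis ennreal_1 ennreal_leI ennreal_plus zero_le_one zero_le_power2)
  qed
  also have "\<dots> = emeasure (mu x) (space M) + (\<integral>\<^sup>+\<xi>. ennreal ((cmod (f \<xi>))\<^sup>2) \<partial>mu x)"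
    using f by (subst nn_integral_add) auto
  also have "\<dots> < \<infinity>" using x xc by (auto simp: spectral_integral_domain_def emeasure_mu)
  finally show "(\<integral>\<^sup>+\<xi>. ennreal (norm (f \<xi>)) \<partial>mu x) < \<infinity>" .
qed (use f in simp)

text \<open>On the range of \<open>E(\<Delta>)\<close> a function that is nearly constant on \<open>\<Delta>\<close> acts nearly as that constant.\<close>

lemma local_bound:
  assumes f: "f \<in> borel_measurable M" and D: "\<Delta> \<in> sets M" and x: "x \<in> carrier V" and e: "\<epsilon> \<ge> 0"
    and b: "\<And>\<xi>. \<xi> \<in> \<Delta> \<Longrightarrow> cmod (f \<xi> - c) \<le> \<epsilon>"
  shows "E \<Delta> x \<in> sdom f" "integrable (mu (E \<Delta> x)) f"
    "cmod ((\<integral>\<xi>. f \<xi> \<partial>mu (E \<Delta> x)) - c * complex_of_real ((vnorm V (E \<Delta> x))\<^sup>2)) \<le> \<epsilon> * (vnorm V (E \<Delta> x))\<^sup>2"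
proof -
  let ?y = "E \<Delta> x"
  have y: "?y \<in> carrier V" using D x by simp
  have ae: "AE \<xi> in mu ?y. \<xi> \<in> \<Delta>" by (rule AE_mu_in[OF x D])
  interpret finite_measure "mu ?y" by (rule finite_mu[OF y])
  have m: "measure (mu ?y) (space M) = (vnorm V ?y)\<^sup>2" using y by (simp add: measure_mu E_space)
  have "(\<integral>\<^sup>+\<xi>. ennreal ((cmod (f \<xi>))\<^sup>2) \<partial>mu ?y) \<le> (\<integral>\<^sup>+\<xi>. ennreal ((cmod c + \<epsilon>)\<^sup>2) \<partial>mu ?y)"
  proof (rule nn_integral_mono_AE)
    show "AE \<xi> in mu ?y. ennreal ((cmod (f \<xi>))\<^sup>2) \<le> ennreal ((cmod c + \<epsilon>)\<^sup>2)"
      using ae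
    proof eventually_elim
      case (elim \<xi>)
      have "cmod (f \<xi>) \<le> cmod c + \<epsilon>"
        using b[OF elim] norm_triangle_ineq2[of "f \<xi>" c] by linarith
      then show ?case by (intro ennreal_leI power_mono) auto
    qed
  qed
  also have "\<dots> < \<infinity>" using y by (simp add: emeasure_mu ennreal_mult_less_top)
  finally show s: "?y \<in> sdom f" using y by (simp add: spectral_integral_domain_def)
  show i: "integrable (mu ?y) f" by (rule sdom_integrable[OF f s])
  have "(\<integral>\<xi>. f \<xi> \<partial>mu ?y) - c * complex_of_real ((vnorm V ?y)\<^sup>2) = (\<integral>\<xi>. f \<xi> - c \<partial>mu ?y)"
    using i by (simp add: m scaleR_conv_of_real mult.commute)
  also have "cmod \<dots> \<le> (\<integral>\<xi>. cmod (f \<xi> - c) \<partial>mu ?y)" by (rule integral_norm_bound)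
  also have "\<dots> \<le> (\<integral>\<xi>. \<epsilon> \<partial>mu ?y)"
    by (rule integral_mono_AE) (use i ae b in auto)
  also have "\<dots> = \<epsilon> * (vnorm V ?y)\<^sup>2" by (simp add: m mult.commute)
  finally show "cmod ((\<integral>\<xi>. f \<xi> \<partial>mu ?y) - c * complex_of_real ((vnorm V ?y)\<^sup>2)) \<le> \<epsilon> * (vnorm V ?y)\<^sup>2" .
qed

text \<open>The graph of \<open>\<integral> f dE\<close> without integrals: \<open>z\<close> is the value at \<open>x\<close>. This form is visibly stable under
  limits. The factor 2 is what the polarized definition of the
  integral yields without a further optimization.\<close>

definition locally_eigen :: "('x \<Rightarrow> complex) \<Rightarrow> 'v \<Rightarrow> 'v \<Rightarrow> bool" where
  "locally_eigen f x z \<longleftrightarrow> x \<in> carrier V \<and> z \<in> carrier V \<and>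
     (\<forall>\<Delta>\<in>sets M. \<forall>c \<epsilon>. \<epsilon> \<ge> 0 \<longrightarrow> (\<forall>\<xi>\<in>\<Delta>. cmod (f \<xi> - c) \<le> \<epsilon>) \<longrightarrow>
        vnorm V (E \<Delta> z \<ominus> c \<odot> E \<Delta> x) \<le> 2 * \<epsilon> * vnorm V (E \<Delta> x))"

lemma locally_eigenD:
  "locally_eigen f x z \<Longrightarrow> \<Delta> \<in> sets M \<Longrightarrow> \<epsilon> \<ge> 0 \<Longrightarrow> (\<And>\<xi>. \<xi> \<in> \<Delta> \<Longrightarrow> cmod (f \<xi> - c) \<le> \<epsilon>) \<Longrightarrow>
    vnorm V (E \<Delta> z \<ominus> c \<odot> E \<Delta> x) \<le> 2 * \<epsilon> * vnorm V (E \<Delta> x)"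
  unfolding locally_eigen_def by blast

text \<open>Balls around a countable dense set of complex numbers, made disjoint, pull back to a countable
  partition on whose pieces \<open>f\<close> is nearly constant.\<close>

lemma fine_partition:
  assumes f: "f \<in> borel_measurable M" and e: "\<epsilon> > 0"
  shows "\<exists>(F :: nat \<Rightarrow> 'x set) c. range F \<subseteq> sets M \<and> disjoint_family F \<and> (\<Union>i. F i) = space M \<and>
    (\<forall>i. \<forall>\<xi>\<in>F i. cmod (f \<xi> - c i) \<le> \<epsilon>)"
proof -
  obtain D :: "complex set" where D: "countable D" "\<And>X. open X \<Longrightarrow> X \<noteq> {} \<Longrightarrow> \<exists>d\<in>D. d \<in> X"
    using countable_dense_exists by blast
  then have "D \<noteq> {}" by blast
  define c where "c = from_nat_into D"
  define A where "A i = f -` ball (c i) \<epsilon> \<inter> space M" for i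
  have "\<exists>i. \<xi> \<in> A i" if "\<xi> \<in> space M" for \<xi>
  proof -
    obtain d where "d \<in> D" "d \<in> ball (f \<xi>) \<epsilon>" using D(2)[of "ball (f \<xi>) \<epsilon>"] e by auto
    moreover from \<open>d \<in> D\<close> obtain i where "d = c i"
      using range_from_nat_into[OF \<open>D \<noteq> {}\<close> D(1)] unfolding c_def by (metis imageE)
    ultimately show ?thesis using that by (intro exI[of _ i]) (auto simp: A_def dist_commute)
  qed
  then have U: "(\<Union>i. A i) = space M" by (auto simp: A_def)
  have As: "range A \<subseteq> sets M" using f by (auto simp: A_def intro: measurable_sets)
  show ?thesis
  proof (intro exI[of _ "disjointed A"] exI[of _ c] conjI allI ballI)
    show "range (disjointed A) \<subseteq> sets M" using sets.range_disjointed_sets[OF As] .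
    show "disjoint_family (disjointed A)" by (rule disjoint_family_disjointed)
    show "(\<Union>i. disjointed A i) = space M" using U by (simp add: UN_disjointed_eq)
    show "cmod (f \<xi> - c i) \<le> \<epsilon>" if "\<xi> \<in> disjointed A i" for i \<xi>
      using that disjointed_subset[of A i] by (force simp: A_def dist_norm norm_minus_commute)
  qed
qed

text \<open>Two values differ on each piece of an \<open>\<epsilon>\<close>-fine partition by at most \<open>4\<epsilon>\<close> times the piece of \<open>x\<close>; the
  squares add up.\<close>

lemma locally_eigen_unique:
  assumes f: "f \<in> borel_measurable M" and z: "locally_eigen f x z" and z': "locally_eigen f x z'"
  shows "z = z'"
proof -
  have c: "x \<in> carrier V" "z \<in> carrier V" "z' \<in> carrier V" using z z' by (auto simp: locally_eigen_def)
  have "(vnorm V (z \<ominus> z'))\<^sup>2 \<le> \<epsilon> * (16 * (vnorm V x)\<^sup>2)" if e: "0 < \<epsilon>" "\<epsilon> < 1" for \<epsilon>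
  proof -
    obtain F :: "nat \<Rightarrow> 'x set" and a where "range F \<subseteq> sets M \<and> disjoint_family F \<and> (\<Union>i. F i) = space M \<and>
        (\<forall>i. \<forall>\<xi>\<in>F i. cmod (f \<xi> - a i) \<le> \<epsilon>)"
      using fine_partition[OF f e(1)] by blast
    then have F: "range F \<subseteq> sets M" "disjoint_family F" "(\<Union>i. F i) = space M"
      "\<And>i \<xi>. \<xi> \<in> F i \<Longrightarrow> cmod (f \<xi> - a i) \<le> \<epsilon>" by auto
    have Fs: "F i \<in> sets M" for i using F by auto
    have "(vnorm V (E (F i) (z \<ominus> z')))\<^sup>2 \<le> \<epsilon> * (16 * (vnorm V (E (F i) x))\<^sup>2)" for i
    proof -
      let ?x = "E (F i) x" let ?z = "E (F i) z" let ?z' = "E (F i) z'"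
      have cc: "?x \<in> carrier V" "?z \<in> carrier V" "?z' \<in> carrier V" using c Fs by auto
      have h: "vnorm V (?z \<ominus> a i \<odot> ?x) \<le> 2 * \<epsilon> * vnorm V ?x" "vnorm V (?z' \<ominus> a i \<odot> ?x) \<le> 2 * \<epsilon> * vnorm V ?x"
        using e F(4)[of _ i] by (auto intro!: locally_eigenD[OF z Fs] locally_eigenD[OF z' Fs])
      have "vnorm V (?z \<ominus> ?z') \<le> vnorm V (?z \<ominus> a i \<odot> ?x) + vnorm V (a i \<odot> ?x \<ominus> ?z')"
        using cc by (intro vnorm_diff_triangle) auto
      also have "vnorm V (a i \<odot> ?x \<ominus> ?z') = vnorm V (?z' \<ominus> a i \<odot> ?x)"
        using cc by (intro vnorm_commute) auto
      finally have "vnorm V (?z \<ominus> ?z') \<le> 4 * \<epsilon> * vnorm V ?x"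
        using h by linarith
      then have "(vnorm V (?z \<ominus> ?z'))\<^sup>2 \<le> (4 * \<epsilon> * vnorm V ?x)\<^sup>2" using cc by (intro power_mono) auto
      also have "\<dots> = (\<epsilon> * \<epsilon>) * (16 * (vnorm V ?x)\<^sup>2)" by (simp add: power2_eq_square)
      also have "\<dots> \<le> \<epsilon> * (16 * (vnorm V ?x)\<^sup>2)" using e by (intro mult_right_mono) auto
      finally show ?thesis using c Fs by (simp add: proj_diff[OF E_proj])
    qed
    moreover have "(\<lambda>i. (vnorm V (E (F i) (z \<ominus> z')))\<^sup>2) sums (vnorm V (z \<ominus> z'))\<^sup>2"
      using E_norm_sums[OF F(1,2), of "z \<ominus> z'"] c F(3) by (simp add: E_space)
    moreover have "(\<lambda>i. \<epsilon> * (16 * (vnorm V (E (F i) x))\<^sup>2)) sums (\<epsilon> * (16 * (vnorm V x)\<^sup>2))"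
      using E_norm_sums[OF F(1,2), of x] c F(3) by (intro sums_mult) (simp add: E_space)
    ultimately show ?thesis by (rule sums_le)
  qed
  then have "(vnorm V (z \<ominus> z'))\<^sup>2 \<le> 0"
    by (rule small_multiple_le_zero)
  then have "vnorm V (z \<ominus> z') = 0" by simp
  then show ?thesis using c by (simp add: vnorm_eq_zero diff_eq_zero)
qed


text \<open>On a piece where \<open>f\<close> is close to \<open>a i\<close>, the norm of \<open>a i\<close> times the piece of \<open>x\<close> is controlled by the
  pieces of \<open>z\<close> and \<open>x\<close>. So \<open>\<integral> \<bar>f\<bar>\<^sup>2 d\<langle>E x, x\<rangle>\<close> is bounded by a combination of \<open>\<parallel>z\<parallel>\<^sup>2\<close> and \<open>\<parallel>x\<parallel>\<^sup>2\<close>.\<close>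

lemma locally_eigen_sdom:
  assumes f: "f \<in> borel_measurable M" and z: "locally_eigen f x z"
  shows "x \<in> sdom f"
proof -
  have c: "x \<in> carrier V" "z \<in> carrier V" using z by (auto simp: locally_eigen_def)
  obtain F :: "nat \<Rightarrow> 'x set" and a where "range F \<subseteq> sets M \<and> disjoint_family F \<and> (\<Union>i. F i) = space M \<and>
        (\<forall>i. \<forall>\<xi>\<in>F i. cmod (f \<xi> - a i) \<le> 1)"
      using fine_partition[OF f zero_less_one] by blast
    then have F: "range F \<subseteq> sets M" "disjoint_family F" "(\<Union>i. F i) = space M"
      "\<And>i \<xi>. \<xi> \<in> F i \<Longrightarrow> cmod (f \<xi> - a i) \<le> 1" by auto
  have Fs: "F i \<in> sets M" for i using F by auto
  let ?b = "\<lambda>i. (cmod (a i) + 1)\<^sup>2"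
  have "(\<integral>\<^sup>+\<xi>. ennreal ((cmod (f \<xi>))\<^sup>2) \<partial>mu x) \<le> (\<integral>\<^sup>+\<xi>. (suminf (\<lambda>i. ennreal (?b i) * indicator (F i) \<xi>)) \<partial>mu x)"
  proof (rule nn_integral_mono)
    fix \<xi> assume "\<xi> \<in> space (mu x)"
    then obtain j where j: "\<xi> \<in> F j" using F(3) by auto
    have "cmod (f \<xi>) \<le> cmod (a j) + 1"
      using F(4)[OF j] norm_triangle_ineq2[of "f \<xi>" "a j"] by linarith
    then have "ennreal ((cmod (f \<xi>))\<^sup>2) \<le> ennreal (?b j)" by (intro ennreal_leI power_mono) auto
    also have "\<dots> = (\<Sum>i\<in>{j}. ennreal (?b i) * indicator (F i) \<xi>)" using j by simp
    also have "\<dots> \<le> suminf (\<lambda>i. ennreal (?b i) * indicator (F i) \<xi>)" by (rule sum_le_suminf) auto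
    finally show "ennreal ((cmod (f \<xi>))\<^sup>2) \<le> suminf (\<lambda>i. ennreal (?b i) * indicator (F i) \<xi>)" .
  qed
  also have "\<dots> = suminf (\<lambda>i. \<integral>\<^sup>+\<xi>. ennreal (?b i) * indicator (F i) \<xi> \<partial>mu x)"
    using Fs by (intro nn_integral_suminf borel_measurable_times_ennreal borel_measurable_indicator) auto
  also have "\<dots> = suminf (\<lambda>i. ennreal (?b i * (vnorm V (E (F i) x))\<^sup>2))"
    using Fs c by (intro suminf_cong) (simp add: nn_integral_cmult_indicator emeasure_mu ennreal_mult)
  also have "\<dots> \<le> suminf (\<lambda>i. ennreal (2 * (vnorm V (E (F i) z))\<^sup>2 + 18 * (vnorm V (E (F i) x))\<^sup>2))"
  proof (intro suminf_le allI ennreal_leI)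
    fix i
    let ?x = "E (F i) x" let ?z = "E (F i) z"
    have cc: "?x \<in> carrier V" "?z \<in> carrier V" using c Fs by auto
    have "vnorm V (?z \<ominus> a i \<odot> ?x) \<le> 2 * 1 * vnorm V ?x"
      using F(4)[of _ i] by (intro locally_eigenD[OF z Fs]) auto
    moreover have "vnorm V (a i \<odot> ?x) - vnorm V ?z \<le> vnorm V (?z \<ominus> a i \<odot> ?x)"
      using vnorm_diff_ineq[of ?z "a i \<odot> ?x"] cc by simp
    ultimately have "(cmod (a i) + 1) * vnorm V ?x \<le> vnorm V ?z + 3 * vnorm V ?x"
      using cc by (simp add: vnorm_smult distrib_right)
    then have "((cmod (a i) + 1) * vnorm V ?x)\<^sup>2 \<le> (vnorm V ?z + 3 * vnorm V ?x)\<^sup>2"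
      using cc by (intro power_mono) auto
    also have "\<dots> \<le> 2 * (vnorm V ?z)\<^sup>2 + 18 * (vnorm V ?x)\<^sup>2"
      using sum_squares_bound[of "vnorm V ?z" "3 * vnorm V ?x"] by (simp add: power2_sum power_mult_distrib)
    finally show "?b i * (vnorm V ?x)\<^sup>2 \<le> 2 * (vnorm V ?z)\<^sup>2 + 18 * (vnorm V ?x)\<^sup>2"
      by (simp add: power_mult_distrib)
  qed auto
  also have "\<dots> < \<infinity>"
  proof -
    have "summable (\<lambda>i. 2 * (vnorm V (E (F i) z))\<^sup>2 + 18 * (vnorm V (E (F i) x))\<^sup>2)"
      using E_norm_sums[OF F(1,2)] c by (intro summable_add summable_mult) (auto simp: sums_iff)
    from suminf_ennreal2[OF _ this] show ?thesis by (simp add: less_top[symmetric])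
  qed
  finally show ?thesis using c by (simp add: spectral_integral_domain_def)
qed

lemma mu_integral_sums:
  assumes f: "f \<in> borel_measurable M" and x: "x \<in> sdom f"
    and F: "range F \<subseteq> sets M" "disjoint_family F" "(\<Union>i. F i) = space M"
  shows "(\<lambda>i. \<integral>\<xi>. f \<xi> \<partial>mu (E (F i) x)) sums (\<integral>\<xi>. f \<xi> \<partial>mu x)"
proof -
  have xc: "x \<in> carrier V" using x by (auto simp: spectral_integral_domain_def)
  have Fs: "F i \<in> sets M" for i using F by auto
  have i: "integrable (mu x) f" by (rule sdom_integrable[OF f x])
  have ii: "integrable (mu x) (\<lambda>\<xi>. indicat_real (F i) \<xi> *\<^sub>R f \<xi>)" for i
    using i Fs by (intro integrable_mult_indicator) auto
  have one: "(\<Sum>i<n. indicat_real (F i) \<xi> *\<^sub>R f \<xi>) = (if j < n then f \<xi> else 0)" if "\<xi> \<in> F j" for \<xi> j n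
  proof -
    have "indicat_real (F i) \<xi> *\<^sub>R f \<xi> = (if i = j then f \<xi> else 0)" for i
      using that F(2) by (auto simp: disjoint_family_on_def indicator_def)
    then show ?thesis by simp
  qed
  have "(\<lambda>n. \<integral>\<xi>. (\<Sum>i<n. indicat_real (F i) \<xi> *\<^sub>R f \<xi>) \<partial>mu x) \<longlonglongrightarrow> (\<integral>\<xi>. f \<xi> \<partial>mu x)"
  proof (rule integral_dominated_convergence[where w = "\<lambda>\<xi>. cmod (f \<xi>)"])
    show "f \<in> borel_measurable (mu x)" using f by simp
    show "(\<lambda>\<xi>. \<Sum>i<n. indicat_real (F i) \<xi> *\<^sub>R f \<xi>) \<in> borel_measurable (mu x)" for n
      using f Fs by measurable
    show "integrable (mu x) (\<lambda>\<xi>. cmod (f \<xi>))" using i by simp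
    show "AE \<xi> in mu x. (\<lambda>n. \<Sum>i<n. indicat_real (F i) \<xi> *\<^sub>R f \<xi>) \<longlonglongrightarrow> f \<xi>"
    proof (rule AE_I2)
      fix \<xi> assume "\<xi> \<in> space (mu x)"
      then obtain j where j: "\<xi> \<in> F j" using F(3) by auto
      show "(\<lambda>n. \<Sum>i<n. indicat_real (F i) \<xi> *\<^sub>R f \<xi>) \<longlonglongrightarrow> f \<xi>"
        unfolding one[OF j] by (rule tendsto_eventually) (auto simp: eventually_sequentially intro!: exI[of _ "Suc j"])
    qed
    show "AE \<xi> in mu x. norm (\<Sum>i<n. indicat_real (F i) \<xi> *\<^sub>R f \<xi>) \<le> cmod (f \<xi>)" for n
    proof (rule AE_I2)
      fix \<xi> assume "\<xi> \<in> space (mu x)"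
      then obtain j where j: "\<xi> \<in> F j" using F(3) by auto
      show "norm (\<Sum>i<n. indicat_real (F i) \<xi> *\<^sub>R f \<xi>) \<le> cmod (f \<xi>)"
        unfolding one[OF j] by simp
    qed
  qed
  then show ?thesis
    unfolding sums_def mu_integral_restrict(1)[OF xc Fs f] Bochner_Integration.integral_sum[OF ii] .
qed

text \<open>Both sides of the weak formula are countable sums over an \<open>\<epsilon>\<close>-fine partition. On each piece either
  side is \<open>a i \<langle>E(F i)x, y\<rangle>\<close> up to \<open>\<epsilon>\<close> times a summable term.\<close>

lemma locally_eigen_imp_spectral_integral:
  assumes f: "f \<in> borel_measurable M" and z: "locally_eigen f x z"
  shows "(x, z) \<in> spectral_integral V M E f"
proof -
  have c: "x \<in> carrier V" "z \<in> carrier V" using z by (auto simp: locally_eigen_def)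
  have x: "x \<in> sdom f" by (rule locally_eigen_sdom[OF f z])
  have "ip V z y = (\<Sum>k<4. \<i> ^ k * (\<integral>\<xi>. f \<xi> \<partial>mu (x \<oplus> (\<i> ^ k) \<odot> y))) / 4" if y: "y \<in> sdom f" for y
  proof -
    have yc: "y \<in> carrier V" using y by (auto simp: spectral_integral_domain_def)
    let ?w = "\<lambda>k::nat. x \<oplus> (\<i> ^ k) \<odot> y"
    have w: "?w k \<in> sdom f" for k
      using x y by (intro sdom_add sdom_smult f) (auto simp: norm_power)
    let ?d = "ip V z y - (\<Sum>k<4. \<i> ^ k * (\<integral>\<xi>. f \<xi> \<partial>mu (?w k))) / 4"
    have "cmod ?d \<le> \<epsilon> * (2 * ((vnorm V x)\<^sup>2 + (vnorm V y)\<^sup>2))" if e: "0 < \<epsilon>" "\<epsilon> < 1" for \<epsilon>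
    proof -
      obtain F :: "nat \<Rightarrow> 'x set" and a where "range F \<subseteq> sets M \<and> disjoint_family F \<and> (\<Union>i. F i) = space M \<and>
        (\<forall>i. \<forall>\<xi>\<in>F i. cmod (f \<xi> - a i) \<le> \<epsilon>)"
      using fine_partition[OF f e(1)] by blast
    then have F: "range F \<subseteq> sets M" "disjoint_family F" "(\<Union>i. F i) = space M"
      "\<And>i \<xi>. \<xi> \<in> F i \<Longrightarrow> cmod (f \<xi> - a i) \<le> \<epsilon>" by auto
      have Fs: "F i \<in> sets M" for i using F by auto
      let ?g = "\<lambda>i. ip V (E (F i) z) y - (\<Sum>k<4. \<i> ^ k * (\<integral>\<xi>. f \<xi> \<partial>mu (E (F i) (?w k)))) / 4"
      have "?g sums ?d"
        using E_sums[OF F(1,2), of z y] c yc F(3)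
        by (intro sums_diff sums_divide sums_sum sums_mult mu_integral_sums f w F) (simp add: E_space)
      moreover have "(\<lambda>i. \<epsilon> * (2 * ((vnorm V (E (F i) x))\<^sup>2 + (vnorm V (E (F i) y))\<^sup>2))) sums
          (\<epsilon> * (2 * ((vnorm V x)\<^sup>2 + (vnorm V y)\<^sup>2)))"
        using E_norm_sums[OF F(1,2), of x] E_norm_sums[OF F(1,2), of y] c yc F(3)
        by (intro sums_mult sums_add) (auto simp: E_space)
      moreover have "cmod (?g i) \<le> \<epsilon> * (2 * ((vnorm V (E (F i) x))\<^sup>2 + (vnorm V (E (F i) y))\<^sup>2))" for i
      proof -
        let ?x = "E (F i) x" let ?y = "E (F i) y" let ?z = "E (F i) z"
        have cc: "?x \<in> carrier V" "?y \<in> carrier V" "?z \<in> carrier V" using c yc Fs by auto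
        have Ew: "E (F i) (?w k) = ?x \<oplus> (\<i> ^ k) \<odot> ?y" for k
          using c yc Fs by (simp add: proj_add[OF E_proj] proj_smult[OF E_proj])
        let ?h = "\<lambda>k. (\<integral>\<xi>. f \<xi> \<partial>mu (E (F i) (?w k))) - a i * complex_of_real ((vnorm V (?x \<oplus> (\<i> ^ k) \<odot> ?y))\<^sup>2)"
        have h: "cmod (?h k) \<le> \<epsilon> * (vnorm V (?x \<oplus> (\<i> ^ k) \<odot> ?y))\<^sup>2" for k
          unfolding Ew[symmetric] using F(4) e c yc by (intro local_bound(3) f Fs) auto
        have "ip V ?z y = ip V ?z ?y" using E_idem[OF Fs c(2), of i] E_sym[OF Fs, of ?z y i] cc yc by simp
        then have "?g i = ip V (?z \<ominus> a i \<odot> ?x) ?y - ((\<Sum>k<4. \<i> ^ k * (\<integral>\<xi>. f \<xi> \<partial>mu (E (F i) (?w k)))) / 4 - a i * ip V ?x ?y)"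
          using cc by (simp add: ip_simps)
        also have "(\<Sum>k<4. \<i> ^ k * (\<integral>\<xi>. f \<xi> \<partial>mu (E (F i) (?w k)))) / 4 - a i * ip V ?x ?y = (\<Sum>k<4. \<i> ^ k * ?h k) / 4"
          unfolding polarization[OF cc(1,2), symmetric] by (simp add: sum4 field_simps)
        finally have "cmod (?g i) \<le> cmod (ip V (?z \<ominus> a i \<odot> ?x) ?y) + cmod ((\<Sum>k<4. \<i> ^ k * ?h k) / 4)"
          by (simp only: norm_triangle_ineq4)
        also have "\<dots> \<le> \<epsilon> * ((vnorm V ?x)\<^sup>2 + (vnorm V ?y)\<^sup>2) + \<epsilon> * ((vnorm V ?x)\<^sup>2 + (vnorm V ?y)\<^sup>2)"
        proof (rule add_mono)
          have "cmod (ip V (?z \<ominus> a i \<odot> ?x) ?y) \<le> vnorm V (?z \<ominus> a i \<odot> ?x) * vnorm V ?y"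
            using cc by (intro cauchy_schwarz) auto
          also have "\<dots> \<le> (2 * \<epsilon> * vnorm V ?x) * vnorm V ?y"
            using F(4)[of _ i] e cc by (intro mult_right_mono locally_eigenD[OF z Fs]) auto
          also have "\<dots> \<le> \<epsilon> * ((vnorm V ?x)\<^sup>2 + (vnorm V ?y)\<^sup>2)"
            using mult_left_mono[OF sum_squares_bound[of "vnorm V ?x" "vnorm V ?y"], of \<epsilon>] e by simp
          finally show "cmod (ip V (?z \<ominus> a i \<odot> ?x) ?y) \<le> \<epsilon> * ((vnorm V ?x)\<^sup>2 + (vnorm V ?y)\<^sup>2)" .
          have "cmod (\<Sum>k<4. \<i> ^ k * ?h k) \<le> (\<Sum>k<4. \<epsilon> * (vnorm V (?x \<oplus> (\<i> ^ k) \<odot> ?y))\<^sup>2)"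
            by (rule sum_norm_le) (use h in \<open>simp add: norm_mult norm_power\<close>)
          also have "\<dots> = (\<epsilon> * ((vnorm V ?x)\<^sup>2 + (vnorm V ?y)\<^sup>2)) * 4"
            unfolding sum_distrib_left[symmetric] polarization_norms[OF cc(1,2)] by simp
          finally show "cmod ((\<Sum>k<4. \<i> ^ k * ?h k) / 4) \<le> \<epsilon> * ((vnorm V ?x)\<^sup>2 + (vnorm V ?y)\<^sup>2)"
            by (simp only: norm_divide norm_numeral)
        qed
        finally show ?thesis by (simp add: algebra_simps)
      qed
      ultimately show ?thesis by (rule norm_sums_le)
    qed
    then have "cmod ?d \<le> 0" by (rule small_multiple_le_zero)
    then show ?thesis by simp
  qed
  then show ?thesis using x c by (auto simp: spectral_integral_def)
qed

text \<open>Test the weak formula with vectors \<open>u\<close> in the range of \<open>E(\<Delta>)\<close>. The parts of the four integrals over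
  the complement of \<open>\<Delta>\<close> coincide and cancel, since the powers of \<open>\<i>\<close> add up to 0.\<close>

lemma spectral_integral_imp_locally_eigen:
  assumes f: "f \<in> borel_measurable M" and xz: "(x, z) \<in> spectral_integral V M E f"
  shows "locally_eigen f x z"
  unfolding locally_eigen_def
proof (intro conjI ballI allI impI)
  have xs: "x \<in> sdom f" and z: "z \<in> carrier V" using xz by (auto simp: spectral_integral_def)
  have form: "ip V z y = (\<Sum>k<4. \<i> ^ k * (\<integral>\<xi>. f \<xi> \<partial>mu (x \<oplus> (\<i> ^ k) \<odot> y))) / 4" if "y \<in> sdom f" for y
    using xz that by (auto simp: spectral_integral_def)
  have x: "x \<in> carrier V" using xs by (auto simp: spectral_integral_domain_def)
  show "x \<in> carrier V" "z \<in> carrier V" by fact+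
  fix \<Delta> c and \<epsilon> :: real assume D: "\<Delta> \<in> sets M" and e: "0 \<le> \<epsilon>" and b: "\<forall>\<xi>\<in>\<Delta>. cmod (f \<xi> - c) \<le> \<epsilon>"
  let ?x = "E \<Delta> x" let ?w = "E \<Delta> z \<ominus> c \<odot> ?x"
  have cc: "?x \<in> carrier V" "?w \<in> carrier V" using D x z by auto
  have key: "cmod (ip V ?w u) \<le> \<epsilon> * ((vnorm V ?x)\<^sup>2 + (vnorm V u)\<^sup>2)"
    if u: "u \<in> carrier V" and Eu: "E \<Delta> u = u" for u
  proof -
    let ?v = "\<lambda>k::nat. ?x \<oplus> (\<i> ^ k) \<odot> u"
    have uy: "u \<in> sdom f" using local_bound(1)[OF f D u e, of c] b Eu by simp
    have w: "x \<oplus> (\<i> ^ k) \<odot> u \<in> sdom f" for k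
      using xs uy by (intro sdom_add sdom_smult f) (auto simp: norm_power)
    have C: "space M - \<Delta> \<in> sets M" using D by auto
    have EC: "E (space M - \<Delta>) u = \<zero>"
      using E_disjoint[OF C D _ u] Eu by (simp add: Diff_disjoint Int_commute)
    have split: "(\<integral>\<xi>. f \<xi> \<partial>mu (x \<oplus> (\<i> ^ k) \<odot> u)) = (\<integral>\<xi>. f \<xi> \<partial>mu (?v k)) + (\<integral>\<xi>. f \<xi> \<partial>mu (E (space M - \<Delta>) x))" for k
    proof -
      let ?y = "x \<oplus> (\<i> ^ k) \<odot> u"
      have y: "?y \<in> carrier V" using x u by simp
      have i: "integrable (mu ?y) f" by (rule sdom_integrable[OF f w])
      have "(\<integral>\<xi>. f \<xi> \<partial>mu ?y) = (\<integral>\<xi>. indicat_real \<Delta> \<xi> *\<^sub>R f \<xi> + indicat_real (space M - \<Delta>) \<xi> *\<^sub>R f \<xi> \<partial>mu ?y)"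
        by (rule Bochner_Integration.integral_cong) (auto simp: indicator_def)
      also have "\<dots> = (\<integral>\<xi>. indicat_real \<Delta> \<xi> *\<^sub>R f \<xi> \<partial>mu ?y) + (\<integral>\<xi>. indicat_real (space M - \<Delta>) \<xi> *\<^sub>R f \<xi> \<partial>mu ?y)"
        using i D C by (intro Bochner_Integration.integral_add integrable_mult_indicator) auto
      also have "\<dots> = (\<integral>\<xi>. f \<xi> \<partial>mu (E \<Delta> ?y)) + (\<integral>\<xi>. f \<xi> \<partial>mu (E (space M - \<Delta>) ?y))"
        using mu_integral_restrict(1)[OF y D f] mu_integral_restrict(1)[OF y C f] by simp
      also have "E \<Delta> ?y = ?v k" using x u D Eu by (simp add: proj_add[OF E_proj] proj_smult[OF E_proj])
      also have "E (space M - \<Delta>) ?y = E (space M - \<Delta>) x"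
        using x u C EC by (simp add: proj_add[OF E_proj] proj_smult[OF E_proj] smult_r_null[simplified])
      finally show ?thesis .
    qed
    have "ip V (E \<Delta> z) u = ip V z u" using E_sym[OF D z u] Eu by simp
    also have "\<dots> = (\<Sum>k<4. \<i> ^ k * (\<integral>\<xi>. f \<xi> \<partial>mu (?v k))) / 4"
      unfolding form[OF uy] split by (simp add: sum4 i_cubed algebra_simps)
    finally have 1: "ip V (E \<Delta> z) u = (\<Sum>k<4. \<i> ^ k * (\<integral>\<xi>. f \<xi> \<partial>mu (?v k))) / 4" .
    let ?h = "\<lambda>k. (\<integral>\<xi>. f \<xi> \<partial>mu (?v k)) - c * complex_of_real ((vnorm V (?v k))\<^sup>2)"
    have h: "cmod (?h k) \<le> \<epsilon> * (vnorm V (?v k))\<^sup>2" for k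
    proof -
      have v: "?v k \<in> carrier V" "E \<Delta> (?v k) = ?v k"
        using cc u D x Eu by (auto simp: proj_add[OF E_proj] proj_smult[OF E_proj] E_idem)
      show ?thesis using local_bound(3)[OF f D v(1) e, of c] b v(2) by simp
    qed
    have "ip V ?w u = (\<Sum>k<4. \<i> ^ k * ?h k) / 4"
    proof -
      have "c * ip V ?x u = (\<Sum>k<4. \<i> ^ k * (c * complex_of_real ((vnorm V (?v k))\<^sup>2))) / 4"
        unfolding polarization[OF cc(1) u, symmetric] by (simp add: sum4 field_simps)
      then show ?thesis
        using cc u D z
        by (simp add: ip_simps 1 right_diff_distrib sum_subtractf diff_divide_distrib del: of_real_power)
    qed
    then have "cmod (ip V ?w u) = cmod (\<Sum>k<4. \<i> ^ k * ?h k) / 4" by (simp only: norm_divide) simp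
    moreover have "cmod (\<Sum>k<4. \<i> ^ k * ?h k) \<le> (\<Sum>k<4. \<epsilon> * (vnorm V (?v k))\<^sup>2)"
      by (rule sum_norm_le) (use h in \<open>simp add: norm_mult norm_power\<close>)
    moreover have "(\<Sum>k<4. \<epsilon> * (vnorm V (?v k))\<^sup>2) = \<epsilon> * (4 * ((vnorm V ?x)\<^sup>2 + (vnorm V u)\<^sup>2))"
      unfolding sum_distrib_left[symmetric] polarization_norms[OF cc(1) u] ..
    ultimately show ?thesis by linarith
  qed
  have Ew: "E \<Delta> ?w = ?w"
    using D x z by (simp add: proj_diff[OF E_proj] proj_smult[OF E_proj] E_idem)
  show "vnorm V ?w \<le> 2 * \<epsilon> * vnorm V ?x"
  proof (cases "vnorm V ?w = 0")
    case True then show ?thesis using cc e by simp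
  next
    case False
    then have wp: "vnorm V ?w > 0" using cc by (simp add: less_le)
    \<comment> \<open>The bound is quadratic in the test vector, so it is optimized along the multiples of \<open>?w\<close>.\<close>
    have s: "s * (vnorm V ?w)\<^sup>2 \<le> \<epsilon> * ((vnorm V ?x)\<^sup>2 + s\<^sup>2 * (vnorm V ?w)\<^sup>2)" if "s \<ge> 0" for s :: real
      using key[of "complex_of_real s \<odot> ?w"] cc that Ew D
      by (simp add: proj_smult[OF E_proj] ip_smult_right ip_self vnorm_smult norm_mult power_mult_distrib
          norm_power)
    show ?thesis
    proof (cases "vnorm V ?x = 0")
      case True
      have "(vnorm V ?w)\<^sup>2 \<le> s * (\<epsilon> * (vnorm V ?w)\<^sup>2)" if "0 < s" "s < 1" for s
        using s[of s] that True by (simp add: power2_eq_square[of s] mult.assoc mult.left_commute[of \<epsilon>])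
      then have "(vnorm V ?w)\<^sup>2 \<le> 0" by (rule small_multiple_le_zero)
      then show ?thesis using wp by simp
    next
      case False
      then have xp: "vnorm V ?x > 0" using cc by (simp add: less_le)
      have "vnorm V ?x * vnorm V ?w \<le> \<epsilon> * (2 * (vnorm V ?x)\<^sup>2)"
        using s[of "vnorm V ?x / vnorm V ?w"] wp xp by (simp add: power_divide power2_eq_square)
      then show ?thesis using xp by (simp add: power2_eq_square)
    qed
  qed
qed

end

context hilbert_space
begin

text \<open>A symmetric idempotent relation on a dense set is the graph of a linear contraction.
  For related pairs \<open>(x, y)\<close> and \<open>(x', y')\<close>, symmetry and idempotence give
  \<open>\<parallel>y - y'\<parallel>\<^sup>2 = \<langle>x - x', y - y'\<rangle>\<close>, so the relation is contractive. Its extension is characterized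
  by being adjoint to the relation, which yields linearity.\<close>

lemma dense_relation_projection:
  fixes R :: "'v \<Rightarrow> 'v \<Rightarrow> bool"
  assumes D: "dense_in D"
    and total: "\<And>x. x \<in> D \<Longrightarrow> \<exists>y. R x y"
    and R_in: "\<And>x y. R x y \<Longrightarrow> x \<in> D \<and> y \<in> D"
    and R_sym: "\<And>x y x' y'. R x y \<Longrightarrow> R x' y' \<Longrightarrow> ip V y x' = ip V x y'"
    and R_idem: "\<And>x y. R x y \<Longrightarrow> R y y"
  obtains P where "orthogonal_projection V P" "\<And>x y. R x y \<Longrightarrow> P x = y"
proof -
  have Dc: "x \<in> carrier V" if "x \<in> D" for x using D that by (auto simp: dense_in_def)
  have Rc: "x \<in> carrier V" "y \<in> carrier V" if "R x y" for x y using R_in[OF that] Dc by auto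
  have contr: "vnorm V (y \<ominus> y') \<le> vnorm V (x \<ominus> x')" if 1: "R x y" and 2: "R x' y'" for x y x' y'
  proof -
    note c = Rc[OF 1] Rc[OF 2]
    have "ip V (y \<ominus> y') (y \<ominus> y') = ip V (x \<ominus> x') (y \<ominus> y')"
      using c R_sym[OF 1 R_idem[OF 1]] R_sym[OF 1 R_idem[OF 2]] R_sym[OF 2 R_idem[OF 1]] R_sym[OF 2 R_idem[OF 2]]
      by (simp add: ip_simps)
    then have "cmod (complex_of_real ((vnorm V (y \<ominus> y'))\<^sup>2)) \<le> vnorm V (x \<ominus> x') * vnorm V (y \<ominus> y')"
      using c cauchy_schwarz[of "x \<ominus> x'" "y \<ominus> y'"] by (simp add: ip_self del: of_real_power)
    then have "vnorm V (y \<ominus> y') * vnorm V (y \<ominus> y') \<le> vnorm V (x \<ominus> x') * vnorm V (y \<ominus> y')"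
      by (simp add: norm_mult power2_eq_square)
    then show ?thesis using c vnorm_nonneg[of "y \<ominus> y'"] vnorm_nonneg[of "x \<ominus> x'"]
      by (cases "vnorm V (y \<ominus> y') = 0") (auto simp: less_le intro: mult_right_le_imp_le)
  qed
  define good where "good x y \<longleftrightarrow> y \<in> carrier V \<and> (\<forall>x' y'. R x' y' \<longrightarrow> ip V y x' = ip V x y')" for x y
  have unique: "y = z" if "good x y" "good x z" for x y z
    using that by (intro dense_eqI[OF D]) (auto simp: good_def dest!: total)
  have approx: "\<exists>s t y. (\<forall>n. R (s n) (t n)) \<and> conv s x sequentially \<and> conv t y sequentially \<and> good x y"
    if x: "x \<in> carrier V" for x
  proof -
    obtain s where s: "range s \<subseteq> D" "conv s x sequentially" by (rule dense_seq[OF D x])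
    then have "\<forall>n. \<exists>t. R (s n) t" using total by (simp add: image_subset_iff)
    then obtain t where t: "\<And>n. R (s n) (t n)" by metis
    have "\<exists>N. \<forall>m\<ge>N. \<forall>n\<ge>N. vnorm V (t m \<ominus> t n) < e" if e: "e > 0" for e
    proof -
      have "\<forall>\<^sub>F n in sequentially. dist (vnorm V (s n \<ominus> x)) 0 < e / 2"
        using s(2) e half_gt_zero unfolding conv_iff tendsto_iff by blast
      then obtain N where N: "\<And>n. n \<ge> N \<Longrightarrow> dist (vnorm V (s n \<ominus> x)) 0 < e / 2"
        unfolding eventually_sequentially by blast
      have "vnorm V (t m \<ominus> t n) < e" if "m \<ge> N" "n \<ge> N" for m n
      proof -
        have c: "s m \<in> carrier V" "s n \<in> carrier V" by (rule Rc(1)[OF t])+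
        have "vnorm V (t m \<ominus> t n) \<le> vnorm V (s m \<ominus> s n)" by (rule contr[OF t t])
        also have "\<dots> \<le> vnorm V (s m \<ominus> x) + vnorm V (x \<ominus> s n)" using c x by (rule_tac vnorm_diff_triangle)
        also have "vnorm V (x \<ominus> s n) = vnorm V (s n \<ominus> x)" using c x by (rule_tac vnorm_commute)
        finally show ?thesis using N[OF that(1)] N[OF that(2)] by (simp add: dist_real_def)
      qed
      then show ?thesis by blast
    qed
    then obtain y where y: "conv t y sequentially" using seq_complete[of t] Rc(2)[OF t] by blast
    have "ip V y x' = ip V x y'" if r: "R x' y'" for x' y'
    proof -
      have "(\<lambda>n. ip V (t n) x') \<longlonglongrightarrow> ip V y x'" "(\<lambda>n. ip V (s n) y') \<longlonglongrightarrow> ip V x y'"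
        using y s(2) Rc[OF r] by (auto intro: conv_ip conv_const)
      then show ?thesis using R_sym[OF t r] LIMSEQ_unique by fastforce
    qed
    then have "good x y" using conv_in[OF y] by (simp add: good_def)
    then show ?thesis using t s y by blast
  qed
  define P where "P x = (THE y. good x y)" for x
  have P: "P x = y" if "good x y" for x y
    unfolding P_def using that unique by blast
  have Pg: "good x (P x)" if "x \<in> carrier V" for x
    using approx[OF that] P by metis
  have Pc: "P x \<in> carrier V" if "x \<in> carrier V" for x using Pg[OF that] by (simp add: good_def)
  have PR: "P x = y" if "R x y" for x y
    using that R_sym Rc by (intro P) (auto simp: good_def)
  have "orthogonal_projection V P"
    unfolding orthogonal_projection_def
  proof (intro conjI ballI allI)
    show "P \<in> carrier V \<rightarrow> carrier V" using Pc by auto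
    fix x assume x: "x \<in> carrier V"
    show "P (P x) = P x"
    proof (rule P)
      show "good (P x) (P x)"
        unfolding good_def
      proof (intro conjI allI impI Pc x)
        fix x' y' assume r: "R x' y'"
        show "ip V (P x) x' = ip V (P x) y'"
          using Pg[OF x] r R_idem[OF r] by (simp add: good_def)
      qed
    qed
    fix y assume y: "y \<in> carrier V"
    show "P (x \<oplus> y) = P x \<oplus> P y"
      using Pg[OF x] Pg[OF y] Rc x y by (intro P) (auto simp: good_def ip_simps)
    obtain s t where st: "\<And>n. R (s n) (t n)" "conv s y sequentially" "conv t (P y) sequentially"
      using approx[OF y] P by metis
    have "(\<lambda>n. ip V (P x) (s n)) \<longlonglongrightarrow> ip V (P x) y" "(\<lambda>n. ip V x (t n)) \<longlonglongrightarrow> ip V x (P y)"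
      using st x Pc by (auto intro: conv_ip conv_const)
    moreover have "ip V (P x) (s n) = ip V x (t n)" for n using Pg[OF x] st(1) by (auto simp: good_def)
    ultimately show "ip V (P x) y = ip V x (P y)" using LIMSEQ_unique by fastforce
  next
    fix c x assume x: "x \<in> carrier V"
    show "P (c \<odot> x) = c \<odot> P x"
      using Pg[OF x] Rc x by (intro P) (auto simp: good_def ip_simps)
  qed
  with PR show ?thesis using that by blast
qed

lemma proj_agree:
  assumes D: "dense_in D" and P: "orthogonal_projection V P"
    and g: "\<And>f l. conv f l sequentially \<Longrightarrow> conv (\<lambda>n. g (f n)) (g l) sequentially"
    and eq: "\<And>x. x \<in> D \<Longrightarrow> P x = g x" and x: "x \<in> carrier V"
  shows "P x = g x"
proof -
  obtain s where s: "range s \<subseteq> D" "conv s x sequentially" by (rule dense_seq[OF D x])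
  have "P (s n) = g (s n)" for n using s(1) eq by auto
  with proj_conv[OF P s(2)] have "conv (\<lambda>n. g (s n)) (P x) sequentially" by simp
  then show ?thesis by (rule conv_unique[OF _ g[OF s(2)] sequentially_bot])
qed

text \<open>Countable additivity only has to be checked on a dense set, because all projections are
  contractions.\<close>

lemma spectral_measureI:
  assumes proj: "\<And>\<Delta>. \<Delta> \<in> sets M \<Longrightarrow> orthogonal_projection V (E \<Delta>)"
    and D: "dense_in D"
    and sp: "\<And>x. x \<in> D \<Longrightarrow> E (space M) x = x"
    and un: "\<And>A B x. A \<in> sets M \<Longrightarrow> B \<in> sets M \<Longrightarrow> A \<inter> B = {} \<Longrightarrow> x \<in> D \<Longrightarrow> E (A \<union> B) x = E A x \<oplus> E B x"
    and tail: "\<And>F x. range F \<subseteq> sets M \<Longrightarrow> disjoint_family F \<Longrightarrow> x \<in> D \<Longrightarrow>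
      (\<lambda>n. vnorm V (E (\<Union>i\<in>{n..}. F i) x)) \<longlonglongrightarrow> 0"
  shows "spectral_measure V M E"
  unfolding spectral_measure_def
proof (intro conjI ballI allI impI proj)
  fix x assume x: "x \<in> carrier V"
  show "E (space M) x = x"
    by (rule proj_agree[OF D proj _ sp x]) auto
next
  fix F :: "nat \<Rightarrow> _" and x
  assume F: "range F \<subseteq> sets M" "disjoint_family F" and x: "x \<in> carrier V"
  have Fs: "F i \<in> sets M" for i using F by auto
  have UN: "E (A \<union> B) y = E A y \<oplus> E B y" if AB: "A \<in> sets M" "B \<in> sets M" "A \<inter> B = {}" and y: "y \<in> carrier V" for A B y
  proof (rule proj_agree[OF D proj _ _ y])
    show "conv (\<lambda>n. E A (f n) \<oplus> E B (f n)) (E A l \<oplus> E B l) sequentially" if "conv f l sequentially" for f l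
      using that AB by (intro conv_add proj_conv[OF proj[of A]] proj_conv[OF proj[of B]])
  qed (use AB un in auto)
  have E0: "E {} y = \<zero>" if "y \<in> carrier V" for y
    using UN[of "{}" "{}" y] that proj_in[OF proj, of "{}" y] by simp
  have fin: "(\<Oplus>i\<in>{..<n}. E (F i) x) = E (\<Union>i<n. F i) x" for n
  proof (induction n)
    case (Suc n)
    have "F n \<inter> F i = {}" if "i < n" for i using F(2) that by (auto simp: disjoint_family_on_def)
    then have "F n \<inter> (\<Union>i<n. F i) = {}" by blast
    then have "E (F n \<union> (\<Union>i<n. F i)) x = E (F n) x \<oplus> E (\<Union>i<n. F i) x"
      using Fs x by (intro UN) auto
    then show ?case using Suc Fs x by (simp add: lessThan_Suc proj_in[OF proj] image_subset_iff)
  qed (simp add: E0 x)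
  let ?R = "\<lambda>n. \<Union>i\<in>{n..}. F i"
  have Rs: "?R n \<in> sets M" for n using Fs by auto
  have t: "(\<lambda>n. vnorm V (E (?R n) x)) \<longlonglongrightarrow> 0"
  proof (rule LIMSEQ_I)
    fix e :: real assume e: "e > 0"
    then obtain y where y: "y \<in> D" "vnorm V (y \<ominus> x) < e / 2" using D x half_gt_zero unfolding dense_in_def by blast
    have yc: "y \<in> carrier V" using y D by (auto simp: dense_in_def)
    obtain N where N: "\<And>n. n \<ge> N \<Longrightarrow> vnorm V (E (?R n) y) < e / 2"
      using LIMSEQ_D[OF tail[OF F y(1)], of "e / 2"] e proj_in[OF proj[OF Rs] yc] by (auto simp: abs_less_iff)
    have "norm (vnorm V (E (?R n) x) - 0) < e" if "n \<ge> N" for n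
    proof -
      have c: "E (?R n) x \<in> carrier V" "E (?R n) y \<in> carrier V" using proj_in[OF proj[OF Rs]] x yc by auto
      have "vnorm V (E (?R n) x) - vnorm V (E (?R n) y) \<le> vnorm V (E (?R n) x \<ominus> E (?R n) y)"
        using vnorm_diff_ineq[OF c] by simp
      also have "\<dots> = vnorm V (E (?R n) (x \<ominus> y))" using proj_diff[OF proj[OF Rs] x yc] by simp
      also have "\<dots> \<le> vnorm V (x \<ominus> y)" using proj_norm_le[OF proj[OF Rs]] x yc by simp
      also have "\<dots> = vnorm V (y \<ominus> x)" by (rule vnorm_commute[OF x yc])
      finally show ?thesis using N[OF that] y(2) c by simp
    qed
    then show "\<exists>no. \<forall>n\<ge>no. norm (vnorm V (E (?R n) x) - 0) < e" by blast
  qed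
  show "conv (\<lambda>n. \<Oplus>i\<in>{..<n}. E (F i) x) (E (\<Union>i. F i) x) sequentially"
  proof (rule convI[OF _ _ _ t])
    have Us: "(\<Union>i<n. F i) \<in> sets M" "(\<Union>i. F i) \<in> sets M" for n :: nat using Fs by auto
    then show "E (\<Union>i. F i) x \<in> carrier V" using proj_in[OF proj] x by auto
    show "\<forall>\<^sub>F n in sequentially. (\<Oplus>i\<in>{..<n}. E (F i) x) \<in> carrier V"
      unfolding fin using proj_in[OF proj[OF Us(1)] x] by simp
    have "vnorm V (E (\<Union>i<n. F i) x \<ominus> E (\<Union>i. F i) x) \<le> vnorm V (E (?R n) x)" for n
    proof -
      have d: "(\<Union>i<n. F i) \<inter> ?R n = {}"
      proof -
        have "F i \<inter> F j = {}" if "i < n" "j \<ge> n" for i j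
          using F(2) that by (auto simp: disjoint_family_on_def)
        then show ?thesis by fastforce
      qed
      have "(\<Union>i. F i) = (\<Union>i<n. F i) \<union> ?R n" by (force simp: not_less)
      then have "E (\<Union>i. F i) x = E (\<Union>i<n. F i) x \<oplus> E (?R n) x"
        using UN[OF Us(1) Rs d x] by simp
      moreover have c: "E (\<Union>i<n. F i) x \<in> carrier V" "E (?R n) x \<in> carrier V"
        using proj_in[OF proj[OF Rs]] proj_in[OF proj[OF Us(1)]] x by auto
      moreover have "a \<ominus> (a \<oplus> b) = \<ominus> b" if "a \<in> carrier V" "b \<in> carrier V" for a b
        using that by (intro ip_eqI) (auto simp: ip_simps)
      ultimately show ?thesis by (simp add: vnorm_inv)
    qed
    then show "\<forall>\<^sub>F n in sequentially. (\<Oplus>i\<in>{..<n}. E (F i) x) \<in> carrier V \<longrightarrow>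
       vnorm V ((\<Oplus>i\<in>{..<n}. E (F i) x) \<ominus> E (\<Union>i. F i) x) \<le> vnorm V (E (?R n) x)"
      unfolding fin by simp
  qed
qed

end

context spectral_family
begin

abbreviation level :: "('x \<Rightarrow> complex) \<Rightarrow> nat \<Rightarrow> 'x set" where
  "level f n \<equiv> {\<xi> \<in> space M. cmod (f \<xi>) \<le> real n}"

lemma level_sets: "f \<in> borel_measurable M \<Longrightarrow> level f n \<in> sets M"
  by measurable

text \<open>The projections of the level sets of \<open>f\<close> increase to the identity.\<close>

lemma level_conv:
  assumes f: "f \<in> borel_measurable M" and x: "x \<in> carrier V"
  shows "conv (\<lambda>n. E (level f n) x) x sequentially"
proof -
  interpret finite_measure "mu x" by (rule finite_mu[OF x])
  have "(\<lambda>n. measure (mu x) (level f n)) \<longlonglongrightarrow> measure (mu x) (\<Union>n. level f n)"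
    using level_sets[OF f] by (intro finite_Lim_measure_incseq) (auto simp: incseq_def intro: order_trans)
  moreover have "(\<Union>n. level f n) = space M"
    using real_arch_simple by auto
  ultimately have m: "(\<lambda>n. (vnorm V (E (level f n) x))\<^sup>2) \<longlonglongrightarrow> (vnorm V x)\<^sup>2"
    using x level_sets[OF f] by (simp add: measure_mu E_space)
  have e: "vnorm V (E (level f n) x \<ominus> x) = sqrt ((vnorm V x)\<^sup>2 - (vnorm V (E (level f n) x))\<^sup>2)" for n
  proof -
    let ?y = "E (level f n) x"
    have y: "?y \<in> carrier V" using level_sets[OF f] x by simp
    have "ip V ?y x = complex_of_real ((vnorm V ?y)\<^sup>2)" by (rule proj_ip[OF E_proj[OF level_sets[OF f]] x])
    then have eq: "(vnorm V (?y \<ominus> x))\<^sup>2 = (vnorm V x)\<^sup>2 - (vnorm V ?y)\<^sup>2"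
      using vnorm_add_sq[OF y M.a_inv_closed[OF x]] x y
      by (simp add: M.minus_eq ip_inv_right vnorm_inv del: of_real_power)
    show ?thesis unfolding eq[symmetric] using x y by simp
  qed
  have "(\<lambda>n. sqrt ((vnorm V x)\<^sup>2 - (vnorm V (E (level f n) x))\<^sup>2)) \<longlonglongrightarrow> sqrt ((vnorm V x)\<^sup>2 - (vnorm V x)\<^sup>2)"
    by (intro tendsto_intros m)
  then show ?thesis
    unfolding conv_iff e using x level_sets[OF f] by simp
qed

lemma locally_eigen_E:
  assumes z: "locally_eigen f x z" and D: "\<Delta> \<in> sets M"
  shows "locally_eigen f (E \<Delta> x) (E \<Delta> z)"
  using z D unfolding locally_eigen_def
  by (auto simp: E_Int)

lemma locally_eigen_lim:
  assumes "\<And>n. locally_eigen f (s n) (t n)" "conv s x sequentially" "conv t z sequentially"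
  shows "locally_eigen f x z"
  unfolding locally_eigen_def
proof (intro conjI ballI allI impI)
  fix \<Delta> c and \<epsilon> :: real assume D: "\<Delta> \<in> sets M" "0 \<le> \<epsilon>" "\<forall>\<xi>\<in>\<Delta>. cmod (f \<xi> - c) \<le> \<epsilon>"
  have "(\<lambda>n. vnorm V (E \<Delta> (t n) \<ominus> c \<odot> E \<Delta> (s n))) \<longlonglongrightarrow> vnorm V (E \<Delta> z \<ominus> c \<odot> E \<Delta> x)"
    using assms D by (intro conv_norm conv_diff conv_smult proj_conv[OF E_proj[OF D(1)]])
  moreover have "(\<lambda>n. 2 * \<epsilon> * vnorm V (E \<Delta> (s n))) \<longlonglongrightarrow> 2 * \<epsilon> * vnorm V (E \<Delta> x)"
    using assms D by (intro tendsto_mult tendsto_const conv_norm proj_conv[OF E_proj[OF D(1)]])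
  moreover have "vnorm V (E \<Delta> (t n) \<ominus> c \<odot> E \<Delta> (s n)) \<le> 2 * \<epsilon> * vnorm V (E \<Delta> (s n))" for n
    using D by (intro locally_eigenD[OF assms(1)]) auto
  ultimately show "vnorm V (E \<Delta> z \<ominus> c \<odot> E \<Delta> x) \<le> 2 * \<epsilon> * vnorm V (E \<Delta> x)"
    by (intro LIMSEQ_le) auto
qed (use assms in \<open>auto intro: conv_in\<close>)

context
  \<comment> \<open>An operator \<open>T\<close> with formal adjoint \<open>T'\<close> on a dense domain that is invariant under \<open>E\<close>; both commute with \<open>E\<close> and act locally as \<open>f\<close> and its conjugate.\<close>
  fixes D T T' f f'
  assumes f: "f \<in> borel_measurable M"
    and f': "f' = (\<lambda>\<xi>. cnj (f \<xi>))"
    and D: "dense_in D"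
    and D_diff: "\<And>x y. x \<in> D \<Longrightarrow> y \<in> D \<Longrightarrow> x \<ominus> y \<in> D"
    and T_diff: "\<And>x y. x \<in> D \<Longrightarrow> y \<in> D \<Longrightarrow> T (x \<ominus> y) = T x \<ominus> T y"
    and T'_diff: "\<And>x y. x \<in> D \<Longrightarrow> y \<in> D \<Longrightarrow> T' (x \<ominus> y) = T' x \<ominus> T' y"
    and ED: "\<And>\<Delta> x. \<Delta> \<in> sets M \<Longrightarrow> x \<in> D \<Longrightarrow> E \<Delta> x \<in> D"
    and ET: "\<And>\<Delta> x. \<Delta> \<in> sets M \<Longrightarrow> x \<in> D \<Longrightarrow> T (E \<Delta> x) = E \<Delta> (T x)"
    and ET': "\<And>\<Delta> x. \<Delta> \<in> sets M \<Longrightarrow> x \<in> D \<Longrightarrow> T' (E \<Delta> x) = E \<Delta> (T' x)"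
    and le: "\<And>x. x \<in> D \<Longrightarrow> locally_eigen f x (T x)"
    and le': "\<And>x. x \<in> D \<Longrightarrow> locally_eigen f' x (T' x)"
    and adj: "\<And>x y. x \<in> D \<Longrightarrow> y \<in> D \<Longrightarrow> ip V (T x) y = ip V x (T' y)"
begin

text \<open>On the range of \<open>E({\<bar>g\<bar> \<le> n})\<close> the operator is bounded by \<open>2n\<close>, so its closure is defined on all
  truncated vectors.\<close>

lemma truncation:
  assumes g: "g \<in> borel_measurable M" and S_diff: "\<And>x y. x \<in> D \<Longrightarrow> y \<in> D \<Longrightarrow> S (x \<ominus> y) = S x \<ominus> S y"
    and ES: "\<And>\<Delta> x. \<Delta> \<in> sets M \<Longrightarrow> x \<in> D \<Longrightarrow> S (E \<Delta> x) = E \<Delta> (S x)"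
    and leS: "\<And>x. x \<in> D \<Longrightarrow> locally_eigen g x (S x)"
    and y: "y \<in> carrier V"
  obtains w where "(E (level g n) y, w) \<in> op_closure V (op_graph D S)"
proof -
  have Dc: "x \<in> carrier V" "S x \<in> carrier V" if "x \<in> D" for x
    using leS[OF that] by (auto simp: locally_eigen_def)
  obtain s where s: "range s \<subseteq> D" "conv s y sequentially" by (rule dense_seq[OF D y])
  have sD: "s k \<in> D" for k using s by auto
  let ?\<Delta> = "level g n"
  have L: "?\<Delta> \<in> sets M" by (rule level_sets[OF g])
  define t where "t k = E ?\<Delta> (S (s k))" for k
  have tc: "t k \<in> carrier V" for k using L Dc[OF sD] by (simp add: t_def)
  have bd: "vnorm V (t j \<ominus> t k) \<le> (2 * real n) * vnorm V (s j \<ominus> s k)" for j k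
  proof -
    let ?d = "s j \<ominus> s k"
    have d: "?d \<in> D" using D_diff sD by blast
    have "t j \<ominus> t k = E ?\<Delta> (S ?d)"
      using sD Dc S_diff proj_diff[OF E_proj[OF L]] by (simp add: t_def)
    moreover have "vnorm V (E ?\<Delta> (S ?d) \<ominus> 0 \<odot> E ?\<Delta> ?d) \<le> 2 * real n * vnorm V (E ?\<Delta> ?d)"
      by (rule locally_eigenD[OF leS[OF d] L]) auto
    moreover have "0 \<odot> E ?\<Delta> ?d = \<zero>" using Dc[OF d] L smult_l_null[of "E ?\<Delta> ?d"] by simp
    moreover have "vnorm V (E ?\<Delta> ?d) \<le> vnorm V ?d" using E_norm_le[OF L] Dc[OF d] by blast
    ultimately show ?thesis using Dc[OF d] L
      by (simp add: order_trans[OF _ mult_left_mono[of "vnorm V (E ?\<Delta> ?d)" "vnorm V ?d" "2 * real n"]])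
  qed
  have "\<exists>N. \<forall>j\<ge>N. \<forall>k\<ge>N. vnorm V (t j \<ominus> t k) < e" if e: "e > 0" for e
  proof -
    have p: "e / (4 * (real n + 1)) > 0" using e by simp
    have "\<forall>\<^sub>F k in sequentially. dist (vnorm V (s k \<ominus> y)) 0 < e / (4 * (real n + 1))"
      using s(2) p unfolding conv_iff tendsto_iff by blast
    then obtain N where N: "\<And>k. k \<ge> N \<Longrightarrow> dist (vnorm V (s k \<ominus> y)) 0 < e / (4 * (real n + 1))"
      unfolding eventually_sequentially by blast
    have "vnorm V (t j \<ominus> t k) < e" if "j \<ge> N" "k \<ge> N" for j k
    proof -
      have c: "s j \<in> carrier V" "s k \<in> carrier V" using Dc sD by auto
      have "vnorm V (s j \<ominus> s k) \<le> vnorm V (s j \<ominus> y) + vnorm V (y \<ominus> s k)" by (rule vnorm_diff_triangle[OF c(1) y c(2)])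
      also have "vnorm V (y \<ominus> s k) = vnorm V (s k \<ominus> y)" by (rule vnorm_commute[OF y c(2)])
      finally have "vnorm V (s j \<ominus> s k) < 2 * (e / (4 * (real n + 1)))"
        using N[OF that(1)] N[OF that(2)] c y by simp
      then have "(2 * real n) * vnorm V (s j \<ominus> s k) \<le> (2 * real n) * (2 * (e / (4 * (real n + 1))))"
        by (intro mult_left_mono) auto
      also have "\<dots> < e" using e by (simp add: field_simps)
      finally show ?thesis using bd[of j k] by linarith
    qed
    then show ?thesis by blast
  qed
  then obtain w where w: "conv t w sequentially" using seq_complete[of t] tc by blast
  have "(E ?\<Delta> y, w) \<in> op_closure V (op_graph D S)"
  proof (rule op_closureI[where F = sequentially and s = "\<lambda>k. E ?\<Delta> (s k)" and t = t])
    show sub: "op_graph D S \<subseteq> carrier V \<times> carrier V" using Dc by (auto simp: op_graph_def)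
    have "(E ?\<Delta> (s k), t k) \<in> op_graph D S" for k
      using ES[OF L sD, of k] ED[OF L sD, of k] by (auto simp: op_graph_def t_def)
    then show "\<forall>\<^sub>F k in sequentially. (E ?\<Delta> (s k), t k) \<in> op_closure V (op_graph D S)"
      using op_closure_superset[OF sub] by (intro always_eventually allI) (rule subsetD)
    show "conv (\<lambda>k. E ?\<Delta> (s k)) (E ?\<Delta> y) sequentially" by (rule proj_conv[OF E_proj[OF L] s(2)])
  qed (use w in auto)
  then show ?thesis by (rule that)
qed

lemma graphs_in: "op_graph D T \<subseteq> carrier V \<times> carrier V" "op_graph D T' \<subseteq> carrier V \<times> carrier V"
  using le le' by (auto simp: op_graph_def locally_eigen_def)

lemma closure_locally_eigen:
  assumes "(x, z) \<in> op_closure V (op_graph D T)" shows "locally_eigen f x z"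
proof -
  obtain s t where st: "\<And>n. (s n, t n) \<in> op_graph D T" "conv s x sequentially" "conv t z sequentially"
    by (rule op_closure_seq[OF graphs_in(1) assms]) (rule that)
  have "locally_eigen f (s n) (t n)" for n using st(1)[of n] le by (auto simp: op_graph_def)
  then show ?thesis using locally_eigen_lim st by blast
qed

text \<open>A pair in the graph of the spectral integral is the limit of its truncations. These lie in the
  closure of \<open>T\<close> because the value of the closure there is determined by the local description.\<close>

lemma closure_eq_spectral_integral: "op_closure V (op_graph D T) = spectral_integral V M E f"
proof (intro equalityI subrelI)
  fix x z assume "(x, z) \<in> op_closure V (op_graph D T)"
  then show "(x, z) \<in> spectral_integral V M E f"
    using closure_locally_eigen locally_eigen_imp_spectral_integral[OF f] by blast
next
  fix x z assume "(x, z) \<in> spectral_integral V M E f"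
  then have le1: "locally_eigen f x z" by (rule spectral_integral_imp_locally_eigen[OF f])
  then have c: "x \<in> carrier V" "z \<in> carrier V" by (auto simp: locally_eigen_def)
  have "(E (level f n) x, E (level f n) z) \<in> op_closure V (op_graph D T)" for n
  proof -
    obtain w where w: "(E (level f n) x, w) \<in> op_closure V (op_graph D T)"
      using truncation[where S = T and g = f and n = n, OF f T_diff ET le c(1)] by blast
    have "w = E (level f n) z"
      using locally_eigen_unique[OF f closure_locally_eigen[OF w] locally_eigen_E[OF le1 level_sets[OF f]]] .
    then show ?thesis using w by simp
  qed
  then show "(x, z) \<in> op_closure V (op_graph D T)"
    by (intro op_closureI[OF graphs_in(1) sequentially_bot _ level_conv[OF f c(1)] level_conv[OF f c(2)]]) auto
qed

text \<open>A pair in the graph of the adjoint is the limit of its truncations. The closure of \<open>T'+"'"+r'\<close> is defined at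
  the truncated argument, and testing with the dense domain identifies its value.\<close>

lemma closure_eq_adjoint: "op_closure V (op_graph D T') = op_adjoint V (op_graph D T)"
proof -
  have Dc: "x \<in> carrier V" "T x \<in> carrier V" if "x \<in> D" for x
    using le[OF that] by (auto simp: locally_eigen_def)
  have sub: "ip V (T u) y = ip V u z" if yz: "(y, z) \<in> op_closure V (op_graph D T')" and u: "u \<in> D" for y z u
  proof -
    obtain s t where st: "\<And>n. (s n, t n) \<in> op_graph D T'" "conv s y sequentially" "conv t z sequentially"
      by (rule op_closure_seq[OF graphs_in(2) yz]) (rule that)
    have "ip V (T u) (s n) = ip V u (t n)" for n
      using st(1)[of n] adj[OF u] by (auto simp: op_graph_def)
    moreover have "(\<lambda>n. ip V (T u) (s n)) \<longlonglongrightarrow> ip V (T u) y" "(\<lambda>n. ip V u (t n)) \<longlonglongrightarrow> ip V u z"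
      using st Dc[OF u] by (auto intro: conv_ip conv_const)
    ultimately show ?thesis using LIMSEQ_unique by fastforce
  qed
  have fm: "f' \<in> borel_measurable M" unfolding f'
    by (rule measurable_compose[OF f borel_measurable_continuous_onI[OF continuous_on_cnj[OF continuous_on_id]]])
  show ?thesis
  proof (intro equalityI subrelI)
    fix y z assume yz: "(y, z) \<in> op_closure V (op_graph D T')"
    then have "y \<in> carrier V" "z \<in> carrier V" unfolding op_closure_iff[OF graphs_in(2)] by auto
    then show "(y, z) \<in> op_adjoint V (op_graph D T)"
      using sub[OF yz] by (auto simp: op_adjoint_def op_graph_def)
  next
    fix y z assume "(y, z) \<in> op_adjoint V (op_graph D T)"
    then have c: "y \<in> carrier V" "z \<in> carrier V" and yz: "\<And>u. u \<in> D \<Longrightarrow> ip V (T u) y = ip V u z"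
      by (auto simp: op_adjoint_def op_graph_def)
    have "(E (level f' n) y, E (level f' n) z) \<in> op_closure V (op_graph D T')" for n
    proof -
      note L = level_sets[OF fm, of n]
      obtain w where w: "(E (level f' n) y, w) \<in> op_closure V (op_graph D T')"
        using truncation[where S = T' and g = f' and n = n, OF fm T'_diff ET' le' c(1)] by blast
      have wc: "w \<in> carrier V" using w unfolding op_closure_iff[OF graphs_in(2)] by auto
      have "w = E (level f' n) z"
      proof (rule dense_eqI[OF D wc])
        show Ez: "E (level f' n) z \<in> carrier V" using L c by simp
        fix u assume u: "u \<in> D"
        have "ip V u w = ip V (T u) (E (level f' n) y)" using sub[OF w u] by simp
        also have "\<dots> = ip V (T (E (level f' n) u)) y"
          using E_sym[OF L _ c(1), of "T u"] ET[OF L u] Dc[OF u] by simp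
        also have "\<dots> = ip V (E (level f' n) u) z" using yz[OF ED[OF L u]] .
        also have "\<dots> = ip V u (E (level f' n) z)" using E_sym[OF L _ c(2)] Dc[OF u] by simp
        finally show "ip V w u = ip V (E (level f' n) z) u"
          using ip_commute[of u w] ip_commute[of u "E (level f' n) z"] wc Ez Dc[OF u] by simp
      qed
      then show ?thesis using w by simp
    qed
    then show "(y, z) \<in> op_closure V (op_graph D T')"
      by (intro op_closureI[OF graphs_in(2) sequentially_bot _ level_conv[OF fm c(1)] level_conv[OF fm c(2)]]) auto
  qed
qed

end

end

section \<open>Closures of *-representations\<close>

lemma (in pre_hilbert_space) conv_dist:
  "conv f l F \<Longrightarrow> e > 0 \<Longrightarrow> eventually (\<lambda>u. dist (vnorm V (f u \<ominus> l)) 0 < e) F"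
  unfolding conv_iff tendsto_iff by blast

locale total_representation = star_representation UNIV \<pi> for \<pi> :: "('a::star_algebra, 'v) rep"
begin

sublocale H: hilbert_space "rep_space \<pi>" by (rule hilbert)

abbreviation V where "V \<equiv> rep_space \<pi>"
abbreviation D where "D \<equiv> rep_dom \<pi>"
abbreviation op where "op \<equiv> rep_op \<pi>"
abbreviation cl where "cl \<equiv> rep_closure UNIV \<pi>"
abbreviation nrm where "nrm \<equiv> vnorm V"

lemma D_in: "x \<in> D \<Longrightarrow> x \<in> carrier V"
  using H.submodule_closed(1)[OF subspace_dom] .

lemmas D_closed = H.submodule_closed(2-)[OF subspace_dom]

lemma op_in [simp]: "x \<in> D \<Longrightarrow> op a x \<in> D"
  using op_closed by simp

lemma D_dense: "H.dense_in D"
  using dense_dom H.dense_in_iff[of D] D_in by auto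

lemma op_diff: "x \<in> D \<Longrightarrow> y \<in> D \<Longrightarrow> op a (x \<ominus>\<^bsub>V\<^esub> y) = op a x \<ominus>\<^bsub>V\<^esub> op a y"
proof -
  assume xy: "x \<in> D" "y \<in> D"
  have e: "u \<ominus>\<^bsub>V\<^esub> v = u \<oplus>\<^bsub>V\<^esub> (-1) \<odot>\<^bsub>V\<^esub> v" if "u \<in> carrier V" "v \<in> carrier V" for u v
    using that by (intro H.ip_eqI) (auto simp: H.ip_simps)
  show ?thesis using xy by (simp add: e D_in D_closed op_add op_smult)
qed

text \<open>A filter on the domain that exhibits \<open>x\<close> as an element of the domain of the closure with values
  \<open>z a\<close>. All properties of the closure are obtained by transporting such filters.\<close>

definition approached :: "'v filter \<Rightarrow> 'v \<Rightarrow> ('a \<Rightarrow> 'v) \<Rightarrow> bool" where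
  "approached F x z \<longleftrightarrow> F \<noteq> bot \<and> eventually (\<lambda>u. u \<in> D) F \<and> H.conv (\<lambda>u. u) x F \<and> (\<forall>a. H.conv (op a) (z a) F)"

lemma approached_graph_cauchy: "approached F x z \<Longrightarrow> graph_cauchy UNIV \<pi> F"
  unfolding graph_cauchy_def
proof (intro conjI ballI allI impI)
  assume A: "approached F x z"
  then show "F \<noteq> bot" "eventually (\<lambda>u. u \<in> D) F" by (auto simp: approached_def)
  have c: "x \<in> carrier V" "z a \<in> carrier V" for a using A by (auto simp: approached_def intro: H.conv_in)
  fix a and e :: real assume e: "e > 0"
  have 1: "eventually (\<lambda>u. dist (nrm (u \<ominus>\<^bsub>V\<^esub> x)) 0 < e / 4) F"
    "eventually (\<lambda>u. dist (nrm (op a u \<ominus>\<^bsub>V\<^esub> z a)) 0 < e / 4) F"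
    using e A by (intro H.conv_dist; simp add: approached_def)+
  let ?P = "\<lambda>u. u \<in> D \<and> dist (nrm (u \<ominus>\<^bsub>V\<^esub> x)) 0 < e / 4 \<and> dist (nrm (op a u \<ominus>\<^bsub>V\<^esub> z a)) 0 < e / 4"
  have "eventually ?P F" using 1 A by (auto simp: approached_def eventually_conj_iff)
  moreover have "graph_norm \<pi> a (u \<ominus>\<^bsub>V\<^esub> v) < e" if u: "?P u" and v: "?P v" for u v
  proof -
    note uc = D_in[of u] D_in[of v] D_in[OF op_in, of u a] D_in[OF op_in, of v a]
    have "nrm (u \<ominus>\<^bsub>V\<^esub> v) \<le> nrm (u \<ominus>\<^bsub>V\<^esub> x) + nrm (v \<ominus>\<^bsub>V\<^esub> x)"
      using H.vnorm_diff_triangle[of u x v] H.vnorm_commute[of x v] uc u v c by simp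
    moreover have "nrm (op a u \<ominus>\<^bsub>V\<^esub> op a v) \<le> nrm (op a u \<ominus>\<^bsub>V\<^esub> z a) + nrm (op a v \<ominus>\<^bsub>V\<^esub> z a)"
      using H.vnorm_diff_triangle[of "op a u" "z a" "op a v"] H.vnorm_commute[of "z a" "op a v"] uc u v c by simp
    ultimately show ?thesis using u v c uc by (simp add: graph_norm_def op_diff dist_real_def)
  qed
  ultimately show "\<forall>\<^sub>F (u, v) in F \<times>\<^sub>F F. graph_norm \<pi> a (u \<ominus>\<^bsub>V\<^esub> v) < e"
    unfolding eventually_prod_filter by (intro exI[of _ ?P]) auto
qed

lemma graph_cauchy_approached:
  assumes G: "graph_cauchy UNIV \<pi> F"
  obtains x z where "approached F x z"
proof -
  have F: "F \<noteq> bot" "eventually (\<lambda>u. u \<in> D) F" using G by (auto simp: graph_cauchy_def)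
  have D2: "eventually (\<lambda>(u, v). u \<in> D \<and> v \<in> D) (F \<times>\<^sub>F F)"
    unfolding eventually_prod_filter using F(2) by blast
  have g: "eventually (\<lambda>(u, v). graph_norm \<pi> a (u \<ominus>\<^bsub>V\<^esub> v) < e) (F \<times>\<^sub>F F)" if "e > 0" for a e
    using G that by (auto simp: graph_cauchy_def)
  obtain x where x: "H.conv (\<lambda>u. u) x F"
  proof (rule H.filter_complete[OF F(1), of "\<lambda>u. u"])
    show "\<forall>\<^sub>F u in F. u \<in> carrier V" using F(2) by eventually_elim (rule D_in)
    show "\<forall>\<^sub>F (u, v) in F \<times>\<^sub>F F. nrm (u \<ominus>\<^bsub>V\<^esub> v) < e" if "e > 0" for e
      using D2 g[OF that, of 0]
    proof eventually_elim
      case (elim p)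
      then show ?case
        by (auto simp: graph_norm_def case_prod_beta D_in D_closed intro: le_less_trans[rotated])
    qed
  qed blast
  have "\<exists>z. H.conv (op a) z F" for a
  proof (rule H.filter_complete[OF F(1), of "op a"])
    show "\<forall>\<^sub>F u in F. op a u \<in> carrier V" using F(2) by eventually_elim (simp add: D_in)
    show "\<forall>\<^sub>F (u, v) in F \<times>\<^sub>F F. nrm (op a u \<ominus>\<^bsub>V\<^esub> op a v) < e" if "e > 0" for e
      using D2 g[OF that, of a]
    proof eventually_elim
      case (elim p)
      then show ?case
        by (auto simp: graph_norm_def case_prod_beta op_diff D_in D_closed intro: le_less_trans[rotated])
    qed
  qed blast
  then obtain z where "\<And>a. H.conv (op a) (z a) F" by metis
  then show ?thesis using that F x by (auto simp: approached_def)
qed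

text \<open>The formal adjoint makes the operators closable: a limit of values is determined by the limit of the
  arguments through testing with the dense domain.\<close>

lemma limit_adjoint:
  assumes "F \<noteq> bot" "eventually (\<lambda>u. u \<in> D) F" "H.conv (\<lambda>u. u) x F" "H.conv (op a) z F" and y: "y \<in> D"
  shows "ip V z y = ip V x (op (star a) y)"
proof -
  have "((\<lambda>u. ip V (op a u) y) \<longlongrightarrow> ip V z y) F"
    using assms D_in by (intro H.conv_ip H.conv_const) auto
  moreover have "((\<lambda>u. ip V u (op (star a) y)) \<longlongrightarrow> ip V x (op (star a) y)) F"
    using assms D_in by (intro H.conv_ip H.conv_const) auto
  then have "((\<lambda>u. ip V (op a u) y) \<longlongrightarrow> ip V x (op (star a) y)) F"
    by (rule tendsto_cong[THEN iffD1, rotated])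
      (use assms(2) in \<open>eventually_elim, simp add: hom_star y\<close>)
  ultimately show ?thesis using assms(1) tendsto_unique by blast
qed

lemma closure_space [simp]: "rep_space cl = V"
  by (simp add: rep_closure_def)

lemma closure_op_eq:
  assumes A: "approached F x z"
  shows "x \<in> rep_dom cl" "rep_op cl a x = z a"
proof -
  note G = approached_graph_cauchy[OF A]
  have F: "F \<noteq> bot" "eventually (\<lambda>u. u \<in> D) F" "H.conv (\<lambda>u. u) x F" "H.conv (op a) (z a) F"
    using A by (auto simp: approached_def)
  show "x \<in> rep_dom cl" using F G by (auto simp: rep_closure_def)
  have uniq: "w = z a" if "graph_cauchy UNIV \<pi> F'" "H.conv (\<lambda>u. u) x F'" "H.conv (op a) w F'" for w F'
  proof (rule H.dense_eqI[OF D_dense])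
    show "w \<in> carrier V" "z a \<in> carrier V" using that F by (auto intro: H.conv_in)
    fix u assume u: "u \<in> D"
    have "F' \<noteq> bot" "eventually (\<lambda>u. u \<in> D) F'" using that by (auto simp: graph_cauchy_def)
    from limit_adjoint[OF this that(2,3) u] limit_adjoint[OF F u]
    show "ip V w u = ip V (z a) u" by simp
  qed
  have "(THE w. \<exists>F. graph_cauchy UNIV \<pi> F \<and> H.conv (\<lambda>u. u) x F \<and> H.conv (op a) w F) = z a"
  proof (rule the_equality)
    show "\<exists>F. graph_cauchy UNIV \<pi> F \<and> H.conv (\<lambda>u. u) x F \<and> H.conv (op a) (z a) F"
      using G F(3,4) by (intro exI[of _ F] conjI)
  qed (elim exE conjE, rule uniq)
  then show "rep_op cl a x = z a" unfolding rep_closure_def by simp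
qed

lemma closure_approached:
  assumes "x \<in> rep_dom cl"
  obtains F where "approached F x (\<lambda>a. rep_op cl a x)"
proof -
  obtain F where F: "graph_cauchy UNIV \<pi> F" "H.conv (\<lambda>u. u) x F"
    using assms by (auto simp: rep_closure_def)
  obtain x' z where A: "approached F x' z" using graph_cauchy_approached[OF F(1)] by blast
  then have "x' = x" using H.conv_unique F(2) by (auto simp: approached_def)
  with A have "approached F x z" by simp
  moreover from closure_op_eq(2)[OF this] have "z = (\<lambda>a. rep_op cl a x)" by auto
  ultimately show ?thesis using that by simp
qed

lemma approached_dom:
  assumes x: "x \<in> D" shows "approached (principal {x}) x (\<lambda>a. op a x)"
proof -
  have "H.conv f (f x) (principal {x})" if "f x \<in> carrier V" for f
    unfolding H.conv_iff
  proof (intro conjI that)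
    show "\<forall>\<^sub>F n in principal {x}. f n \<in> carrier V" using that by (simp add: eventually_principal)
    show "((\<lambda>n. nrm (f n \<ominus>\<^bsub>V\<^esub> f x)) \<longlongrightarrow> 0) (principal {x})"
      using that by (intro tendsto_eventually) (simp add: eventually_principal H.diff_eq_zero[THEN iffD2])
  qed
  from this[of "\<lambda>u. u"] this[of "op a" for a] show ?thesis
    using x by (simp add: approached_def D_in principal_eq_bot_iff eventually_principal)
qed

lemma closure_extends: "x \<in> D \<Longrightarrow> x \<in> rep_dom cl" "x \<in> D \<Longrightarrow> rep_op cl a x = op a x"
  using closure_op_eq[OF approached_dom] by auto

lemma closure_in: "x \<in> rep_dom cl \<Longrightarrow> x \<in> carrier V" "x \<in> rep_dom cl \<Longrightarrow> rep_op cl a x \<in> carrier V"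
  by (erule closure_approached, auto simp: approached_def intro: H.conv_in)+

lemma closure_approx:
  assumes x: "x \<in> rep_dom cl" and K: "finite K" and e: "e > 0"
  shows "\<exists>u\<in>D. nrm (u \<ominus>\<^bsub>V\<^esub> x) < e \<and> (\<forall>a\<in>K. nrm (op a u \<ominus>\<^bsub>V\<^esub> rep_op cl a x) < e)"
proof -
  obtain F where F: "approached F x (\<lambda>a. rep_op cl a x)" using closure_approached[OF x] by blast
  have "eventually (\<lambda>u. dist (nrm (u \<ominus>\<^bsub>V\<^esub> x)) 0 < e) F"
    using F e by (auto simp: approached_def H.conv_iff tendsto_iff)
  moreover have "eventually (\<lambda>u. \<forall>a\<in>K. dist (nrm (op a u \<ominus>\<^bsub>V\<^esub> rep_op cl a x)) 0 < e) F"
    using F e K by (intro eventually_ball_finite) (auto simp: approached_def H.conv_iff tendsto_iff)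
  moreover have "eventually (\<lambda>u. u \<in> D) F" using F by (auto simp: approached_def)
  ultimately have "eventually (\<lambda>u. u \<in> D \<and> dist (nrm (u \<ominus>\<^bsub>V\<^esub> x)) 0 < e \<and>
      (\<forall>a\<in>K. dist (nrm (op a u \<ominus>\<^bsub>V\<^esub> rep_op cl a x)) 0 < e)) F"
    by eventually_elim auto
  then obtain u where "u \<in> D \<and> dist (nrm (u \<ominus>\<^bsub>V\<^esub> x)) 0 < e \<and>
      (\<forall>a\<in>K. dist (nrm (op a u \<ominus>\<^bsub>V\<^esub> rep_op cl a x)) 0 < e)"
    using F eventually_happens' unfolding approached_def by blast
  then show ?thesis by (auto simp: dist_real_def intro: abs_less_iff[THEN iffD1, THEN conjunct1])
qed

text \<open>The sets of vectors that approximate \<open>x\<close> and finitely many values up to \<open>e\<close> generate the required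
  filter.\<close>

lemma closureI:
  assumes x: "x \<in> carrier V" and z: "\<And>a. z a \<in> carrier V"
    and approx: "\<And>K e. finite K \<Longrightarrow> e > 0 \<Longrightarrow>
      \<exists>u\<in>D. nrm (u \<ominus>\<^bsub>V\<^esub> x) < e \<and> (\<forall>a\<in>K. nrm (op a u \<ominus>\<^bsub>V\<^esub> z a) < e)"
  obtains F where "approached F x z"
proof -
  define U where "U = (\<lambda>(K, e). {u \<in> D. nrm (u \<ominus>\<^bsub>V\<^esub> x) < e \<and> (\<forall>a\<in>K. nrm (op a u \<ominus>\<^bsub>V\<^esub> z a) < e)})"
  define I where "I = {(K :: 'a set, e :: real). finite K \<and> e > 0}"
  define F where "F = (INF i\<in>I. principal (U i))"
  have ev: "eventually P F \<longleftrightarrow> (\<exists>i\<in>I. \<forall>u\<in>U i. P u)" for P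
    unfolding F_def eventually_principal[symmetric]
  proof (rule eventually_INF_base)
    show "I \<noteq> {}" unfolding I_def by (auto intro!: exI[of _ "{}"] exI[of _ 1])
    fix i j assume "i \<in> I" "j \<in> I"
    then obtain K e K' e' where "i = (K, e)" "j = (K', e')" "finite K" "finite K'" "e > 0" "e' > 0"
      by (auto simp: I_def)
    then show "\<exists>k\<in>I. principal (U k) \<le> inf (principal (U i)) (principal (U j))"
      by (intro bexI[of _ "(K \<union> K', min e e')"]) (auto simp: I_def U_def)
  qed
  have evI: "eventually P F" if "finite K" "e > 0"
    "\<And>u. u \<in> D \<Longrightarrow> nrm (u \<ominus>\<^bsub>V\<^esub> x) < e \<Longrightarrow> (\<forall>a\<in>K. nrm (op a u \<ominus>\<^bsub>V\<^esub> z a) < e) \<Longrightarrow> P u" for P K e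
    unfolding ev using that by (intro bexI[of _ "(K, e)"]) (auto simp: I_def U_def)
  have "F \<noteq> bot"
    unfolding trivial_limit_def ev using approx by (fastforce simp: I_def U_def)
  moreover have D: "eventually (\<lambda>u. u \<in> D) F" by (rule evI[of "{}" 1]) auto
  moreover have "H.conv (\<lambda>u. u) x F"
    unfolding H.conv_iff
  proof (intro conjI x tendstoI)
    show "eventually (\<lambda>u. u \<in> carrier V) F" using D by eventually_elim (rule D_in)
    show "eventually (\<lambda>u. dist (nrm (u \<ominus>\<^bsub>V\<^esub> x)) 0 < e) F" if "e > 0" for e
      using that x D_in by (intro evI[of "{}" e]) auto
  qed
  moreover have "H.conv (op a) (z a) F" for a
    unfolding H.conv_iff
  proof (intro conjI z tendstoI)
    show "eventually (\<lambda>u. op a u \<in> carrier V) F" using D by eventually_elim (simp add: D_in)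
    show "eventually (\<lambda>u. dist (nrm (op a u \<ominus>\<^bsub>V\<^esub> z a)) 0 < e) F" if "e > 0" for e
      using that z D_in[OF op_in] by (intro evI[of "{a}" e]) auto
  qed
  ultimately show ?thesis using that by (auto simp: approached_def)
qed

lemma conv_filtermap: "H.conv f l (filtermap g F) \<longleftrightarrow> H.conv (\<lambda>n. f (g n)) l F"
  by (simp add: H.conv_iff eventually_filtermap filterlim_filtermap)

lemma conv_prod:
  assumes "H.conv f l F" "F' \<noteq> bot" shows "H.conv (\<lambda>p. f (fst p)) l (F \<times>\<^sub>F F')"
  using assms unfolding H.conv_iff
  by (auto intro: filterlim_compose[OF _ filterlim_fst] eventually_compose_filterlim[OF _ filterlim_fst])

lemma conv_prod':
  assumes "H.conv f l F'" "F \<noteq> bot" shows "H.conv (\<lambda>p. f (snd p)) l (F \<times>\<^sub>F F')"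
  using assms unfolding H.conv_iff
  by (auto intro: filterlim_compose[OF _ filterlim_snd] eventually_compose_filterlim[OF _ filterlim_snd])

lemma approached_map:
  assumes A: "approached F x z" and g: "\<And>u. u \<in> D \<Longrightarrow> g u \<in> D" and x': "H.conv g x' F"
    and z': "\<And>a. H.conv (\<lambda>u. op a (g u)) (z' a) F"
  shows "approached (filtermap g F) x' z'"
proof -
  have "\<forall>\<^sub>F u in F. g u \<in> D" using A g by (auto simp: approached_def elim: eventually_mono)
  then show ?thesis using A x' z' by (simp add: approached_def conv_filtermap eventually_filtermap filtermap_bot_iff)
qed

lemma closure_mult:
  assumes x: "x \<in> rep_dom cl"
  shows "rep_op cl a x \<in> rep_dom cl" "rep_op cl b (rep_op cl a x) = rep_op cl (b * a) x"
proof -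
  obtain F where F: "approached F x (\<lambda>a. rep_op cl a x)" using closure_approached[OF x] by blast
  have "approached (filtermap (op a) F) (rep_op cl a x) (\<lambda>b. rep_op cl (b * a) x)"
  proof (rule approached_map[OF F])
    fix b
    have "H.conv (op (b * a)) (rep_op cl (b * a) x) F" using F by (auto simp: approached_def)
    moreover have "eventually (\<lambda>u. op (b * a) u = op b (op a u)) F"
      using F by (auto simp: approached_def hom_mult elim: eventually_mono)
    ultimately show "H.conv (\<lambda>u. op b (op a u)) (rep_op cl (b * a) x) F"
      by (rule limitin_transform_eventually[rotated])
  qed (use F in \<open>auto simp: approached_def\<close>)
  from closure_op_eq[OF this] show "rep_op cl a x \<in> rep_dom cl" "rep_op cl b (rep_op cl a x) = rep_op cl (b * a) x"
    by auto
qed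

lemma closure_smult:
  assumes x: "x \<in> rep_dom cl"
  shows "c \<odot>\<^bsub>V\<^esub> x \<in> rep_dom cl" "rep_op cl a (c \<odot>\<^bsub>V\<^esub> x) = c \<odot>\<^bsub>V\<^esub> rep_op cl a x"
proof -
  obtain F where F: "approached F x (\<lambda>a. rep_op cl a x)" using closure_approached[OF x] by blast
  have "approached (filtermap (\<lambda>u. c \<odot>\<^bsub>V\<^esub> u) F) (c \<odot>\<^bsub>V\<^esub> x) (\<lambda>a. c \<odot>\<^bsub>V\<^esub> rep_op cl a x)"
  proof (rule approached_map[OF F])
    fix b
    have "H.conv (\<lambda>u. c \<odot>\<^bsub>V\<^esub> op b u) (c \<odot>\<^bsub>V\<^esub> rep_op cl b x) F"
      using F by (intro H.conv_smult) (auto simp: approached_def)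
    moreover have "eventually (\<lambda>u. c \<odot>\<^bsub>V\<^esub> op b u = op b (c \<odot>\<^bsub>V\<^esub> u)) F"
      using F by (auto simp: approached_def op_smult elim: eventually_mono)
    ultimately show "H.conv (\<lambda>u. op b (c \<odot>\<^bsub>V\<^esub> u)) (c \<odot>\<^bsub>V\<^esub> rep_op cl b x) F"
      by (rule limitin_transform_eventually[rotated])
  qed (use F D_closed in \<open>auto simp: approached_def intro: H.conv_smult\<close>)
  from closure_op_eq[OF this] show "c \<odot>\<^bsub>V\<^esub> x \<in> rep_dom cl" "rep_op cl a (c \<odot>\<^bsub>V\<^esub> x) = c \<odot>\<^bsub>V\<^esub> rep_op cl a x"
    by auto
qed

lemma closure_add:
  assumes x: "x \<in> rep_dom cl" and y: "y \<in> rep_dom cl"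
  shows "x \<oplus>\<^bsub>V\<^esub> y \<in> rep_dom cl" "rep_op cl a (x \<oplus>\<^bsub>V\<^esub> y) = rep_op cl a x \<oplus>\<^bsub>V\<^esub> rep_op cl a y"
proof -
  obtain F where F: "approached F x (\<lambda>a. rep_op cl a x)" using closure_approached[OF x] by blast
  obtain F' where F': "approached F' y (\<lambda>a. rep_op cl a y)" using closure_approached[OF y] by blast
  have b: "F \<noteq> bot" "F' \<noteq> bot" using F F' by (auto simp: approached_def)
  have D2: "eventually (\<lambda>p. fst p \<in> D \<and> snd p \<in> D) (F \<times>\<^sub>F F')"
    unfolding eventually_prod_filter using F F' by (auto simp: approached_def)
  have "approached (filtermap (\<lambda>p. fst p \<oplus>\<^bsub>V\<^esub> snd p) (F \<times>\<^sub>F F')) (x \<oplus>\<^bsub>V\<^esub> y) (\<lambda>a. rep_op cl a x \<oplus>\<^bsub>V\<^esub> rep_op cl a y)"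
    unfolding approached_def conv_filtermap eventually_filtermap
  proof (intro conjI allI)
    show "filtermap (\<lambda>p. fst p \<oplus>\<^bsub>V\<^esub> snd p) (F \<times>\<^sub>F F') \<noteq> bot"
      using b by (simp add: filtermap_bot_iff prod_filter_eq_bot)
    show "\<forall>\<^sub>F p in F \<times>\<^sub>F F'. fst p \<oplus>\<^bsub>V\<^esub> snd p \<in> D"
      using D2 by eventually_elim (auto intro: D_closed)
    show "H.conv (\<lambda>p. fst p \<oplus>\<^bsub>V\<^esub> snd p) (x \<oplus>\<^bsub>V\<^esub> y) (F \<times>\<^sub>F F')"
      using F F' b conv_prod[of "\<lambda>u. u"] conv_prod'[of "\<lambda>u. u"] by (intro H.conv_add) (auto simp: approached_def)
    fix a
    have "H.conv (\<lambda>p. op a (fst p) \<oplus>\<^bsub>V\<^esub> op a (snd p)) (rep_op cl a x \<oplus>\<^bsub>V\<^esub> rep_op cl a y) (F \<times>\<^sub>F F')"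
      using F F' b by (intro H.conv_add conv_prod conv_prod') (auto simp: approached_def)
    moreover have "eventually (\<lambda>p. op a (fst p) \<oplus>\<^bsub>V\<^esub> op a (snd p) = op a (fst p \<oplus>\<^bsub>V\<^esub> snd p)) (F \<times>\<^sub>F F')"
      using D2 by eventually_elim (simp add: op_add)
    ultimately show "H.conv (\<lambda>p. op a (fst p \<oplus>\<^bsub>V\<^esub> snd p)) (rep_op cl a x \<oplus>\<^bsub>V\<^esub> rep_op cl a y) (F \<times>\<^sub>F F')"
      by (rule limitin_transform_eventually[rotated])
  qed
  from closure_op_eq[OF this]
  show "x \<oplus>\<^bsub>V\<^esub> y \<in> rep_dom cl" "rep_op cl a (x \<oplus>\<^bsub>V\<^esub> y) = rep_op cl a x \<oplus>\<^bsub>V\<^esub> rep_op cl a y" by auto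
qed

text \<open>Pointwise continuous identities between operators carry over to the closure.\<close>

lemma closure_linear_limit:
  assumes x: "x \<in> rep_dom cl"
    and eq: "\<And>u. u \<in> D \<Longrightarrow> op c u = f (op a u) (op b u)"
    and f: "\<And>F g h l m. H.conv g l F \<Longrightarrow> H.conv h m F \<Longrightarrow> H.conv (\<lambda>u. f (g u) (h u)) (f l m) (F :: 'v filter)"
  shows "rep_op cl c x = f (rep_op cl a x) (rep_op cl b x)"
proof -
  obtain F where F: "approached F x (\<lambda>a. rep_op cl a x)" using closure_approached[OF x] by blast
  have 1: "H.conv (\<lambda>u. f (op a u) (op b u)) (f (rep_op cl a x) (rep_op cl b x)) F"
    using F by (intro f) (auto simp: approached_def)
  have "eventually (\<lambda>u. f (op a u) (op b u) = op c u) F"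
    using F by (auto simp: approached_def eq elim: eventually_mono)
  with 1 have "H.conv (op c) (f (rep_op cl a x) (rep_op cl b x)) F"
    by (rule limitin_transform_eventually[rotated])
  moreover have "H.conv (op c) (rep_op cl c x) F" "F \<noteq> bot" using F by (auto simp: approached_def)
  ultimately show ?thesis using H.conv_unique by blast
qed

lemma closure_star:
  assumes x: "x \<in> rep_dom cl" and y: "y \<in> rep_dom cl"
  shows "ip V (rep_op cl a x) y = ip V x (rep_op cl (star a) y)"
proof -
  obtain F where F: "approached F x (\<lambda>a. rep_op cl a x)" using closure_approached[OF x] by blast
  have F1: "F \<noteq> bot" "eventually (\<lambda>u. u \<in> D) F" "H.conv (\<lambda>u. u) x F" "H.conv (op a) (rep_op cl a x) F"
    using F by (auto simp: approached_def)
  obtain F' where F': "approached F' y (\<lambda>a. rep_op cl a y)" using closure_approached[OF y] by blast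
  have F2: "F' \<noteq> bot" "eventually (\<lambda>u. u \<in> D) F'" "H.conv (\<lambda>u. u) y F'" "H.conv (op (star a)) (rep_op cl (star a) y) F'"
    using F' by (auto simp: approached_def)
  have "((\<lambda>v. ip V (rep_op cl a x) v) \<longlongrightarrow> ip V (rep_op cl a x) y) F'"
    using F2(3) closure_in x by (intro H.conv_ip H.conv_const) auto
  moreover have "((\<lambda>v. ip V x (op (star a) v)) \<longlongrightarrow> ip V x (rep_op cl (star a) y)) F'"
    using F2(4) closure_in x by (intro H.conv_ip H.conv_const) auto
  then have "((\<lambda>v. ip V (rep_op cl a x) v) \<longlongrightarrow> ip V x (rep_op cl (star a) y)) F'"
    by (rule tendsto_cong[THEN iffD1, rotated])
      (use F2(2) in \<open>eventually_elim, simp add: limit_adjoint[OF F1]\<close>)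
  ultimately show ?thesis using F2(1) tendsto_unique by blast
qed

lemma closure_submodule: "submodule (rep_dom cl) complex_ring V"
proof (rule H.submoduleI)
  show "rep_dom cl \<subseteq> carrier V" using closure_in by auto
  show "\<zero>\<^bsub>V\<^esub> \<in> rep_dom cl" using closure_extends D_closed(1) by auto
  show "\<ominus>\<^bsub>V\<^esub> x \<in> rep_dom cl" if "x \<in> rep_dom cl" for x
  proof -
    have "(-1) \<odot>\<^bsub>V\<^esub> x = \<ominus>\<^bsub>V\<^esub> x" using closure_in(1)[OF that] by (intro H.ip_eqI) (auto simp: H.ip_simps)
    then show ?thesis using closure_smult(1)[OF that, of "-1"] by simp
  qed
qed (auto intro: closure_add closure_smult)

lemma closure_dense: "H.dense_in (rep_dom cl)"
  using D_dense closure_extends closure_in unfolding H.dense_in_def by blast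

theorem closure_star_representation: "star_representation S cl"
proof (rule star_representation.intro)
  show "hilbert_space (rep_space cl)" by (simp add: hilbert)
  show "submodule (rep_dom cl) complex_ring (rep_space cl)" by (simp add: closure_submodule)
  show "vtop (rep_space cl) closure_of rep_dom cl = carrier (rep_space cl)"
    using H.dense_in_iff[of "rep_dom cl"] closure_dense closure_in by (auto simp: H.dense_in_def)
  show "rep_op cl (a + b) x = rep_op cl a x \<oplus>\<^bsub>rep_space cl\<^esub> rep_op cl b x" if "x \<in> rep_dom cl" for a b x
    unfolding closure_space
    by (rule closure_linear_limit[OF that]) (auto simp: hom_add intro: H.conv_add)
  show "rep_op cl (c *\<^sub>C a) x = c \<odot>\<^bsub>rep_space cl\<^esub> rep_op cl a x" if "x \<in> rep_dom cl" for a c x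
    unfolding closure_space
    by (rule closure_linear_limit[OF that, where f = "\<lambda>u v. c \<odot>\<^bsub>V\<^esub> u" and b = a]) (auto simp: hom_scaleC intro: H.conv_smult)
qed (simp_all add: closure_mult closure_add closure_smult closure_star)

lemma closure_op_diff: "x \<in> rep_dom cl \<Longrightarrow> y \<in> rep_dom cl \<Longrightarrow> rep_op cl a (x \<ominus>\<^bsub>V\<^esub> y) = rep_op cl a x \<ominus>\<^bsub>V\<^esub> rep_op cl a y"
proof -
  assume xy: "x \<in> rep_dom cl" "y \<in> rep_dom cl"
  have e: "u \<ominus>\<^bsub>V\<^esub> v = u \<oplus>\<^bsub>V\<^esub> (-1) \<odot>\<^bsub>V\<^esub> v" if "u \<in> carrier V" "v \<in> carrier V" for u v
    using that by (intro H.ip_eqI) (auto simp: H.ip_simps)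
  show ?thesis using xy by (simp add: e closure_in closure_add closure_smult)
qed

text \<open>The limit of a Cauchy filter on the domain of the closure is again approximated by elements of the
  original domain, hence belongs to the domain of the closure. The set \<open>B\<close> may be smaller than the
  algebra as long as it determines the same Cauchy filters.\<close>

theorem closed_closure:
  assumes zero: "0 \<in> B" and dom: "\<And>\<Phi>. graph_cauchy B cl \<Phi> \<Longrightarrow> graph_cauchy UNIV cl \<Phi>"
  shows "closed_rep B cl"
  unfolding closed_rep_def
proof (intro allI impI)
  fix \<Phi> assume "graph_cauchy B cl \<Phi>"
  then have G: "graph_cauchy UNIV cl \<Phi>" by (rule dom)
  interpret C: total_representation cl
    by (rule total_representation.intro, rule closure_star_representation)
  obtain x z where A: "C.approached \<Phi> x z" using C.graph_cauchy_approached[OF G] by blast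
  have F: "\<Phi> \<noteq> bot" "eventually (\<lambda>u. u \<in> rep_dom cl) \<Phi>" "H.conv (\<lambda>u. u) x \<Phi>" "\<And>a. H.conv (rep_op cl a) (z a) \<Phi>"
    using A unfolding C.approached_def by auto
  have c: "x \<in> carrier V" "z a \<in> carrier V" for a using F by (auto intro: H.conv_in)
  obtain F' where F': "approached F' x z"
  proof (rule closureI[OF c])
    fix K :: "'a set" and e :: real assume K: "finite K" and e: "e > 0"
    have "eventually (\<lambda>u. dist (nrm (u \<ominus>\<^bsub>V\<^esub> x)) 0 < e / 2) \<Phi>"
      using F(3) e by (intro H.conv_dist) auto
    moreover have "eventually (\<lambda>u. \<forall>a\<in>K. dist (nrm (rep_op cl a u \<ominus>\<^bsub>V\<^esub> z a)) 0 < e / 2) \<Phi>"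
      using F(4) e K by (intro eventually_ball_finite ballI H.conv_dist) auto
    ultimately have "eventually (\<lambda>u. u \<in> rep_dom cl \<and> dist (nrm (u \<ominus>\<^bsub>V\<^esub> x)) 0 < e / 2 \<and>
        (\<forall>a\<in>K. dist (nrm (rep_op cl a u \<ominus>\<^bsub>V\<^esub> z a)) 0 < e / 2)) \<Phi>"
      using F(2) by eventually_elim auto
    then obtain u where u: "u \<in> rep_dom cl" "dist (nrm (u \<ominus>\<^bsub>V\<^esub> x)) 0 < e / 2"
        "\<And>a. a \<in> K \<Longrightarrow> dist (nrm (rep_op cl a u \<ominus>\<^bsub>V\<^esub> z a)) 0 < e / 2"
      using F(1) eventually_happens' by blast
    obtain w where w: "w \<in> D" "nrm (w \<ominus>\<^bsub>V\<^esub> u) < e / 2" "\<And>a. a \<in> K \<Longrightarrow> nrm (op a w \<ominus>\<^bsub>V\<^esub> rep_op cl a u) < e / 2"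
      using closure_approx[OF u(1) K, of "e / 2"] e by auto
    show "\<exists>u\<in>D. nrm (u \<ominus>\<^bsub>V\<^esub> x) < e \<and> (\<forall>a\<in>K. nrm (op a u \<ominus>\<^bsub>V\<^esub> z a) < e)"
    proof (intro bexI[of _ w] conjI ballI w(1))
      show "nrm (w \<ominus>\<^bsub>V\<^esub> x) < e"
        using H.vnorm_diff_triangle[of w u x] D_in[OF w(1)] closure_in(1)[OF u(1)] c u(2) w(2) by simp
      fix a assume "a \<in> K"
      then show "nrm (op a w \<ominus>\<^bsub>V\<^esub> z a) < e"
        using H.vnorm_diff_triangle[of "op a w" "rep_op cl a u" "z a"] D_in[OF op_in[OF w(1)], of a]
          closure_in(2)[OF u(1)] c u(3)[of a] w(3)[of a] by simp
    qed
  qed blast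
  have xd: "x \<in> rep_dom cl" and zx: "rep_op cl a x = z a" for a using closure_op_eq[OF F'] by auto
  let ?S = "{{y \<in> rep_dom cl. graph_norm cl a (y \<ominus>\<^bsub>rep_space cl\<^esub> x) < r} | a x r. a \<in> B \<and> x \<in> rep_dom cl \<and> 0 < r}"
  have ev: "x \<in> U \<Longrightarrow> eventually (\<lambda>y. y \<in> U) \<Phi>" if "generate_topology_on ?S U" for U
    using that
  proof (induction rule: generate_topology_on.induct)
    case (Int a b) then show ?case by (simp add: eventually_conj_iff)
  next
    case (UN K)
    then obtain k where "k \<in> K" "x \<in> k" by auto
    then have "eventually (\<lambda>y. y \<in> k) \<Phi>" using UN by blast
    then show ?case by (rule eventually_mono) (use \<open>k \<in> K\<close> in blast)
  next
    case (Basis s)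
    then obtain a x0 r where s: "s = {y \<in> rep_dom cl. graph_norm cl a (y \<ominus>\<^bsub>V\<^esub> x0) < r}" "x0 \<in> rep_dom cl" "0 < r"
      by auto
    have gl: "((\<lambda>y. nrm (y \<ominus>\<^bsub>V\<^esub> x0) + nrm (rep_op cl a y \<ominus>\<^bsub>V\<^esub> rep_op cl a x0)) \<longlongrightarrow>
        nrm (x \<ominus>\<^bsub>V\<^esub> x0) + nrm (z a \<ominus>\<^bsub>V\<^esub> rep_op cl a x0)) \<Phi>"
      using F s(2) closure_in by (intro tendsto_add H.conv_norm H.conv_diff H.conv_const) auto
    have "nrm (x \<ominus>\<^bsub>V\<^esub> x0) + nrm (z a \<ominus>\<^bsub>V\<^esub> rep_op cl a x0) < r"
      using Basis(2) xd s by (simp add: graph_norm_def closure_op_diff zx)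
    from order_tendstoD(2)[OF gl this] F(2) show ?case
      by eventually_elim (use s in \<open>simp add: graph_norm_def closure_op_diff\<close>)
  qed simp
  have "limitin (graph_topology B cl) (\<lambda>y. y) x \<Phi>"
    unfolding limitin_def
  proof (intro conjI allI impI)
    show "x \<in> topspace (graph_topology B cl)"
    proof -
      have "graph_norm cl 0 (x \<ominus>\<^bsub>V\<^esub> x) = 0"
        using xd unfolding graph_norm_def closure_op_diff[OF xd xd]
        by (simp add: H.diff_eq_zero[THEN iffD2] closure_in)
      then have "x \<in> {y \<in> rep_dom cl. graph_norm cl 0 (y \<ominus>\<^bsub>rep_space cl\<^esub> x) < 1}"
        using xd by simp
      moreover have "{y \<in> rep_dom cl. graph_norm cl 0 (y \<ominus>\<^bsub>rep_space cl\<^esub> x) < 1} \<in> ?S"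
        using xd zero zero_less_one by blast
      ultimately show ?thesis
        unfolding graph_topology_def topology_generated_by_topspace by blast
    qed
    show "\<forall>\<^sub>F y in \<Phi>. y \<in> U" if "openin (graph_topology B cl) U \<and> x \<in> U" for U
      using that ev unfolding graph_topology_def openin_topology_generated_by_iff by blast
  qed
  then show "\<exists>x. limitin (graph_topology B cl) (\<lambda>y. y) x \<Phi>" by blast
qed

end

section \<open>Graded *-algebras\<close>

lemma star_zero [simp]: "star (0 :: 'a::star_algebra) = 0"
  using star_add[of "0::'a" 0] by simp

lemma star_one [simp]: "star (1 :: 'a::star_algebra) = 1"
  by (metis mult_1_right star_mult star_star)

context graded_star_algebra
begin

abbreviation B where "B \<equiv> A \<one>"
abbreviation comp where "comp \<equiv> component G A"

lemma comp_decomposition: "decomposition G A a (comp a)"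
  unfolding component_def using direct_sum[of a] by (rule theI')

lemma comp_unique: "decomposition G A a f \<Longrightarrow> comp a = f"
  using direct_sum[of a] comp_decomposition by blast

lemma comp_in: "g \<in> carrier G \<Longrightarrow> comp a g \<in> A g"
  and comp_out: "g \<notin> carrier G \<Longrightarrow> comp a g = 0"
  and comp_finite: "finite {g. comp a g \<noteq> 0}"
  and comp_sum: "a = (\<Sum>g | comp a g \<noteq> 0. comp a g)"
  using comp_decomposition[of a] by (auto simp: decomposition_def)

lemma zero_in: "g \<in> carrier G \<Longrightarrow> 0 \<in> A g"
  using subspace_component cvs.subspace_0 by blast

lemma add_in: "g \<in> carrier G \<Longrightarrow> x \<in> A g \<Longrightarrow> y \<in> A g \<Longrightarrow> x + y \<in> A g"
  using subspace_component cvs.subspace_add by blast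

lemma scale_in: "g \<in> carrier G \<Longrightarrow> x \<in> A g \<Longrightarrow> c *\<^sub>C x \<in> A g"
  using subspace_component cvs.subspace_scale by blast

lemma comp_homogeneous:
  assumes g: "g \<in> carrier G" and a: "a \<in> A g"
  shows "comp a = (\<lambda>k. if k = g then a else 0)"
proof (rule comp_unique)
  show "decomposition G A a (\<lambda>k. if k = g then a else 0)"
  proof (cases "a = 0")
    case True
    then show ?thesis using zero_in by (simp add: decomposition_def)
  next
    case False
    then have "{k. (if k = g then a else 0) \<noteq> 0} = {g}" by auto
    then show ?thesis unfolding decomposition_def using g a zero_in by simp
  qed
qed

lemma comp_add: "comp (a + b) = (\<lambda>k. comp a k + comp b k)"
proof (rule comp_unique)
  let ?S = "{g. comp a g \<noteq> 0} \<union> {g. comp b g \<noteq> 0}"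
  have f: "finite ?S" using comp_finite by auto
  have s: "{g. comp a g + comp b g \<noteq> 0} \<subseteq> ?S" by auto
  have 1: "a = (\<Sum>g\<in>?S. comp a g)"
    by (rule trans[OF comp_sum], rule sum.mono_neutral_left[OF f]) auto
  have 2: "b = (\<Sum>g\<in>?S. comp b g)"
    by (rule trans[OF comp_sum], rule sum.mono_neutral_left[OF f]) auto
  have "a + b = (\<Sum>g\<in>?S. comp a g + comp b g)"
    unfolding sum.distrib 1[symmetric] 2[symmetric] ..
  also have "\<dots> = (\<Sum>g | comp a g + comp b g \<noteq> 0. comp a g + comp b g)"
    using f s by (intro sum.mono_neutral_right) auto
  finally show "decomposition G A (a + b) (\<lambda>k. comp a k + comp b k)"
    using finite_subset[OF s f] by (auto simp: decomposition_def comp_out intro: add_in comp_in)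
qed

lemma comp_zero: "comp 0 = (\<lambda>k. 0)"
  using comp_homogeneous[OF one_closed zero_in[OF one_closed]] by simp

lemma comp_sum_distrib: "comp (\<Sum>i\<in>I. f i) k = (\<Sum>i\<in>I. comp (f i) k)"
  by (induction I rule: infinite_finite_induct) (auto simp: comp_zero comp_add)

lemma graded_induct:
  assumes "P 0" "\<And>x y. P x \<Longrightarrow> P y \<Longrightarrow> P (x + y)" "\<And>g x. g \<in> carrier G \<Longrightarrow> x \<in> A g \<Longrightarrow> P x"
  shows "P a"
proof -
  have "P (\<Sum>g\<in>I. comp a g)" if "I \<subseteq> carrier G" for I
    using that by (induction I rule: infinite_finite_induct) (auto intro: assms comp_in)
  moreover have "{g. comp a g \<noteq> 0} \<subseteq> carrier G" using comp_out by blast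
  ultimately have "P (\<Sum>g | comp a g \<noteq> 0. comp a g)" by blast
  then show ?thesis by (simp only: comp_sum[symmetric])
qed

text \<open>Comparing degrees in \<open>x = 1 x\<close> shows that the component of 1 of trivial degree is a left unit on
  homogeneous elements.\<close>

lemma one_in: "1 \<in> B"
proof -
  let ?e = "comp 1"
  have "?e \<one> * x = x" for x
  proof (induction x rule: graded_induct)
    case (3 h x)
    have "x = (\<Sum>g | ?e g \<noteq> 0. ?e g * x)"
      using comp_sum[of 1] by (metis mult_1_left sum_distrib_right)
    then have "comp x h = (\<Sum>g | ?e g \<noteq> 0. comp (?e g * x) h)"
      using comp_sum_distrib by metis
    also have "\<dots> = (\<Sum>g | ?e g \<noteq> 0. if g = \<one> then ?e \<one> * x else 0)"
    proof (rule sum.cong[OF refl])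
      fix g assume "g \<in> {g. ?e g \<noteq> 0}"
      then have g: "g \<in> carrier G" using comp_out by auto
      have m: "?e g * x \<in> A (g \<otimes> h)" using g 3 by (intro mult_component comp_in)
      have "h = g \<otimes> h \<longleftrightarrow> g = \<one>" using g 3(1) by (rule_tac r_cancel_one')
      then show "comp (?e g * x) h = (if g = \<one> then ?e \<one> * x else 0)"
        using comp_homogeneous[OF m_closed[OF g 3(1)] m] by simp
    qed
    also have "\<dots> = ?e \<one> * x" using comp_finite[of 1] by (auto simp: sum.delta)
    finally show ?case using comp_homogeneous[OF 3] by simp
  qed (auto simp: distrib_left)
  then have "?e \<one> = 1" by (metis mult_1_right)
  then show ?thesis using comp_in[OF one_closed, of 1] by simp
qed

lemma graded_part_carrier: "graded_part A (carrier G) = UNIV"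
proof -
  have "a \<in> graded_part A (carrier G)" for a
    unfolding graded_part_def
    by (induction a rule: graded_induct) (auto intro: cvs.span_zero cvs.span_add cvs.span_base)
  then show ?thesis by auto
qed

lemma component_le_graded_part: "g \<in> K \<Longrightarrow> A g \<subseteq> graded_part A K"
  unfolding graded_part_def by (auto intro: cvs.span_base)

end

locale graded_with_subgroup = graded_star_algebra G A for G (structure) and A :: "'g \<Rightarrow> 'a::star_algebra set" +
  fixes H assumes subgroup_H: "subgroup H G"
begin

lemma H_carrier: "h \<in> H \<Longrightarrow> h \<in> carrier G"
  using subgroup_H subgroup.mem_carrier by metis

abbreviation p where "p \<equiv> part_projection G A H"

lemma p_eq:
  assumes "finite S" "{h. h \<in> H \<and> comp a h \<noteq> 0} \<subseteq> S" "S \<subseteq> H"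
  shows "p a = (\<Sum>h\<in>S. comp a h)"
  unfolding part_projection_def by (rule sum.mono_neutral_left) (use assms in auto)

lemma p_add: "p (a + b) = p a + p b"
proof -
  let ?S = "{h \<in> H. comp a h \<noteq> 0 \<or> comp b h \<noteq> 0}"
  have f: "finite ?S"
    by (rule finite_subset[of _ "{g. comp a g \<noteq> 0} \<union> {g. comp b g \<noteq> 0}"]) (auto simp: comp_finite)
  have "p a = (\<Sum>h\<in>?S. comp a h)" "p b = (\<Sum>h\<in>?S. comp b h)" "p (a + b) = (\<Sum>h\<in>?S. comp (a + b) h)"
    by (rule p_eq[OF f]; auto simp: comp_add)+
  then show ?thesis by (simp add: comp_add sum.distrib)
qed

lemma p_homogeneous:
  assumes "g \<in> carrier G" "a \<in> A g" shows "p a = (if g \<in> H then a else 0)"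
proof (cases "g \<in> H")
  case True
  then have "p a = (\<Sum>h\<in>{g}. comp a h)" by (intro p_eq) (auto simp: comp_homogeneous[OF assms])
  then show ?thesis using True by (simp add: comp_homogeneous[OF assms])
qed (auto simp: part_projection_def comp_homogeneous[OF assms])

lemma p_zero: "p 0 = 0"
  using p_homogeneous[OF one_closed zero_in[OF one_closed]] by simp

lemma p_scale: "p (c *\<^sub>C a) = c *\<^sub>C p a"
  by (induction a rule: graded_induct)
    (auto simp: p_zero p_add scaleC_add_right p_homogeneous scale_in cvs.scale_zero_right)

lemma p_star: "p (star a) = star (p a)"
proof (induction a rule: graded_induct)
  case (3 g x)
  have "inv g \<in> H \<longleftrightarrow> g \<in> H"
    using 3 subgroup_H by (metis inv_inv subgroup.m_inv_closed)
  then show ?case using 3 p_homogeneous[OF inv_closed[OF 3(1)] star_component[OF 3]] by (simp add: p_homogeneous)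
qed (auto simp: p_zero p_add star_add)

text \<open>Right multiplication by an element of degree in \<open>H\<close> does not change membership of a degree in \<open>H\<close>.\<close>

lemma p_mult_right:
  assumes b: "b \<in> graded_part A H" shows "p (a * b) = p a * b"
  using b unfolding graded_part_def
proof (induction b rule: cvs.span_induct_alt)
  case base then show ?case by (simp add: p_zero)
next
  case (step c x y)
  then obtain h where h: "h \<in> H" "x \<in> A h" by auto
  have "p (a * x) = p a * x"
  proof (induction a rule: graded_induct)
    case (3 g u)
    have "g \<otimes> h \<in> H \<longleftrightarrow> g \<in> H"
      using h 3 subgroup_H H_carrier
      by (metis inv_solve_right m_closed subgroup.m_closed subgroup.m_inv_closed)
    then show ?case
      using p_homogeneous[OF m_closed[OF 3(1) H_carrier[OF h(1)]] mult_component[OF 3(1) H_carrier[OF h(1)] 3(2) h(2)]]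
        p_homogeneous[OF 3] by simp
  qed (auto simp: p_zero p_add distrib_right)
  then show ?case using step by (simp add: distrib_left p_add mult_scaleC_right p_scale)
qed

lemma p_in: "p a \<in> graded_part A H"
proof (induction a rule: graded_induct)
  case (3 g x) then show ?case
    using component_le_graded_part[of g H] by (auto simp: p_homogeneous graded_part_def intro: cvs.span_zero)
qed (auto simp: p_zero p_add graded_part_def intro: cvs.span_zero cvs.span_add)

end

section \<open>The partial action on characters\<close>

locale partial_action = graded_star_algebra G A for G (structure) and A :: "'g \<Rightarrow> 'a::star_algebra set" +
  assumes commutative: "\<And>a b. a \<in> A \<one> \<Longrightarrow> b \<in> A \<one> \<Longrightarrow> a * b = b * a"
    and character_condition: "\<And>\<xi> g c d. \<xi> \<in> positive_characters G A \<Longrightarrow> g \<in> carrier G \<Longrightarrow> c \<in> A g \<Longrightarrow> d \<in> A g \<Longrightarrow>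
         \<xi> (star c * d) * \<xi> (star d * c) = \<xi> (star c * c) * \<xi> (star d * d)"
begin

abbreviation X where "X \<equiv> positive_characters G A"
abbreviation Dom where "Dom g \<equiv> action_domain G A g"
abbreviation act where "act g \<xi> \<equiv> act_character G A g \<xi>"

lemma mem_e:
  assumes g: "g \<in> carrier G"
  shows "a \<in> A g \<Longrightarrow> c \<in> A g \<Longrightarrow> star a * c \<in> B"
    "a \<in> A g \<Longrightarrow> c \<in> A g \<Longrightarrow> a * star c \<in> B"
    "b \<in> B \<Longrightarrow> a \<in> A g \<Longrightarrow> b * a \<in> A g"
    "a \<in> A g \<Longrightarrow> b \<in> B \<Longrightarrow> a * b \<in> A g"
  using g mult_component[of "inv g" g "star a" c] mult_component[of g "inv g" a "star c"]
    mult_component[of \<one> g b a] mult_component[of g \<one> a b] star_component[of g] by auto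

lemma X_char:
  assumes "\<xi> \<in> X"
  shows "x \<in> B \<Longrightarrow> y \<in> B \<Longrightarrow> \<xi> (x + y) = \<xi> x + \<xi> y"
    "x \<in> B \<Longrightarrow> y \<in> B \<Longrightarrow> \<xi> (x * y) = \<xi> x * \<xi> y"
    "x \<in> B \<Longrightarrow> \<xi> (c *\<^sub>C x) = c * \<xi> x"
    "x \<in> B \<Longrightarrow> \<xi> (star x) = cnj (\<xi> x)"
    "\<xi> \<in> extensional B"
  using assms by (auto simp: positive_characters_def star_characters_def)

lemma X_one: "\<xi> \<in> X \<Longrightarrow> \<xi> 1 = 1"
proof -
  assume x: "\<xi> \<in> X"
  then obtain b where "b \<in> B" "\<xi> b \<noteq> 0" by (auto simp: positive_characters_def star_characters_def)
  then show ?thesis using X_char(2)[OF x, of 1 b] one_in by simp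
qed

lemma X_square:
  assumes x: "\<xi> \<in> X" and g: "g \<in> carrier G" and a: "a \<in> A g"
  shows "\<xi> (star a * a) \<in> \<real>\<^sub>\<ge>\<^sub>0"
proof -
  have "star a * a \<in> sums_of_squares"
    unfolding sums_of_squares_def by (rule CollectI, rule exI[of _ 1], rule exI[of _ "\<lambda>_. a"]) simp
  then show ?thesis using x mem_e(1)[OF g a a] by (auto simp: positive_characters_def)
qed

lemma Dom_X: "\<xi> \<in> Dom g \<Longrightarrow> \<xi> \<in> X"
  by (simp add: action_domain_def)

lemma DomI: "\<xi> \<in> X \<Longrightarrow> a \<in> A g \<Longrightarrow> \<xi> (star a * a) \<noteq> 0 \<Longrightarrow> \<xi> \<in> Dom g"
  by (auto simp: action_domain_def)

text \<open>Elements of trivial degree commute with \<open>aa\<^sup>*\<close> and \<open>dd\<^sup>*\<close>. Moving \<open>b\<close> past them gives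
  \<open>\<xi>(a\<^sup>*ba) \<xi>(a\<^sup>*d) = \<xi>(a\<^sup>*a) \<xi>(a\<^sup>*bd)\<close> and \<open>\<xi>(a\<^sup>*bd) \<xi>(d\<^sup>*d) = \<xi>(a\<^sup>*d) \<xi>(d\<^sup>*bd)\<close>. The factor \<open>\<xi>(a\<^sup>*d)\<close> can
  be cancelled because the character condition makes it nonzero.\<close>

lemma conj_independent:
  assumes x: "\<xi> \<in> X" and g: "g \<in> carrier G" and a: "a \<in> A g" and d: "d \<in> A g" and b: "b \<in> B"
    and nz: "\<xi> (star a * a) \<noteq> 0" "\<xi> (star d * d) \<noteq> 0"
  shows "\<xi> (star a * b * a) / \<xi> (star a * a) = \<xi> (star d * b * d) / \<xi> (star d * d)"
proof -
  note m = mem_e[OF g]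
  have ad: "\<xi> (star a * d) \<noteq> 0" using character_condition[OF x g a d] nz by auto
  have "b * (a * star a) = (a * star a) * b" using b m(2)[OF a a] by (rule commutative)
  then have "star a * (b * (a * star a)) * d = star a * ((a * star a) * b) * d" by (simp only:)
  then have "(star a * (b * a)) * (star a * d) = (star a * a) * (star a * (b * d))"
    by (simp only: mult.assoc)
  then have 1: "\<xi> (star a * (b * a)) * \<xi> (star a * d) = \<xi> (star a * a) * \<xi> (star a * (b * d))"
    using X_char(2)[OF x m(1)[OF a m(3)[OF b a]] m(1)[OF a d]] X_char(2)[OF x m(1)[OF a a] m(1)[OF a m(3)[OF b d]]]
    by simp
  have "b * (d * star d) = (d * star d) * b" using b m(2)[OF d d] by (rule commutative)
  then have "star a * (b * (d * star d)) * d = star a * ((d * star d) * b) * d" by (simp only:)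
  then have "(star a * (b * d)) * (star d * d) = (star a * d) * (star d * (b * d))"
    by (simp only: mult.assoc)
  then have 2: "\<xi> (star a * (b * d)) * \<xi> (star d * d) = \<xi> (star a * d) * \<xi> (star d * (b * d))"
    using X_char(2)[OF x m(1)[OF a m(3)[OF b d]] m(1)[OF d d]] X_char(2)[OF x m(1)[OF a d] m(1)[OF d m(3)[OF b d]]]
    by simp
  have "\<xi> (star a * (b * a)) * \<xi> (star d * d) * \<xi> (star a * d) = \<xi> (star a * a) * \<xi> (star d * (b * d)) * \<xi> (star a * d)"
  proof -
    have "(x * m) * u = (n * y) * u" if "x * u = n * w" "w * m = u * y" for x m u n y w :: complex
    proof -
      have "(x * m) * u = (x * u) * m" by (simp only: ac_simps)
      also have "\<dots> = (n * w) * m" by (simp only: that(1))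
      also have "\<dots> = n * (w * m)" by (simp only: mult.assoc)
      also have "\<dots> = n * (u * y)" by (simp only: that(2))
      also have "\<dots> = (n * y) * u" by (simp only: ac_simps)
      finally show ?thesis .
    qed
    then show ?thesis using 1 2 .
  qed
  then have "\<xi> (star a * (b * a)) * \<xi> (star d * d) = \<xi> (star a * a) * \<xi> (star d * (b * d))"
    using ad by simp
  then show ?thesis using nz by (simp add: field_simps mult.assoc)
qed

lemma act_eq:
  assumes x: "\<xi> \<in> X" and g: "g \<in> carrier G" and a: "a \<in> A g" and nz: "\<xi> (star a * a) \<noteq> 0"
  shows "act g \<xi> = (\<lambda>b\<in>B. \<xi> (star a * b * a) / \<xi> (star a * a))"
proof -
  define d where "d = (SOME a. a \<in> A g \<and> \<xi> (star a * a) \<noteq> 0)"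
  have d: "d \<in> A g \<and> \<xi> (star d * d) \<noteq> 0" unfolding d_def by (rule someI[of _ a]) (use a nz in simp)
  have "act g \<xi> = (\<lambda>b\<in>B. \<xi> (star d * b * d) / \<xi> (star d * d))"
    by (simp add: act_character_def Let_def flip: d_def)
  also have "\<dots> = (\<lambda>b\<in>B. \<xi> (star a * b * a) / \<xi> (star a * a))"
    using conj_independent[OF x g _ a _ _ nz] d by (intro restrict_ext) auto
  finally show ?thesis .
qed

text \<open>The formula that defines the action also holds for \<open>\<xi>(a\<^sup>*a) = 0\<close>: the character condition for
  \<open>a\<close> and \<open>ba\<close> shows that the left-hand side vanishes as well.\<close>

lemma conj_formula:
  assumes x: "\<xi> \<in> Dom g" and g: "g \<in> carrier G" and a: "a \<in> A g" and b: "b \<in> B"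
  shows "\<xi> (star a * (b * a)) = \<xi> (star a * a) * act g \<xi> b"
proof (cases "\<xi> (star a * a) = 0")
  case True
  note X = Dom_X[OF x]
  have "star (star a * (b * a)) = star (b * a) * a" by (simp add: star_mult star_star)
  then have "\<xi> (star (b * a) * a) = cnj (\<xi> (star a * (b * a)))"
    using X_char(4)[OF X mem_e(1)[OF g a mem_e(3)[OF g b a]]] by simp
  then have "\<xi> (star a * (b * a)) * cnj (\<xi> (star a * (b * a))) = 0"
    using character_condition[OF X g a mem_e(3)[OF g b a]] True by simp
  then show ?thesis using True by simp
next
  case False
  then show ?thesis using act_eq[OF Dom_X[OF x] g a False] b by (simp add: mult.assoc)
qed

lemma act_in_X:
  assumes x: "\<xi> \<in> Dom g" and g: "g \<in> carrier G"
  shows "act g \<xi> \<in> X"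
proof -
  note X = Dom_X[OF x] and m = mem_e[OF g]
  obtain a where a: "a \<in> A g" and nz: "\<xi> (star a * a) \<noteq> 0" using x by (auto simp: action_domain_def)
  let ?N = "\<xi> (star a * a)"
  have val: "act g \<xi> b = \<xi> (star a * (b * a)) / ?N" if "b \<in> B" for b
    using act_eq[OF X g a nz] that by (simp add: mult.assoc)
  have aba: "star a * (b * a) \<in> B" if "b \<in> B" for b using m a that by blast
  note Bcl = add_in[OF one_closed] scale_in[OF one_closed] mem_e(3)[OF one_closed]
  have Bstar: "star b \<in> B" if "b \<in> B" for b using star_component[OF one_closed that] by simp
  have "act g \<xi> \<in> star_characters B"
    unfolding star_characters_def
  proof (intro CollectI conjI ballI allI)
    show "act g \<xi> \<in> extensional B" using act_eq[OF X g a nz] by simp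
    fix u v assume uv: "u \<in> B" "v \<in> B"
    show "act g \<xi> (u + v) = act g \<xi> u + act g \<xi> v"
      using uv aba Bcl X_char(1)[OF X]
      by (simp add: val distrib_left distrib_right add_divide_distrib)
    have "star a * (u * (a * star a)) * (v * a) = star a * ((a * star a) * u) * (v * a)"
      using commutative[OF uv(1) m(2)[OF a a]] by (simp only:)
    then have "(star a * (u * a)) * (star a * (v * a)) = (star a * a) * (star a * (u * v * a))"
      by (simp only: mult.assoc)
    then have "\<xi> (star a * (u * a)) * \<xi> (star a * (v * a)) = ?N * \<xi> (star a * (u * v * a))"
      using X_char(2)[OF X aba[OF uv(1)] aba[OF uv(2)]] X_char(2)[OF X m(1)[OF a a] aba[OF Bcl(3)[OF uv]]]
      by simp
    then show "act g \<xi> (u * v) = act g \<xi> u * act g \<xi> v"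
      using nz uv Bcl by (simp add: val field_simps)
  next
    fix c u assume u: "u \<in> B"
    show "act g \<xi> (c *\<^sub>C u) = c * act g \<xi> u"
      using u aba Bcl X_char(3)[OF X] by (simp add: val mult_scaleC_left mult_scaleC_right)
  next
    fix u assume u: "u \<in> B"
    have "star (star a * (u * a)) = star a * (star u * a)" by (simp add: star_mult star_star mult.assoc)
    then have "\<xi> (star a * (star u * a)) = cnj (\<xi> (star a * (u * a)))"
      using X_char(4)[OF X aba[OF u]] by simp
    moreover have "cnj ?N = ?N" using X_square[OF X g a] by (auto elim!: nonneg_Reals_cases)
    ultimately show "act g \<xi> (star u) = cnj (act g \<xi> u)"
      using u Bstar by (simp add: val)
  next
    show "\<exists>u\<in>B. act g \<xi> u \<noteq> 0"
      using nz val[OF one_in] by (intro bexI[of _ 1] one_in) simp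
  qed
  moreover have "act g \<xi> u \<in> \<real>\<^sub>\<ge>\<^sub>0" if u: "u \<in> sums_of_squares \<inter> B" for u
  proof -
    obtain n :: nat and f :: "nat \<Rightarrow> 'a" where f: "u = (\<Sum>i<n. star (f i) * f i)" using u by (auto simp: sums_of_squares_def)
    have "star a * (u * a) = (\<Sum>i<n. star (f i * a) * (f i * a))"
      by (simp add: f sum_distrib_left sum_distrib_right star_mult mult.assoc)
    then have "star a * (u * a) \<in> sums_of_squares" by (auto simp: sums_of_squares_def)
    then have "\<xi> (star a * (u * a)) \<in> \<real>\<^sub>\<ge>\<^sub>0" using X u aba by (auto simp: positive_characters_def)
    then show ?thesis using X_square[OF X g a] u by (simp add: val nonneg_Reals_divide_I)
  qed
  ultimately show ?thesis by (auto simp: positive_characters_def)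
qed

lemma act_inverse:
  assumes x: "\<xi> \<in> Dom g" and g: "g \<in> carrier G"
  shows "act g \<xi> \<in> Dom (inv g)" "act (inv g) (act g \<xi>) = \<xi>"
proof -
  note X = Dom_X[OF x] and m = mem_e[OF g]
  obtain a where a: "a \<in> A g" and nz: "\<xi> (star a * a) \<noteq> 0" using x by (auto simp: action_domain_def)
  have sa: "star a \<in> A (inv g)" by (rule star_component[OF g a])
  have val: "act g \<xi> (a * b * star a) = \<xi> (star a * a) * \<xi> b" if b: "b \<in> B" for b
  proof -
    have "a * b * star a \<in> B" using m(2)[OF m(4)[OF a b] a] .
    then have "act g \<xi> (a * b * star a) = \<xi> ((star a * a) * b * (star a * a)) / \<xi> (star a * a)"
      using act_eq[OF X g a nz] by (simp add: mult.assoc)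
    also have "\<xi> ((star a * a) * b * (star a * a)) = \<xi> (star a * a) * \<xi> b * \<xi> (star a * a)"
      using X_char(2)[OF X] m(1)[OF a a] b mem_e(3)[OF one_closed] by simp
    finally show ?thesis using nz by simp
  qed
  have 1: "act g \<xi> (star (star a) * star a) = \<xi> (star a * a)"
    using val[OF one_in] X_one[OF X] by (simp add: star_star)
  show "act g \<xi> \<in> Dom (inv g)"
    using 1 nz by (intro DomI[OF act_in_X[OF x g] sa]) simp
  have "act (inv g) (act g \<xi>) = (\<lambda>b\<in>B. act g \<xi> (star (star a) * b * star a) / act g \<xi> (star (star a) * star a))"
    using 1 nz g by (intro act_eq[OF act_in_X[OF x g] _ sa]) auto
  also have "\<dots> = (\<lambda>b\<in>B. \<xi> b)"
    using 1 val nz by (intro restrict_ext) (simp add: star_star)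
  also have "\<dots> = \<xi>" using X_char(5)[OF X] by (simp add: extensional_restrict)
  finally show "act (inv g) (act g \<xi>) = \<xi>" .
qed

lemma act_compose:
  assumes x: "\<xi> \<in> Dom h" "act h \<xi> \<in> Dom g" and g: "g \<in> carrier G" and h: "h \<in> carrier G"
  shows "\<xi> \<in> Dom (g \<otimes> h)" "act (g \<otimes> h) \<xi> = act g (act h \<xi>)"
proof -
  note X = Dom_X[OF x(1)]
  obtain a where a: "a \<in> A h" and nza: "\<xi> (star a * a) \<noteq> 0" using x by (auto simp: action_domain_def)
  obtain c where c: "c \<in> A g" and nzc: "act h \<xi> (star c * c) \<noteq> 0" using x by (auto simp: action_domain_def)
  have ca: "c * a \<in> A (g \<otimes> h)" by (rule mult_component[OF g h c a])
  have f: "\<xi> (star (c * a) * b * (c * a)) = \<xi> (star a * a) * act h \<xi> (star c * b * c)" if "b \<in> B" for b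
    using conj_formula[OF x(1) h a mem_e(1)[OF g c mem_e(3)[OF g that c]]] by (simp add: star_mult mult.assoc)
  have f1: "\<xi> (star (c * a) * (c * a)) = \<xi> (star a * a) * act h \<xi> (star c * c)"
    using f[OF one_in] by simp
  show "\<xi> \<in> Dom (g \<otimes> h)" using f1 nza nzc by (intro DomI[OF X ca]) simp
  have "act (g \<otimes> h) \<xi> = (\<lambda>b\<in>B. \<xi> (star (c * a) * b * (c * a)) / \<xi> (star (c * a) * (c * a)))"
    using f1 nza nzc g h by (intro act_eq[OF X _ ca]) auto
  also have "\<dots> = (\<lambda>b\<in>B. act h \<xi> (star c * b * c) / act h \<xi> (star c * c))"
    using nza by (intro restrict_ext) (simp add: f f1)
  also have "\<dots> = act g (act h \<xi>)"
    using act_eq[OF act_in_X[OF x(1) h] g c nzc] by simp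
  finally show "act (g \<otimes> h) \<xi> = act g (act h \<xi>)" .
qed

text \<open>If \<open>\<xi>\<close> does not vanish on the square of a product \<open>ac\<close>, then it lies in the domain of the degree of \<open>c\<close>
  and is moved by it into the domain of the degree of \<open>a\<close>. The first assertion uses the character
  condition for \<open>c\<close> and \<open>a\<^sup>*ac\<close>.\<close>

lemma act_product:
  assumes x: "\<xi> \<in> X" and g: "g \<in> carrier G" and k: "k \<in> carrier G" and a: "a \<in> A g" and c: "c \<in> A k"
    and nz: "\<xi> (star (a * c) * (a * c)) \<noteq> 0"
  shows "\<xi> \<in> Dom k" "act k \<xi> \<in> Dom g" "\<xi> \<in> Dom (g \<otimes> k)" "act (g \<otimes> k) \<xi> = act g (act k \<xi>)"
proof -
  let ?d = "(star a * a) * c"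
  note b = mem_e(1)[OF g a a]
  have e: "star (a * c) * (a * c) = star c * ?d" "star ?d * c = star c * ?d"
    by (simp_all add: star_mult star_star mult.assoc)
  have nz': "\<xi> (star c * ?d) \<noteq> 0" using nz e by simp
  have "\<xi> (star c * c) \<noteq> 0"
    using character_condition[OF x k c mem_e(3)[OF k b c]] nz' e(2) by auto
  then show 1: "\<xi> \<in> Dom k" using DomI[OF x c] by simp
  have "act k \<xi> (star a * a) \<noteq> 0" using conj_formula[OF 1 k c b] nz' by auto
  then show 2: "act k \<xi> \<in> Dom g" using DomI[OF act_in_X[OF 1 k] a] by simp
  show "\<xi> \<in> Dom (g \<otimes> k)" "act (g \<otimes> k) \<xi> = act g (act k \<xi>)" by (rule act_compose[OF 1 2 g k])+
qed

text \<open>As the action of \<open>g\<close> inverts that of its inverse, images under the action are preimages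
  (\<open>act_set_eq_pull\<close>), which behave better with respect to set operations and measurability.\<close>

definition pull :: "'g \<Rightarrow> ('a \<Rightarrow> complex) set \<Rightarrow> ('a \<Rightarrow> complex) set" where
  "pull g \<Delta> = {\<xi> \<in> Dom g. act g \<xi> \<in> \<Delta>}"

lemma act_set_eq_pull:
  assumes g: "g \<in> carrier G"
  shows "act_set G A g \<Delta> = pull (inv g) \<Delta>"
proof (intro equalityI subsetI)
  fix \<xi> assume "\<xi> \<in> act_set G A g \<Delta>"
  then obtain \<eta> where "\<eta> \<in> \<Delta>" "\<eta> \<in> Dom g" "\<xi> = act g \<eta>" by (auto simp: act_set_def)
  then show "\<xi> \<in> pull (inv g) \<Delta>" using act_inverse[OF _ g] by (auto simp: pull_def)
next
  fix \<xi> assume "\<xi> \<in> pull (inv g) \<Delta>"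
  then have "\<xi> \<in> Dom (inv g)" "act (inv g) \<xi> \<in> \<Delta>" by (auto simp: pull_def)
  with act_inverse[OF this(1)] g show "\<xi> \<in> act_set G A g \<Delta>"
    unfolding act_set_def by (intro image_eqI[of _ _ "act (inv g) \<xi>"]) auto
qed

lemma pull_simps:
  "pull g (\<Delta> \<union> \<Delta>') = pull g \<Delta> \<union> pull g \<Delta>'" "pull g \<Delta> \<inter> pull g \<Delta>' = pull g (\<Delta> \<inter> \<Delta>')"
  "pull g {} = {}" "pull g (\<Union>i\<in>I. F i) = (\<Union>i\<in>I. pull g (F i))"
  by (auto simp: pull_def)

lemma pull_X: "g \<in> carrier G \<Longrightarrow> pull g X = Dom g"
  using act_in_X by (auto simp: pull_def)

lemma pull_one: "\<Delta> \<subseteq> X \<Longrightarrow> pull \<one> \<Delta> = \<Delta>"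
proof -
  assume D: "\<Delta> \<subseteq> X"
  have "\<xi> \<in> Dom \<one> \<and> act \<one> \<xi> = \<xi>" if x: "\<xi> \<in> X" for \<xi>
  proof -
    have nz: "\<xi> (star 1 * 1) \<noteq> 0" using X_one[OF x] by simp
    have "act \<one> \<xi> = (\<lambda>b\<in>B. \<xi> b)"
      using act_eq[OF x one_closed one_in nz] X_one[OF x] by simp
    then show ?thesis using DomI[OF x one_in nz] X_char(5)[OF x] by (simp add: extensional_restrict)
  qed
  then show ?thesis using D Dom_X by (auto simp: pull_def)
qed

text \<open>The covariance relation for the left multiplication by \<open>a\<close>, on the characters that matter for the
  vectors \<open>t (a * c) v\<close>.\<close>

lemma pull_left_mult:
  assumes x: "\<xi> \<in> X" and g: "g \<in> carrier G" and k: "k \<in> carrier G" and a: "a \<in> A g" and c: "c \<in> A k"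
    and nz: "\<xi> (star (a * c) * (a * c)) \<noteq> 0"
  shows "\<xi> \<in> pull (g \<otimes> k) (act_set G A g \<Delta>) \<longleftrightarrow> \<xi> \<in> pull k \<Delta>"
  using act_product[OF assms] act_inverse[OF act_product(2)[OF assms] g]
  unfolding act_set_eq_pull[OF g] pull_def by auto

text \<open>The symmetry of the prescribed projections, on the characters that matter for \<open>\<rho>(b\<^sup>*a)\<close>.\<close>

lemma pull_star_mult:
  assumes x: "\<xi> \<in> X" and g: "g \<in> carrier G" and g': "g' \<in> carrier G" and a: "a \<in> A g" and b: "b \<in> A g'"
    and nz: "\<xi> (star (star b * a) * (star b * a)) \<noteq> 0"
  shows "\<xi> \<in> pull (inv g' \<otimes> g) (pull g' \<Delta>) \<longleftrightarrow> \<xi> \<in> pull g \<Delta>"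
proof -
  note P = act_product[OF x inv_closed[OF g'] g star_component[OF g' b] a nz]
  note I = act_inverse[OF P(2) inv_closed[OF g']]
  show ?thesis using P I g' unfolding pull_def by auto
qed

abbreviation T where "T \<equiv> character_topology G A"
abbreviation M where "M \<equiv> borel_of T"

lemma topspace_T [simp]: "topspace T = X"
proof -
  have "X \<in> {{\<xi> \<in> X. \<xi> b \<in> U} | b U. b \<in> B \<and> open U}"
    using zero_in[OF one_closed] by (auto intro!: exI[of _ 0] exI[of _ UNIV])
  then show ?thesis unfolding character_topology_def topology_generated_by_topspace by blast
qed

lemma space_M [simp]: "space M = X"
  by (simp add: borel_of_def space_measure_of_conv)

lemma opens_sub: "{U. openin T U} \<subseteq> Pow X"
  using openin_subset[of T] by auto

lemma sets_M: "sets M = sigma_sets X {U. openin T U}"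
  unfolding borel_of_def topspace_T by (rule sets_measure_of[OF opens_sub])

lemma open_sets_M: "openin T U \<Longrightarrow> U \<in> sets M"
  unfolding sets_M by (rule sigma_sets.Basic) simp

lemma sets_M_sub: "\<Delta> \<in> sets M \<Longrightarrow> \<Delta> \<subseteq> X"
  using sets.sets_into_space by force

lemma open_preimage: "b \<in> B \<Longrightarrow> open U \<Longrightarrow> openin T {\<xi> \<in> X. \<xi> b \<in> U}"
  unfolding character_topology_def by (rule topology_generated_by_Basis) blast

lemma continuous_eval: "b \<in> B \<Longrightarrow> continuous_map T euclidean (\<lambda>\<xi>. \<xi> b)"
  using open_preimage by (auto simp: continuous_map_def)

lemma measurable_eval: "b \<in> B \<Longrightarrow> (\<lambda>\<xi>. \<xi> b) \<in> borel_measurable M"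
proof (rule borel_measurableI)
  fix S :: "complex set" assume "b \<in> B" "open S"
  moreover have "(\<lambda>\<xi>. \<xi> b) -` S \<inter> space M = {\<xi> \<in> X. \<xi> b \<in> S}" by auto
  ultimately show "(\<lambda>\<xi>. \<xi> b) -` S \<inter> space M \<in> sets M"
    by (simp only: open_sets_M[OF open_preimage])
qed

lemma open_quotient:
  assumes "b \<in> B" "c \<in> B" "open U"
  shows "openin T {\<xi> \<in> X. \<xi> c \<noteq> 0 \<and> \<xi> b / \<xi> c \<in> U}"
proof -
  let ?W = "{z :: complex \<times> complex. snd z \<noteq> 0 \<and> fst z / snd z \<in> U}"
  have o: "open {z :: complex \<times> complex. snd z \<noteq> 0}"
    by (intro open_Collect_neq continuous_intros)
  have "continuous_on {z :: complex \<times> complex. snd z \<noteq> 0} (\<lambda>z. fst z / snd z)"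
    by (intro continuous_intros) auto
  from continuous_open_preimage[OF this o assms(3)] have "open ?W"
    by (simp add: vimage_def Int_def)
  moreover have "continuous_map T (prod_topology euclidean euclidean) (\<lambda>\<xi>. (\<xi> b, \<xi> c))"
    using assms continuous_eval by (intro continuous_map_pairedI) auto
  ultimately have "openin T {\<xi> \<in> topspace T. (\<xi> b, \<xi> c) \<in> ?W}"
    by (intro openin_continuous_map_preimage[of T euclidean]) auto
  then show ?thesis by simp
qed

lemma Dom_open: "g \<in> carrier G \<Longrightarrow> openin T (Dom g)"
proof -
  assume g: "g \<in> carrier G"
  have "Dom g = (\<Union>a\<in>A g. {\<xi> \<in> X. \<xi> (star a * a) \<in> - {0}})"
    by (auto simp: action_domain_def)
  moreover have "openin T {\<xi> \<in> X. \<xi> (star a * a) \<in> - {0}}" if "a \<in> A g" for a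
    using that g by (intro open_preimage mem_e(1)) auto
  ultimately show ?thesis by (auto simp only: intro!: openin_Union)
qed

text \<open>The action is continuous: near a given character it is computed with one fixed element \<open>a\<close>.\<close>

lemma pull_open:
  assumes g: "g \<in> carrier G" and U: "openin T U"
  shows "openin T (pull g U)"
proof -
  let ?S = "{{\<xi> \<in> X. \<xi> b \<in> U} | b U. b \<in> B \<and> open U}"
  have "generate_topology_on ?S U"
    using U unfolding character_topology_def openin_topology_generated_by_iff .
  then show ?thesis
  proof (induction rule: generate_topology_on.induct)
    case Empty then show ?case by (simp add: pull_simps)
  next
    case (Int a b) then show ?case by (simp flip: pull_simps(2) add: openin_Int)
  next
    case (UN K)
    have "pull g (\<Union> K) = (\<Union>k\<in>K. pull g k)" by (auto simp: pull_def)
    then show ?case using UN by (auto intro!: openin_clauses(3))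
  next
    case (Basis s)
    then obtain b U where s: "s = {\<xi> \<in> X. \<xi> b \<in> U}" "b \<in> B" "open U" by auto
    have "pull g s = (\<Union>a\<in>A g. {\<xi> \<in> X. \<xi> (star a * a) \<noteq> 0 \<and> \<xi> (star a * b * a) / \<xi> (star a * a) \<in> U})"
    proof (intro equalityI subsetI)
      fix \<xi> assume "\<xi> \<in> pull g s"
      then have x: "\<xi> \<in> Dom g" "act g \<xi> b \<in> U" by (auto simp: pull_def s)
      then obtain a where a: "a \<in> A g" "\<xi> (star a * a) \<noteq> 0" by (auto simp: action_domain_def)
      then show "\<xi> \<in> (\<Union>a\<in>A g. {\<xi> \<in> X. \<xi> (star a * a) \<noteq> 0 \<and> \<xi> (star a * b * a) / \<xi> (star a * a) \<in> U})"
        using x act_eq[OF Dom_X[OF x(1)] g a] s Dom_X[OF x(1)] by auto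
    next
      fix \<xi> assume "\<xi> \<in> (\<Union>a\<in>A g. {\<xi> \<in> X. \<xi> (star a * a) \<noteq> 0 \<and> \<xi> (star a * b * a) / \<xi> (star a * a) \<in> U})"
      then obtain a where a: "a \<in> A g" "\<xi> \<in> X" "\<xi> (star a * a) \<noteq> 0" "\<xi> (star a * b * a) / \<xi> (star a * a) \<in> U" by auto
      then have d: "\<xi> \<in> Dom g" by (auto intro: DomI)
      then show "\<xi> \<in> pull g s"
        using act_eq[OF a(2) g a(1,3)] act_in_X[OF d g] a s by (simp add: pull_def)
    qed
    moreover have "openin T {\<xi> \<in> X. \<xi> (star a * a) \<noteq> 0 \<and> \<xi> (star a * b * a) / \<xi> (star a * a) \<in> U}" if "a \<in> A g" for a
      using that s mem_e[OF g] by (intro open_quotient) (auto simp: mult.assoc)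
    ultimately show ?case by (auto intro!: openin_clauses(3))
  qed
qed

lemma pull_sets:
  assumes g: "g \<in> carrier G" and D: "\<Delta> \<in> sets M"
  shows "pull g \<Delta> \<in> sets M"
proof -
  have "\<Delta> \<in> sigma_sets X {U. openin T U}" using D sets_M by simp
  then show ?thesis
  proof (induction rule: sigma_sets.induct)
    case (Basic U) then show ?case using pull_open[OF g] open_sets_M by simp
  next
    case Empty then show ?case by (simp add: pull_simps)
  next
    case (Compl U)
    have "pull g (X - U) = Dom g - pull g U" using pull_X[OF g] by (auto simp: pull_def)
    then show ?case using Compl open_sets_M[OF Dom_open[OF g]] by auto
  next
    case (Union F)
    then show ?case by (auto simp: pull_simps(4))
  qed
qed

end

section \<open>The induced *-representation on the tensor product\<close>

lemma sum_singles: "(\<Sum>k\<in>Poly_Mapping.keys p. Poly_Mapping.single k (Poly_Mapping.lookup p k)) = p"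
  by (rule poly_mapping_eqI) (simp add: lookup_sum lookup_single when_def in_keys_iff)

locale inducible_representation = graded_with_subgroup G A H
  for G (structure) and A :: "'g \<Rightarrow> 'a::star_algebra set" and H +
  fixes \<rho> :: "('a, 'v) rep"
  assumes rho: "star_representation (graded_part A H) \<rho>"
    and inducible: "inducible G A H \<rho>"
begin

sublocale R: star_representation "graded_part A H" \<rho> by (rule rho)
sublocale K: hilbert_space "rep_space \<rho>" by (rule R.hilbert)

abbreviation D where "D \<equiv> rep_dom \<rho>"
abbreviation F where "F \<equiv> free_space G A H \<rho>"
abbreviation N where "N \<equiv> tensor_relations G A H \<rho>"

lemma D_in: "v \<in> D \<Longrightarrow> v \<in> carrier (rep_space \<rho>)"
  using K.submodule_closed(1)[OF R.subspace_dom] .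

lemmas D_closed = K.submodule_closed(2-)[OF R.subspace_dom]

text \<open>The form \<open>\<langle>a \<otimes> v, b \<otimes> w\<rangle> = \<langle>\<rho>(p(b\<^sup>*a)) v, w\<rangle>\<close> on pairs.\<close>

definition \<beta> :: "'a \<times> 'v \<Rightarrow> 'a \<times> 'v \<Rightarrow> complex" where
  "\<beta> k l = ip (rep_space \<rho>) (rep_op \<rho> (p (star (fst l) * fst k)) (snd k)) (snd l)"

lemma F_carrier: "x \<in> carrier F \<longleftrightarrow> Poly_Mapping.keys x \<subseteq> UNIV \<times> D"
  by (simp add: free_space_def)

lemma F_ops [simp]: "x \<oplus>\<^bsub>F\<^esub> y = x + y" "\<zero>\<^bsub>F\<^esub> = 0"
  by (simp_all add: free_space_def)

lemma lookup_smult: "Poly_Mapping.lookup (c \<odot>\<^bsub>F\<^esub> x) k = c * Poly_Mapping.lookup x k"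
  by (simp add: free_space_def Poly_Mapping.map.rep_eq when_def)

lemma keys_smult: "Poly_Mapping.keys (c \<odot>\<^bsub>F\<^esub> x) \<subseteq> Poly_Mapping.keys x"
  by (auto simp: in_keys_iff lookup_smult)

lemma F_add_in: "x \<in> carrier F \<Longrightarrow> y \<in> carrier F \<Longrightarrow> x + y \<in> carrier F"
  unfolding F_carrier using Poly_Mapping.keys_add[of x y] by blast

lemma F_minus_in: "x \<in> carrier F \<Longrightarrow> - x \<in> carrier F"
  by (simp add: F_carrier)

lemma F_diff_in: "x \<in> carrier F \<Longrightarrow> y \<in> carrier F \<Longrightarrow> x - y \<in> carrier F"
  using F_add_in[of x "- y"] F_minus_in by simp

lemma F_zero_in [simp]: "0 \<in> carrier F"
  by (simp add: F_carrier)

lemma F_single_in: "v \<in> D \<Longrightarrow> Poly_Mapping.single (a, v) c \<in> carrier F"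
  by (simp add: F_carrier)

lemma F_sum_in: "(\<And>i. i \<in> I \<Longrightarrow> f i \<in> carrier F) \<Longrightarrow> (\<Sum>i\<in>I. f i) \<in> carrier F"
  by (induction I rule: infinite_finite_induct) (auto intro: F_add_in)

lemma F_smult_in: "x \<in> carrier F \<Longrightarrow> c \<odot>\<^bsub>F\<^esub> x \<in> carrier F"
  unfolding F_carrier using keys_smult[of c x] by blast

lemma ip_F:
  assumes "finite S" "Poly_Mapping.keys x \<subseteq> S" "finite S'" "Poly_Mapping.keys y \<subseteq> S'"
  shows "ip F x y = (\<Sum>k\<in>S. \<Sum>l\<in>S'. Poly_Mapping.lookup x k * cnj (Poly_Mapping.lookup y l) * \<beta> k l)"
proof -
  have "ip F x y = (\<Sum>k\<in>Poly_Mapping.keys x. \<Sum>l\<in>Poly_Mapping.keys y.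
      Poly_Mapping.lookup x k * cnj (Poly_Mapping.lookup y l) * \<beta> k l)"
    by (simp add: free_space_def \<beta>_def case_prod_beta)
  also have "\<dots> = (\<Sum>k\<in>Poly_Mapping.keys x. \<Sum>l\<in>S'. Poly_Mapping.lookup x k * cnj (Poly_Mapping.lookup y l) * \<beta> k l)"
    by (intro sum.cong refl sum.mono_neutral_left assms) (auto simp: in_keys_iff)
  also have "\<dots> = (\<Sum>k\<in>S. \<Sum>l\<in>S'. Poly_Mapping.lookup x k * cnj (Poly_Mapping.lookup y l) * \<beta> k l)"
    by (intro sum.mono_neutral_left assms) (auto simp: in_keys_iff)
  finally show ?thesis .
qed

lemma p_op_in: "v \<in> D \<Longrightarrow> rep_op \<rho> (p x) v \<in> D"
  using R.op_closed[OF p_in] .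

lemma \<beta>_commute: "snd k \<in> D \<Longrightarrow> snd l \<in> D \<Longrightarrow> \<beta> l k = cnj (\<beta> k l)"
proof -
  assume kl: "snd k \<in> D" "snd l \<in> D"
  have "\<beta> l k = ip (rep_space \<rho>) (snd l) (rep_op \<rho> (star (p (star (fst k) * fst l))) (snd k))"
    unfolding \<beta>_def by (rule R.hom_star[OF p_in kl(2,1)])
  also have "star (p (star (fst k) * fst l)) = p (star (fst l) * fst k)"
    by (simp add: p_star[symmetric] star_mult star_star)
  finally show ?thesis
    using K.ip_commute[OF D_in[OF p_op_in[OF kl(1)]] D_in[OF kl(2)]] by (simp add: \<beta>_def)
qed

lemma F_abelian_group: "abelian_group F"
proof (rule abelian_groupI; (unfold F_ops)?)
  show "\<exists>y\<in>carrier F. y + x = 0" if "x \<in> carrier F" for x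
    using F_minus_in[OF that] by (intro bexI[of _ "- x"]) auto
qed (auto simp: F_add_in add_ac)

sublocale F: hermitian_space F
proof -
  have "Module.module complex_ring F"
    by (rule moduleI[OF complex_cring F_abelian_group])
      (auto intro!: F_smult_in poly_mapping_eqI simp: lookup_smult lookup_add algebra_simps)
  then interpret FM: Module.module complex_ring F .
  show "hermitian_space F"
  proof unfold_locales
    fix x y z assume c: "x \<in> carrier F" "y \<in> carrier F" "z \<in> carrier F"
    let ?S = "Poly_Mapping.keys x \<union> Poly_Mapping.keys y" and ?S' = "Poly_Mapping.keys z"
    have s: "Poly_Mapping.keys (x + y) \<subseteq> ?S" by (rule Poly_Mapping.keys_add)
    show "ip F (x \<oplus>\<^bsub>F\<^esub> y) z = ip F x z + ip F y z"
      using s by (simp add: ip_F[of ?S _ ?S'] lookup_add distrib_right sum.distrib)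
  next
    fix c x y
    show "ip F (c \<odot>\<^bsub>F\<^esub> x) y = c * ip F x y"
      using keys_smult[of c x]
      by (simp add: ip_F[of "Poly_Mapping.keys x" _ "Poly_Mapping.keys y"] lookup_smult sum_distrib_left mult.assoc)
  next
    fix x y assume c: "x \<in> carrier F" "y \<in> carrier F"
    have "ip F y x = (\<Sum>k\<in>Poly_Mapping.keys y. \<Sum>l\<in>Poly_Mapping.keys x.
        Poly_Mapping.lookup y k * cnj (Poly_Mapping.lookup x l) * \<beta> k l)"
      by (rule ip_F) auto
    also have "\<dots> = (\<Sum>k\<in>Poly_Mapping.keys y. \<Sum>l\<in>Poly_Mapping.keys x.
        cnj (Poly_Mapping.lookup x l * cnj (Poly_Mapping.lookup y k) * \<beta> l k))"
    proof (intro sum.cong refl)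
      fix k l assume "k \<in> Poly_Mapping.keys y" "l \<in> Poly_Mapping.keys x"
      then have "snd k \<in> D" "snd l \<in> D" using c unfolding F_carrier by auto
      from \<beta>_commute[OF this(2,1)]
      show "Poly_Mapping.lookup y k * cnj (Poly_Mapping.lookup x l) * \<beta> k l =
        cnj (Poly_Mapping.lookup x l * cnj (Poly_Mapping.lookup y k) * \<beta> l k)" by simp
    qed
    also have "\<dots> = (\<Sum>l\<in>Poly_Mapping.keys x. \<Sum>k\<in>Poly_Mapping.keys y.
        cnj (Poly_Mapping.lookup x l * cnj (Poly_Mapping.lookup y k) * \<beta> l k))"
      by (rule sum.swap)
    also have "\<dots> = cnj (\<Sum>l\<in>Poly_Mapping.keys x. \<Sum>k\<in>Poly_Mapping.keys y.
        Poly_Mapping.lookup x l * cnj (Poly_Mapping.lookup y k) * \<beta> l k)"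
      by (simp only: cnj_sum)
    also have "\<dots> = cnj (ip F x y)"
      by (subst ip_F[of "Poly_Mapping.keys x" x "Poly_Mapping.keys y" y]) auto
    finally show "ip F y x = cnj (ip F x y)" .
  qed
qed

abbreviation gen :: "'a \<Rightarrow> 'v \<Rightarrow> ('a \<times> 'v) \<Rightarrow>\<^sub>0 complex" where "gen \<equiv> tensor_gen"

lemma ip_gen_right:
  assumes "x \<in> carrier F"
  shows "ip F x (gen b w) = (\<Sum>k\<in>Poly_Mapping.keys x. Poly_Mapping.lookup x k * \<beta> k (b, w))"
  using ip_F[of "Poly_Mapping.keys x" x "{(b, w)}" "gen b w"] by simp

lemma ip_gen_gen: "ip F (gen a v) (gen b w) = \<beta> (a, v) (b, w)"
  using ip_F[of "{(a, v)}" "gen a v" "{(b, w)}" "gen b w"] by simp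

lemma ip_expand_right:
  "ip F x y = (\<Sum>(b, w)\<in>Poly_Mapping.keys y. cnj (Poly_Mapping.lookup y (b, w)) * ip F x (gen b w))"
proof -
  have 1: "ip F x (gen (fst l) (snd l)) = (\<Sum>k\<in>Poly_Mapping.keys x. Poly_Mapping.lookup x k * \<beta> k l)" for l
    using ip_F[of "Poly_Mapping.keys x" x "{l}" "gen (fst l) (snd l)"] by simp
  have "ip F x y = (\<Sum>k\<in>Poly_Mapping.keys x. \<Sum>l\<in>Poly_Mapping.keys y.
      Poly_Mapping.lookup x k * cnj (Poly_Mapping.lookup y l) * \<beta> k l)" by (rule ip_F) auto
  also have "\<dots> = (\<Sum>l\<in>Poly_Mapping.keys y. \<Sum>k\<in>Poly_Mapping.keys x.
      Poly_Mapping.lookup x k * cnj (Poly_Mapping.lookup y l) * \<beta> k l)" by (rule sum.swap)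
  also have "\<dots> = (\<Sum>l\<in>Poly_Mapping.keys y. cnj (Poly_Mapping.lookup y l) * ip F x (gen (fst l) (snd l)))"
    unfolding 1 sum_distrib_left by (intro sum.cong refl) (simp add: mult_ac)
  finally show ?thesis by (simp add: case_prod_beta)
qed

lemma ip_F_sum_left:
  "(\<And>i. i \<in> I \<Longrightarrow> f i \<in> carrier F) \<Longrightarrow> y \<in> carrier F \<Longrightarrow> ip F (\<Sum>i\<in>I. f i) y = (\<Sum>i\<in>I. ip F (f i) y)"
proof (induction I rule: infinite_finite_induct)
  case (insert i I)
  then show ?case using F.ip_add_left[of "f i" "\<Sum>i\<in>I. f i" y] F_sum_in[of I f] by simp
qed (use F.ip_zero_left in auto)

lemma ip_F_diff_left: "x \<in> carrier F \<Longrightarrow> y \<in> carrier F \<Longrightarrow> z \<in> carrier F \<Longrightarrow> ip F (x - y) z = ip F x z - ip F y z"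
  using F.ip_add_left[of "x - y" y z] F_diff_in[of x y] by simp

lemma single_smult: "Poly_Mapping.single k c = c \<odot>\<^bsub>F\<^esub> Poly_Mapping.single k 1"
  by (rule poly_mapping_eqI) (simp add: lookup_smult lookup_single when_def)

lemma ip_single_left: "v \<in> D \<Longrightarrow> y \<in> carrier F \<Longrightarrow> ip F (Poly_Mapping.single (a, v) c) y = c * ip F (gen a v) y"
  by (subst single_smult) (simp add: F.ip_smult_left F_single_in)

lemma \<beta>_add_left: "v \<in> D \<Longrightarrow> w \<in> D \<Longrightarrow> \<beta> (a + a', v) (b, w) = \<beta> (a, v) (b, w) + \<beta> (a', v) (b, w)"
  by (simp add: \<beta>_def distrib_left p_add R.hom_add p_in K.ip_add_left D_in p_op_in)

lemma \<beta>_scale_left: "v \<in> D \<Longrightarrow> w \<in> D \<Longrightarrow> \<beta> (c *\<^sub>C a, v) (b, w) = c * \<beta> (a, v) (b, w)"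
  by (simp add: \<beta>_def mult_scaleC_right p_scale R.hom_scaleC p_in K.ip_smult_left D_in p_op_in)

lemma \<beta>_add_vec: "v \<in> D \<Longrightarrow> v' \<in> D \<Longrightarrow> w \<in> D \<Longrightarrow> \<beta> (a, v \<oplus>\<^bsub>rep_space \<rho>\<^esub> v') (b, w) = \<beta> (a, v) (b, w) + \<beta> (a, v') (b, w)"
  by (simp add: \<beta>_def R.op_add p_in K.ip_add_left D_in p_op_in)

lemma \<beta>_scale_vec: "v \<in> D \<Longrightarrow> w \<in> D \<Longrightarrow> \<beta> (a, c \<odot>\<^bsub>rep_space \<rho>\<^esub> v) (b, w) = c * \<beta> (a, v) (b, w)"
  by (simp add: \<beta>_def R.op_smult p_in K.ip_smult_left D_in p_op_in)

lemma \<beta>_balanced: "x \<in> graded_part A H \<Longrightarrow> v \<in> D \<Longrightarrow> \<beta> (a * x, v) (b, w) = \<beta> (a, rep_op \<rho> x v) (b, w)"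
  by (simp add: \<beta>_def mult.assoc[symmetric] p_mult_right R.hom_mult p_in)

definition rad where "rad = {x \<in> carrier F. \<forall>y\<in>carrier F. ip F x y = 0}"

lemma radI:
  assumes "x \<in> carrier F" "\<And>b w. w \<in> D \<Longrightarrow> ip F x (gen b w) = 0"
  shows "x \<in> rad"
proof -
  have "ip F x y = 0" if "y \<in> carrier F" for y
    unfolding ip_expand_right[of x y] using that by (intro sum.neutral) (auto simp: F_carrier assms(2))
  then show ?thesis using assms(1) by (simp add: rad_def)
qed

lemma rad_submodule: "submodule rad complex_ring F"
  by (rule F.submoduleI) (auto simp: rad_def F.ip_simps simp del: F_ops)

definition gens where "gens =
  ({tensor_gen (a + b) v - tensor_gen a v - tensor_gen b v | a b v. v \<in> rep_dom \<rho>} \<union>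
        {tensor_gen a (v \<oplus>\<^bsub>rep_space \<rho>\<^esub> w) - tensor_gen a v - tensor_gen a w | a v w.
           v \<in> rep_dom \<rho> \<and> w \<in> rep_dom \<rho>} \<union>
        {tensor_gen (c *\<^sub>C a) v - Poly_Mapping.single (a, v) c | c a v. v \<in> rep_dom \<rho>} \<union>
        {tensor_gen a (c \<odot>\<^bsub>rep_space \<rho>\<^esub> v) - Poly_Mapping.single (a, v) c | c a v.
           v \<in> rep_dom \<rho>} \<union>
        {tensor_gen (a * b) v - tensor_gen a (rep_op \<rho> b v) | a b v.
           b \<in> graded_part A H \<and> v \<in> rep_dom \<rho>})"

text \<open>The form respects the tensor relations; for the relation of balancing this is the compatibility of
  the projection onto the part graded by \<open>H\<close> with right multiplication.\<close>

lemma gens_rad: "gens \<subseteq> rad"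
proof
  fix x assume "x \<in> gens"
  then consider
    (1) a b v where "x = gen (a + b) v - gen a v - gen b v" "v \<in> D"
    | (2) a v w where "x = gen a (v \<oplus>\<^bsub>rep_space \<rho>\<^esub> w) - gen a v - gen a w" "v \<in> D" "w \<in> D"
    | (3) c a v where "x = gen (c *\<^sub>C a) v - Poly_Mapping.single (a, v) c" "v \<in> D"
    | (4) c a v where "x = gen a (c \<odot>\<^bsub>rep_space \<rho>\<^esub> v) - Poly_Mapping.single (a, v) c" "v \<in> D"
    | (5) a b v where "x = gen (a * b) v - gen a (rep_op \<rho> b v)" "b \<in> graded_part A H" "v \<in> D"
    unfolding gens_def by blast
  then show "x \<in> rad"
  proof cases
    case 1 then show ?thesis
      by (intro radI) (simp_all add: F_diff_in F_single_in ip_F_diff_left ip_gen_gen \<beta>_add_left)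
  next
    case 2 then show ?thesis
      by (intro radI) (simp_all add: F_diff_in F_single_in ip_F_diff_left ip_gen_gen \<beta>_add_vec D_closed)
  next
    case 3 then show ?thesis
      by (intro radI) (simp_all add: F_diff_in F_single_in ip_F_diff_left ip_gen_gen ip_single_left \<beta>_scale_left)
  next
    case 4 then show ?thesis
      by (intro radI) (simp_all add: F_diff_in F_single_in ip_F_diff_left ip_gen_gen ip_single_left \<beta>_scale_vec D_closed)
  next
    case 5 then show ?thesis
      by (intro radI) (simp_all add: F_diff_in F_single_in ip_F_diff_left ip_gen_gen \<beta>_balanced R.op_closed)
  qed
qed

lemma N_hull: "N = (\<lambda>N. submodule N complex_ring F) hull gens"
  by (simp add: tensor_relations_def gens_def)

lemma N_rad: "N \<subseteq> rad"
  unfolding N_hull hull_def using gens_rad rad_submodule by blast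

text \<open>The hull is an intersection, and it is a submodule of the carrier because the radical is a member of the family.\<close>

lemma N_submodule: "submodule N complex_ring F"
proof (rule F.submoduleI)
  have rad: "rad \<in> {t. submodule t complex_ring F \<and> gens \<subseteq> t}" using rad_submodule gens_rad by simp
  show "N \<subseteq> carrier F" using N_rad by (auto simp: rad_def)
  note E = F.submodule_closed F.submoduleE
  show "\<zero>\<^bsub>F\<^esub> \<in> N" unfolding N_hull hull_def using E(2) by blast
  show "\<ominus>\<^bsub>F\<^esub> a \<in> N" if "a \<in> N" for a using that E(8) unfolding N_hull hull_def by blast
  show "a \<oplus>\<^bsub>F\<^esub> b \<in> N" if "a \<in> N" "b \<in> N" for a b using that E(3) unfolding N_hull hull_def by blast
  show "c \<odot>\<^bsub>F\<^esub> a \<in> N" if "a \<in> N" for a c using that E(5) unfolding N_hull hull_def by blast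
qed

sublocale FQ: quotient_by_radical F N
proof (intro quotient_by_radical.intro quotient_by_radical_axioms.intro F.hermitian_space_axioms N_submodule)
  show "ip F x y = 0" if "x \<in> N" "y \<in> carrier F" for x y using that N_rad by (auto simp: rad_def)
qed

abbreviation TS where "TS \<equiv> tensor_space G A H \<rho>"
abbreviation q1 where "q1 x \<equiv> N +>\<^bsub>F\<^esub> x"

lemma TS_eq: "TS = quotient_space F N"
  by (simp add: tensor_space_def)

sublocale TS: semi_ip_space TS
proof -
  interpret Q: hermitian_space TS unfolding TS_eq by (rule FQ.Q_hermitian)
  show "semi_ip_space TS"
    by unfold_locales (use inducible in \<open>auto simp: inducible_def\<close>)
qed

sublocale TQ: quotient_by_radical TS "null_space TS"
  by (rule TS.null_quotient_by_radical)

abbreviation QS where "QS \<equiv> quotient_space TS (null_space TS)"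
abbreviation q2 where "q2 x \<equiv> null_space TS +>\<^bsub>TS\<^esub> x"

sublocale QS: pre_hilbert_space QS by (rule TS.null_quotient_pre_hilbert)

abbreviation V where "V \<equiv> completion QS"

sublocale V: hilbert_space V by (rule QS.completion_hilbert)

text \<open>The isometric map of the free space onto the dense domain in the completion. Working with it hides the
  three successive quotients.\<close>

definition J where "J x = completion_embedding QS (q2 (q1 x))"

lemma q1_in [simp]: "x \<in> carrier F \<Longrightarrow> q1 x \<in> carrier TS"
  unfolding TS_eq by simp

lemma J_in [simp]: "x \<in> carrier F \<Longrightarrow> J x \<in> carrier V"
  unfolding J_def by (intro QS.emb_in TQ.Q_in q1_in)

lemma J_add: "x \<in> carrier F \<Longrightarrow> y \<in> carrier F \<Longrightarrow> J (x + y) = J x \<oplus>\<^bsub>V\<^esub> J y"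
  using FQ.Q_add[of x y] TQ.Q_add[of "q1 x" "q1 y"] QS.emb_add[of "q2 (q1 x)" "q2 (q1 y)"]
  unfolding J_def TS_eq[symmetric] by simp

lemma J_smult: "x \<in> carrier F \<Longrightarrow> J (c \<odot>\<^bsub>F\<^esub> x) = c \<odot>\<^bsub>V\<^esub> J x"
  using FQ.Q_smult[of x c] TQ.Q_smult[of "q1 x" c] QS.emb_smult[of "q2 (q1 x)" c]
  unfolding J_def TS_eq[symmetric] by simp

lemma J_ip: "x \<in> carrier F \<Longrightarrow> y \<in> carrier F \<Longrightarrow> ip V (J x) (J y) = ip F x y"
  using FQ.Q_ip[of x y] TQ.Q_ip[of "q1 x" "q1 y"] QS.emb_ip[of "q2 (q1 x)" "q2 (q1 y)"]
  unfolding J_def TS_eq[symmetric] by simp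

lemma J_image: "completion_embedding QS ` carrier QS = J ` carrier F"
proof -
  have "carrier TS = q1 ` carrier F" unfolding TS_eq by (rule FQ.Q_carrier)
  then show ?thesis unfolding J_def TQ.Q_carrier by (simp only: image_image)
qed

lemma J_dense: "V.dense_in (J ` carrier F)"
  using QS.emb_dense unfolding J_image .

text \<open>Vectors of the form \<open>J x\<close> are equal as soon as they have the same products with the generators.\<close>

lemma J_eqI:
  assumes "x \<in> carrier F" "y \<in> carrier F" "\<And>b w. w \<in> D \<Longrightarrow> ip F x (gen b w) = ip F y (gen b w)"
  shows "J x = J y"
proof (rule V.dense_eqI[OF J_dense])
  fix u assume "u \<in> J ` carrier F"
  then obtain z where z: "z \<in> carrier F" "u = J z" by auto
  have "ip F x z = ip F y z"
    unfolding ip_expand_right[of x z] ip_expand_right[of y z]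
    using z assms(3) by (intro sum.cong refl) (auto simp: F_carrier)
  then show "ip V (J x) u = ip V (J y) u" using z assms by (simp add: J_ip)
qed (use assms in auto)

abbreviation L where "L \<equiv> free_left_mult"

lemma L_in: "x \<in> carrier F \<Longrightarrow> L a x \<in> carrier F"
  unfolding free_left_mult_def by (rule F_sum_in) (auto simp: F_carrier intro!: F_single_in[unfolded F_carrier])

text \<open>Left multiplication has a formal adjoint already on the free space. Therefore it preserves the
  radical and acts on the vectors \<open>J x\<close>, whichever representatives are chosen in the quotients.\<close>

lemma ip_L:
  assumes x: "x \<in> carrier F" and w: "w \<in> D"
  shows "ip F (L a x) (gen b w) = ip F x (gen (star a * b) w)"
proof -
  have "ip F (L a x) (gen b w) = (\<Sum>k\<in>Poly_Mapping.keys x. ip F (Poly_Mapping.single (a * fst k, snd k) (Poly_Mapping.lookup x k)) (gen b w))"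
    unfolding free_left_mult_def case_prod_beta using x w
    by (subst ip_F_sum_left) (auto simp: F_carrier)
  also have "\<dots> = (\<Sum>k\<in>Poly_Mapping.keys x. Poly_Mapping.lookup x k * \<beta> k (star a * b, w))"
  proof (rule sum.cong[OF refl])
    fix k assume "k \<in> Poly_Mapping.keys x"
    then have "snd k \<in> D" using x by (auto simp: F_carrier)
    moreover have "\<beta> (a * fst k, snd k) (b, w) = \<beta> k (star a * b, w)"
      by (simp add: \<beta>_def star_mult star_star mult.assoc)
    ultimately show "ip F (Poly_Mapping.single (a * fst k, snd k) (Poly_Mapping.lookup x k)) (gen b w) =
        Poly_Mapping.lookup x k * \<beta> k (star a * b, w)"
      using w by (simp add: ip_single_left F_single_in ip_gen_gen)
  qed
  also have "\<dots> = ip F x (gen (star a * b) w)" by (rule ip_gen_right[OF x, symmetric])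
  finally show ?thesis .
qed

definition \<pi>0 where "\<pi>0 = \<lparr>rep_space = V, rep_dom = completion_embedding QS ` carrier QS,
  rep_op = (\<lambda>a x. completion_embedding QS (quotient_map TS (null_space TS) (tensor_left_mult G A H \<rho> a)
                                (the_inv_into (carrier QS) (completion_embedding QS) x)))\<rparr>"

lemma induced_rep_eq: "induced_rep G A H \<rho> = rep_closure UNIV \<pi>0"
  unfolding induced_rep_def \<pi>0_def Let_def ..

lemma \<pi>0_simps [simp]: "rep_space \<pi>0 = V" "rep_dom \<pi>0 = J ` carrier F"
  by (simp_all add: \<pi>0_def J_image)

lemma \<pi>0_op:
  assumes x: "x \<in> carrier F"
  shows "rep_op \<pi>0 a (J x) = J (L a x)"
proof -
  have "the_inv_into (carrier QS) (completion_embedding QS) (J x) = q2 (q1 x)"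
    unfolding J_def by (rule the_inv_into_f_f[OF QS.emb_inj TQ.Q_in[OF q1_in[OF x]]])
  moreover obtain Y where Y: "Y \<in> carrier TS" "Y \<ominus>\<^bsub>TS\<^esub> q1 x \<in> null_space TS"
    "quotient_map TS (null_space TS) (tensor_left_mult G A H \<rho> a) (q2 (q1 x)) = q2 (tensor_left_mult G A H \<rho> a Y)"
    by (rule TQ.Q_quotient_map[OF q1_in[OF x]]) (rule that)
  moreover obtain y where y: "y \<in> carrier F" "Y = q1 y"
    using Y(1) unfolding TS_eq FQ.Q_carrier by auto
  moreover obtain z where z: "z \<in> carrier F" "z \<ominus>\<^bsub>F\<^esub> y \<in> N"
    "quotient_map F N (L a) (q1 y) = q1 (L a z)"
    by (rule FQ.Q_quotient_map[OF y(1)]) (rule that)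
  ultimately have op: "rep_op \<pi>0 a (J x) = J (L a z)"
    by (simp add: \<pi>0_def J_def tensor_left_mult_def)
  have "q1 z = q1 y" using FQ.q_eq[OF z(1) y(1)] z(2) by simp
  moreover have "q2 (q1 y) = q2 (q1 x)" using TQ.q_eq[OF Y(1) q1_in[OF x]] Y(2) y(2) by simp
  ultimately have Jz: "J z = J x" unfolding J_def by simp
  have "J (L a z) = J (L a x)"
  proof (rule J_eqI)
    fix b w assume w: "w \<in> D"
    have "ip F z (gen (star a * b) w) = ip F x (gen (star a * b) w)"
      using J_ip[OF z(1) F_single_in[OF w]] J_ip[OF x F_single_in[OF w]] Jz by simp
    then show "ip F (L a z) (gen b w) = ip F (L a x) (gen b w)" using ip_L x z w by simp
  qed (use x z L_in in auto)
  then show ?thesis using op by simp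
qed

lemma ip_gen_right_linear:
  assumes x: "x \<in> carrier F" and w: "w \<in> D"
  shows "ip F x (gen (a + b) w) = ip F x (gen a w) + ip F x (gen b w)"
    "ip F x (gen (c *\<^sub>C a) w) = cnj c * ip F x (gen a w)"
proof -
  have s: "snd k \<in> D" if "k \<in> Poly_Mapping.keys x" for k using x that by (auto simp: F_carrier)
  have 1: "\<beta> k (a + b, w) = \<beta> k (a, w) + \<beta> k (b, w)" "\<beta> k (c *\<^sub>C a, w) = cnj c * \<beta> k (a, w)"
    if "k \<in> Poly_Mapping.keys x" for k
    using \<beta>_commute[of "(a + b, w)" k] \<beta>_commute[of "(a, w)" k] \<beta>_commute[of "(b, w)" k] \<beta>_commute[of "(c *\<^sub>C a, w)" k]
      \<beta>_add_left[OF w, of "snd k" a b "fst k"] \<beta>_scale_left[OF w, of "snd k" c a "fst k"] s[OF that] w by auto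
  show "ip F x (gen (a + b) w) = ip F x (gen a w) + ip F x (gen b w)"
    "ip F x (gen (c *\<^sub>C a) w) = cnj c * ip F x (gen a w)"
    unfolding ip_gen_right[OF x] by (simp_all add: 1 distrib_left sum.distrib sum_distrib_left mult_ac)
qed

lemma \<pi>0_star_representation: "star_representation UNIV \<pi>0"
proof (rule star_representation.intro; (unfold \<pi>0_simps)?)
  show "hilbert_space V" by (rule V.hilbert_space_axioms)
  have zero: "J 0 = \<zero>\<^bsub>V\<^esub>"
    using J_smult[of 0 0] V.smult_l_null[of "J 0"] F.smult_l_null[of 0] by simp
  show "submodule (J ` carrier F) complex_ring V"
  proof (rule V.submoduleI)
    show "\<zero>\<^bsub>V\<^esub> \<in> J ` carrier F" using zero F_zero_in by (metis imageI)
    show sm: "c \<odot>\<^bsub>V\<^esub> u \<in> J ` carrier F" if "u \<in> J ` carrier F" for c u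
      using that by (auto simp flip: J_smult simp: F_smult_in)
    show "\<ominus>\<^bsub>V\<^esub> u \<in> J ` carrier F" if "u \<in> J ` carrier F" for u
    proof -
      have "u \<in> carrier V" using that by auto
      then have "(-1) \<odot>\<^bsub>V\<^esub> u = \<ominus>\<^bsub>V\<^esub> u" by (intro V.ip_eqI) (auto simp: V.ip_simps)
      then show ?thesis using sm[OF that, of "-1"] by simp
    qed
    show "u \<oplus>\<^bsub>V\<^esub> v \<in> J ` carrier F" if "u \<in> J ` carrier F" "v \<in> J ` carrier F" for u v
      using that by (auto simp flip: J_add simp: F_add_in)
  qed auto
  show "vtop V closure_of (J ` carrier F) = carrier V"
    using J_dense by (subst V.dense_in_iff) auto
  fix a b c u v
  assume u: "u \<in> J ` carrier F"
  then obtain x where x: "x \<in> carrier F" "u = J x" by auto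
  show "rep_op \<pi>0 a u \<in> J ` carrier F" using x L_in by (auto simp: \<pi>0_op)
  show "rep_op \<pi>0 a (c \<odot>\<^bsub>V\<^esub> u) = c \<odot>\<^bsub>V\<^esub> rep_op \<pi>0 a u"
    using x by (simp add: \<pi>0_op L_in F_smult_in flip: J_smult)
      (intro J_eqI, auto simp: L_in F_smult_in ip_L F.ip_smult_left F_single_in)
  show "rep_op \<pi>0 (a + b) u = rep_op \<pi>0 a u \<oplus>\<^bsub>V\<^esub> rep_op \<pi>0 b u"
    using x by (simp add: \<pi>0_op L_in flip: J_add)
      (intro J_eqI, auto simp: L_in F_add_in ip_L F.ip_add_left[unfolded F_ops] F_single_in star_add distrib_right ip_gen_right_linear)
  show "rep_op \<pi>0 (c *\<^sub>C a) u = c \<odot>\<^bsub>V\<^esub> rep_op \<pi>0 a u"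
    using x by (simp add: \<pi>0_op L_in flip: J_smult)
      (intro J_eqI, auto simp: L_in F_smult_in ip_L F.ip_smult_left F_single_in star_scaleC mult_scaleC_left ip_gen_right_linear)
  show "rep_op \<pi>0 (a * b) u = rep_op \<pi>0 a (rep_op \<pi>0 b u)"
    using x by (simp add: \<pi>0_op L_in) (intro J_eqI, auto simp: L_in ip_L star_mult mult.assoc)
  assume v: "v \<in> J ` carrier F"
  then obtain y where y: "y \<in> carrier F" "v = J y" by auto
  show "rep_op \<pi>0 a (u \<oplus>\<^bsub>V\<^esub> v) = rep_op \<pi>0 a u \<oplus>\<^bsub>V\<^esub> rep_op \<pi>0 a v"
    using x y by (simp add: \<pi>0_op L_in F_add_in flip: J_add)
      (intro J_eqI, auto simp: L_in F_add_in ip_L F.ip_add_left[unfolded F_ops] F_single_in)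
  have "ip F (L a x) y = ip F x (L (star a) y)"
  proof -
    have "ip F (L (star a) y) x = (\<Sum>k\<in>Poly_Mapping.keys y. ip F (Poly_Mapping.single (star a * fst k, snd k) (Poly_Mapping.lookup y k)) x)"
      unfolding free_left_mult_def case_prod_beta using x y
      by (subst ip_F_sum_left) (auto simp: F_carrier)
    also have "\<dots> = (\<Sum>k\<in>Poly_Mapping.keys y. Poly_Mapping.lookup y k * cnj (ip F x (gen (star a * fst k) (snd k))))"
    proof (rule sum.cong[OF refl])
      fix k assume "k \<in> Poly_Mapping.keys y"
      then have s: "snd k \<in> D" using y by (auto simp: F_carrier)
      show "ip F (Poly_Mapping.single (star a * fst k, snd k) (Poly_Mapping.lookup y k)) x =
          Poly_Mapping.lookup y k * cnj (ip F x (gen (star a * fst k) (snd k)))"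
        by (rule trans[OF ip_single_left[OF s x(1)]])
          (simp only: F.ip_commute[OF x(1) F_single_in[OF s], of "star a * fst k" 1])
    qed
    finally have "ip F x (L (star a) y) = (\<Sum>k\<in>Poly_Mapping.keys y. cnj (Poly_Mapping.lookup y k) * ip F x (gen (star a * fst k) (snd k)))"
      by (simp only: F.ip_commute[OF L_in[OF y(1)] x(1)] cnj_sum complex_cnj_mult complex_cnj_cnj)
    also have "\<dots> = (\<Sum>k\<in>Poly_Mapping.keys y. cnj (Poly_Mapping.lookup y k) * ip F (L a x) (gen (fst k) (snd k)))"
      using x y by (intro sum.cong refl) (auto simp: ip_L F_carrier)
    also have "\<dots> = ip F (L a x) y" by (subst ip_expand_right[of "L a x" y]) (simp add: case_prod_beta)
    finally show ?thesis by simp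
  qed
  then show "ip V (rep_op \<pi>0 a u) v = ip V u (rep_op \<pi>0 (star a) v)"
    using x y by (simp add: \<pi>0_op L_in J_ip)
qed

sublocale I: total_representation \<pi>0
  by (rule total_representation.intro, rule \<pi>0_star_representation)

text \<open>The vector \<open>a \<otimes> v\<close> of the induced representation.\<close>

definition t where "t a v = J (gen a v)"

lemma t_in [simp]: "v \<in> D \<Longrightarrow> t a v \<in> J ` carrier F" "v \<in> D \<Longrightarrow> t a v \<in> carrier V"
  by (simp_all add: t_def F_single_in)

lemma t_ip: "v \<in> D \<Longrightarrow> w \<in> D \<Longrightarrow> ip V (t a v) (t b w) = \<beta> (a, v) (b, w)"
  by (simp add: t_def J_ip F_single_in ip_gen_gen)

lemma t_add: "v \<in> D \<Longrightarrow> t (a + b) v = t a v \<oplus>\<^bsub>V\<^esub> t b v"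
  unfolding t_def by (simp add: F_single_in flip: J_add)
    (intro J_eqI, auto simp: F_single_in F_add_in F.ip_add_left[unfolded F_ops] ip_gen_gen \<beta>_add_left)

lemma t_add_vec: "v \<in> D \<Longrightarrow> w \<in> D \<Longrightarrow> t a (v \<oplus>\<^bsub>rep_space \<rho>\<^esub> w) = t a v \<oplus>\<^bsub>V\<^esub> t a w"
  unfolding t_def by (simp add: F_single_in D_closed flip: J_add)
    (intro J_eqI, auto simp: F_single_in D_closed F_add_in F.ip_add_left[unfolded F_ops] ip_gen_gen \<beta>_add_vec)

lemma t_zero: "v \<in> D \<Longrightarrow> t 0 v = \<zero>\<^bsub>V\<^esub>"
  using t_add[of v 0 0] t_in(2)[of v 0] by simp

lemma t_smult_vec: "v \<in> D \<Longrightarrow> t a (c \<odot>\<^bsub>rep_space \<rho>\<^esub> v) = J (Poly_Mapping.single (a, v) c)"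
  unfolding t_def by (intro J_eqI) (auto simp: F_single_in D_closed ip_gen_gen ip_single_left \<beta>_scale_vec)

lemma \<pi>0_t: "v \<in> D \<Longrightarrow> rep_op \<pi>0 a (t b v) = t (a * b) v"
  by (simp add: t_def \<pi>0_op F_single_in free_left_mult_def)

text \<open>Every vector of the domain is a finite sum of vectors \<open>t a v\<close> with homogeneous \<open>a\<close>; scalars are absorbed in
  \<open>v\<close>.\<close>

lemma D0_induct:
  assumes u: "u \<in> J ` carrier F" and zero: "P \<zero>\<^bsub>V\<^esub>"
    and step: "\<And>x g a v. x \<in> J ` carrier F \<Longrightarrow> P x \<Longrightarrow> g \<in> carrier G \<Longrightarrow> a \<in> A g \<Longrightarrow> v \<in> D \<Longrightarrow> P (x \<oplus>\<^bsub>V\<^esub> t a v)"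
  shows "P u"
proof -
  have st: "P x \<longrightarrow> P (x \<oplus>\<^bsub>V\<^esub> t a v)" if x: "x \<in> J ` carrier F" and v: "v \<in> D" for x a v
    using x
  proof (induction a arbitrary: x rule: graded_induct)
    case 1 then show ?case using v by (auto simp: t_zero)
  next
    case (2 a b)
    have "x \<oplus>\<^bsub>V\<^esub> t a v \<in> J ` carrier F" using I.D_closed(2) 2(3) v by simp
    moreover have "x \<oplus>\<^bsub>V\<^esub> t (a + b) v = (x \<oplus>\<^bsub>V\<^esub> t a v) \<oplus>\<^bsub>V\<^esub> t b v"
      using 2(3) v by (auto simp: t_add V.M.a_assoc)
    ultimately show ?case using 2 by simp
  qed (use step v in blast)
  obtain p where p: "p \<in> carrier F" "u = J p" using u by auto
  have "P (J (\<Sum>k\<in>S. Poly_Mapping.single k (Poly_Mapping.lookup p k)))" if "S \<subseteq> Poly_Mapping.keys p" for S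
    using that
  proof (induction S rule: infinite_finite_induct)
    case (infinite S) then show ?case using finite_subset finite_keys by blast
  next
    case empty
    have "J 0 = \<zero>\<^bsub>V\<^esub>" using J_add[of 0 0] J_in[of 0] by simp
    then show ?case using zero by simp
  next
    case (insert k S)
    obtain a v where k: "k = (a, v)" by (cases k)
    have v: "v \<in> D" using insert k p by (auto simp: F_carrier)
    let ?s = "\<Sum>k\<in>S. Poly_Mapping.single k (Poly_Mapping.lookup p k)"
    have s: "?s \<in> carrier F" using insert p by (intro F_sum_in) (auto simp: F_carrier)
    have "J (Poly_Mapping.single k (Poly_Mapping.lookup p k) + ?s) = J ?s \<oplus>\<^bsub>V\<^esub> t a (Poly_Mapping.lookup p k \<odot>\<^bsub>rep_space \<rho>\<^esub> v)"
      using s v k by (simp add: J_add F_single_in t_smult_vec V.M.a_comm)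
    then show ?case using insert st[of "J ?s"] s v D_closed(4)[OF v] by simp
  qed
  from this[OF subset_refl] show ?thesis
    using p(2) by (simp only: sum_singles)
qed

end

section \<open>The spectral measure of the induced representation\<close>

text \<open>For a logarithmically convex sequence the ratios of successive terms increase, so the first ratio is
  at most the exponential growth rate.\<close>

lemma log_convex_growth:
  fixes r :: "nat \<Rightarrow> real"
  assumes nonneg: "\<And>k. 0 \<le> r k" and convex: "\<And>k. (r (Suc k))\<^sup>2 \<le> r k * r (Suc (Suc k))"
    and growth: "\<And>k. r k \<le> C * q ^ k" and q: "0 \<le> q"
  shows "r 1 \<le> q * r 0"
proof (rule ccontr)
  assume n: "\<not> r 1 \<le> q * r 0"
  have r1: "r 1 > 0" using n q nonneg[of 0] mult_nonneg_nonneg[of q "r 0"] by linarith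
  have r0: "r 0 > 0"
  proof (rule ccontr)
    assume "\<not> r 0 > 0"
    then have "r 0 = 0" using nonneg[of 0] by simp
    then show False using convex[of 0] r1 by simp
  qed
  define m where "m = r 1 / r 0"
  have m: "m > 0" "m > q" using r0 r1 n by (auto simp: m_def field_simps)
  have step: "r k > 0 \<and> r (Suc k) \<ge> m * r k" for k
  proof (induction k)
    case 0 then show ?case using r0 by (simp add: m_def)
  next
    case (Suc k)
    then have p: "r (Suc k) > 0" using m mult_pos_pos[of m "r k"] by linarith
    have "(m * r k) * r (Suc k) \<le> r (Suc k) * r (Suc k)" using Suc p by (intro mult_right_mono) auto
    also have "\<dots> \<le> r k * r (Suc (Suc k))" using convex[of k] by (simp add: power2_eq_square)
    finally have "r k * (m * r (Suc k)) \<le> r k * r (Suc (Suc k))" by (simp add: mult_ac)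
    then have "m * r (Suc k) \<le> r (Suc (Suc k))" using Suc by simp
    with p show ?case by simp
  qed
  have low: "r k \<ge> r 0 * m ^ k" for k
  proof (induction k)
    case (Suc k)
    have "r 0 * m ^ Suc k = m * (r 0 * m ^ k)" by simp
    also have "\<dots> \<le> m * r k" using Suc m by (intro mult_left_mono) auto
    also have "\<dots> \<le> r (Suc k)" using step by blast
    finally show ?case .
  qed simp
  show False
  proof (cases "q = 0")
    case True then show False using growth[of 1] r1 by simp
  next
    case False
    then have q: "q > 0" using q by simp
    have "m / q > 1" using m q by simp
    then obtain k where k: "C / r 0 < (m / q) ^ k" using real_arch_pow by blast
    have "r 0 * m ^ k \<le> C * q ^ k" using low[of k] growth[of k] by linarith
    then have "(m / q) ^ k \<le> C / r 0" using r0 q by (simp add: power_divide field_simps)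
    then show False using k by simp
  qed
qed

context spectral_family
begin

text \<open>Summed over an \<open>\<epsilon>\<close>-fine partition, the form is at least \<open>-3\<epsilon> \<parallel>x\<parallel>\<^sup>2\<close>.\<close>

lemma locally_eigen_nonneg:
  assumes f: "f \<in> borel_measurable M" and z: "locally_eigen f x z" and D: "\<Delta> \<in> sets M" and Ex: "E \<Delta> x = x"
    and nn: "\<And>\<xi>. \<xi> \<in> \<Delta> \<Longrightarrow> 0 \<le> Re (f \<xi>)"
  shows "0 \<le> Re (ip V z x)"
proof -
  have c: "x \<in> carrier V" "z \<in> carrier V" using z by (auto simp: locally_eigen_def)
  have "- Re (ip V z x) \<le> \<epsilon> * (3 * (vnorm V x)\<^sup>2)" if e: "0 < \<epsilon>" "\<epsilon> < 1" for \<epsilon>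
  proof -
    obtain F :: "nat \<Rightarrow> 'x set" and a where "range F \<subseteq> sets M \<and> disjoint_family F \<and> (\<Union>i. F i) = space M \<and>
        (\<forall>i. \<forall>\<xi>\<in>F i. cmod (f \<xi> - a i) \<le> \<epsilon>)"
      using fine_partition[OF f e(1)] by blast
    then have F: "range F \<subseteq> sets M" "disjoint_family F" "(\<Union>i. F i) = space M"
      "\<And>i \<xi>. \<xi> \<in> F i \<Longrightarrow> cmod (f \<xi> - a i) \<le> \<epsilon>" by auto
    have Fs: "F i \<in> sets M" for i using F by auto
    have "- Re (ip V (E (F i) z) x) \<le> \<epsilon> * (3 * (vnorm V (E (F i) x))\<^sup>2)" for i
    proof -
      let ?x = "E (F i) x" let ?z = "E (F i) z"
      have cc: "?x \<in> carrier V" "?z \<in> carrier V" using c Fs by auto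
      have zx: "ip V ?z x = ip V ?z ?x" using E_idem[OF Fs c(2), of i] E_sym[OF Fs cc(2) c(1), of i] by simp
      show ?thesis
      proof (cases "F i \<inter> \<Delta> = {}")
        case True
        then have "?x = \<zero>" using E_disjoint[OF Fs D True c(1)] Ex by simp
        then show ?thesis using zx cc by (simp add: ip_zero_right)
      next
        case False
        then obtain \<xi> where "\<xi> \<in> F i" "\<xi> \<in> \<Delta>" by auto
        then have "Re (a i) \<ge> - \<epsilon>"
          using nn[of \<xi>] F(4)[of \<xi> i] abs_Re_le_cmod[of "f \<xi> - a i"] by simp
        then have 1: "Re (a i) * (vnorm V ?x)\<^sup>2 \<ge> - \<epsilon> * (vnorm V ?x)\<^sup>2" by (intro mult_right_mono) auto
        have "cmod (ip V (?z \<ominus> a i \<odot> ?x) ?x) \<le> vnorm V (?z \<ominus> a i \<odot> ?x) * vnorm V ?x"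
          using cc by (intro cauchy_schwarz) auto
        also have "\<dots> \<le> (2 * \<epsilon> * vnorm V ?x) * vnorm V ?x"
          using F(4)[of _ i] e cc by (intro mult_right_mono locally_eigenD[OF z Fs]) auto
        finally have 2: "Re (ip V (?z \<ominus> a i \<odot> ?x) ?x) \<ge> - (2 * \<epsilon> * (vnorm V ?x)\<^sup>2)"
          using abs_Re_le_cmod[of "ip V (?z \<ominus> a i \<odot> ?x) ?x"] by (simp add: power2_eq_square mult.assoc)
        have "ip V ?z ?x = ip V (?z \<ominus> a i \<odot> ?x) ?x + a i * complex_of_real ((vnorm V ?x)\<^sup>2)"
          using cc by (simp add: ip_simps ip_self del: of_real_power)
        then have "Re (ip V ?z ?x) = Re (ip V (?z \<ominus> a i \<odot> ?x) ?x) + Re (a i) * (vnorm V ?x)\<^sup>2"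
          by (simp del: of_real_power)
        then show ?thesis using 1 2 zx by (simp add: algebra_simps)
      qed
    qed
    moreover have "(\<lambda>i. - Re (ip V (E (F i) z) x)) sums (- Re (ip V z x))"
      using E_sums[OF F(1,2) c(2,1)] c F(3) by (intro sums_minus sums_Re) (simp add: E_space)
    moreover have "(\<lambda>i. \<epsilon> * (3 * (vnorm V (E (F i) x))\<^sup>2)) sums (\<epsilon> * (3 * (vnorm V x)\<^sup>2))"
      using E_norm_sums[OF F(1,2), of x] c F(3) by (intro sums_mult) (simp add: E_space)
    ultimately show ?thesis by (rule sums_le)
  qed
  then have "- Re (ip V z x) \<le> 0" by (rule small_multiple_le_zero)
  then show ?thesis by simp
qed

lemma tail_to_zero:
  assumes F: "range F \<subseteq> sets M" "disjoint_family F" and x: "x \<in> carrier V"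
  shows "(\<lambda>n. vnorm V (E (\<Union>i\<in>{n..}. F i) x)) \<longlonglongrightarrow> 0"
proof -
  let ?R = "\<lambda>n. \<Union>i\<in>{n..}. F i"
  interpret finite_measure "mu x" by (rule finite_mu[OF x])
  have Rs: "?R n \<in> sets M" for n using F(1) by auto
  have "(\<Inter>n. ?R n) = {}"
  proof (rule ccontr)
    assume "(\<Inter>n. ?R n) \<noteq> {}"
    then obtain \<xi> where "\<xi> \<in> (\<Inter>n. ?R n)" by blast
    then have \<xi>: "\<exists>i\<ge>n. \<xi> \<in> F i" for n by auto
    obtain i where i: "\<xi> \<in> F i" using \<xi>[of 0] by auto
    obtain j where "j \<ge> Suc i" "\<xi> \<in> F j" using \<xi>[of "Suc i"] by auto
    moreover from this have "i \<noteq> j" by simp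
    ultimately show False using i F(2) unfolding disjoint_family_on_def by blast
  qed
  moreover have "(\<lambda>n. measure (mu x) (?R n)) \<longlonglongrightarrow> measure (mu x) (\<Inter>n. ?R n)"
  proof (rule finite_Lim_measure_decseq)
    show "decseq ?R" unfolding decseq_def by (intro allI impI UN_mono) auto
  qed (use Rs in auto)
  ultimately have "(\<lambda>n. (vnorm V (E (?R n) x))\<^sup>2) \<longlonglongrightarrow> 0"
    using Rs x by (simp add: measure_mu)
  from tendsto_real_sqrt[OF this] show ?thesis using Rs x by simp
qed

end

locale well_behaved_induction =
  partial_action G A + inducible_representation G A H \<rho>
  for G (structure) and A :: "'g \<Rightarrow> 'a::star_algebra set" and H and \<rho> :: "('a, 'v) rep" +
  fixes E
  assumes E_spectral: "spectral_measure (rep_space \<rho>) M E"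
    and E_closure: "\<And>b. b \<in> B \<Longrightarrow> op_closure (rep_space \<rho>) (op_graph D (rep_op \<rho> b)) =
           spectral_integral (rep_space \<rho>) M E (\<lambda>\<xi>. \<xi> b)"
    and E_commute: "\<And>h a \<Delta>. h \<in> H \<Longrightarrow> a \<in> A h \<Longrightarrow> \<Delta> \<in> sets M \<Longrightarrow>
           op_graph D (rep_op \<rho> a) O op_graph (carrier (rep_space \<rho>)) (E (act_set G A h \<Delta>))
           \<subseteq> op_graph (carrier (rep_space \<rho>)) (E \<Delta>) O op_graph D (rep_op \<rho> a)"
begin

sublocale S: spectral_family "rep_space \<rho>" M E
  by (intro spectral_family.intro K.hilbert_space_axioms spectral_family_axioms.intro E_spectral)

abbreviation W where "W \<equiv> rep_space \<rho>"
abbreviation D0 where "D0 \<equiv> J ` carrier F"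
abbreviation op0 where "op0 \<equiv> rep_op \<pi>0"
abbreviation cl where "cl \<equiv> rep_closure UNIV \<pi>0"

lemma one_H: "\<one> \<in> H" using subgroup_H subgroup.one_closed by metis

lemma A_part: "h \<in> H \<Longrightarrow> a \<in> A h \<Longrightarrow> a \<in> graded_part A H"
  using component_le_graded_part by blast

lemma rho_in: "h \<in> H \<Longrightarrow> a \<in> A h \<Longrightarrow> v \<in> D \<Longrightarrow> rep_op \<rho> a v \<in> D"
  using R.op_closed A_part by blast

lemma E_D_commute:
  assumes h: "h \<in> H" and a: "a \<in> A h" and D: "\<Delta> \<in> sets M" and v: "v \<in> D"
  shows "E \<Delta> v \<in> D" "E (act_set G A h \<Delta>) (rep_op \<rho> a v) = rep_op \<rho> a (E \<Delta> v)"
proof -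
  have "(v, E (act_set G A h \<Delta>) (rep_op \<rho> a v)) \<in>
      op_graph D (rep_op \<rho> a) O op_graph (carrier W) (E (act_set G A h \<Delta>))"
    using v D_in[OF rho_in[OF h a v]] by (auto simp: op_graph_def)
  then have "(v, E (act_set G A h \<Delta>) (rep_op \<rho> a v)) \<in> op_graph (carrier W) (E \<Delta>) O op_graph D (rep_op \<rho> a)"
    using E_commute[OF h a D] by blast
  then show "E \<Delta> v \<in> D" "E (act_set G A h \<Delta>) (rep_op \<rho> a v) = rep_op \<rho> a (E \<Delta> v)"
    by (auto simp: op_graph_def)
qed

lemma E_in_D: "\<Delta> \<in> sets M \<Longrightarrow> v \<in> D \<Longrightarrow> E \<Delta> v \<in> D"
  using E_D_commute(1)[OF one_H zero_in[OF one_closed]] .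

lemma X_sets: "X \<in> sets M" using sets.top[of M] by simp

text \<open>The covariance of \<open>\<rho>\<close> for arbitrary Borel sets. A set is first cut down to the range of the action of
  \<open>h\<close>, which is harmless since covariance for the set of all characters shows that \<open>\<rho>(c)v\<close> is
  concentrated there.\<close>

lemma E_pull:
  assumes h: "h \<in> H" and c: "c \<in> A h" and S: "S \<in> sets M" and v: "v \<in> D"
  shows "E S (rep_op \<rho> c v) = rep_op \<rho> c (E (pull h S) v)"
proof -
  note hc = H_carrier[OF h]
  have ic: "inv h \<in> carrier G" using hc by simp
  let ?u = "rep_op \<rho> c v"
  have u: "?u \<in> carrier W" using D_in[OF rho_in[OF h c v]] .
  have Ds: "Dom (inv h) \<in> sets M" using open_sets_M[OF Dom_open[OF ic]] .
  have "E (Dom (inv h)) ?u = rep_op \<rho> c (E X v)"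
    using E_D_commute(2)[OF h c X_sets v] by (simp add: act_set_eq_pull[OF hc] pull_X[OF ic])
  also have "E X v = v" using S.E_space[OF D_in[OF v]] by simp
  finally have "E S ?u = E S (E (Dom (inv h)) ?u)" by simp
  also have "\<dots> = E (S \<inter> Dom (inv h)) ?u" by (rule S.E_Int[OF S Ds u])
  also have "S \<inter> Dom (inv h) = act_set G A h (pull h S)"
  proof -
    have "act (inv h) \<xi> \<in> Dom h" "act h (act (inv h) \<xi>) = \<xi>" if "\<xi> \<in> Dom (inv h)" for \<xi>
      using act_inverse[OF that ic] hc by auto
    then show ?thesis unfolding act_set_eq_pull[OF hc] by (auto simp: pull_def)
  qed
  also have "E (act_set G A h (pull h S)) ?u = rep_op \<rho> c (E (pull h S) v)"
    by (rule E_D_commute(2)[OF h c pull_sets[OF hc S] v])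
  finally show ?thesis .
qed

lemma E_B: "b \<in> B \<Longrightarrow> S \<in> sets M \<Longrightarrow> v \<in> D \<Longrightarrow> E S (rep_op \<rho> b v) = rep_op \<rho> b (E S v)"
  using E_pull[OF one_H, of b S v] pull_one[OF sets_M_sub[of S]] by simp

lemma rho_locally_eigen:
  assumes b: "b \<in> B" and v: "v \<in> D"
  shows "S.locally_eigen (\<lambda>\<xi>. \<xi> b) v (rep_op \<rho> b v)"
proof (rule S.spectral_integral_imp_locally_eigen[OF measurable_eval[OF b]])
  have sub: "op_graph D (rep_op \<rho> b) \<subseteq> carrier W \<times> carrier W"
    using D_in rho_in[OF one_H b] by (auto simp: op_graph_def)
  have "(v, rep_op \<rho> b v) \<in> op_graph D (rep_op \<rho> b)" using v by (simp add: op_graph_def)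
  then show "(v, rep_op \<rho> b v) \<in> spectral_integral W M E (\<lambda>\<xi>. \<xi> b)"
    using K.op_closure_superset[OF sub] E_closure[OF b] by blast
qed

lemma form_nonneg:
  assumes b: "b \<in> B" and w: "w \<in> D" and S: "S \<in> sets M" and Ew: "E S w = w"
    and nn: "\<And>\<xi>. \<xi> \<in> S \<Longrightarrow> 0 \<le> Re (\<xi> b)"
  shows "0 \<le> Re (ip W (rep_op \<rho> b w) w)"
  by (rule S.locally_eigen_nonneg[OF measurable_eval[OF b] rho_locally_eigen[OF b w] S Ew]) (rule nn)

lemma rho_norm_sq:
  assumes h: "h \<in> H" and c: "c \<in> A h" and w: "w \<in> D"
  shows "(vnorm W (rep_op \<rho> c w))\<^sup>2 = Re (ip W (rep_op \<rho> (star c * c) w) w)"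
proof -
  note cp = A_part[OF h c]
  have sp: "star c \<in> graded_part A H"
    using star_component[OF H_carrier[OF h] c] A_part[of "inv h"] h subgroup_H subgroup.m_inv_closed by metis
  have "ip W (rep_op \<rho> (star c * c) w) w = ip W (rep_op \<rho> (star c) (rep_op \<rho> c w)) w"
    by (simp add: R.hom_mult[OF sp cp w])
  also have "\<dots> = ip W (rep_op \<rho> c w) (rep_op \<rho> (star (star c)) w)"
    by (rule R.hom_star[OF sp rho_in[OF h c w] w])
  finally show ?thesis using K.vnorm_sq[OF D_in[OF rho_in[OF h c w]]] by (simp add: star_star)
qed

lemma t_norm_sq:
  assumes g: "g \<in> carrier G" and a: "a \<in> A g" and w: "w \<in> D"
  shows "(vnorm V (t a w))\<^sup>2 = Re (ip W (rep_op \<rho> (star a * a) w) w)"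
  using V.vnorm_sq[OF t_in(2)[OF w]] p_homogeneous[OF one_closed mem_e(1)[OF g a a]] one_H
  by (simp add: t_ip[OF w w] \<beta>_def)

lemma rho_zero: "v \<in> D \<Longrightarrow> rep_op \<rho> 0 v = \<zero>\<^bsub>W\<^esub>"
proof -
  assume v: "v \<in> D"
  have "0 \<in> graded_part A H" using A_part[OF one_H zero_in[OF one_closed]] .
  from R.hom_scaleC[OF this v, of 0] show ?thesis
    using K.smult_l_null[of "rep_op \<rho> 0 v"] D_in[OF R.op_closed[OF \<open>0 \<in> graded_part A H\<close> v]] by simp
qed

lemma form_null:
  assumes b: "b \<in> B" and v: "v \<in> D" and S: "S \<in> sets M" and z: "\<And>\<xi>. \<xi> \<in> S \<Longrightarrow> \<xi> b = 0"
    and nn: "0 \<le> Re (ip W (rep_op \<rho> b (E S v)) (E S v))"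
  shows "Re (ip W (rep_op \<rho> b (E S v)) (E S v)) = 0"
proof -
  let ?w = "E S v"
  have w: "?w \<in> D" by (rule E_in_D[OF S v])
  have bm: "(-1) *\<^sub>C b \<in> B" by (rule scale_in[OF one_closed b])
  have val: "\<xi> ((-1) *\<^sub>C b) = 0" if "\<xi> \<in> S" for \<xi>
    using X_char(3)[of \<xi> b "-1"] sets_M_sub[OF S] z[OF that] that b by auto
  have "0 \<le> Re (ip W (rep_op \<rho> ((-1) *\<^sub>C b) ?w) ?w)"
    by (rule form_nonneg[OF bm w S S.E_idem[OF S D_in[OF v]]]) (simp only: val zero_complex.simps order_refl)
  moreover have "ip W (rep_op \<rho> ((-1) *\<^sub>C b) ?w) ?w = - ip W (rep_op \<rho> b ?w) ?w"
    using R.hom_scaleC[OF A_part[OF one_H b] w, of "-1"] K.ip_smult_left[of "rep_op \<rho> b ?w" ?w "-1"]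
      D_in[OF w] D_in[OF rho_in[OF one_H b w]] by simp
  ultimately show ?thesis using nn by simp
qed

lemma rho_null:
  assumes h: "h \<in> H" and c: "c \<in> A h" and v: "v \<in> D" and S: "S \<in> sets M"
    and z: "\<And>\<xi>. \<xi> \<in> S \<Longrightarrow> \<xi> (star c * c) = 0"
  shows "rep_op \<rho> c (E S v) = \<zero>\<^bsub>W\<^esub>"
proof -
  note w = E_in_D[OF S v]
  have "(vnorm W (rep_op \<rho> c (E S v)))\<^sup>2 = 0"
    unfolding rho_norm_sq[OF h c w]
  proof (rule form_null[OF mem_e(1)[OF H_carrier[OF h] c c] v S])
    show "0 \<le> Re (ip W (rep_op \<rho> (star c * c) (E S v)) (E S v))"
      unfolding rho_norm_sq[OF h c w, symmetric] by simp
  qed (rule z)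
  then show ?thesis using K.vnorm_eq_zero[OF D_in[OF rho_in[OF h c w]]] by simp
qed

lemma t_null:
  assumes g: "g \<in> carrier G" and a: "a \<in> A g" and v: "v \<in> D" and S: "S \<in> sets M"
    and z: "\<And>\<xi>. \<xi> \<in> S \<Longrightarrow> \<xi> (star a * a) = 0"
  shows "t a (E S v) = \<zero>\<^bsub>V\<^esub>"
proof -
  note w = E_in_D[OF S v]
  have "(vnorm V (t a (E S v)))\<^sup>2 = 0"
    unfolding t_norm_sq[OF g a w]
  proof (rule form_null[OF mem_e(1)[OF g a a] v S])
    show "0 \<le> Re (ip W (rep_op \<rho> (star a * a) (E S v)) (E S v))"
      unfolding t_norm_sq[OF g a w, symmetric] by simp
  qed (rule z)
  then show ?thesis using V.vnorm_eq_zero[OF t_in(2)[OF w]] by simp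
qed

lemma E_split:
  assumes "S \<in> sets M" "S' \<in> sets M" "v \<in> D"
  shows "E S v = E (S \<inter> S') v \<oplus>\<^bsub>W\<^esub> E (S - S') v"
proof -
  have "S = (S \<inter> S') \<union> (S - S')" by auto
  then show ?thesis using S.E_Un[of "S \<inter> S'" "S - S'" v] assms D_in by auto
qed

lemma rho_agree:
  assumes h: "h \<in> H" and c: "c \<in> A h" and v: "v \<in> D" and S: "S \<in> sets M" "S' \<in> sets M"
    and eq: "\<And>\<xi>. \<xi> \<in> X \<Longrightarrow> \<xi> (star c * c) \<noteq> 0 \<Longrightarrow> \<xi> \<in> S \<longleftrightarrow> \<xi> \<in> S'"
  shows "rep_op \<rho> c (E S v) = rep_op \<rho> c (E S' v)"
proof -
  have *: "rep_op \<rho> c (E S v) = rep_op \<rho> c (E (S \<inter> S') v)"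
    if S: "S \<in> sets M" "S' \<in> sets M" and eq: "\<And>\<xi>. \<xi> \<in> X \<Longrightarrow> \<xi> (star c * c) \<noteq> 0 \<Longrightarrow> \<xi> \<in> S \<longleftrightarrow> \<xi> \<in> S'" for S S'
  proof -
    have i: "E (S \<inter> S') v \<in> D" "E (S - S') v \<in> D" using E_in_D S v by auto
    have "rep_op \<rho> c (E (S - S') v) = \<zero>\<^bsub>W\<^esub>"
      using S eq sets_M_sub[OF S(1)] by (intro rho_null[OF h c v]) auto
    then show ?thesis
      using E_split[OF S v] R.op_add[OF A_part[OF h c] i] D_in[OF rho_in[OF h c i(1)]] by simp
  qed
  show ?thesis using *[OF S eq] *[OF S(2,1)] eq by (simp add: Int_commute)
qed

text \<open>Only the characters with \<open>\<xi>(a\<^sup>*a) \<noteq> 0\<close> matter for the spectral part of a vector under \<open>t a\<close>.\<close>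

lemma t_agree:
  assumes g: "g \<in> carrier G" and a: "a \<in> A g" and v: "v \<in> D" and S: "S \<in> sets M" "S' \<in> sets M"
    and eq: "\<And>\<xi>. \<xi> \<in> X \<Longrightarrow> \<xi> (star a * a) \<noteq> 0 \<Longrightarrow> \<xi> \<in> S \<longleftrightarrow> \<xi> \<in> S'"
  shows "t a (E S v) = t a (E S' v)"
proof -
  have *: "t a (E S v) = t a (E (S \<inter> S') v)"
    if S: "S \<in> sets M" "S' \<in> sets M" and eq: "\<And>\<xi>. \<xi> \<in> X \<Longrightarrow> \<xi> (star a * a) \<noteq> 0 \<Longrightarrow> \<xi> \<in> S \<longleftrightarrow> \<xi> \<in> S'" for S S'
  proof -
    have i: "E (S \<inter> S') v \<in> D" "E (S - S') v \<in> D" using E_in_D S v by auto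
    have "t a (E (S - S') v) = \<zero>\<^bsub>V\<^esub>"
      using S eq sets_M_sub[OF S(1)] by (intro t_null[OF g a v]) auto
    then show ?thesis using E_split[OF S v] t_add_vec[OF i, of a] t_in(2)[OF i(1), of a] by simp
  qed
  show ?thesis using *[OF S eq] *[OF S(2,1)] eq by (simp add: Int_commute)
qed

text \<open>If \<open>inv g' \<otimes> g\<close> is in \<open>H\<close>, covariance of \<open>\<rho>\<close> moves the projection past \<open>\<rho>(b\<^sup>*a)\<close>, and the two pullbacks agree on the
  characters that matter. Otherwise both sides vanish.\<close>

lemma t_symmetric:
  assumes g: "g \<in> carrier G" "g' \<in> carrier G" and a: "a \<in> A g" and b: "b \<in> A g'" and v: "v \<in> D" and w: "w \<in> D"
    and \<Delta>: "\<Delta> \<in> sets M"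
  shows "ip V (t a (E (pull g \<Delta>) v)) (t b w) = ip V (t a v) (t b (E (pull g' \<Delta>) w))"
proof -
  let ?h = "inv g' \<otimes> g" and ?c = "star b * a"
  have hc: "?h \<in> carrier G" using g by simp
  have c: "?c \<in> A ?h" using mult_component[OF inv_closed[OF g(2)] g(1) star_component[OF g(2) b] a] .
  have Dl: "E (pull g \<Delta>) v \<in> D" "E (pull g' \<Delta>) w \<in> D" using E_in_D pull_sets g \<Delta> v w by auto
  have l: "ip V (t a v') (t b w') = ip W (rep_op \<rho> (p ?c) v') w'" if "v' \<in> D" "w' \<in> D" for v' w'
    using t_ip[OF that] by (simp add: \<beta>_def)
  show ?thesis
  proof (cases "?h \<in> H")
    case False
    then have "p ?c = 0" using p_homogeneous[OF hc c] by simp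
    then show ?thesis using l Dl v w by (simp add: rho_zero K.ip_zero_left D_in)
  next
    case True
    then have pc: "p ?c = ?c" using p_homogeneous[OF hc c] by simp
    note gs = pull_sets[OF g(1) \<Delta>] pull_sets[OF g(2) \<Delta>]
    have "ip V (t a v) (t b (E (pull g' \<Delta>) w)) = ip W (rep_op \<rho> ?c v) (E (pull g' \<Delta>) w)"
      using l[OF v Dl(2)] pc by simp
    also have "\<dots> = ip W (E (pull g' \<Delta>) (rep_op \<rho> ?c v)) w"
      using S.E_sym[OF gs(2) D_in[OF rho_in[OF True c v]] D_in[OF w]] by simp
    also have "E (pull g' \<Delta>) (rep_op \<rho> ?c v) = rep_op \<rho> ?c (E (pull ?h (pull g' \<Delta>)) v)"
      by (rule E_pull[OF True c gs(2) v])
    also have "\<dots> = rep_op \<rho> ?c (E (pull g \<Delta>) v)"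
      by (rule rho_agree[OF True c v pull_sets[OF hc gs(2)] gs(1)])
        (rule pull_star_mult[OF _ g a b])
    also have "ip W \<dots> w = ip V (t a (E (pull g \<Delta>) v)) (t b w)" using l[OF Dl(1) w] pc by simp
    finally show ?thesis by simp
  qed
qed

text \<open>The linear extension of \<open>t a v \<mapsto> t a (E (pull g \<Delta>) v)\<close>, as a relation: that it is single-valued
  is a consequence of its symmetry.\<close>

inductive Rel :: "('a \<Rightarrow> complex) set \<Rightarrow> _ \<Rightarrow> _ \<Rightarrow> bool" for \<Delta> where
  Rel_zero: "Rel \<Delta> \<zero>\<^bsub>V\<^esub> \<zero>\<^bsub>V\<^esub>"
| Rel_step: "Rel \<Delta> x y \<Longrightarrow> g \<in> carrier G \<Longrightarrow> a \<in> A g \<Longrightarrow> v \<in> D \<Longrightarrow>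
    Rel \<Delta> (x \<oplus>\<^bsub>V\<^esub> t a v) (y \<oplus>\<^bsub>V\<^esub> t a (E (pull g \<Delta>) v))"

lemma D0_zero: "\<zero>\<^bsub>V\<^esub> \<in> D0" using I.D_closed(1) by simp

lemma D0_add: "x \<in> D0 \<Longrightarrow> y \<in> D0 \<Longrightarrow> x \<oplus>\<^bsub>V\<^esub> y \<in> D0" using I.D_closed(2)[of x y] by simp

lemma D0_in: "x \<in> D0 \<Longrightarrow> x \<in> carrier V" by auto

lemma pull_in_D: "g \<in> carrier G \<Longrightarrow> \<Delta> \<in> sets M \<Longrightarrow> v \<in> D \<Longrightarrow> E (pull g \<Delta>) v \<in> D"
  using E_in_D pull_sets by blast

lemma Rel_in:
  assumes \<Delta>: "\<Delta> \<in> sets M" and "Rel \<Delta> x y" shows "x \<in> D0 \<and> y \<in> D0"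
  using assms(2)
  by (induction rule: Rel.induct) (auto simp: D0_zero intro!: D0_add t_in(1) pull_in_D[OF _ \<Delta>] simp del: image_iff)

lemma Rel_idem:
  assumes \<Delta>: "\<Delta> \<in> sets M" and "Rel \<Delta> x y" shows "Rel \<Delta> y y"
  using assms(2)
proof (induction rule: Rel.induct)
  case (Rel_step x y g a v)
  from Rel.Rel_step[OF Rel_step.IH Rel_step(2,3) pull_in_D[OF Rel_step(2) \<Delta> Rel_step(4)]]
  show ?case using S.E_idem[OF pull_sets[OF Rel_step(2) \<Delta>] D_in[OF Rel_step(4)]] by simp
qed (rule Rel_zero)

lemma Rel_total: "x \<in> D0 \<Longrightarrow> \<exists>y. Rel \<Delta> x y"
  by (induction x rule: D0_induct[consumes 1]) (auto intro: Rel.intros)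

lemma Rel_sym:
  assumes \<Delta>: "\<Delta> \<in> sets M" and r: "Rel \<Delta> x y" and r': "Rel \<Delta> x' y'"
  shows "ip V y x' = ip V x y'"
proof -
  have 1: "ip V (t a (E (pull g \<Delta>) v)) x' = ip V (t a v) y'"
    if g: "g \<in> carrier G" and a: "a \<in> A g" and v: "v \<in> D" for g a v
    using r'
  proof (induction rule: Rel.induct)
    case Rel_zero
    then show ?case using pull_in_D[OF g \<Delta> v] v by (simp add: V.ip_zero_right)
  next
    case (Rel_step x y g' b w)
    have "x \<in> carrier V" "y \<in> carrier V" using Rel_in[OF \<Delta> Rel_step(1)] D0_in by auto
    then show ?case
      using Rel_step t_symmetric[OF g Rel_step(2) a Rel_step(3) v Rel_step(4) \<Delta>] pull_in_D[OF _ \<Delta>] g v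
      by (simp add: V.ip_add_right)
  qed
  note c' = conjunct1[OF Rel_in[OF \<Delta> r'], THEN D0_in] conjunct2[OF Rel_in[OF \<Delta> r'], THEN D0_in]
  from r show ?thesis
  proof (induction rule: Rel.induct)
    case Rel_zero then show ?case using c' by (simp add: V.ip_zero_left)
  next
    case (Rel_step x y g a v)
    have "x \<in> carrier V" "y \<in> carrier V" using Rel_in[OF \<Delta> Rel_step(1)] D0_in by auto
    then show ?case
      using Rel_step 1[OF Rel_step(2-4)] pull_in_D[OF _ \<Delta>] c' by (simp add: V.ip_add_left)
  qed
qed

definition E_ind where
  "E_ind \<Delta> = (SOME P. orthogonal_projection V P \<and> (\<forall>x y. Rel \<Delta> x y \<longrightarrow> P x = y))"

lemma E_ind:
  assumes \<Delta>: "\<Delta> \<in> sets M"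
  shows E_ind_proj: "orthogonal_projection V (E_ind \<Delta>)" and E_ind_Rel: "Rel \<Delta> x y \<Longrightarrow> E_ind \<Delta> x = y"
proof -
  have "\<exists>P. orthogonal_projection V P \<and> (\<forall>x y. Rel \<Delta> x y \<longrightarrow> P x = y)"
    by (rule V.dense_relation_projection[OF J_dense Rel_total Rel_in[OF \<Delta>] Rel_sym[OF \<Delta>] Rel_idem[OF \<Delta>]]) blast+
  from someI_ex[OF this] show "orthogonal_projection V (E_ind \<Delta>)" "Rel \<Delta> x y \<Longrightarrow> E_ind \<Delta> x = y"
    unfolding E_ind_def by blast+
qed

lemma E_ind_D0: "\<Delta> \<in> sets M \<Longrightarrow> x \<in> D0 \<Longrightarrow> E_ind \<Delta> x \<in> D0"
  using Rel_total[of x \<Delta>] E_ind_Rel Rel_in by blast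

lemma E_ind_t:
  assumes "\<Delta> \<in> sets M" "g \<in> carrier G" "a \<in> A g" "v \<in> D"
  shows "E_ind \<Delta> (t a v) = t a (E (pull g \<Delta>) v)"
proof -
  have "Rel \<Delta> (\<zero>\<^bsub>V\<^esub> \<oplus>\<^bsub>V\<^esub> t a v) (\<zero>\<^bsub>V\<^esub> \<oplus>\<^bsub>V\<^esub> t a (E (pull g \<Delta>) v))"
    using assms by (intro Rel_step Rel_zero)
  then show ?thesis using E_ind_Rel[OF assms(1)] pull_in_D[OF assms(2,1,4)] assms(4) by simp
qed

lemmas E_ind_add = V.proj_add[OF E_ind_proj]
lemmas E_ind_zero = V.proj_zero[OF E_ind_proj]
lemmas E_ind_in = V.proj_in[OF E_ind_proj]

text \<open>For the tails of a disjoint family, \<open>\<parallel>t a (E S v)\<parallel>\<^sup>2 \<le> \<parallel>\<rho>(a\<^sup>*a)v\<parallel> \<parallel>E(S)v\<parallel>\<close> reduces countable additivity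
  to that of \<open>E\<close>.\<close>

lemma E_ind_spectral: "spectral_measure V M E_ind"
proof (rule V.spectral_measureI[OF E_ind_proj J_dense])
  show "E_ind (space M) x = x" if "x \<in> D0" for x
    using that
  proof (induction x rule: D0_induct[consumes 1])
    case 1 then show ?case by (simp add: E_ind_zero X_sets)
  next
    case (2 x g a v)
    have "E_ind X (t a v) = t a (E (pull g X) v)" by (rule E_ind_t[OF X_sets 2(2-4)])
    also have "\<dots> = t a (E X v)"
      using 2 by (intro t_agree[OF 2(2-4)] pull_sets X_sets) (auto simp: pull_X intro: DomI)
    also have "E X v = v" using S.E_space[OF D_in[OF 2(4)]] by simp
    finally show ?case using 2 D0_in by (simp add: E_ind_add X_sets)
  qed
next
  fix P Q x assume PQ: "P \<in> sets M" "Q \<in> sets M" "P \<inter> Q = {}" and x: "x \<in> D0"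
  have PQs: "P \<union> Q \<in> sets M" using PQ by auto
  show "E_ind (P \<union> Q) x = E_ind P x \<oplus>\<^bsub>V\<^esub> E_ind Q x"
    using x
  proof (induction x rule: D0_induct[consumes 1])
    case 1 then show ?case by (simp add: E_ind_zero PQ PQs)
  next
    case (2 x g a v)
    note s = pull_sets[OF 2(2) PQ(1)] pull_sets[OF 2(2) PQ(2)]
    have d: "pull g P \<inter> pull g Q = {}" using PQ(3) by (simp add: pull_simps)
    have "E_ind (P \<union> Q) (t a v) = t a (E (pull g P) v \<oplus>\<^bsub>W\<^esub> E (pull g Q) v)"
      using E_ind_t[OF PQs 2(2-4)] S.E_Un[OF s d D_in[OF 2(4)]] by (simp add: pull_simps)
    also have "\<dots> = E_ind P (t a v) \<oplus>\<^bsub>V\<^esub> E_ind Q (t a v)"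
      using t_add_vec[OF E_in_D[OF s(1) 2(4)] E_in_D[OF s(2) 2(4)]] E_ind_t[OF PQ(1) 2(2-4)] E_ind_t[OF PQ(2) 2(2-4)] by simp
    finally show ?case
      using 2 PQ PQs D0_in[OF 2(1)] t_in(2)[OF 2(4), of a]
      by (simp add: E_ind_add E_ind_in V.M.a_ac)
  qed
next
  fix F :: "nat \<Rightarrow> _" and x assume F: "range F \<subseteq> sets M" "disjoint_family F" and x: "x \<in> D0"
  let ?R = "\<lambda>n. \<Union>i\<in>{n..}. F i"
  have Rs: "?R n \<in> sets M" for n using F(1) by auto
  show "(\<lambda>n. vnorm V (E_ind (?R n) x)) \<longlonglongrightarrow> 0"
    using x
  proof (induction x rule: D0_induct[consumes 1])
    case 1 then show ?case by (simp add: E_ind_zero Rs)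
  next
    case (2 x g a v)
    let ?w = "\<lambda>n. E (pull g (?R n)) v" and ?b = "star a * a"
    have ps: "pull g (?R n) \<in> sets M" for n by (rule pull_sets[OF 2(2) Rs])
    have w: "?w n \<in> D" for n by (rule E_in_D[OF ps 2(4)])
    have b: "?b \<in> B" by (rule mem_e(1)[OF 2(2,3,3)])
    have bv: "rep_op \<rho> ?b u \<in> D" if "u \<in> D" for u by (rule rho_in[OF one_H b that])
    have w0: "(\<lambda>n. vnorm W (?w n)) \<longlonglongrightarrow> 0"
    proof -
      have "range (\<lambda>i. pull g (F i)) \<subseteq> sets M" using pull_sets[OF 2(2)] F(1) by auto
      moreover have "disjoint_family (\<lambda>i. pull g (F i))"
        using F(2) by (auto simp: disjoint_family_on_def pull_def)
      ultimately show ?thesis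
        using S.tail_to_zero[of "\<lambda>i. pull g (F i)" v] D_in[OF 2(4)] by (simp add: pull_simps)
    qed
    have bd: "(vnorm V (t a (?w n)))\<^sup>2 \<le> vnorm W (rep_op \<rho> ?b v) * vnorm W (?w n)" for n
    proof -
      have "(vnorm V (t a (?w n)))\<^sup>2 \<le> cmod (ip W (rep_op \<rho> ?b (?w n)) (?w n))"
        unfolding t_norm_sq[OF 2(2,3) w] by (rule complex_Re_le_cmod)
      also have "\<dots> \<le> vnorm W (rep_op \<rho> ?b (?w n)) * vnorm W (?w n)"
        by (rule K.cauchy_schwarz[OF D_in[OF bv[OF w]] D_in[OF w]])
      also have "rep_op \<rho> ?b (?w n) = E (pull g (?R n)) (rep_op \<rho> ?b v)"
        by (rule E_B[OF b ps 2(4), symmetric])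
      also have "vnorm W \<dots> * vnorm W (?w n) \<le> vnorm W (rep_op \<rho> ?b v) * vnorm W (?w n)"
        using S.E_norm_le[OF ps D_in[OF bv[OF 2(4)]]] D_in[OF w] by (intro mult_right_mono) auto
      finally show ?thesis .
    qed
    have "(\<lambda>n. (vnorm V (t a (?w n)))\<^sup>2) \<longlonglongrightarrow> 0"
    proof (rule tendsto_sandwich[OF _ _ tendsto_const])
      show "(\<lambda>n. vnorm W (rep_op \<rho> ?b v) * vnorm W (?w n)) \<longlonglongrightarrow> 0"
        using tendsto_mult_right_zero[OF w0] .
    qed (use bd in auto)
    from tendsto_real_sqrt[OF this] have t0: "(\<lambda>n. vnorm V (t a (?w n))) \<longlonglongrightarrow> 0"
      using t_in(2)[OF w] by simp
    have "vnorm V (E_ind (?R n) (x \<oplus>\<^bsub>V\<^esub> t a v)) \<le> vnorm V (E_ind (?R n) x) + vnorm V (t a (?w n))" for n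
      using E_ind_t[OF Rs 2(2-4), of n] E_ind_add[OF Rs D0_in[OF 2(1)] t_in(2)[OF 2(4)], of n a]
        V.vnorm_triangle[OF E_ind_in[OF Rs D0_in[OF 2(1)]] t_in(2)[OF w], of n a n] by simp
    moreover have "E_ind (?R n) (x \<oplus>\<^bsub>V\<^esub> t a v) \<in> carrier V" for n
      using D0_in[OF 2(1)] t_in(2)[OF 2(4)] by (intro E_ind_in[OF Rs]) simp
    ultimately show ?case
      by (intro tendsto_sandwich[OF _ _ tendsto_const tendsto_add_zero[OF 2(5) t0]]) auto
  qed
qed

sublocale P: spectral_family V M E_ind
  by (intro spectral_family.intro V.hilbert_space_axioms spectral_family_axioms.intro E_ind_spectral)

end

section \<open>Covariance and integrability of the induced representation\<close>

lemma add_le_double: "k \<le> n + m \<Longrightarrow> 0 \<le> m \<Longrightarrow> n + k \<le> 2 * (n + m)" for n m k :: real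
  by simp

context well_behaved_induction
begin

lemma act_set_sets: "g \<in> carrier G \<Longrightarrow> \<Delta> \<in> sets M \<Longrightarrow> act_set G A g \<Delta> \<in> sets M"
  by (simp add: act_set_eq_pull pull_sets)

lemma op0_in: "x \<in> D0 \<Longrightarrow> op0 a x \<in> D0"
  using I.op_in[of x a] by simp

lemma op0_add: "x \<in> D0 \<Longrightarrow> y \<in> D0 \<Longrightarrow> op0 a (x \<oplus>\<^bsub>V\<^esub> y) = op0 a x \<oplus>\<^bsub>V\<^esub> op0 a y"
  using I.op_add[of a x y] by simp

lemma op0_zero: "op0 a \<zero>\<^bsub>V\<^esub> = \<zero>\<^bsub>V\<^esub>"
  using op0_add[OF D0_zero D0_zero, of a] D0_in[OF op0_in[OF D0_zero, of a]] by simp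

text \<open>On \<open>t b v\<close> both sides apply \<open>t (a * b)\<close> to spectral parts of \<open>v\<close> for two sets that agree on the
  characters that matter for \<open>a * b\<close>.\<close>

lemma E_ind_commute_D0:
  assumes g: "g \<in> carrier G" and a: "a \<in> A g" and \<Delta>: "\<Delta> \<in> sets M" and x: "x \<in> D0"
  shows "op0 a (E_ind \<Delta> x) = E_ind (act_set G A g \<Delta>) (op0 a x)"
  using x
proof (induction x rule: D0_induct[consumes 1])
  case 1
  then show ?case by (simp add: E_ind_zero \<Delta> op0_zero act_set_sets[OF g \<Delta>])
next
  case (2 x k b v)
  note \<Delta>' = act_set_sets[OF g \<Delta>]
  note gk = m_closed[OF g 2(2)]
  have ab: "a * b \<in> A (g \<otimes> k)" by (rule mult_component[OF g 2(2) a 2(3)])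
  have "op0 a (E_ind \<Delta> (t b v)) = t (a * b) (E (pull k \<Delta>) v)"
    using E_ind_t[OF \<Delta> 2(2-4)] \<pi>0_t[OF pull_in_D[OF 2(2) \<Delta> 2(4)]] by simp
  also have "\<dots> = t (a * b) (E (pull (g \<otimes> k) (act_set G A g \<Delta>)) v)"
    by (rule t_agree[OF gk ab 2(4) pull_sets[OF 2(2) \<Delta>] pull_sets[OF gk \<Delta>'], symmetric,
          OF _ , THEN sym]) (rule pull_left_mult[OF _ g 2(2) a 2(3), symmetric])
  also have "\<dots> = E_ind (act_set G A g \<Delta>) (op0 a (t b v))"
    using E_ind_t[OF \<Delta>' gk ab 2(4)] \<pi>0_t[OF 2(4)] by simp
  finally have *: "op0 a (E_ind \<Delta> (t b v)) = E_ind (act_set G A g \<Delta>) (op0 a (t b v))" .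
  note tv = t_in(1)[OF 2(4), of b]
  have "op0 a (E_ind \<Delta> (x \<oplus>\<^bsub>V\<^esub> t b v)) = op0 a (E_ind \<Delta> x) \<oplus>\<^bsub>V\<^esub> op0 a (E_ind \<Delta> (t b v))"
    using E_ind_add[OF \<Delta> D0_in[OF 2(1)] D0_in[OF tv]] op0_add[OF E_ind_D0[OF \<Delta> 2(1)] E_ind_D0[OF \<Delta> tv]] by simp
  also have "\<dots> = E_ind (act_set G A g \<Delta>) (op0 a (x \<oplus>\<^bsub>V\<^esub> t b v))"
    using 2(5) * op0_add[OF 2(1) tv] E_ind_add[OF \<Delta>' D0_in[OF op0_in[OF 2(1)]] D0_in[OF op0_in[OF tv]]] by simp
  finally show ?case .
qed

lemma act_set_one: "\<Delta> \<in> sets M \<Longrightarrow> act_set G A \<one> \<Delta> = \<Delta>"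
  using pull_one[OF sets_M_sub] by (simp add: act_set_eq_pull)

lemma E_ind_B_D0: "b \<in> B \<Longrightarrow> \<Delta> \<in> sets M \<Longrightarrow> x \<in> D0 \<Longrightarrow> op0 b (E_ind \<Delta> x) = E_ind \<Delta> (op0 b x)"
  using E_ind_commute_D0[OF one_closed] act_set_one by simp

text \<open>The image under a projection of a filter that exhibits \<open>x\<close> exhibits the projection of \<open>x\<close>. Convergence
  of the values is clear for homogeneous elements and passes to sums.\<close>

lemma E_ind_closure:
  assumes \<Delta>: "\<Delta> \<in> sets M" and x: "x \<in> rep_dom cl"
  shows "E_ind \<Delta> x \<in> rep_dom cl"
    "g \<in> carrier G \<Longrightarrow> a \<in> A g \<Longrightarrow> rep_op cl a (E_ind \<Delta> x) = E_ind (act_set G A g \<Delta>) (rep_op cl a x)"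
proof -
  obtain F where F: "I.approached F x (\<lambda>a. rep_op cl a x)" using I.closure_approached[OF x] by blast
  have D0F: "eventually (\<lambda>u. u \<in> D0) F" and Fb: "F \<noteq> bot" using F by (auto simp: I.approached_def)
  have hom: "V.conv (\<lambda>u. op0 a (E_ind \<Delta> u)) (E_ind (act_set G A g \<Delta>) (rep_op cl a x)) F"
    if g: "g \<in> carrier G" and a: "a \<in> A g" for g a
  proof -
    have "V.conv (\<lambda>u. E_ind (act_set G A g \<Delta>) (op0 a u)) (E_ind (act_set G A g \<Delta>) (rep_op cl a x)) F"
      using F by (intro V.proj_conv[OF E_ind_proj[OF act_set_sets[OF g \<Delta>]]]) (auto simp: I.approached_def)
    moreover have "eventually (\<lambda>u. E_ind (act_set G A g \<Delta>) (op0 a u) = op0 a (E_ind \<Delta> u)) F"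
      using D0F by eventually_elim (simp add: E_ind_commute_D0[OF g a \<Delta>])
    ultimately show ?thesis by (rule limitin_transform_eventually[rotated])
  qed
  have "\<exists>z. V.conv (\<lambda>u. op0 a (E_ind \<Delta> u)) z F" for a
  proof (induction a rule: graded_induct)
    case 1 then show ?case using hom[OF one_closed zero_in[OF one_closed]] by blast
  next
    case (2 a b)
    then obtain z z' where z: "V.conv (\<lambda>u. op0 a (E_ind \<Delta> u)) z F" "V.conv (\<lambda>u. op0 b (E_ind \<Delta> u)) z' F" by blast
    have "V.conv (\<lambda>u. op0 a (E_ind \<Delta> u) \<oplus>\<^bsub>V\<^esub> op0 b (E_ind \<Delta> u)) (z \<oplus>\<^bsub>V\<^esub> z') F" by (rule V.conv_add[OF z])
    moreover have "eventually (\<lambda>u. op0 a (E_ind \<Delta> u) \<oplus>\<^bsub>V\<^esub> op0 b (E_ind \<Delta> u) = op0 (a + b) (E_ind \<Delta> u)) F"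
      using D0F
    proof eventually_elim
      case (elim u)
      then show ?case using I.hom_add[of a b "E_ind \<Delta> u"] E_ind_D0[OF \<Delta> elim] by simp
    qed
    ultimately have "V.conv (\<lambda>u. op0 (a + b) (E_ind \<Delta> u)) (z \<oplus>\<^bsub>V\<^esub> z') F"
      by (rule limitin_transform_eventually[rotated])
    then show ?case by blast
  qed (use hom in blast)
  then obtain z where z: "\<And>a. V.conv (\<lambda>u. op0 a (E_ind \<Delta> u)) (z a) F" by metis
  have "I.approached (filtermap (E_ind \<Delta>) F) (E_ind \<Delta> x) z"
  proof (rule I.approached_map[OF F])
    show "E_ind \<Delta> u \<in> rep_dom \<pi>0" if "u \<in> rep_dom \<pi>0" for u using E_ind_D0[OF \<Delta>] that by simp
    have "V.conv (\<lambda>u. E_ind \<Delta> u) (E_ind \<Delta> x) F"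
      using F by (intro V.proj_conv[OF E_ind_proj[OF \<Delta>]]) (simp add: I.approached_def)
    then show "limitin (vtop (rep_space \<pi>0)) (E_ind \<Delta>) (E_ind \<Delta> x) F" by simp
    show "limitin (vtop (rep_space \<pi>0)) (\<lambda>u. op0 a (E_ind \<Delta> u)) (z a) F" for a using z by simp
  qed
  note res = I.closure_op_eq[OF this]
  show "E_ind \<Delta> x \<in> rep_dom cl" by (rule res(1))
  show "rep_op cl a (E_ind \<Delta> x) = E_ind (act_set G A g \<Delta>) (rep_op cl a x)" if "g \<in> carrier G" "a \<in> A g"
    unfolding res(2) using V.conv_unique[OF z hom[OF that] Fb] .
qed

lemma power_in: "b \<in> B \<Longrightarrow> b ^ k \<in> B"
  by (induction k) (auto intro: one_in mem_e(3)[OF one_closed])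

lemma X_power: "\<xi> \<in> X \<Longrightarrow> b \<in> B \<Longrightarrow> \<xi> (b ^ k) = \<xi> b ^ k"
  by (induction k) (auto simp: X_one X_char(2) power_in)

lemma star_power: "star (s :: 'a) = s \<Longrightarrow> star (s ^ k) = s ^ k"
  by (induction k) (auto simp: star_mult power_commutes)

text \<open>The difference of the squares of both sides is the form of \<open>\<rho>\<close> at an element of trivial degree.
  By \<open>conj_formula\<close> this element takes on \<open>pull g \<Delta>\<close> the values
  \<open>\<xi>(a\<^sup>*a) (q\<^sup>2\<^sup>k - \<xi>\<^sup>g(s)\<^sup>2\<^sup>k) \<ge> 0\<close>.\<close>

lemma generator_bound:
  assumes g: "g \<in> carrier G" and a: "a \<in> A g" and v: "v \<in> D" and \<Delta>: "\<Delta> \<in> sets M"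
    and s: "s \<in> B" "star s = s" and sb: "\<And>\<xi>. \<xi> \<in> \<Delta> \<Longrightarrow> \<exists>r. \<xi> s = complex_of_real r \<and> 0 \<le> r \<and> r \<le> q"
    and q: "0 \<le> q"
  shows "vnorm V (t (s ^ k * a) (E (pull g \<Delta>) v)) \<le> q ^ k * vnorm V (t a (E (pull g \<Delta>) v))"
proof -
  let ?S = "pull g \<Delta>" let ?w = "E ?S v"
  note S = pull_sets[OF g \<Delta>] and w = pull_in_D[OF g \<Delta> v]
  have sk: "s ^ k \<in> B" by (rule power_in[OF s(1)])
  have sa: "s ^ k * a \<in> A g" by (rule mem_e(3)[OF g sk a])
  let ?b1 = "star a * a" and ?b2 = "star (s ^ k * a) * (s ^ k * a)"
  have b1: "?b1 \<in> B" and b2: "?b2 \<in> B" using mem_e(1)[OF g] a sa by auto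
  have skk: "s ^ k * s ^ k \<in> B" by (rule mem_e(3)[OF one_closed sk sk])
  let ?Q = "complex_of_real (q ^ k * q ^ k)"
  let ?c = "?Q *\<^sub>C ?b1 + (-1) *\<^sub>C ?b2"
  have cm: "?c \<in> B" by (intro add_in scale_in one_closed b1 b2)
  have "0 \<le> Re (ip W (rep_op \<rho> ?c ?w) ?w)"
  proof (rule form_nonneg[OF cm w S S.E_idem[OF S D_in[OF v]]])
    fix \<xi> assume "\<xi> \<in> ?S"
    then have d: "\<xi> \<in> Dom g" "act g \<xi> \<in> \<Delta>" by (auto simp: pull_def)
    have x: "\<xi> \<in> X" by (rule Dom_X[OF d(1)])
    have x': "act g \<xi> \<in> X" by (rule act_in_X[OF d(1) g])
    obtain r where r: "act g \<xi> s = complex_of_real r" "0 \<le> r" "r \<le> q" using sb[OF d(2)] by blast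
    obtain n where n: "\<xi> ?b1 = complex_of_real n" "0 \<le> n"
      using X_square[OF x g a] by (auto elim: nonneg_Reals_cases)
    have "?b2 = star a * ((s ^ k * s ^ k) * a)"
      by (simp add: star_mult star_power[OF s(2)] mult.assoc)
    then have "\<xi> ?b2 = \<xi> ?b1 * act g \<xi> (s ^ k * s ^ k)"
      using conj_formula[OF d(1) g a skk] by simp
    also have "act g \<xi> (s ^ k * s ^ k) = complex_of_real (r ^ k * r ^ k)"
      using X_char(2)[OF x' sk sk] X_power[OF x' s(1)] r(1) by simp
    finally have 2: "\<xi> ?b2 = complex_of_real (n * (r ^ k * r ^ k))" using n(1) by simp
    have "\<xi> ?c = ?Q * \<xi> ?b1 + (-1) * \<xi> ?b2"
      using X_char(1)[OF x scale_in[OF one_closed b1] scale_in[OF one_closed b2], of ?Q "-1"]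
        X_char(3)[OF x b1, of ?Q] X_char(3)[OF x b2, of "-1"] by (simp only:)
    also have "\<dots> = complex_of_real (n * (q ^ k * q ^ k) - n * (r ^ k * r ^ k))"
      unfolding n(1) 2 by simp
    finally have "Re (\<xi> ?c) = n * (q ^ k * q ^ k - r ^ k * r ^ k)" by (simp add: right_diff_distrib)
    moreover have "r ^ k * r ^ k \<le> q ^ k * q ^ k"
      using r q by (intro mult_mono power_mono) auto
    ultimately show "0 \<le> Re (\<xi> ?c)" using n(2) by simp
  qed
  also have "ip W (rep_op \<rho> ?c ?w) ?w = ?Q * ip W (rep_op \<rho> ?b1 ?w) ?w - ip W (rep_op \<rho> ?b2 ?w) ?w"
  proof -
    note pt = A_part[OF one_H]
    note i = D_in[OF rho_in[OF one_H b1 w]] D_in[OF rho_in[OF one_H b2 w]] D_in[OF w]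
    have "rep_op \<rho> ?c ?w = ?Q \<odot>\<^bsub>W\<^esub> rep_op \<rho> ?b1 ?w \<oplus>\<^bsub>W\<^esub> (-1) \<odot>\<^bsub>W\<^esub> rep_op \<rho> ?b2 ?w"
      using R.hom_add[OF pt[OF scale_in[OF one_closed b1]] pt[OF scale_in[OF one_closed b2]] w]
        R.hom_scaleC[OF pt[OF b1] w] R.hom_scaleC[OF pt[OF b2] w] by (simp only:)
    then show ?thesis using i by (simp add: K.ip_add_left K.ip_smult_left)
  qed
  finally have "(vnorm V (t (s ^ k * a) ?w))\<^sup>2 \<le> (q ^ k * q ^ k) * (vnorm V (t a ?w))\<^sup>2"
    unfolding t_norm_sq[OF g a w] t_norm_sq[OF g sa w] by simp
  then have "(vnorm V (t (s ^ k * a) ?w))\<^sup>2 \<le> (q ^ k * vnorm V (t a ?w))\<^sup>2"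
    by (simp add: power2_eq_square mult_ac)
  then show ?thesis using q t_in(2)[OF w] by (rule_tac power2_le_imp_le) auto
qed

text \<open>The bound for single vectors \<open>t a v\<close> survives in sums at the price of a constant.\<close>

lemma D0_growth:
  assumes \<Delta>: "\<Delta> \<in> sets M" and s: "s \<in> B" "star s = s"
    and sb: "\<And>\<xi>. \<xi> \<in> \<Delta> \<Longrightarrow> \<exists>r. \<xi> s = complex_of_real r \<and> 0 \<le> r \<and> r \<le> q" and q: "0 \<le> q"
    and x: "x \<in> D0"
  shows "\<exists>C. \<forall>k. vnorm V (op0 (s ^ k) (E_ind \<Delta> x)) \<le> C * q ^ k"
  using x
proof (induction x rule: D0_induct[consumes 1])
  case 1
  then show ?case by (intro exI[of _ 0]) (simp add: E_ind_zero \<Delta> op0_zero)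
next
  case (2 x g a v)
  then obtain C where C: "\<And>k. vnorm V (op0 (s ^ k) (E_ind \<Delta> x)) \<le> C * q ^ k" by blast
  let ?w = "E (pull g \<Delta>) v"
  note w = pull_in_D[OF 2(2) \<Delta> 2(4)]
  note tv = t_in(1)[OF 2(4), of a]
  have "vnorm V (op0 (s ^ k) (E_ind \<Delta> (x \<oplus>\<^bsub>V\<^esub> t a v))) \<le> (C + vnorm V (t a ?w)) * q ^ k" for k
  proof -
    have "op0 (s ^ k) (E_ind \<Delta> (x \<oplus>\<^bsub>V\<^esub> t a v)) = op0 (s ^ k) (E_ind \<Delta> x) \<oplus>\<^bsub>V\<^esub> t (s ^ k * a) ?w"
      using E_ind_add[OF \<Delta> D0_in[OF 2(1)] D0_in[OF tv]] op0_add[OF E_ind_D0[OF \<Delta> 2(1)] E_ind_D0[OF \<Delta> tv]]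
        E_ind_t[OF \<Delta> 2(2-4)] \<pi>0_t[OF w] by simp
    then have "vnorm V (op0 (s ^ k) (E_ind \<Delta> (x \<oplus>\<^bsub>V\<^esub> t a v))) \<le>
        vnorm V (op0 (s ^ k) (E_ind \<Delta> x)) + vnorm V (t (s ^ k * a) ?w)"
      using V.vnorm_triangle[OF D0_in[OF op0_in[OF E_ind_D0[OF \<Delta> 2(1)]]] t_in(2)[OF w]] by simp
    also have "\<dots> \<le> C * q ^ k + q ^ k * vnorm V (t a ?w)"
      by (rule add_mono[OF C generator_bound[OF 2(2-4) \<Delta> s _ q]]) (rule sb)
    finally show ?thesis by (simp add: algebra_simps)
  qed
  then show ?case by blast
qed

lemma op0_one: "x \<in> D0 \<Longrightarrow> op0 1 x = x"
proof (induction x rule: D0_induct[consumes 1])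
  case (2 x g a v)
  then show ?case using op0_add[OF 2(1) t_in(1)[OF 2(4)]] \<pi>0_t[OF 2(4)] by simp
qed (rule op0_zero)

lemma op0_mult: "x \<in> D0 \<Longrightarrow> op0 (a * b) x = op0 a (op0 b x)"
  using I.hom_mult[of a b x] by simp

lemma op0_star: "x \<in> D0 \<Longrightarrow> y \<in> D0 \<Longrightarrow> ip V (op0 a x) y = ip V x (op0 (star a) y)"
  using I.hom_star[of a x y] by simp

text \<open>The constant of \<open>D0_growth\<close> is removed by logarithmic convexity: with \<open>s = c\<^sup>*c\<close> the numbers
  \<open>r k = \<parallel>\<pi>(s\<^sup>k) y\<parallel>\<close> satisfy \<open>r(k+1)\<^sup>2 \<le> r(k) r(k+2)\<close>, because \<open>\<pi>(s)\<close> is symmetric.\<close>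

lemma D0_bound:
  assumes \<Delta>: "\<Delta> \<in> sets M" and c: "c \<in> B" and cb: "\<And>\<xi>. \<xi> \<in> \<Delta> \<Longrightarrow> cmod (\<xi> c) \<le> \<epsilon>" and e: "0 \<le> \<epsilon>"
    and x: "x \<in> D0"
  shows "vnorm V (op0 c (E_ind \<Delta> x)) \<le> \<epsilon> * vnorm V (E_ind \<Delta> x)"
proof -
  let ?y = "E_ind \<Delta> x" and ?s = "star c * c"
  have y: "?y \<in> D0" by (rule E_ind_D0[OF \<Delta> x])
  have s: "?s \<in> B" "star ?s = ?s" using mem_e(1)[OF one_closed c c] by (simp_all add: star_mult star_star)
  have sb: "\<exists>r. \<xi> ?s = complex_of_real r \<and> 0 \<le> r \<and> r \<le> \<epsilon>\<^sup>2" if "\<xi> \<in> \<Delta>" for \<xi>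
  proof -
    have x: "\<xi> \<in> X" using sets_M_sub[OF \<Delta>] that by auto
    have sc: "star c \<in> B" using star_component[OF one_closed c] by simp
    have "\<xi> ?s = \<xi> c * cnj (\<xi> c)"
      using X_char(2)[OF x sc c] X_char(4)[OF x c] by (simp add: mult.commute)
    also have "\<dots> = complex_of_real ((cmod (\<xi> c))\<^sup>2)" by (rule complex_norm_square[symmetric])
    finally have "\<xi> ?s = complex_of_real ((cmod (\<xi> c))\<^sup>2)" .
    then show ?thesis using cb[OF that] by (intro exI[of _ "(cmod (\<xi> c))\<^sup>2"]) (auto intro: power_mono)
  qed
  define r where "r k = vnorm V (op0 (?s ^ k) ?y)" for k
  have o: "op0 a ?y \<in> D0" "op0 a ?y \<in> carrier V" for a using op0_in[OF y, of a] by auto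
  have "\<exists>C. \<forall>k. vnorm V (op0 (?s ^ k) ?y) \<le> C * (\<epsilon>\<^sup>2) ^ k"
    by (rule D0_growth[OF \<Delta> s]) (erule sb, simp, rule x)
  then obtain C where C: "\<And>k. r k \<le> C * (\<epsilon>\<^sup>2) ^ k" unfolding r_def by blast
  have "r 1 \<le> \<epsilon>\<^sup>2 * r 0"
  proof (rule log_convex_growth[OF _ _ C])
    show "0 \<le> r k" for k using o by (simp add: r_def)
    show "(r (Suc k))\<^sup>2 \<le> r k * r (Suc (Suc k))" for k
    proof -
      have "(r (Suc k))\<^sup>2 = Re (ip V (op0 (?s ^ Suc k) ?y) (op0 (?s ^ Suc k) ?y))"
        unfolding r_def by (rule V.vnorm_sq[OF o(2)])
      also have "op0 (?s ^ Suc k) ?y = op0 ?s (op0 (?s ^ k) ?y)" using op0_mult[OF y, of ?s "?s ^ k"] by simp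
      also have "ip V (op0 ?s (op0 (?s ^ k) ?y)) (op0 ?s (op0 (?s ^ k) ?y)) =
          ip V (op0 (?s ^ k) ?y) (op0 ?s (op0 ?s (op0 (?s ^ k) ?y)))"
        using op0_star[OF o(1) op0_in[OF o(1)], of ?s "?s ^ k" ?s "?s ^ k"] s(2) by simp
      also have "op0 ?s (op0 ?s (op0 (?s ^ k) ?y)) = op0 (?s ^ Suc (Suc k)) ?y"
        using op0_mult[OF y, of ?s "?s ^ k"] op0_mult[OF y, of ?s "?s ^ Suc k"] by simp
      also have "Re (ip V (op0 (?s ^ k) ?y) (op0 (?s ^ Suc (Suc k)) ?y)) \<le> cmod (ip V (op0 (?s ^ k) ?y) (op0 (?s ^ Suc (Suc k)) ?y))"
        by (rule complex_Re_le_cmod)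
      also have "\<dots> \<le> r k * r (Suc (Suc k))" unfolding r_def by (rule V.cauchy_schwarz[OF o(2) o(2)])
      finally show ?thesis .
    qed
  qed simp
  then have 1: "vnorm V (op0 ?s ?y) \<le> \<epsilon>\<^sup>2 * vnorm V ?y" by (simp add: r_def op0_one[OF y])
  have "(vnorm V (op0 c ?y))\<^sup>2 = Re (ip V (op0 c ?y) (op0 c ?y))" by (rule V.vnorm_sq[OF o(2)])
  also have "ip V (op0 c ?y) (op0 c ?y) = ip V ?y (op0 ?s ?y)"
    using op0_star[OF y o(1), of c c] op0_mult[OF y, of "star c" c] by simp
  also have "Re \<dots> \<le> vnorm V ?y * vnorm V (op0 ?s ?y)"
    by (rule order_trans[OF complex_Re_le_cmod V.cauchy_schwarz[OF D0_in[OF y] o(2)]])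
  also have "\<dots> \<le> vnorm V ?y * (\<epsilon>\<^sup>2 * vnorm V ?y)"
    using 1 D0_in[OF y] by (intro mult_left_mono) auto
  finally have "(vnorm V (op0 c ?y))\<^sup>2 \<le> (\<epsilon> * vnorm V ?y)\<^sup>2" by (simp add: power2_eq_square mult_ac)
  then show ?thesis using e D0_in[OF y] by (rule_tac power2_le_imp_le) auto
qed

text \<open>Apply \<open>D0_bound\<close> to \<open>b - c\<close>.\<close>

lemma D0_locally_eigen:
  assumes b: "b \<in> B" and x: "x \<in> D0"
  shows "P.locally_eigen (\<lambda>\<xi>. \<xi> b) x (op0 b x)"
  unfolding P.locally_eigen_def
proof (intro conjI ballI allI impI)
  show "x \<in> carrier V" "op0 b x \<in> carrier V" using D0_in x op0_in by auto
  fix \<Delta> c and \<epsilon> :: real assume \<Delta>: "\<Delta> \<in> sets M" and e: "0 \<le> \<epsilon>" and bd: "\<forall>\<xi>\<in>\<Delta>. cmod (\<xi> b - c) \<le> \<epsilon>"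
  let ?y = "E_ind \<Delta> x" and ?c = "b + (- c) *\<^sub>C 1"
  have y: "?y \<in> D0" by (rule E_ind_D0[OF \<Delta> x])
  have one: "(- c) *\<^sub>C 1 \<in> B" by (rule scale_in[OF one_closed one_in])
  have cB: "?c \<in> B" by (rule add_in[OF one_closed b one])
  have val: "\<xi> ?c = \<xi> b - c" if "\<xi> \<in> \<Delta>" for \<xi>
  proof -
    have x: "\<xi> \<in> X" using sets_M_sub[OF \<Delta>] that by auto
    have "\<xi> ?c = \<xi> b + (- c) * \<xi> 1"
      using X_char(1)[OF x b one] X_char(3)[OF x one_in, of "- c"] by (simp only:)
    then show ?thesis using X_one[OF x] by simp
  qed
  have "op0 ?c ?y = op0 b ?y \<oplus>\<^bsub>V\<^esub> (- c) \<odot>\<^bsub>V\<^esub> ?y"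
    using I.hom_add[of b "(- c) *\<^sub>C 1" ?y] I.hom_scaleC[of 1 ?y "- c"] y op0_one[OF y] by (simp only: \<pi>0_simps UNIV_I)
  also have "\<dots> = op0 b ?y \<ominus>\<^bsub>V\<^esub> c \<odot>\<^bsub>V\<^esub> ?y"
    using D0_in[OF y] D0_in[OF op0_in[OF y]] by (intro V.ip_eqI) (auto simp: V.ip_simps)
  also have "op0 b ?y = E_ind \<Delta> (op0 b x)" by (rule E_ind_B_D0[OF b \<Delta> x])
  finally have "vnorm V (E_ind \<Delta> (op0 b x) \<ominus>\<^bsub>V\<^esub> c \<odot>\<^bsub>V\<^esub> ?y) = vnorm V (op0 ?c ?y)" by simp
  also have "\<dots> \<le> \<epsilon> * vnorm V ?y"
    by (rule D0_bound[OF \<Delta> cB _ e x]) (use bd val in simp)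
  also have "\<dots> \<le> 2 * \<epsilon> * vnorm V ?y" using e D0_in[OF y] by (intro mult_right_mono) auto
  finally show "vnorm V (E_ind \<Delta> (op0 b x) \<ominus>\<^bsub>V\<^esub> c \<odot>\<^bsub>V\<^esub> ?y) \<le> 2 * \<epsilon> * vnorm V ?y" .
qed

lemma induced_locally_eigen:
  assumes b: "b \<in> B" and x: "x \<in> rep_dom cl"
  shows "P.locally_eigen (\<lambda>\<xi>. \<xi> b) x (rep_op cl b x)"
proof -
  have c: "x \<in> carrier V" "rep_op cl b x \<in> carrier V" using I.closure_in[OF x] by auto
  have "\<exists>u\<in>D0. vnorm V (u \<ominus>\<^bsub>V\<^esub> x) < 1 / real (Suc n) \<and> vnorm V (op0 b u \<ominus>\<^bsub>V\<^esub> rep_op cl b x) < 1 / real (Suc n)" for n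
    using I.closure_approx[OF x, of "{b}" "1 / real (Suc n)"] by simp
  then obtain s where s: "\<And>n. s n \<in> D0" "\<And>n. vnorm V (s n \<ominus>\<^bsub>V\<^esub> x) < 1 / real (Suc n)"
    "\<And>n. vnorm V (op0 b (s n) \<ominus>\<^bsub>V\<^esub> rep_op cl b x) < 1 / real (Suc n)" by metis
  have l0: "(\<lambda>n. 1 / real (Suc n)) \<longlonglongrightarrow> 0" using LIMSEQ_inverse_real_of_nat by (simp add: field_simps)
  have sc: "s n \<in> carrier V" "op0 b (s n) \<in> carrier V" for n using D0_in s(1) op0_in by auto
  have "V.conv s x sequentially"
    by (rule V.convI[OF c(1) _ _ l0]) (use s(2) sc in \<open>auto intro!: always_eventually less_imp_le\<close>)
  moreover have "V.conv (\<lambda>n. op0 b (s n)) (rep_op cl b x) sequentially"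
    by (rule V.convI[OF c(2) _ _ l0]) (use s(3) sc in \<open>auto intro!: always_eventually less_imp_le\<close>)
  ultimately show ?thesis
    by (rule P.locally_eigen_lim[rotated]) (rule D0_locally_eigen[OF b s(1)])
qed

lemma induced_locally_eigen_star:
  assumes b: "b \<in> B" and x: "x \<in> rep_dom cl"
  shows "P.locally_eigen (\<lambda>\<xi>. cnj (\<xi> b)) x (rep_op cl (star b) x)"
proof -
  have sb: "star b \<in> B" using star_component[OF one_closed b] by simp
  have "\<xi> (star b) = cnj (\<xi> b)" if "\<Delta> \<in> sets M" "\<xi> \<in> \<Delta>" for \<xi> \<Delta>
    using X_char(4)[OF _ b] sets_M_sub that by blast
  then show ?thesis
    using induced_locally_eigen[OF sb x] unfolding P.locally_eigen_def by auto
qed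

lemma induced_closure_spectral:
  assumes b: "b \<in> B"
  shows "op_closure V (op_graph (rep_dom cl) (rep_op cl b)) = spectral_integral V M E_ind (\<lambda>\<xi>. \<xi> b)"
    "op_closure V (op_graph (rep_dom cl) (rep_op cl (star b))) = op_adjoint V (op_graph (rep_dom cl) (rep_op cl b))"
proof -
  have sb: "star b \<in> B" using star_component[OF one_closed b] by simp
  note meas = measurable_eval[OF b]
  have dense: "V.dense_in (rep_dom cl)" using I.closure_dense by simp
  have diff: "x \<ominus>\<^bsub>V\<^esub> y \<in> rep_dom cl" if "x \<in> rep_dom cl" "y \<in> rep_dom cl" for x y
    using V.submodule_closed(4)[OF _ that] I.closure_submodule by simp
  have op_diff: "rep_op cl c (x \<ominus>\<^bsub>V\<^esub> y) = rep_op cl c x \<ominus>\<^bsub>V\<^esub> rep_op cl c y"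
    if "x \<in> rep_dom cl" "y \<in> rep_dom cl" for c x y
    using I.closure_op_diff[OF that] by simp
  have ET: "rep_op cl c (E_ind \<Delta> x) = E_ind \<Delta> (rep_op cl c x)"
    if "c \<in> B" "\<Delta> \<in> sets M" "x \<in> rep_dom cl" for c \<Delta> x
    using E_ind_closure(2)[OF that(2,3) one_closed that(1)] act_set_one[OF that(2)] by simp
  have adj: "ip V (rep_op cl b x) y = ip V x (rep_op cl (star b) y)"
    if "x \<in> rep_dom cl" "y \<in> rep_dom cl" for x y
    using I.closure_star[OF that] by simp
  show "op_closure V (op_graph (rep_dom cl) (rep_op cl b)) = spectral_integral V M E_ind (\<lambda>\<xi>. \<xi> b)"
    by (rule P.closure_eq_spectral_integral[where T' = "rep_op cl (star b)" and f' = "\<lambda>\<xi>. cnj (\<xi> b)"])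
      (fact meas refl dense diff op_diff ET[OF b] ET[OF sb] E_ind_closure(1) induced_locally_eigen[OF b]
        induced_locally_eigen_star[OF b] adj)+
  show "op_closure V (op_graph (rep_dom cl) (rep_op cl (star b))) = op_adjoint V (op_graph (rep_dom cl) (rep_op cl b))"
    by (rule P.closure_eq_adjoint[where f = "\<lambda>\<xi>. \<xi> b" and f' = "\<lambda>\<xi>. cnj (\<xi> b)"])
      (fact meas refl dense diff op_diff ET[OF b] ET[OF sb] E_ind_closure(1) induced_locally_eigen[OF b]
        induced_locally_eigen_star[OF b] adj)+
qed

lemma graph_norm_square:
  assumes d: "d \<in> rep_dom cl"
  shows "graph_norm cl a d \<le> 2 * graph_norm cl (star a * a) d"
proof -
  have c: "d \<in> carrier V" "rep_op cl c d \<in> carrier V" for c using I.closure_in[OF d] by auto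
  let ?n = "vnorm V d" and ?m = "vnorm V (rep_op cl (star a * a) d)"
  have "(vnorm V (rep_op cl a d))\<^sup>2 = Re (ip V (rep_op cl a d) (rep_op cl a d))" by (rule V.vnorm_sq[OF c(2)])
  also have "ip V (rep_op cl a d) (rep_op cl a d) = ip V d (rep_op cl (star a * a) d)"
    using I.closure_star[OF d I.closure_mult(1)[OF d], of a a] I.closure_mult(2)[OF d, of "star a" a] by simp
  also have "Re \<dots> \<le> ?n * ?m"
    by (rule order_trans[OF complex_Re_le_cmod V.cauchy_schwarz[OF c(1) c(2)]])
  also have "\<dots> \<le> (?n + ?m)\<^sup>2" using c by (simp add: power2_sum)
  finally have "vnorm V (rep_op cl a d) \<le> ?n + ?m" using c by (rule_tac power2_le_imp_le) auto
  then show ?thesis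
    unfolding graph_norm_def I.closure_space \<pi>0_simps
    by (rule add_le_double) (rule V.vnorm_nonneg[OF c(2)])
qed

text \<open>Homogeneous elements are controlled by \<open>a\<^sup>*a\<close>, which has trivial degree; every element is a finite
  sum of homogeneous ones.\<close>

lemma graph_cauchy_B:
  assumes G: "graph_cauchy B cl \<Phi>"
  shows "graph_cauchy UNIV cl \<Phi>"
proof -
  have F: "\<Phi> \<noteq> bot" "\<forall>\<^sub>F x in \<Phi>. x \<in> rep_dom cl" using G by (auto simp: graph_cauchy_def)
  have D2: "\<forall>\<^sub>F q in \<Phi> \<times>\<^sub>F \<Phi>. fst q \<in> rep_dom cl \<and> snd q \<in> rep_dom cl"
    unfolding eventually_prod_filter using F(2) by auto
  have diff: "x \<ominus>\<^bsub>V\<^esub> y \<in> rep_dom cl" if "x \<in> rep_dom cl" "y \<in> rep_dom cl" for x y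
    using V.submodule_closed(4)[OF _ that] I.closure_submodule by simp
  have hom: "\<forall>\<^sub>F q in \<Phi> \<times>\<^sub>F \<Phi>. graph_norm cl a (fst q \<ominus>\<^bsub>V\<^esub> snd q) < e"
    if g: "g \<in> carrier G" "a \<in> A g" and e: "e > 0" for g a e
  proof -
    have "\<forall>\<^sub>F (x, y) in \<Phi> \<times>\<^sub>F \<Phi>. graph_norm cl (star a * a) (x \<ominus>\<^bsub>V\<^esub> y) < e / 2"
      using G half_gt_zero[OF e] mem_e(1)[OF g(1) g(2) g(2)]
      unfolding graph_cauchy_def I.closure_space \<pi>0_simps by blast
    with D2 show ?thesis
    proof eventually_elim
      case (elim q)
      then show ?case using graph_norm_square[OF diff, of "fst q" "snd q" a] by (auto simp: case_prod_beta)
    qed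
  qed
  have "\<forall>e>0. \<forall>\<^sub>F q in \<Phi> \<times>\<^sub>F \<Phi>. graph_norm cl a (fst q \<ominus>\<^bsub>V\<^esub> snd q) < e" for a
  proof (induction a rule: graded_induct)
    case 1 then show ?case using hom[OF one_closed zero_in[OF one_closed]] by blast
  next
    case (2 a b)
    show ?case
    proof (intro allI impI)
      fix e :: real assume "e > 0"
      then have "\<forall>\<^sub>F q in \<Phi> \<times>\<^sub>F \<Phi>. graph_norm cl a (fst q \<ominus>\<^bsub>V\<^esub> snd q) < e / 2"
        "\<forall>\<^sub>F q in \<Phi> \<times>\<^sub>F \<Phi>. graph_norm cl b (fst q \<ominus>\<^bsub>V\<^esub> snd q) < e / 2" using 2 half_gt_zero by blast+
      with D2 show "\<forall>\<^sub>F q in \<Phi> \<times>\<^sub>F \<Phi>. graph_norm cl (a + b) (fst q \<ominus>\<^bsub>V\<^esub> snd q) < e"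
      proof eventually_elim
        case (elim q)
        let ?d = "fst q \<ominus>\<^bsub>V\<^esub> snd q"
        have d: "?d \<in> rep_dom cl" using elim diff by blast
        have c: "?d \<in> carrier V" "rep_op cl c ?d \<in> carrier V" for c using I.closure_in[OF d] by auto
        have "rep_op cl (a + b) ?d = rep_op cl a ?d \<oplus>\<^bsub>V\<^esub> rep_op cl b ?d"
          using star_representation.hom_add[OF I.closure_star_representation[of UNIV] _ _ d] by simp
        then have "graph_norm cl (a + b) ?d \<le> graph_norm cl a ?d + graph_norm cl b ?d"
          using V.vnorm_triangle[OF c(2) c(2), of a b] V.vnorm_nonneg[OF c(1)] by (simp add: graph_norm_def)
        then show ?case using elim by simp
      qed
    qed
  qed (use hom in blast)
  then show ?thesis using F unfolding graph_cauchy_def case_prod_unfold by simp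
qed

theorem induced_well_behaved: "well_behaved G A (carrier G) (induced_rep G A H \<rho>)"
  unfolding induced_rep_eq well_behaved_def
proof (intro conjI)
  show "star_representation (graded_part A (carrier G)) cl" by (rule I.closure_star_representation)
  show "integrable_rep B cl"
    unfolding integrable_rep_def
  proof (intro conjI ballI)
    show "star_representation B cl" by (rule I.closure_star_representation)
    show "closed_rep B cl" by (rule I.closed_closure[OF zero_in[OF one_closed] graph_cauchy_B])
    show "op_closure (rep_space cl) (op_graph (rep_dom cl) (rep_op cl (star b))) =
        op_adjoint (rep_space cl) (op_graph (rep_dom cl) (rep_op cl b))" if "b \<in> B" for b
      using induced_closure_spectral(2)[OF that] by simp
  qed
  show "\<exists>E. spectral_measure (rep_space cl) M E \<and>
        (\<forall>b\<in>B. op_closure (rep_space cl) (op_graph (rep_dom cl) (rep_op cl b)) = spectral_integral (rep_space cl) M E (\<lambda>\<xi>. \<xi> b)) \<and>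
        (\<forall>g\<in>carrier G. \<forall>a\<in>A g. \<forall>\<Delta>\<in>sets M.
           op_graph (rep_dom cl) (rep_op cl a) O op_graph (carrier (rep_space cl)) (E (act_set G A g \<Delta>))
           \<subseteq> op_graph (carrier (rep_space cl)) (E \<Delta>) O op_graph (rep_dom cl) (rep_op cl a))"
  proof (intro exI[of _ E_ind] conjI ballI)
    show "spectral_measure (rep_space cl) M E_ind" using E_ind_spectral by simp
    show "op_closure (rep_space cl) (op_graph (rep_dom cl) (rep_op cl b)) = spectral_integral (rep_space cl) M E_ind (\<lambda>\<xi>. \<xi> b)"
      if "b \<in> B" for b using induced_closure_spectral(1)[OF that] by simp
    fix g a \<Delta> assume g: "g \<in> carrier G" and a: "a \<in> A g" and \<Delta>: "\<Delta> \<in> sets M"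
    show "op_graph (rep_dom cl) (rep_op cl a) O op_graph (carrier (rep_space cl)) (E_ind (act_set G A g \<Delta>))
           \<subseteq> op_graph (carrier (rep_space cl)) (E_ind \<Delta>) O op_graph (rep_dom cl) (rep_op cl a)"
    proof (rule subrelI)
      fix x z assume "(x, z) \<in> op_graph (rep_dom cl) (rep_op cl a) O op_graph (carrier (rep_space cl)) (E_ind (act_set G A g \<Delta>))"
      then have x: "x \<in> rep_dom cl" and z: "z = E_ind (act_set G A g \<Delta>) (rep_op cl a x)"
        by (auto simp: op_graph_def)
      have "x \<in> carrier (rep_space cl)" using I.closure_in(1)[OF x] by simp
      then have "(x, E_ind \<Delta> x) \<in> op_graph (carrier (rep_space cl)) (E_ind \<Delta>)" by (simp add: op_graph_def)
      moreover have "(E_ind \<Delta> x, z) \<in> op_graph (rep_dom cl) (rep_op cl a)"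
        using E_ind_closure[OF \<Delta> x] g a unfolding z by (auto simp: op_graph_def)
      ultimately show "(x, z) \<in> op_graph (carrier (rep_space cl)) (E_ind \<Delta>) O op_graph (rep_dom cl) (rep_op cl a)" by blast
    qed
  qed
qed

end

theorem proposition24:
  fixes G :: "('g, 'm) monoid_scheme"
    and A :: "'g \<Rightarrow> 'a::star_algebra set"
    and H :: "'g set"
    and \<rho> :: "('a, 'v) rep"
  assumes graded: "graded_star_algebra G A"
    and commutative: "\<forall>a\<in>A \<one>\<^bsub>G\<^esub>. \<forall>b\<in>A \<one>\<^bsub>G\<^esub>. a * b = b * a"
    and generated: "countably_generated (A \<one>\<^bsub>G\<^esub>)"
    and character_condition:
      "\<forall>\<xi>\<in>positive_characters G A. \<forall>g\<in>carrier G. \<forall>c\<in>A g. \<forall>d\<in>A g.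
         \<xi> (star c * d) * \<xi> (star d * c) = \<xi> (star c * c) * \<xi> (star d * d)"
    and loc_compact: "locally_compact_space (character_topology G A)"
    and subgroup: "subgroup H G"
    and well_behaved: "well_behaved G A H \<rho>"
    and inducible: "inducible G A H \<rho>"
    and metrizable: "metrizable_space (graph_topology (graded_part A H) \<rho>)"
  shows "well_behaved G A (carrier G) (induced_rep G A H \<rho>)"
proof -
  obtain E where E: "spectral_measure (rep_space \<rho>) (borel_of (character_topology G A)) E"
    "\<forall>b\<in>A \<one>\<^bsub>G\<^esub>. op_closure (rep_space \<rho>) (op_graph (rep_dom \<rho>) (rep_op \<rho> b)) =
           spectral_integral (rep_space \<rho>) (borel_of (character_topology G A)) E (\<lambda>\<xi>. \<xi> b)"
    "\<forall>g\<in>H. \<forall>a\<in>A g. \<forall>\<Delta>\<in>sets (borel_of (character_topology G A)).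
           op_graph (rep_dom \<rho>) (rep_op \<rho> a) O
             op_graph (carrier (rep_space \<rho>)) (E (act_set G A g \<Delta>))
           \<subseteq> op_graph (carrier (rep_space \<rho>)) (E \<Delta>) O op_graph (rep_dom \<rho>) (rep_op \<rho> a)"
    using well_behaved unfolding well_behaved_def by blast
  interpret graded_star_algebra G A by (rule graded)
  interpret well_behaved_induction G A H \<rho> E
  proof (intro well_behaved_induction.intro partial_action.intro partial_action_axioms.intro
      inducible_representation.intro inducible_representation_axioms.intro graded_with_subgroup.intro
      graded_with_subgroup_axioms.intro well_behaved_induction_axioms.intro graded subgroup inducible E(1))
    show "a * b = b * a" if "a \<in> A \<one>\<^bsub>G\<^esub>" "b \<in> A \<one>\<^bsub>G\<^esub>" for a b using commutative that by blast
    show "\<xi> (star c * d) * \<xi> (star d * c) = \<xi> (star c * c) * \<xi> (star d * d)"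
      if "\<xi> \<in> positive_characters G A" "g \<in> carrier G" "c \<in> A g" "d \<in> A g" for \<xi> g c d
      using character_condition that by blast
    show "star_representation (graded_part A H) \<rho>" using well_behaved by (simp add: well_behaved_def)
  qed (use E(2,3) in blast)+
  show ?thesis by (rule induced_well_behaved)
qed

end
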